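(* Let $A$ be a non-negatively graded finite-dimensional basic $k$-algebra with $A_i\cdot A_j=A_{i+j}$ for all $i,j\geqslant0$ and $A_0$ self-injective, let $\{e_\lambda\}_{\lambda\in\Lambda}$ be a complete set of orthogonal primitive idempotents of $A$ (lying in $A_0$), and let $\leqslant$ be a partial order on this set. Suppose that $A$ is standardly stratified with respect to $\leqslant$ and that all standard modules are concentrated in degree $0$ and are Koszul. Then $A_0\cong\Delta$ as $A$-modules, where $\Delta$ is the direct sum of all standard modules, and $\Gamma=\operatorname{Ext}^*_A(A_0,A_0)$ is standardly stratified with respect to the poset $(\{e_\lambda\}_{\lambda\in\Lambda},\leqslant^{\mathrm{op}})$.
   Context: $k$ is an algebraically closed field. Modules are left modules; graded modules are locally finite. An algebra is self-injective if each of its projective modules is injective. $M$ is generated in degree $s$ if $M=A\cdot M_s$. $A_0$ is an $A$-module as $A/\bigoplus_{i\geqslant1}A_i$. A graded $A$-module $M$ generated in degree $0$ is Koszul if it has a graded projective resolution $\cdots\to P^1\to P^0\to M\to0$ with $P^i$ generated in degree $i$ for all $i\geqslant0$. Write $\lambda\leqslant\mu$ for $e_\lambda\leqslant e_\mu$. For a finite-dimensional basic $k$-algebra $B$ with a complete set of orthogonal primitive idempotents $\{e_\lambda\}_{\lambda\in\Lambda}$ and a partial order $\leqslant$ on this set, put $P_\lambda=Be_\lambda$ and let the standard module be $\Delta_\lambda=P_\lambda/\sum_{\mu\not\leqslant\lambda}\operatorname{tr}_{P_\mu}(P_\lambda)$, where $\operatorname{tr}_{P_\mu}(P_\lambda)$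 is the sum of the images of all homomorphisms $P_\mu\to P_\lambda$. $B$ is standardly stratified with respect to $\leqslant$ if for every $\lambda$ the kernel of $P_\lambda\to\Delta_\lambda$ has a finite filtration with successive quotients isomorphic to $\Delta_\mu$ with $\mu>\lambda$. $\Gamma=\bigoplus_{i\geqslant0}\operatorname{Ext}^i_A(A_0,A_0)$ has the Yoneda product, and $\operatorname{Ext}^*_A(M,A_0)$ is a left $\Gamma$-module. The primitive idempotents of $\Gamma$ are identified with those of $A$: $e_\lambda$ corresponds to the idempotent of $\Gamma$ (the projection of $A_0$ onto $A_0e_\lambda$) with $\Gamma e_\lambda=\operatorname{Ext}^*_A(A_0e_\lambda,A_0)$. $\leqslant^{\mathrm{op}}$ is the opposite order. *)

theory Defs
  imports "HOL-Algebra.Algebraic_Closure" "HOL-Algebra.Module"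
begin

section \<open>Left modules over a (not necessarily commutative) ring\<close>

text \<open>
  Modules are represented by the record \<open>module\<close> of HOL-Algebra. Its \<open>mult\<close> and \<open>one\<close>
  fields carry no meaning for a module and are left undefined. The library locale \<open>module\<close>
  requires a commutative ring of scalars, hence the following variant.
\<close>

locale left_module = R?: ring R + M?: abelian_group M
  for R :: "('a, 'r) ring_scheme" (structure) and M :: "('a, 'm, 's) module_scheme" (structure) +
  assumes smult_closed [simp, intro]:
      "\<lbrakk> a \<in> carrier R; x \<in> carrier M \<rbrakk> \<Longrightarrow> a \<odot>\<^bsub>M\<^esub> x \<in> carrier M"
    and smult_l_distr:
      "\<lbrakk> a \<in> carrier R; b \<in> carrier R; x \<in> carrier M \<rbrakk> \<Longrightarrow>
       (a \<oplus>\<^bsub>R\<^esub> b) \<odot>\<^bsub>M\<^esub> x = a \<odot>\<^bsub>M\<^esub> x \<oplus>\<^bsub>M\<^esub> b \<odot>\<^bsub>M\<^esub> x"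
    and smult_r_distr:
      "\<lbrakk> a \<in> carrier R; x \<in> carrier M; y \<in> carrier M \<rbrakk> \<Longrightarrow>
       a \<odot>\<^bsub>M\<^esub> (x \<oplus>\<^bsub>M\<^esub> y) = a \<odot>\<^bsub>M\<^esub> x \<oplus>\<^bsub>M\<^esub> a \<odot>\<^bsub>M\<^esub> y"
    and smult_assoc1:
      "\<lbrakk> a \<in> carrier R; b \<in> carrier R; x \<in> carrier M \<rbrakk> \<Longrightarrow>
       (a \<otimes>\<^bsub>R\<^esub> b) \<odot>\<^bsub>M\<^esub> x = a \<odot>\<^bsub>M\<^esub> (b \<odot>\<^bsub>M\<^esub> x)"
    and smult_one [simp]:
      "x \<in> carrier M \<Longrightarrow> \<one>\<^bsub>R\<^esub> \<odot>\<^bsub>M\<^esub> x = x"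

definition mod_hom ::
    "('a, 'r) ring_scheme \<Rightarrow> ('a, 'm) module \<Rightarrow> ('a, 'n) module \<Rightarrow> ('m \<Rightarrow> 'n) set" where
  "mod_hom R M N = {f \<in> carrier M \<rightarrow>\<^sub>E carrier N.
     (\<forall>x\<in>carrier M. \<forall>y\<in>carrier M. f (x \<oplus>\<^bsub>M\<^esub> y) = f x \<oplus>\<^bsub>N\<^esub> f y) \<and>
     (\<forall>a\<in>carrier R. \<forall>x\<in>carrier M. f (a \<odot>\<^bsub>M\<^esub> x) = a \<odot>\<^bsub>N\<^esub> f x)}"

definition mod_iso ::
    "('a, 'r) ring_scheme \<Rightarrow> ('a, 'm) module \<Rightarrow> ('a, 'n) module \<Rightarrow> bool" where
  "mod_iso R M N \<longleftrightarrow> (\<exists>f\<in>mod_hom R M N. bij_betw f (carrier M) (carrier N))"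

text \<open>The set of all finite sums of elements of \<open>S\<close> and their negatives.\<close>

definition add_span :: "('a, 'm) ring_scheme \<Rightarrow> 'a set \<Rightarrow> 'a set" where
  "add_span M S = generate (add_monoid M) S"

definition quot_module :: "('a, 'm) module \<Rightarrow> 'm set \<Rightarrow> ('a, 'm set) module" where
  "quot_module M N =
     \<lparr>carrier = a_rcosets\<^bsub>M\<^esub> N, monoid.mult = undefined, monoid.one = undefined,
      ring.zero = N, ring.add = (\<lambda>U V. U <+>\<^bsub>M\<^esub> V),
      smult = (\<lambda>a U. \<Union>x\<in>U. N +>\<^bsub>M\<^esub> (a \<odot>\<^bsub>M\<^esub> x))\<rparr>"

definition dsum_module :: "'i set \<Rightarrow> ('i \<Rightarrow> ('a, 'm) module) \<Rightarrow> ('a, 'i \<Rightarrow> 'm) module" where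
  "dsum_module I M =
     \<lparr>carrier = {x \<in> (\<Pi>\<^sub>E i\<in>I. carrier (M i)). finite {i\<in>I. x i \<noteq> \<zero>\<^bsub>M i\<^esub>}},
      monoid.mult = undefined, monoid.one = undefined,
      ring.zero = (\<lambda>i\<in>I. \<zero>\<^bsub>M i\<^esub>),
      ring.add = (\<lambda>x y. \<lambda>i\<in>I. x i \<oplus>\<^bsub>M i\<^esub> y i),
      smult = (\<lambda>a x. \<lambda>i\<in>I. a \<odot>\<^bsub>M i\<^esub> x i)\<rparr>"

definition regular_module :: "('k, 'a) module \<Rightarrow> ('a, 'a) module" where
  "regular_module B =
     \<lparr>carrier = carrier B, monoid.mult = undefined, monoid.one = undefined,
      ring.zero = ring.zero B, ring.add = ring.add B, smult = monoid.mult B\<rparr>"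

text \<open>
  Lifting property against epimorphisms \<open>U \<rightarrow> V\<close>. Test modules have to live in fixed types:
  the free module on the underlying set of \<open>P\<close> has a copy in \<open>'p \<Rightarrow> 'a\<close>, so lifting the identity
  of \<open>P\<close> already makes \<open>P\<close> a direct summand of a free module, whence the lifting property
  for modules over all types.
\<close>

definition projective_module :: "('k, 'a) module \<Rightarrow> ('a, 'p) module \<Rightarrow> bool" where
  "projective_module R P \<longleftrightarrow> left_module R P \<and>
     (\<forall>(U :: ('a, 'p \<Rightarrow> 'a) module) (V :: ('a, 'p) module). left_module R U \<longrightarrow> left_module R V \<longrightarrow>
        (\<forall>g\<in>mod_hom R U V. g ` carrier U = carrier V \<longrightarrow>
           (\<forall>f\<in>mod_hom R P V. \<exists>h\<in>mod_hom R P U. \<forall>x\<in>carrier P. g (h x) = f x)))"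

text \<open>
  The type \<open>nat \<Rightarrow> 'a\<close> contains copies of all finitely generated modules, in particular of the
  left ideals and of the regular module, so by Baer's criterion the extension property
  below implies the one for modules over all types.
\<close>

definition injective_module :: "('k, 'a) module \<Rightarrow> ('a, 'q) module \<Rightarrow> bool" where
  "injective_module R Q \<longleftrightarrow> left_module R Q \<and>
     (\<forall>(U :: ('a, nat \<Rightarrow> 'a) module) (V :: ('a, nat \<Rightarrow> 'a) module).
        left_module R U \<longrightarrow> left_module R V \<longrightarrow>
        (\<forall>i\<in>mod_hom R U V. inj_on i (carrier U) \<longrightarrow>
           (\<forall>f\<in>mod_hom R U Q. \<exists>g\<in>mod_hom R V Q. \<forall>x\<in>carrier U. g (i x) = f x)))"

text \<open>
  Again \<open>nat \<Rightarrow> 'a\<close> contains copies of all finitely generated projective modules; for a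
  finite-dimensional algebra (noetherian, so that direct sums of injectives are injective)
  this covers all projective modules.
\<close>

definition self_injective :: "('k, 'a) module \<Rightarrow> bool" where
  "self_injective R \<longleftrightarrow>
     (\<forall>P :: ('a, nat \<Rightarrow> 'a) module. projective_module R P \<longrightarrow> injective_module R P)"


section \<open>Finite-dimensional basic algebras\<close>

definition fin_dim :: "('k, 'z) ring_scheme \<Rightarrow> ('k, 'v) module \<Rightarrow> bool" where
  "fin_dim K V \<longleftrightarrow> (\<exists>S. finite S \<and> S \<subseteq> carrier V \<and>
     carrier V = {finsum V (\<lambda>v. c v \<odot>\<^bsub>V\<^esub> v) S | c. c \<in> S \<rightarrow> carrier K})"

definition fd_algebra :: "('k, 'z) ring_scheme \<Rightarrow> ('k, 'a) module \<Rightarrow> bool" where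
  "fd_algebra K A \<longleftrightarrow> field K \<and> ring A \<and> module K A \<and>
     (\<forall>c\<in>carrier K. \<forall>x\<in>carrier A. \<forall>y\<in>carrier A.
        (c \<odot>\<^bsub>A\<^esub> x) \<otimes>\<^bsub>A\<^esub> y = c \<odot>\<^bsub>A\<^esub> (x \<otimes>\<^bsub>A\<^esub> y) \<and>
        x \<otimes>\<^bsub>A\<^esub> (c \<odot>\<^bsub>A\<^esub> y) = c \<odot>\<^bsub>A\<^esub> (x \<otimes>\<^bsub>A\<^esub> y)) \<and>
     fin_dim K A"

definition idempotent_elt :: "('a, 'r) ring_scheme \<Rightarrow> 'a \<Rightarrow> bool" where
  "idempotent_elt B x \<longleftrightarrow> x \<in> carrier B \<and> x \<otimes>\<^bsub>B\<^esub> x = x"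

definition primitive_idempotent :: "('a, 'r) ring_scheme \<Rightarrow> 'a \<Rightarrow> bool" where
  "primitive_idempotent B x \<longleftrightarrow> idempotent_elt B x \<and> x \<noteq> \<zero>\<^bsub>B\<^esub> \<and>
     (\<forall>f g. idempotent_elt B f \<longrightarrow> idempotent_elt B g \<longrightarrow>
        f \<otimes>\<^bsub>B\<^esub> g = \<zero>\<^bsub>B\<^esub> \<longrightarrow> g \<otimes>\<^bsub>B\<^esub> f = \<zero>\<^bsub>B\<^esub> \<longrightarrow> x = f \<oplus>\<^bsub>B\<^esub> g \<longrightarrow>
        f = \<zero>\<^bsub>B\<^esub> \<or> g = \<zero>\<^bsub>B\<^esub>)"

definition complete_primitive_idempotents ::
    "('a, 'r) ring_scheme \<Rightarrow> 'l set \<Rightarrow> ('l \<Rightarrow> 'a) \<Rightarrow> bool" where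
  "complete_primitive_idempotents B \<Lambda> e \<longleftrightarrow> finite \<Lambda> \<and>
     (\<forall>l\<in>\<Lambda>. primitive_idempotent B (e l)) \<and>
     (\<forall>l\<in>\<Lambda>. \<forall>m\<in>\<Lambda>. l \<noteq> m \<longrightarrow> e l \<otimes>\<^bsub>B\<^esub> e m = \<zero>\<^bsub>B\<^esub>) \<and>
     finsum B e \<Lambda> = \<one>\<^bsub>B\<^esub>"

definition proj_mod :: "('k, 'a) module \<Rightarrow> ('l \<Rightarrow> 'a) \<Rightarrow> 'l \<Rightarrow> ('a, 'a) module" where
  "proj_mod B e l = (regular_module B)\<lparr>carrier := (\<lambda>b. b \<otimes>\<^bsub>B\<^esub> e l) ` carrier B\<rparr>"

definition basic_algebra :: "('k, 'a) module \<Rightarrow> 'l set \<Rightarrow> ('l \<Rightarrow> 'a) \<Rightarrow> bool" where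
  "basic_algebra B \<Lambda> e \<longleftrightarrow>
     (\<forall>l\<in>\<Lambda>. \<forall>m\<in>\<Lambda>. l \<noteq> m \<longrightarrow> \<not> mod_iso B (proj_mod B e l) (proj_mod B e m))"


section \<open>Standard modules and standardly stratified algebras\<close>

text \<open>The partial order is the relation \<open>r\<close>, where \<open>(l, m) \<in> r\<close> means \<open>e l \<le> e m\<close>.\<close>

definition trace_module ::
    "('k, 'a) module \<Rightarrow> ('a, 'm) module \<Rightarrow> ('a, 'n) module \<Rightarrow> 'n set" where
  "trace_module B P M = add_span M (\<Union>f\<in>mod_hom B P M. f ` carrier P)"

definition std_kernel ::
    "('k, 'a) module \<Rightarrow> 'l set \<Rightarrow> ('l \<Rightarrow> 'a) \<Rightarrow> 'l rel \<Rightarrow> 'l \<Rightarrow> 'a set" where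
  "std_kernel B \<Lambda> e r l = add_span (proj_mod B e l)
     (\<Union>m\<in>{m\<in>\<Lambda>. (m, l) \<notin> r}. trace_module B (proj_mod B e m) (proj_mod B e l))"

definition std_module ::
    "('k, 'a) module \<Rightarrow> 'l set \<Rightarrow> ('l \<Rightarrow> 'a) \<Rightarrow> 'l rel \<Rightarrow> 'l \<Rightarrow> ('a, 'a set) module" where
  "std_module B \<Lambda> e r l = quot_module (proj_mod B e l) (std_kernel B \<Lambda> e r l)"

definition has_filtration ::
    "('k, 'a) module \<Rightarrow> ('a, 'm) module \<Rightarrow> ('l \<Rightarrow> ('a, 'n) module) \<Rightarrow> 'l set \<Rightarrow> bool" where
  "has_filtration B M D S \<longleftrightarrow> (\<exists>n (F :: nat \<Rightarrow> 'm set).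
     F 0 = {\<zero>\<^bsub>M\<^esub>} \<and> F n = carrier M \<and> (\<forall>i\<le>n. submodule (F i) B M) \<and>
     (\<forall>i<n. F i \<subseteq> F (Suc i) \<and>
        (\<exists>m\<in>S. mod_iso B (quot_module (M\<lparr>carrier := F (Suc i)\<rparr>) (F i)) (D m))))"

definition standardly_stratified ::
    "('k, 'z) ring_scheme \<Rightarrow> ('k, 'a) module \<Rightarrow> 'l set \<Rightarrow> ('l \<Rightarrow> 'a) \<Rightarrow> 'l rel \<Rightarrow> bool" where
  "standardly_stratified K B \<Lambda> e r \<longleftrightarrow>
     fd_algebra K B \<and> complete_primitive_idempotents B \<Lambda> e \<and> basic_algebra B \<Lambda> e \<and>
     partial_order_on \<Lambda> r \<and>
     (\<forall>l\<in>\<Lambda>. has_filtration B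
        ((proj_mod B e l)\<lparr>carrier := std_kernel B \<Lambda> e r l\<rparr>)
        (std_module B \<Lambda> e r)
        {m\<in>\<Lambda>. (l, m) \<in> r \<and> m \<noteq> l})"


section \<open>Graded algebras, graded modules, Koszul modules\<close>

definition internal_dsum :: "('m, 'r) ring_scheme \<Rightarrow> ('i \<Rightarrow> 'm set) \<Rightarrow> bool" where
  "internal_dsum M G \<longleftrightarrow> (\<forall>i. additive_subgroup (G i) M) \<and>
     (\<forall>x\<in>carrier M. \<exists>!f. (\<forall>i. f i \<in> G i) \<and> finite {i. f i \<noteq> \<zero>\<^bsub>M\<^esub>} \<and>
        x = finsum M f {i. f i \<noteq> \<zero>\<^bsub>M\<^esub>})"

definition graded_algebra ::
    "('k, 'z) ring_scheme \<Rightarrow> ('k, 'a) module \<Rightarrow> (nat \<Rightarrow> 'a set) \<Rightarrow> bool" where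
  "graded_algebra K A \<A> \<longleftrightarrow> internal_dsum A \<A> \<and> (\<forall>i. submodule (\<A> i) K A) \<and>
     (\<forall>i j. \<forall>x\<in>\<A> i. \<forall>y\<in>\<A> j. x \<otimes>\<^bsub>A\<^esub> y \<in> \<A> (i + j))"

definition degree_zero_ring :: "('k, 'a) module \<Rightarrow> (nat \<Rightarrow> 'a set) \<Rightarrow> ('k, 'a) module" where
  "degree_zero_ring A \<A> = A\<lparr>carrier := \<A> 0\<rparr>"

definition positive_part :: "('k, 'a) module \<Rightarrow> (nat \<Rightarrow> 'a set) \<Rightarrow> 'a set" where
  "positive_part A \<A> = add_span A (\<Union>i\<in>{1..}. \<A> i)"

definition degree_zero_module ::
    "('k, 'a) module \<Rightarrow> (nat \<Rightarrow> 'a set) \<Rightarrow> ('a, 'a set) module" where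
  "degree_zero_module A \<A> = quot_module (regular_module A) (positive_part A \<A>)"

definition restrict_scalars :: "('k, 'a) module \<Rightarrow> ('a, 'm) module \<Rightarrow> ('k, 'm) module" where
  "restrict_scalars A M =
     \<lparr>carrier = carrier M, monoid.mult = undefined, monoid.one = undefined, ring.zero = ring.zero M, ring.add = ring.add M,
      smult = (\<lambda>c x. (c \<odot>\<^bsub>A\<^esub> \<one>\<^bsub>A\<^esub>) \<odot>\<^bsub>M\<^esub> x)\<rparr>"

text \<open>The last clause is local finiteness.\<close>

definition graded_module ::
    "('k, 'z) ring_scheme \<Rightarrow> ('k, 'a) module \<Rightarrow> (nat \<Rightarrow> 'a set) \<Rightarrow>
     ('a, 'm) module \<Rightarrow> (int \<Rightarrow> 'm set) \<Rightarrow> bool" where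
  "graded_module K A \<A> M G \<longleftrightarrow> left_module A M \<and> internal_dsum M G \<and>
     (\<forall>i j. \<forall>a\<in>\<A> i. \<forall>x\<in>G j. a \<odot>\<^bsub>M\<^esub> x \<in> G (int i + j)) \<and>
     (\<forall>j. fin_dim K ((restrict_scalars A M)\<lparr>carrier := G j\<rparr>))"

definition generated_in_degree ::
    "('k, 'a) module \<Rightarrow> ('a, 'm) module \<Rightarrow> (int \<Rightarrow> 'm set) \<Rightarrow> int \<Rightarrow> bool" where
  "generated_in_degree A M G s \<longleftrightarrow>
     carrier M = add_span M {a \<odot>\<^bsub>M\<^esub> x | a x. a \<in> carrier A \<and> x \<in> G s}"

definition concentrated_in_degree_zero :: "('a, 'm) module \<Rightarrow> (int \<Rightarrow> 'm set) \<Rightarrow> bool" where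
  "concentrated_in_degree_zero M G \<longleftrightarrow> (\<forall>i. i \<noteq> 0 \<longrightarrow> G i = {\<zero>\<^bsub>M\<^esub>})"

definition projective_resolution ::
    "('k, 'a) module \<Rightarrow> ('a, 'm) module \<Rightarrow>
     (nat \<Rightarrow> ('a, 'p) module) \<Rightarrow> (nat \<Rightarrow> 'p \<Rightarrow> 'p) \<Rightarrow> ('p \<Rightarrow> 'm) \<Rightarrow> bool" where
  "projective_resolution A M P d \<epsilon> \<longleftrightarrow> left_module A M \<and>
     (\<forall>i. projective_module A (P i)) \<and>
     (\<forall>i. d i \<in> mod_hom A (P (Suc i)) (P i)) \<and>
     \<epsilon> \<in> mod_hom A (P 0) M \<and>
     \<epsilon> ` carrier (P 0) = carrier M \<and>
     d 0 ` carrier (P 1) = a_kernel (P 0) M \<epsilon> \<and>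
     (\<forall>i. d (Suc i) ` carrier (P (Suc (Suc i))) = a_kernel (P (Suc i)) (P i) (d i))"

text \<open>
  A locally finite module generated in a single degree is finitely generated, hence has a copy
  in \<open>nat \<Rightarrow> 'a\<close>; so the choice of this type for the terms of the resolution is no restriction.
\<close>

definition koszul_module ::
    "('k, 'z) ring_scheme \<Rightarrow> ('k, 'a) module \<Rightarrow> (nat \<Rightarrow> 'a set) \<Rightarrow>
     ('a, 'm) module \<Rightarrow> (int \<Rightarrow> 'm set) \<Rightarrow> bool" where
  "koszul_module K A \<A> M G \<longleftrightarrow> graded_module K A \<A> M G \<and> generated_in_degree A M G 0 \<and>
     (\<exists>(P :: nat \<Rightarrow> ('a, nat \<Rightarrow> 'a) module) (Q :: nat \<Rightarrow> int \<Rightarrow> (nat \<Rightarrow> 'a) set) d \<epsilon>.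
        projective_resolution A M P d \<epsilon> \<and>
        (\<forall>i. graded_module K A \<A> (P i) (Q i) \<and> generated_in_degree A (P i) (Q i) (int i)) \<and>
        (\<forall>j. \<epsilon> ` Q 0 j \<subseteq> G j) \<and>
        (\<forall>i j. d i ` Q (Suc i) j \<subseteq> Q i j))"

text \<open>
  The grading of the standard module induced by \<open>(A e\<^sub>l)\<^sub>i = A\<^sub>i e\<^sub>l\<close>: the image of
  \<open>A\<^sub>i e\<^sub>l\<close> under the quotient map.
\<close>

definition std_grading ::
    "('k, 'a) module \<Rightarrow> (nat \<Rightarrow> 'a set) \<Rightarrow> 'l set \<Rightarrow> ('l \<Rightarrow> 'a) \<Rightarrow> 'l rel \<Rightarrow> 'l \<Rightarrow>
     int \<Rightarrow> 'a set set" where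
  "std_grading A \<A> \<Lambda> e r l i =
     (if i < 0 then {\<zero>\<^bsub>std_module A \<Lambda> e r l\<^esub>}
      else (\<lambda>a. std_kernel A \<Lambda> e r l +>\<^bsub>proj_mod A e l\<^esub> (a \<otimes>\<^bsub>A\<^esub> e l)) ` \<A> (nat i))"


section \<open>Ext and the Yoneda algebra\<close>

text \<open>
  Everything is computed from a projective resolution
  \<open>\<cdots> \<rightarrow> P 2 \<rightarrow> P 1 \<rightarrow> P 0 \<rightarrow> M\<close> with differentials \<open>d i : P (i+1) \<rightarrow> P i\<close> and augmentation
  \<open>\<epsilon>\<close>; \<open>Ext\<^sup>i(M, N)\<close> is the cohomology of \<open>Hom\<^sub>A(P, N)\<close> in degree \<open>i\<close>.
\<close>

definition hom_space ::
    "('k, 'a) module \<Rightarrow> ('a, 'm) module \<Rightarrow> ('a, 'n) module \<Rightarrow> ('k, 'm \<Rightarrow> 'n) module" where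
  "hom_space A M N =
     \<lparr>carrier = mod_hom A M N, monoid.mult = undefined, monoid.one = undefined,
      ring.zero = (\<lambda>x\<in>carrier M. \<zero>\<^bsub>N\<^esub>),
      ring.add = (\<lambda>f g. \<lambda>x\<in>carrier M. f x \<oplus>\<^bsub>N\<^esub> g x),
      smult = (\<lambda>c f. \<lambda>x\<in>carrier M. (c \<odot>\<^bsub>A\<^esub> \<one>\<^bsub>A\<^esub>) \<odot>\<^bsub>N\<^esub> f x)\<rparr>"

definition cocycles ::
    "('k, 'a) module \<Rightarrow> (nat \<Rightarrow> ('a, 'p) module) \<Rightarrow> (nat \<Rightarrow> 'p \<Rightarrow> 'p) \<Rightarrow> ('a, 'n) module \<Rightarrow>
     nat \<Rightarrow> ('p \<Rightarrow> 'n) set" where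
  "cocycles A P d N i =
     {f \<in> mod_hom A (P i) N. \<forall>x\<in>carrier (P (Suc i)). f (d i x) = \<zero>\<^bsub>N\<^esub>}"

definition coboundaries ::
    "('k, 'a) module \<Rightarrow> (nat \<Rightarrow> ('a, 'p) module) \<Rightarrow> (nat \<Rightarrow> 'p \<Rightarrow> 'p) \<Rightarrow> ('a, 'n) module \<Rightarrow>
     nat \<Rightarrow> ('p \<Rightarrow> 'n) set" where
  "coboundaries A P d N i =
     (case i of
        0 \<Rightarrow> {\<lambda>x\<in>carrier (P 0). \<zero>\<^bsub>N\<^esub>}
      | Suc j \<Rightarrow> (\<lambda>f. compose (carrier (P (Suc j))) f (d j)) ` mod_hom A (P j) N)"

definition ext_class ::
    "('k, 'a) module \<Rightarrow> (nat \<Rightarrow> ('a, 'p) module) \<Rightarrow> (nat \<Rightarrow> 'p \<Rightarrow> 'p) \<Rightarrow> ('a, 'n) module \<Rightarrow>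
     nat \<Rightarrow> ('p \<Rightarrow> 'n) \<Rightarrow> ('p \<Rightarrow> 'n) set" where
  "ext_class A P d N i f = coboundaries A P d N i +>\<^bsub>hom_space A (P i) N\<^esub> f"

definition ext_space ::
    "('k, 'a) module \<Rightarrow> (nat \<Rightarrow> ('a, 'p) module) \<Rightarrow> (nat \<Rightarrow> 'p \<Rightarrow> 'p) \<Rightarrow> ('a, 'n) module \<Rightarrow>
     nat \<Rightarrow> ('k, ('p \<Rightarrow> 'n) set) module" where
  "ext_space A P d N i =
     quot_module ((hom_space A (P i) N)\<lparr>carrier := cocycles A P d N i\<rparr>) (coboundaries A P d N i)"

text \<open>A chain map \<open>\<phi> m : P (j+m) \<rightarrow> P m\<close> lifting the cocycle \<open>g : P j \<rightarrow> M\<close>.\<close>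

definition chain_lift ::
    "('k, 'a) module \<Rightarrow> (nat \<Rightarrow> ('a, 'p) module) \<Rightarrow> (nat \<Rightarrow> 'p \<Rightarrow> 'p) \<Rightarrow> ('p \<Rightarrow> 'm) \<Rightarrow>
     nat \<Rightarrow> ('p \<Rightarrow> 'm) \<Rightarrow> (nat \<Rightarrow> 'p \<Rightarrow> 'p) \<Rightarrow> bool" where
  "chain_lift A P d \<epsilon> j g \<phi> \<longleftrightarrow>
     (\<forall>m. \<phi> m \<in> mod_hom A (P (j + m)) (P m)) \<and>
     (\<forall>x\<in>carrier (P j). \<epsilon> (\<phi> 0 x) = g x) \<and>
     (\<forall>m. \<forall>x\<in>carrier (P (Suc (j + m))). d m (\<phi> (Suc m) x) = \<phi> m (d (j + m) x))"

text \<open>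
  The Yoneda product \<open>[f] [g]\<close> (first \<open>g\<close>, then \<open>f\<close>) of \<open>[f] \<in> Ext\<^sup>i(M, M)\<close> and
  \<open>[g] \<in> Ext\<^sup>j(M, M)\<close> is the class of \<open>f \<circ> \<phi> i\<close> for a lift \<open>\<phi>\<close> of \<open>g\<close>. This class does not
  depend on the choices, so the union below is a single coset.
\<close>

definition yoneda_product ::
    "('k, 'a) module \<Rightarrow> (nat \<Rightarrow> ('a, 'p) module) \<Rightarrow> (nat \<Rightarrow> 'p \<Rightarrow> 'p) \<Rightarrow> ('p \<Rightarrow> 'm) \<Rightarrow>
     ('a, 'm) module \<Rightarrow> nat \<Rightarrow> nat \<Rightarrow> ('p \<Rightarrow> 'm) set \<Rightarrow> ('p \<Rightarrow> 'm) set \<Rightarrow> ('p \<Rightarrow> 'm) set" where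
  "yoneda_product A P d \<epsilon> M i j F G =
     (\<Union>f\<in>F. \<Union>g\<in>G. \<Union>\<phi>\<in>{\<phi>. chain_lift A P d \<epsilon> j g \<phi>}.
        ext_class A P d M (i + j) (compose (carrier (P (i + j))) f (\<phi> i)))"

text \<open>The element of \<open>Ext\<^sup>0(M, M)\<close> given by an endomorphism \<open>h\<close> of \<open>M\<close>.\<close>

definition ext_of_endo ::
    "('k, 'a) module \<Rightarrow> (nat \<Rightarrow> ('a, 'p) module) \<Rightarrow> (nat \<Rightarrow> 'p \<Rightarrow> 'p) \<Rightarrow> ('p \<Rightarrow> 'm) \<Rightarrow>
     ('a, 'm) module \<Rightarrow> ('m \<Rightarrow> 'm) \<Rightarrow> nat \<Rightarrow> ('p \<Rightarrow> 'm) set" where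
  "ext_of_endo A P d \<epsilon> M h i =
     (if i = 0 then ext_class A P d M 0 (compose (carrier (P 0)) h \<epsilon>)
      else \<zero>\<^bsub>(ext_space A P d M i :: ('k, ('p \<Rightarrow> 'm) set) module)\<^esub>)"

definition ext_algebra ::
    "('k, 'a) module \<Rightarrow> (nat \<Rightarrow> ('a, 'p) module) \<Rightarrow> (nat \<Rightarrow> 'p \<Rightarrow> 'p) \<Rightarrow> ('p \<Rightarrow> 'm) \<Rightarrow>
     ('a, 'm) module \<Rightarrow> ('k, nat \<Rightarrow> ('p \<Rightarrow> 'm) set) module" where
  "ext_algebra A P d \<epsilon> M =
     (dsum_module UNIV (ext_space A P d M))
       \<lparr>monoid.mult := (\<lambda>x y n. finsum (ext_space A P d M n)
                   (\<lambda>i. yoneda_product A P d \<epsilon> M i (n - i) (x i) (y (n - i))) {..n}),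
        monoid.one := ext_of_endo A P d \<epsilon> M (\<lambda>x\<in>carrier M. x)\<rparr>"

text \<open>The projection of \<open>A\<^sub>0\<close> onto \<open>A\<^sub>0 e\<^sub>l\<close>, i.e. right multiplication by \<open>e\<^sub>l\<close>.\<close>

definition degree_zero_proj ::
    "('k, 'a) module \<Rightarrow> (nat \<Rightarrow> 'a set) \<Rightarrow> ('l \<Rightarrow> 'a) \<Rightarrow> 'l \<Rightarrow> 'a set \<Rightarrow> 'a set" where
  "degree_zero_proj A \<A> e l =
     (\<lambda>U\<in>carrier (degree_zero_module A \<A>).
        \<Union>x\<in>U. positive_part A \<A> +>\<^bsub>A\<^esub> (x \<otimes>\<^bsub>A\<^esub> e l))"

end

theory Submission
  imports Defs
begin

text \<open>
  Let \<open>J\<close> be the positive part of \<open>A\<close>. Since \<open>\<Delta>\<^sub>l\<close> is concentrated in degree \<open>0\<close> and has a linear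
  projective resolution, it is projective over \<open>A\<^sub>0\<close>, hence isomorphic to \<open>A\<^sub>0 e\<^sub>l\<close>; this gives
  \<open>A\<^sub>0 \<cong> \<Delta>\<close> and identifies the kernel of \<open>A e\<^sub>l \<rightarrow> \<Delta>\<^sub>l\<close> with \<open>J e\<^sub>l\<close>. By stratification the
  \<open>A\<^sub>0\<close>-module \<open>A\<^sub>1 e\<^sub>l\<close> is generated by the spaces \<open>e\<^sub>k A\<^sub>1 e\<^sub>l\<close> with \<open>k > l\<close>. In a linear resolution
  \<open>R\<close> of \<open>\<Delta>\<^sub>l\<close> the generators of \<open>R\<^sub>i\<^sub>+\<^sub>1\<close> embed into \<open>A\<^sub>1\<close> times those of \<open>R\<^sub>i\<close>, and the embedding
  splits because \<open>A\<^sub>0\<close> is self-injective; so the weights of the generators strictly increase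
  with \<open>i\<close>. Hence \<open>R\<close> is finite, and \<open>Ext(\<Delta>\<^sub>l, \<Delta>\<^sub>m) = 0\<close> unless \<open>l \<le> m\<close>. Therefore \<open>\<Gamma>\<close> is a
  finite-dimensional directed algebra: for the opposite order its standard modules are the
  modules \<open>\<Gamma> e\<^sub>l\<close> themselves, with trivial kernels.
\<close>

subsection \<open>Modules and homomorphisms\<close>

text \<open>Splitting matters because a submodule of a module generated by weights above
  \<open>l\<close> need not be generated by such weights. A retract is also a quotient, and
  generators pass to quotients together with their weights; the retraction thus carries the weights
  of A_1 times the generators of R_i to those of R_(i+1). A linear resolution is minimal: its
  differentials have image in J R_i, and J annihilates A_0. Every homomorphism from R_i to A_0 is
  therefore a cocycle, and it is determined by its values on the generators of R_i. Such a value on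
  a generator of weight k, followed by right multiplication by e_m, lies in e_k A_0 e_m; this space
  vanishes unless k <= m, because it lies in the trace part of the kernel of A e_m ->
  \<open>\<Delta> m\<close>, which has no element of degree 0. Together with l <= k this gives l <=
  m. The algebra \<Gamma> is given by an arbitrary projective resolution P of A_0. Instead of
  replacing P, the proof chooses chain maps P -> R -> P whose composite lifts the projection of A_0
  onto A_0 e_l; multiplication by the idempotent of l then factors every class through the linear
  resolution R of \<open>\<Delta> l\<close>.\<close>

context left_module
begin

lemma smult_l_null [simp]: "x \<in> carrier M \<Longrightarrow> \<zero>\<^bsub>R\<^esub> \<odot>\<^bsub>M\<^esub> x = \<zero>\<^bsub>M\<^esub>"
  by (metis M.add.r_cancel_one' R.l_zero R.zero_closed smult_closed smult_l_distr)

lemma smult_r_null [simp]: "a \<in> carrier R \<Longrightarrow> a \<odot>\<^bsub>M\<^esub> \<zero>\<^bsub>M\<^esub> = \<zero>\<^bsub>M\<^esub>"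
  by (metis M.add.r_cancel_one' M.l_zero M.zero_closed smult_closed smult_r_distr)

lemma smult_l_minus:
  "\<lbrakk>a \<in> carrier R; x \<in> carrier M\<rbrakk> \<Longrightarrow> (\<ominus>\<^bsub>R\<^esub> a) \<odot>\<^bsub>M\<^esub> x = \<ominus>\<^bsub>M\<^esub> (a \<odot>\<^bsub>M\<^esub> x)"
  by (metis M.add.inv_equality R.add.inv_closed R.l_neg smult_closed smult_l_distr smult_l_null)

lemma smult_r_minus:
  "\<lbrakk>a \<in> carrier R; x \<in> carrier M\<rbrakk> \<Longrightarrow> a \<odot>\<^bsub>M\<^esub> (\<ominus>\<^bsub>M\<^esub> x) = \<ominus>\<^bsub>M\<^esub> (a \<odot>\<^bsub>M\<^esub> x)"
  by (metis M.add.inv_closed M.add.inv_equality M.l_neg smult_closed smult_r_distr smult_r_null)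

lemma finsum_smult_ldistr:
  "\<lbrakk>finite S; a \<in> carrier R; f \<in> S \<rightarrow> carrier M\<rbrakk> \<Longrightarrow>
   a \<odot>\<^bsub>M\<^esub> finsum M f S = finsum M (\<lambda>i. a \<odot>\<^bsub>M\<^esub> f i) S"
  by (induct set: finite) (auto simp: Pi_def smult_r_distr)

lemma submoduleI:
  assumes "H \<subseteq> carrier M" "\<zero>\<^bsub>M\<^esub> \<in> H"
    and "\<And>a b. \<lbrakk>a \<in> H; b \<in> H\<rbrakk> \<Longrightarrow> a \<oplus>\<^bsub>M\<^esub> b \<in> H"
    and smult: "\<And>a x. \<lbrakk>a \<in> carrier R; x \<in> H\<rbrakk> \<Longrightarrow> a \<odot>\<^bsub>M\<^esub> x \<in> H"
  shows "submodule H R M"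
proof -
  have "\<ominus>\<^bsub>M\<^esub> x \<in> H" if "x \<in> H" for x
    using smult[of "\<ominus>\<^bsub>R\<^esub> \<one>\<^bsub>R\<^esub>" x] that assms(1) by (auto simp: smult_l_minus)
  then show ?thesis
    using assms by (intro submodule.intro subgroup.intro submodule_axioms.intro) (auto simp: a_inv_def)
qed

lemma submoduleD:
  assumes "submodule H R M"
  shows "H \<subseteq> carrier M" "\<zero>\<^bsub>M\<^esub> \<in> H"
    and "\<And>a b. \<lbrakk>a \<in> H; b \<in> H\<rbrakk> \<Longrightarrow> a \<oplus>\<^bsub>M\<^esub> b \<in> H"
    and "\<And>x. x \<in> H \<Longrightarrow> \<ominus>\<^bsub>M\<^esub> x \<in> H"
    and "\<And>a x. \<lbrakk>a \<in> carrier R; x \<in> H\<rbrakk> \<Longrightarrow> a \<odot>\<^bsub>M\<^esub> x \<in> H"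
proof -
  interpret submodule H R M by fact
  interpret subgroup H "add_monoid M" by (rule subgroup_axioms)
  show "H \<subseteq> carrier M" using subset by simp
  show "\<zero>\<^bsub>M\<^esub> \<in> H" using one_closed by simp
  show "a \<oplus>\<^bsub>M\<^esub> b \<in> H" if "a \<in> H" "b \<in> H" for a b using m_closed[OF that] by simp
  show "\<ominus>\<^bsub>M\<^esub> x \<in> H" if "x \<in> H" for x using m_inv_closed[OF that] by (simp add: a_inv_def)
  show "a \<odot>\<^bsub>M\<^esub> x \<in> H" if "a \<in> carrier R" "x \<in> H" for a x using smult_closed that by blast
qed

end

text \<open>Negatives need no separate hypothesis: (-1) x is an additive inverse of x. The law 0 x =
  0 is listed instead, since it cannot be derived before the group structure is known.\<close>

lemma left_moduleI:
  fixes M :: "('a, 'm, 's) module_scheme"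
  assumes "ring R"
    and "\<And>x y. \<lbrakk>x \<in> carrier M; y \<in> carrier M\<rbrakk> \<Longrightarrow> x \<oplus>\<^bsub>M\<^esub> y \<in> carrier M"
    and "\<zero>\<^bsub>M\<^esub> \<in> carrier M"
    and "\<And>x y z. \<lbrakk>x \<in> carrier M; y \<in> carrier M; z \<in> carrier M\<rbrakk> \<Longrightarrow>
      (x \<oplus>\<^bsub>M\<^esub> y) \<oplus>\<^bsub>M\<^esub> z = x \<oplus>\<^bsub>M\<^esub> (y \<oplus>\<^bsub>M\<^esub> z)"
    and "\<And>x y. \<lbrakk>x \<in> carrier M; y \<in> carrier M\<rbrakk> \<Longrightarrow> x \<oplus>\<^bsub>M\<^esub> y = y \<oplus>\<^bsub>M\<^esub> x"
    and "\<And>x. x \<in> carrier M \<Longrightarrow> \<zero>\<^bsub>M\<^esub> \<oplus>\<^bsub>M\<^esub> x = x"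
    and smult_closed: "\<And>a x. \<lbrakk>a \<in> carrier R; x \<in> carrier M\<rbrakk> \<Longrightarrow> a \<odot>\<^bsub>M\<^esub> x \<in> carrier M"
    and l_distr: "\<And>a b x. \<lbrakk>a \<in> carrier R; b \<in> carrier R; x \<in> carrier M\<rbrakk> \<Longrightarrow>
      (a \<oplus>\<^bsub>R\<^esub> b) \<odot>\<^bsub>M\<^esub> x = a \<odot>\<^bsub>M\<^esub> x \<oplus>\<^bsub>M\<^esub> b \<odot>\<^bsub>M\<^esub> x"
    and "\<And>a x y. \<lbrakk>a \<in> carrier R; x \<in> carrier M; y \<in> carrier M\<rbrakk> \<Longrightarrow>
      a \<odot>\<^bsub>M\<^esub> (x \<oplus>\<^bsub>M\<^esub> y) = a \<odot>\<^bsub>M\<^esub> x \<oplus>\<^bsub>M\<^esub> a \<odot>\<^bsub>M\<^esub> y"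
    and "\<And>a b x. \<lbrakk>a \<in> carrier R; b \<in> carrier R; x \<in> carrier M\<rbrakk> \<Longrightarrow>
      (a \<otimes>\<^bsub>R\<^esub> b) \<odot>\<^bsub>M\<^esub> x = a \<odot>\<^bsub>M\<^esub> (b \<odot>\<^bsub>M\<^esub> x)"
    and one: "\<And>x. x \<in> carrier M \<Longrightarrow> \<one>\<^bsub>R\<^esub> \<odot>\<^bsub>M\<^esub> x = x"
    and null: "\<And>x. x \<in> carrier M \<Longrightarrow> \<zero>\<^bsub>R\<^esub> \<odot>\<^bsub>M\<^esub> x = \<zero>\<^bsub>M\<^esub>"
  shows "left_module R M"
proof -
  interpret R: ring R by fact
  have "\<exists>y\<in>carrier M. y \<oplus>\<^bsub>M\<^esub> x = \<zero>\<^bsub>M\<^esub>" if "x \<in> carrier M" for x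
    using that l_distr[of "\<ominus>\<^bsub>R\<^esub> \<one>\<^bsub>R\<^esub>" "\<one>\<^bsub>R\<^esub>" x] one[OF that] null[OF that]
    by (intro bexI[of _ "(\<ominus>\<^bsub>R\<^esub> \<one>\<^bsub>R\<^esub>) \<odot>\<^bsub>M\<^esub> x"]) (auto simp: smult_closed R.l_neg)
  then have "abelian_group M" by (intro abelian_groupI) (use assms in auto)
  then show ?thesis
    using assms by (intro left_module.intro left_module_axioms.intro) auto
qed

lemma submodule_left_module:
  assumes "left_module R M" "submodule H R M"
  shows "left_module R (M\<lparr>carrier := H\<rparr>)"
proof -
  interpret left_module R M by fact
  note H = submoduleD[OF assms(2)]
  show ?thesis
    by (rule left_moduleI[OF R.ring_axioms])
      (use H in \<open>auto simp: subset_iff M.a_assoc smult_l_distr smult_r_distr smult_assoc1 intro: M.a_comm\<close>)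
qed

lemma finsum_carrier_update:
  assumes "abelian_group M" "abelian_group (M\<lparr>carrier := H\<rparr>)" "H \<subseteq> carrier M" "f \<in> S \<rightarrow> H"
  shows "finsum (M\<lparr>carrier := H\<rparr>) f S = finsum M f S"
proof -
  interpret M: abelian_group M by fact
  interpret N: abelian_group "M\<lparr>carrier := H\<rparr>" by fact
  have "f \<in> S \<rightarrow> carrier M" using assms by auto
  with assms(4) show ?thesis
    by (induct S rule: infinite_finite_induct) auto
qed

lemma mod_homI:
  assumes "\<And>x. x \<in> carrier M \<Longrightarrow> f x \<in> carrier N"
    and "\<And>x. x \<notin> carrier M \<Longrightarrow> f x = undefined"
    and "\<And>x y. \<lbrakk>x \<in> carrier M; y \<in> carrier M\<rbrakk> \<Longrightarrow> f (x \<oplus>\<^bsub>M\<^esub> y) = f x \<oplus>\<^bsub>N\<^esub> f y"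
    and "\<And>a x. \<lbrakk>a \<in> carrier R; x \<in> carrier M\<rbrakk> \<Longrightarrow> f (a \<odot>\<^bsub>M\<^esub> x) = a \<odot>\<^bsub>N\<^esub> f x"
  shows "f \<in> mod_hom R M N"
  using assms by (auto simp: mod_hom_def PiE_def extensional_def)

lemma mod_hom_restrictI:
  assumes "left_module R M"
    and "\<And>x. x \<in> carrier M \<Longrightarrow> f x \<in> carrier N"
    and "\<And>x y. \<lbrakk>x \<in> carrier M; y \<in> carrier M\<rbrakk> \<Longrightarrow> f (x \<oplus>\<^bsub>M\<^esub> y) = f x \<oplus>\<^bsub>N\<^esub> f y"
    and "\<And>a x. \<lbrakk>a \<in> carrier R; x \<in> carrier M\<rbrakk> \<Longrightarrow> f (a \<odot>\<^bsub>M\<^esub> x) = a \<odot>\<^bsub>N\<^esub> f x"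
  shows "restrict f (carrier M) \<in> mod_hom R M N"
proof -
  interpret left_module R M by fact
  show ?thesis using assms by (intro mod_homI) auto
qed

lemma mod_homD:
  assumes "f \<in> mod_hom R M N"
  shows "\<And>x. x \<in> carrier M \<Longrightarrow> f x \<in> carrier N"
    and "\<And>x. x \<notin> carrier M \<Longrightarrow> f x = undefined"
    and "\<And>x y. \<lbrakk>x \<in> carrier M; y \<in> carrier M\<rbrakk> \<Longrightarrow> f (x \<oplus>\<^bsub>M\<^esub> y) = f x \<oplus>\<^bsub>N\<^esub> f y"
    and "\<And>a x. \<lbrakk>a \<in> carrier R; x \<in> carrier M\<rbrakk> \<Longrightarrow> f (a \<odot>\<^bsub>M\<^esub> x) = a \<odot>\<^bsub>N\<^esub> f x"
  using assms by (auto simp: mod_hom_def PiE_def extensional_def)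

lemma mod_hom_ext:
  assumes "f \<in> mod_hom R M N" "g \<in> mod_hom R M N" "\<And>x. x \<in> carrier M \<Longrightarrow> f x = g x"
  shows "f = g"
  using assms mod_homD(2) by (metis ext)

lemma mod_hom_zero:
  assumes "f \<in> mod_hom R M N" "left_module R M" "left_module R N"
  shows "f \<zero>\<^bsub>M\<^esub> = \<zero>\<^bsub>N\<^esub>"
proof -
  interpret M: left_module R M by fact
  interpret N: left_module R N by fact
  have "f (\<zero>\<^bsub>R\<^esub> \<odot>\<^bsub>M\<^esub> \<zero>\<^bsub>M\<^esub>) = \<zero>\<^bsub>R\<^esub> \<odot>\<^bsub>N\<^esub> f \<zero>\<^bsub>M\<^esub>" by (rule mod_homD[OF assms(1)]) auto
  then show ?thesis using mod_homD(1)[OF assms(1)] by simp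
qed

lemma mod_hom_minus:
  assumes "f \<in> mod_hom R M N" "left_module R M" "left_module R N" "x \<in> carrier M"
  shows "f (\<ominus>\<^bsub>M\<^esub> x) = \<ominus>\<^bsub>N\<^esub> f x"
proof -
  interpret M: left_module R M by fact
  interpret N: left_module R N by fact
  have "f (\<ominus>\<^bsub>M\<^esub> x) \<oplus>\<^bsub>N\<^esub> f x = \<zero>\<^bsub>N\<^esub>"
    using mod_homD(3)[OF assms(1), of "\<ominus>\<^bsub>M\<^esub> x" x] assms(4) mod_hom_zero[OF assms(1-3)] by (simp add: M.l_neg)
  then show ?thesis
    using mod_homD(1)[OF assms(1)] assms(4) by (metis M.a_inv_closed N.minus_equality)
qed

lemma mod_hom_finsum:
  assumes "f \<in> mod_hom R M N" "left_module R M" "left_module R N" "finite S" "g \<in> S \<rightarrow> carrier M"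
  shows "f (finsum M g S) = finsum N (\<lambda>i. f (g i)) S"
proof -
  interpret M: left_module R M by fact
  interpret N: left_module R N by fact
  show ?thesis
    using assms(4,5) mod_homD[OF assms(1)]
    by (induct S) (auto simp: mod_hom_zero[OF assms(1-3)] Pi_def)
qed

lemma mod_hom_compose:
  assumes "f \<in> mod_hom R M N" "g \<in> mod_hom R N L" "left_module R M"
  shows "compose (carrier M) g f \<in> mod_hom R M L"
  unfolding compose_def
  by (rule mod_hom_restrictI[OF assms(3)]) (use mod_homD[OF assms(1)] mod_homD[OF assms(2)] in auto)

lemma mod_hom_id: "left_module R M \<Longrightarrow> (\<lambda>x\<in>carrier M. x) \<in> mod_hom R M M"
  by (rule mod_hom_restrictI) auto

lemma a_kernel_iff: "x \<in> a_kernel M N f \<longleftrightarrow> x \<in> carrier M \<and> f x = \<zero>\<^bsub>N\<^esub>"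
  by (auto simp: a_kernel_def')

lemma submodule_image:
  assumes "f \<in> mod_hom R M N" "left_module R M" "left_module R N"
  shows "submodule (f ` carrier M) R N"
proof -
  interpret M: left_module R M by fact
  interpret N: left_module R N by fact
  note f = mod_homD[OF assms(1)]
  show ?thesis
  proof (rule N.submoduleI)
    show "\<zero>\<^bsub>N\<^esub> \<in> f ` carrier M" using mod_hom_zero[OF assms] by (metis M.zero_closed imageI)
    show "a \<oplus>\<^bsub>N\<^esub> b \<in> f ` carrier M" if "a \<in> f ` carrier M" "b \<in> f ` carrier M" for a b
      using that f(3) by (auto simp flip: f(3))
    show "a \<odot>\<^bsub>N\<^esub> x \<in> f ` carrier M" if "a \<in> carrier R" "x \<in> f ` carrier M" for a x
      using that by (auto simp flip: f(4))
  qed (use f in auto)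
qed

subsection \<open>Additive spans\<close>

lemma add_span_incl: "x \<in> S \<Longrightarrow> x \<in> add_span M S"
  by (simp add: add_span_def generate.incl)

lemma add_span_zero: "\<zero>\<^bsub>M\<^esub> \<in> add_span M S"
  using generate.one[of "add_monoid M"] by (simp add: add_span_def)

lemma add_span_add: "\<lbrakk>x \<in> add_span M S; y \<in> add_span M S\<rbrakk> \<Longrightarrow> x \<oplus>\<^bsub>M\<^esub> y \<in> add_span M S"
  using generate.eng[of x "add_monoid M" S y] by (simp add: add_span_def)

text \<open>Generation adjoins inverses of generators only, so the case \<open>minus\<close>
  concerns elements of \<open>S\<close> and not arbitrary elements of the span.\<close>

lemma (in abelian_group) add_span_induct [consumes 2, case_names zero incl minus add]:
  assumes "x \<in> add_span G S" "S \<subseteq> carrier G" "P \<zero>" "\<And>x. x \<in> S \<Longrightarrow> P x"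
    and "\<And>x. \<lbrakk>x \<in> S; P x\<rbrakk> \<Longrightarrow> P (\<ominus> x)"
    and "\<And>x y. \<lbrakk>x \<in> carrier G; y \<in> carrier G; P x; P y\<rbrakk> \<Longrightarrow> P (x \<oplus> y)"
  shows "P x"
proof -
  have "x \<in> carrier G \<and> P x"
    using assms(1) unfolding add_span_def
  proof (induct rule: generate.induct)
    case (inv h)
    then show ?case using assms(2,4,5) by (auto simp flip: a_inv_def)
  qed (use assms in auto)
  then show ?thesis by blast
qed

lemma (in abelian_group) add_span_carrier:
  assumes "S \<subseteq> carrier G" shows "add_span G S \<subseteq> carrier G"
proof
  fix x assume "x \<in> add_span G S"
  then show "x \<in> carrier G" using assms by (induct rule: add_span_induct) (use assms in auto)
qed

lemma (in abelian_group) add_span_minus: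
  assumes "S \<subseteq> carrier G" "x \<in> add_span G S" shows "\<ominus> x \<in> add_span G S"
  using assms(2,1)
proof (induct rule: add_span_induct)
  case zero
  have "\<ominus> \<zero> = \<zero>" by (metis a_inv_closed l_neg r_zero zero_closed)
  then show ?case using add_span_zero[of G S] by metis
next
  case (incl x)
  then have "inv\<^bsub>add_monoid G\<^esub> x \<in> generate (add_monoid G) S" by (rule generate.inv)
  then show ?case by (simp add: add_span_def a_inv_def)
next
  case (minus x)
  then show ?case using assms(1) by (auto simp: add_span_incl subset_iff)
next
  case (add x y)
  then show ?case by (simp add: add_span_add minus_add)
qed

lemma (in abelian_group) add_span_least:
  assumes "additive_subgroup H G" "S \<subseteq> H" shows "add_span G S \<subseteq> H"
proof
  interpret additive_subgroup H G by fact
  fix x assume "x \<in> add_span G S"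
  moreover have "S \<subseteq> carrier G" using assms(2) a_subset by auto
  ultimately show "x \<in> H" using assms(2)
    by (induct rule: add_span_induct) auto
qed

lemma (in abelian_group) additive_subgroupI':
  assumes "H \<subseteq> carrier G" "\<zero> \<in> H" "\<And>x y. \<lbrakk>x \<in> H; y \<in> H\<rbrakk> \<Longrightarrow> x \<oplus> y \<in> H" "\<And>x. x \<in> H \<Longrightarrow> \<ominus> x \<in> H"
  shows "additive_subgroup H G"
  using assms by (intro additive_subgroupI subgroup.intro) (auto simp: a_inv_def)

lemma (in abelian_group) additive_subgroup_add_span:
  assumes "S \<subseteq> carrier G" shows "additive_subgroup (add_span G S) G"
  by (rule additive_subgroupI') (use assms in \<open>auto simp: add_span_zero add_span_add add_span_minus dest: add_span_carrier\<close>)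

lemma (in left_module) submodule_additive_subgroup: "submodule H R M \<Longrightarrow> additive_subgroup H M"
  by (rule M.additive_subgroupI') (auto dest: submoduleD)

lemma (in left_module) submodule_add_span:
  assumes "S \<subseteq> carrier M" "\<And>a x. \<lbrakk>a \<in> carrier R; x \<in> S\<rbrakk> \<Longrightarrow> a \<odot>\<^bsub>M\<^esub> x \<in> S"
  shows "submodule (add_span M S) R M"
proof (rule submoduleI)
  fix a x assume a: "a \<in> carrier R" and "x \<in> add_span M S"
  from this(2) show "a \<odot>\<^bsub>M\<^esub> x \<in> add_span M S" using assms(1)
  proof (induct rule: M.add_span_induct)
    case (minus x)
    then show ?case using a assms by (auto simp: subset_iff smult_r_minus intro: M.add_span_minus)
  qed (use a assms in \<open>auto simp: add_span_zero add_span_add smult_r_distr intro: add_span_incl\<close>)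
qed (use assms M.add_span_carrier in \<open>auto simp: add_span_zero add_span_add\<close>)

lemma (in abelian_group) finsum_in_additive_subgroup:
  assumes "additive_subgroup H G" "\<And>i. i \<in> S \<Longrightarrow> f i \<in> H"
  shows "finsum G f S \<in> H"
proof -
  interpret additive_subgroup H G by fact
  show ?thesis using assms(2)
  proof (induct S rule: infinite_finite_induct)
    case (insert x F)
    then have "f \<in> F \<rightarrow> carrier G" "f x \<in> carrier G" using a_subset by auto
    with insert show ?case by auto
  qed (auto simp: zero_closed)
qed

text \<open>The general form of checking a claim on generators. It is applied to homogeneous
  components, to the action of a fixed scalar or on a fixed element, and to homomorphisms, often
  with \<open>H\<close> the zero subgroup in order to prove vanishing.\<close>

lemma add_span_image:
  assumes "abelian_group M" "abelian_group N" "S \<subseteq> carrier M" "x \<in> add_span M S"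
    and closed: "\<And>x. x \<in> carrier M \<Longrightarrow> f x \<in> carrier N"
    and add: "\<And>x y. \<lbrakk>x \<in> carrier M; y \<in> carrier M\<rbrakk> \<Longrightarrow> f (x \<oplus>\<^bsub>M\<^esub> y) = f x \<oplus>\<^bsub>N\<^esub> f y"
    and incl: "\<And>x. x \<in> S \<Longrightarrow> f x \<in> H" and H: "additive_subgroup H N"
  shows "f x \<in> H"
proof -
  interpret M: abelian_group M by fact
  interpret N: abelian_group N by fact
  interpret H: additive_subgroup H N by fact
  have 0: "f \<zero>\<^bsub>M\<^esub> = \<zero>\<^bsub>N\<^esub>"
    using add[of "\<zero>\<^bsub>M\<^esub>" "\<zero>\<^bsub>M\<^esub>"] closed[of "\<zero>\<^bsub>M\<^esub>"] by (metis M.l_zero M.zero_closed N.add.r_cancel_one')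
  show ?thesis
    using assms(4,3)
  proof (induct rule: M.add_span_induct)
    case (minus x)
    then have x: "x \<in> carrier M" using assms(3) by auto
    then have "f (\<ominus>\<^bsub>M\<^esub> x) \<oplus>\<^bsub>N\<^esub> f x = \<zero>\<^bsub>N\<^esub>"
      using add[of "\<ominus>\<^bsub>M\<^esub> x" x] 0 by (simp add: M.l_neg)
    then have "f (\<ominus>\<^bsub>M\<^esub> x) = \<ominus>\<^bsub>N\<^esub> f x"
      using x closed by (metis M.a_inv_closed N.minus_equality)
    then show ?case using minus by simp
  qed (use 0 add incl in auto)
qed

subsection \<open>Quotient modules\<close>

lemma carrier_quot_module: "carrier (quot_module M N) = (\<lambda>x. N +>\<^bsub>M\<^esub> x) ` carrier M"
  by (auto simp: quot_module_def A_RCOSETS_def')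

lemma zero_quot_module [simp]: "\<zero>\<^bsub>quot_module M N\<^esub> = N"
  by (simp add: quot_module_def)

lemma a_r_coset_carrier_update [simp]: "N +>\<^bsub>M\<lparr>carrier := H\<rparr>\<^esub> x = N +>\<^bsub>M\<^esub> x"
  by (simp add: a_r_coset_def')

locale module_quotient = left_module R M
  for R :: "('a, 'r) ring_scheme" and M :: "('a, 'm) module" +
  fixes N assumes sub: "submodule N R M"
begin

sublocale N: abelian_subgroup N M
  by (rule abelian_subgroupI3[OF submodule_additive_subgroup[OF sub] M.abelian_group_axioms])

lemma coset_eq_iff:
  assumes "x \<in> carrier M" "y \<in> carrier M"
  shows "N +>\<^bsub>M\<^esub> x = N +>\<^bsub>M\<^esub> y \<longleftrightarrow> x \<ominus>\<^bsub>M\<^esub> y \<in> N"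
  using assms by (metis N.a_rcos_module_minus N.a_rcos_self N.a_repr_independence' R.ring_axioms
      M.abelian_group_axioms N.a_rcos_module a_minus_def)

lemma coset_zero: "N +>\<^bsub>M\<^esub> \<zero>\<^bsub>M\<^esub> = N"
  by (rule M.a_coset_add_zero[OF N.a_subset])

lemma coset_zero_iff: assumes "x \<in> carrier M" shows "N +>\<^bsub>M\<^esub> x = N \<longleftrightarrow> x \<in> N"
proof -
  have "\<ominus>\<^bsub>M\<^esub> \<zero>\<^bsub>M\<^esub> = \<zero>\<^bsub>M\<^esub>" by (rule M.minus_equality) auto
  then have "x \<ominus>\<^bsub>M\<^esub> \<zero>\<^bsub>M\<^esub> = x" using assms by (simp only: a_minus_def M.r_zero)
  then show ?thesis using coset_eq_iff[OF assms M.zero_closed] coset_zero by simp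
qed

lemma coset_self: "x \<in> carrier M \<Longrightarrow> x \<in> N +>\<^bsub>M\<^esub> x"
  by (rule N.a_rcos_self)

lemma coset_memD:
  assumes "x \<in> carrier M" "y \<in> N +>\<^bsub>M\<^esub> x"
  shows "y \<in> carrier M" "N +>\<^bsub>M\<^esub> y = N +>\<^bsub>M\<^esub> x"
  by (rule N.a_elemrcos_carrier[OF assms], rule N.a_repr_independence'[OF assms(2,1), symmetric])

lemma add_coset:
  assumes "x \<in> carrier M" "y \<in> carrier M"
  shows "(N +>\<^bsub>M\<^esub> x) \<oplus>\<^bsub>quot_module M N\<^esub> (N +>\<^bsub>M\<^esub> y) = N +>\<^bsub>M\<^esub> (x \<oplus>\<^bsub>M\<^esub> y)"
  using N.a_rcos_sum[OF assms] by (simp add: quot_module_def)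

text \<open>The scalar action on a quotient is a union over all representatives of the coset. Two
  representatives differ by an element of the submodule, so all the cosets united are equal.\<close>

lemma smult_coset:
  assumes "a \<in> carrier R" "x \<in> carrier M"
  shows "a \<odot>\<^bsub>quot_module M N\<^esub> (N +>\<^bsub>M\<^esub> x) = N +>\<^bsub>M\<^esub> (a \<odot>\<^bsub>M\<^esub> x)"
proof -
  have "N +>\<^bsub>M\<^esub> (a \<odot>\<^bsub>M\<^esub> y) = N +>\<^bsub>M\<^esub> (a \<odot>\<^bsub>M\<^esub> x)" if y: "y \<in> N +>\<^bsub>M\<^esub> x" for y
  proof -
    have "y \<in> carrier M" "y \<ominus>\<^bsub>M\<^esub> x \<in> N"
      using coset_memD[OF assms(2) y] coset_eq_iff[OF coset_memD(1)[OF assms(2) y] assms(2)] by simp_all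
    moreover from this have "a \<odot>\<^bsub>M\<^esub> y \<ominus>\<^bsub>M\<^esub> a \<odot>\<^bsub>M\<^esub> x = a \<odot>\<^bsub>M\<^esub> (y \<ominus>\<^bsub>M\<^esub> x)"
      using assms by (simp add: a_minus_def smult_r_distr smult_r_minus)
    ultimately show ?thesis using assms submoduleD(5)[OF sub] by (subst coset_eq_iff) auto
  qed
  then have "(\<Union>y\<in>N +>\<^bsub>M\<^esub> x. N +>\<^bsub>M\<^esub> (a \<odot>\<^bsub>M\<^esub> y)) = (\<Union>y\<in>N +>\<^bsub>M\<^esub> x. N +>\<^bsub>M\<^esub> (a \<odot>\<^bsub>M\<^esub> x))"
    by (rule SUP_cong[OF refl])
  then show ?thesis using coset_self[OF assms(2)] by (auto simp: quot_module_def)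
qed

lemma left_module_quot: "left_module R (quot_module M N)"
proof (rule left_moduleI[OF R.ring_axioms])
  show "\<zero>\<^bsub>quot_module M N\<^esub> \<in> carrier (quot_module M N)"
    using coset_zero by (auto simp: carrier_quot_module intro!: image_eqI[of _ _ "\<zero>\<^bsub>M\<^esub>"])
  have "N \<oplus>\<^bsub>quot_module M N\<^esub> (N +>\<^bsub>M\<^esub> x) = N +>\<^bsub>M\<^esub> x" if "x \<in> carrier M" for x
    using add_coset[of "\<zero>\<^bsub>M\<^esub>" x] that by (simp add: coset_zero)
  then show "\<And>x. x \<in> carrier (quot_module M N) \<Longrightarrow> \<zero>\<^bsub>quot_module M N\<^esub> \<oplus>\<^bsub>quot_module M N\<^esub> x = x"
    by (auto simp: carrier_quot_module)
  show "x \<oplus>\<^bsub>quot_module M N\<^esub> y = y \<oplus>\<^bsub>quot_module M N\<^esub> x"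
    if "x \<in> carrier (quot_module M N)" "y \<in> carrier (quot_module M N)" for x y
    using that by (auto simp: carrier_quot_module add_coset) (simp_all add: M.a_comm)
qed (auto simp: carrier_quot_module add_coset smult_coset M.a_assoc smult_l_distr smult_r_distr
      smult_assoc1 coset_zero)

sublocale Q: left_module R "quot_module M N"
  by (rule left_module_quot)

lemma proj_hom: "(\<lambda>x\<in>carrier M. N +>\<^bsub>M\<^esub> x) \<in> mod_hom R M (quot_module M N)"
  by (rule mod_hom_restrictI[OF left_module_axioms])
    (auto simp: carrier_quot_module add_coset smult_coset)

end

lemma module_quotientI: "\<lbrakk>left_module R M; submodule N R M\<rbrakk> \<Longrightarrow> module_quotient R M N"
  by (simp add: module_quotient_def module_quotient_axioms_def)

lemma left_module_regular_module:
  fixes B :: "('k, 'b) module"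
  assumes "ring B" shows "left_module B (regular_module B)"
proof -
  interpret B: ring B by fact
  show ?thesis
    by (rule left_moduleI[OF assms])
      (auto simp: regular_module_def B.a_assoc B.l_distr B.r_distr B.m_assoc intro: B.a_comm)
qed

subsection \<open>Spanning sets and free modules\<close>

text \<open>Phrased through submodules instead of coefficients: the same notion serves over
  \<open>K\<close> and over \<open>A\<close>, and using a spanning set means exhibiting a single
  submodule.\<close>

definition spans :: "('a, 'r) ring_scheme \<Rightarrow> ('a, 'm, 's) module_scheme \<Rightarrow> 'm set \<Rightarrow> bool" where
  "spans R M S \<longleftrightarrow> S \<subseteq> carrier M \<and> (\<forall>W. submodule W R M \<longrightarrow> S \<subseteq> W \<longrightarrow> carrier M \<subseteq> W)"

lemma spansD: "\<lbrakk>spans R M S; submodule W R M; S \<subseteq> W; x \<in> carrier M\<rbrakk> \<Longrightarrow> x \<in> W"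
  by (auto simp: spans_def)

text \<open>Coordinates outside \<open>I\<close> are zero. For \<open>I = carrier P\<close> the
  module has exactly the type of the test modules \<open>U\<close> in
  \<open>projective_module\<close>.\<close>

definition free_module :: "('a, 'r) ring_scheme \<Rightarrow> 'i set \<Rightarrow> ('a, 'i \<Rightarrow> 'a) module" where
  "free_module R I =
     \<lparr>carrier = {h. (\<forall>i. h i \<in> carrier R) \<and> (\<forall>i. i \<notin> I \<longrightarrow> h i = \<zero>\<^bsub>R\<^esub>) \<and> finite {i\<in>I. h i \<noteq> \<zero>\<^bsub>R\<^esub>}},
      monoid.mult = undefined, monoid.one = undefined,
      ring.zero = (\<lambda>i. \<zero>\<^bsub>R\<^esub>),
      ring.add = (\<lambda>x y i. x i \<oplus>\<^bsub>R\<^esub> y i),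
      smult = (\<lambda>a x i. a \<otimes>\<^bsub>R\<^esub> x i)\<rparr>"

text \<open>The sum runs over the support because \<open>finsum\<close> over an infinite index set
  is zero by default, and \<open>I\<close> may be infinite.\<close>

definition lin_comb ::
    "('a, 'r) ring_scheme \<Rightarrow> ('a, 'm, 's) module_scheme \<Rightarrow> 'i set \<Rightarrow> ('i \<Rightarrow> 'm) \<Rightarrow> ('i \<Rightarrow> 'a) \<Rightarrow> 'm" where
  "lin_comb R M I b h = finsum M (\<lambda>i. h i \<odot>\<^bsub>M\<^esub> b i) {i\<in>I. h i \<noteq> \<zero>\<^bsub>R\<^esub>}"

lemma left_module_free_module:
  assumes "ring R" shows "left_module R (free_module R I)"
proof -
  interpret ring R by fact
  show ?thesis
  proof (rule left_moduleI[OF assms])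
    show "x \<oplus>\<^bsub>free_module R I\<^esub> y \<in> carrier (free_module R I)"
      if "x \<in> carrier (free_module R I)" "y \<in> carrier (free_module R I)" for x y
    proof -
      have "finite ({i\<in>I. x i \<noteq> \<zero>\<^bsub>R\<^esub>} \<union> {i\<in>I. y i \<noteq> \<zero>\<^bsub>R\<^esub>})"
        using that by (auto simp: free_module_def)
      then have "finite {i\<in>I. x i \<oplus>\<^bsub>R\<^esub> y i \<noteq> \<zero>\<^bsub>R\<^esub>}"
        by (rule rev_finite_subset) (use that in \<open>auto simp: free_module_def\<close>)
      then show ?thesis using that by (auto simp: free_module_def)
    qed
    show "a \<odot>\<^bsub>free_module R I\<^esub> x \<in> carrier (free_module R I)"
      if "a \<in> carrier R" "x \<in> carrier (free_module R I)" for a x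
      using that by (auto simp: free_module_def elim!: rev_finite_subset)
  qed (auto simp: free_module_def fun_eq_iff a_assoc m_assoc l_distr r_distr intro: a_comm)
qed

context left_module
begin

lemma lin_comb_superset:
  assumes "finite F" "F \<subseteq> I" "{i\<in>I. h i \<noteq> \<zero>\<^bsub>R\<^esub>} \<subseteq> F" "b \<in> I \<rightarrow> carrier M" "\<And>i. i \<in> I \<Longrightarrow> h i \<in> carrier R"
  shows "lin_comb R M I b h = finsum M (\<lambda>i. h i \<odot>\<^bsub>M\<^esub> b i) F"
  unfolding lin_comb_def
  by (rule M.add.finprod_mono_neutral_cong_left) (use assms in \<open>auto simp: subset_iff Pi_iff\<close>)

lemma lin_comb_closed:
  assumes "b \<in> I \<rightarrow> carrier M" "\<And>i. i \<in> I \<Longrightarrow> h i \<in> carrier R"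
  shows "lin_comb R M I b h \<in> carrier M"
  unfolding lin_comb_def using assms by (intro M.finsum_closed) auto

lemma lin_comb_add:
  assumes "b \<in> I \<rightarrow> carrier M" "\<And>i. i \<in> I \<Longrightarrow> h i \<in> carrier R" "\<And>i. i \<in> I \<Longrightarrow> k i \<in> carrier R"
    and "finite {i\<in>I. h i \<noteq> \<zero>\<^bsub>R\<^esub>}" "finite {i\<in>I. k i \<noteq> \<zero>\<^bsub>R\<^esub>}"
  shows "lin_comb R M I b (\<lambda>i. h i \<oplus>\<^bsub>R\<^esub> k i) = lin_comb R M I b h \<oplus>\<^bsub>M\<^esub> lin_comb R M I b k"
proof -
  let ?F = "{i\<in>I. h i \<noteq> \<zero>\<^bsub>R\<^esub>} \<union> {i\<in>I. k i \<noteq> \<zero>\<^bsub>R\<^esub>}"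
  have F: "finite ?F" "?F \<subseteq> I" using assms by auto
  have "finsum M (\<lambda>i. (h i \<oplus>\<^bsub>R\<^esub> k i) \<odot>\<^bsub>M\<^esub> b i) ?F
      = finsum M (\<lambda>i. h i \<odot>\<^bsub>M\<^esub> b i \<oplus>\<^bsub>M\<^esub> k i \<odot>\<^bsub>M\<^esub> b i) ?F"
    using assms by (intro M.finsum_cong') (auto simp: smult_l_distr Pi_iff)
  also have "\<dots> = finsum M (\<lambda>i. h i \<odot>\<^bsub>M\<^esub> b i) ?F \<oplus>\<^bsub>M\<^esub> finsum M (\<lambda>i. k i \<odot>\<^bsub>M\<^esub> b i) ?F"
    using assms by (intro M.finsum_addf) auto
  finally show ?thesis
    using assms F by (subst (1 2 3) lin_comb_superset[where F = ?F]) auto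
qed

lemma lin_comb_smult:
  assumes "b \<in> I \<rightarrow> carrier M" "\<And>i. i \<in> I \<Longrightarrow> h i \<in> carrier R" "a \<in> carrier R"
    and "finite {i\<in>I. h i \<noteq> \<zero>\<^bsub>R\<^esub>}"
  shows "lin_comb R M I b (\<lambda>i. a \<otimes>\<^bsub>R\<^esub> h i) = a \<odot>\<^bsub>M\<^esub> lin_comb R M I b h"
proof -
  let ?F = "{i\<in>I. h i \<noteq> \<zero>\<^bsub>R\<^esub>}"
  have "finsum M (\<lambda>i. (a \<otimes>\<^bsub>R\<^esub> h i) \<odot>\<^bsub>M\<^esub> b i) ?F = finsum M (\<lambda>i. a \<odot>\<^bsub>M\<^esub> (h i \<odot>\<^bsub>M\<^esub> b i)) ?F"
    using assms by (intro M.finsum_cong') (auto simp: smult_assoc1 Pi_iff)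
  also have "\<dots> = a \<odot>\<^bsub>M\<^esub> finsum M (\<lambda>i. h i \<odot>\<^bsub>M\<^esub> b i) ?F"
    using assms by (intro finsum_smult_ldistr[symmetric]) auto
  finally show ?thesis
    using assms by (subst (1 2) lin_comb_superset[where F = ?F]) auto
qed

lemma lin_comb_basis:
  assumes "b \<in> I \<rightarrow> carrier M" "j \<in> I"
  defines "\<delta> \<equiv> \<lambda>i. if i = j then \<one>\<^bsub>R\<^esub> else \<zero>\<^bsub>R\<^esub>"
  shows "\<delta> \<in> carrier (free_module R I)" "lin_comb R M I b \<delta> = b j"
proof -
  have "{i\<in>I. \<delta> i \<noteq> \<zero>\<^bsub>R\<^esub>} \<subseteq> {j}" by (auto simp: \<delta>_def)
  then show "\<delta> \<in> carrier (free_module R I)"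
    using assms(2) by (auto simp: free_module_def \<delta>_def elim: rev_finite_subset)
  have "lin_comb R M I b \<delta> = finsum M (\<lambda>i. \<delta> i \<odot>\<^bsub>M\<^esub> b i) {j}"
    using assms by (intro lin_comb_superset) (auto simp: \<delta>_def)
  then show "lin_comb R M I b \<delta> = b j" using assms by (auto simp: Pi_iff)
qed

end

lemma lin_comb_hom:
  assumes "left_module R M" "b \<in> I \<rightarrow> carrier M"
  shows "restrict (lin_comb R M I b) (carrier (free_module R I)) \<in> mod_hom R (free_module R I) M"
proof -
  interpret left_module R M by fact
  show ?thesis
    by (rule mod_hom_restrictI[OF left_module_free_module[OF R.ring_axioms]])
      (use assms in \<open>auto simp: free_module_def lin_comb_add lin_comb_smult intro: lin_comb_closed\<close>)
qed

lemma lin_comb_surj: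
  fixes M :: "('a, 'm) module"
  assumes "left_module R M" "spans R M (b ` I)"
  shows "lin_comb R M I b ` carrier (free_module R I) = carrier M"
proof -
  interpret left_module R M by fact
  have b: "b \<in> I \<rightarrow> carrier M" using assms by (auto simp: spans_def)
  have "lin_comb R M I b ` carrier (free_module R I)
      = restrict (lin_comb R M I b) (carrier (free_module R I)) ` carrier (free_module R I)" by simp
  then have sub: "submodule (lin_comb R M I b ` carrier (free_module R I)) R M"
    using submodule_image[OF lin_comb_hom[OF assms(1) b] left_module_free_module[OF R.ring_axioms] assms(1)]
    by simp
  have "b ` I \<subseteq> lin_comb R M I b ` carrier (free_module R I)"
  proof
    fix x assume "x \<in> b ` I"
    then obtain j where j: "j \<in> I" "x = b j" by auto
    then show "x \<in> lin_comb R M I b ` carrier (free_module R I)"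
      using lin_comb_basis[OF b j(1)] by (metis imageI)
  qed
  then show ?thesis using spansD[OF assms(2) sub] submoduleD(1)[OF sub] by auto
qed

lemma (in left_module) submodule_lin_combs:
  "finite S \<Longrightarrow> S \<subseteq> carrier M \<Longrightarrow> submodule {finsum M (\<lambda>v. c v \<odot>\<^bsub>M\<^esub> v) S | c. c \<in> S \<rightarrow> carrier R} R M"
proof (rule submoduleI)
  let ?W = "{finsum M (\<lambda>v. c v \<odot>\<^bsub>M\<^esub> v) S | c. c \<in> S \<rightarrow> carrier R}"
  assume S: "finite S" "S \<subseteq> carrier M"
  show "?W \<subseteq> carrier M" using S by (auto intro!: M.finsum_closed)
  have "finsum M (\<lambda>v. \<zero>\<^bsub>R\<^esub> \<odot>\<^bsub>M\<^esub> v) S = finsum M (\<lambda>v. \<zero>\<^bsub>M\<^esub>) S"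
    using S by (intro M.finsum_cong') auto
  then have "finsum M (\<lambda>v. (\<lambda>_. \<zero>\<^bsub>R\<^esub>) v \<odot>\<^bsub>M\<^esub> v) S = \<zero>\<^bsub>M\<^esub>" by simp
  then show "\<zero>\<^bsub>M\<^esub> \<in> ?W" by (intro CollectI exI[of _ "\<lambda>_. \<zero>\<^bsub>R\<^esub>"]) auto
  fix x assume "x \<in> ?W"
  then obtain c where c: "x = finsum M (\<lambda>v. c v \<odot>\<^bsub>M\<^esub> v) S" "c \<in> S \<rightarrow> carrier R" by auto
  { fix y assume "y \<in> ?W"
    then obtain k where k: "y = finsum M (\<lambda>v. k v \<odot>\<^bsub>M\<^esub> v) S" "k \<in> S \<rightarrow> carrier R" by auto
    have "finsum M (\<lambda>v. (c v \<oplus>\<^bsub>R\<^esub> k v) \<odot>\<^bsub>M\<^esub> v) S = finsum M (\<lambda>v. c v \<odot>\<^bsub>M\<^esub> v \<oplus>\<^bsub>M\<^esub> k v \<odot>\<^bsub>M\<^esub> v) S"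
      using S c k by (intro M.finsum_cong') (auto simp: smult_l_distr Pi_iff subset_iff)
    also have "\<dots> = x \<oplus>\<^bsub>M\<^esub> y" using S c k by (simp add: M.finsum_addf Pi_iff subset_iff)
    finally show "x \<oplus>\<^bsub>M\<^esub> y \<in> ?W" using c k by (intro CollectI exI[of _ "\<lambda>v. c v \<oplus>\<^bsub>R\<^esub> k v"]) (auto simp: Pi_iff)
  }
  fix a assume a: "a \<in> carrier R"
  have "finsum M (\<lambda>v. (a \<otimes>\<^bsub>R\<^esub> c v) \<odot>\<^bsub>M\<^esub> v) S = finsum M (\<lambda>v. a \<odot>\<^bsub>M\<^esub> (c v \<odot>\<^bsub>M\<^esub> v)) S"
    using S c a by (intro M.finsum_cong') (auto simp: smult_assoc1 Pi_iff subset_iff)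
  also have "\<dots> = a \<odot>\<^bsub>M\<^esub> x" using S c a by (simp add: finsum_smult_ldistr Pi_iff subset_iff)
  finally show "a \<odot>\<^bsub>M\<^esub> x \<in> ?W" using c a by (intro CollectI exI[of _ "\<lambda>v. a \<otimes>\<^bsub>R\<^esub> c v"]) (auto simp: Pi_iff)
qed

lemma fin_dim_iff:
  assumes "left_module K V"
  shows "fin_dim K V \<longleftrightarrow> (\<exists>S. finite S \<and> spans K V S)"
proof
  interpret left_module K V by fact
  {
    assume "fin_dim K V"
    then obtain S where S: "finite S" "S \<subseteq> carrier V"
        "carrier V = {finsum V (\<lambda>v. c v \<odot>\<^bsub>V\<^esub> v) S | c. c \<in> S \<rightarrow> carrier K}"
      by (auto simp: fin_dim_def)
    have "carrier V \<subseteq> W" if W: "submodule W K V" "S \<subseteq> W" for W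
    proof
      fix x assume "x \<in> carrier V"
      then obtain c where "x = finsum V (\<lambda>v. c v \<odot>\<^bsub>V\<^esub> v) S" "c \<in> S \<rightarrow> carrier K" using S by auto
      moreover from this have "\<And>v. v \<in> S \<Longrightarrow> c v \<odot>\<^bsub>V\<^esub> v \<in> W"
        using W(2) submoduleD(5)[OF W(1)] by (auto simp: Pi_iff)
      ultimately show "x \<in> W"
        by (simp only: M.finsum_in_additive_subgroup[OF submodule_additive_subgroup[OF W(1)]])
    qed
    then show "\<exists>S. finite S \<and> spans K V S" using S by (auto simp: spans_def)
  }
  assume "\<exists>S. finite S \<and> spans K V S"
  then obtain S where S: "finite S" "spans K V S" by auto
  then have sub: "S \<subseteq> carrier V" by (simp add: spans_def)
  let ?W = "{finsum V (\<lambda>v. c v \<odot>\<^bsub>V\<^esub> v) S | c. c \<in> S \<rightarrow> carrier K}"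
  have W: "submodule ?W K V" by (rule submodule_lin_combs[OF S(1) sub])
  have "S \<subseteq> ?W"
  proof
    fix s assume s: "s \<in> S"
    let ?c = "\<lambda>v. if v = s then \<one>\<^bsub>K\<^esub> else \<zero>\<^bsub>K\<^esub>"
    have "finsum V (\<lambda>v. ?c v \<odot>\<^bsub>V\<^esub> v) S = finsum V (\<lambda>v. if s = v then v else \<zero>\<^bsub>V\<^esub>) S"
      using s sub by (intro M.finsum_cong') auto
    also have "\<dots> = s" using M.add.finprod_singleton[OF s S(1), of "\<lambda>v. v"] sub by auto
    finally show "s \<in> ?W" by (intro CollectI exI[of _ ?c]) auto
  qed
  then have "carrier V = ?W" using S(2) W submoduleD(1)[OF W] by (auto simp: spans_def)
  then show "fin_dim K V" using S(1) sub by (auto simp: fin_dim_def)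
qed

subsection \<open>Projective modules\<close>

text \<open>The coordinates of the dual basis lemma: x is the sum of the \<phi>_i(x) b_i. The index
  type is free, so projectivity can be handled without restrictions on the types of test
  modules.\<close>

definition dual_basis ::
    "('a, 'r) ring_scheme \<Rightarrow> ('a, 'p) module \<Rightarrow> 'i set \<Rightarrow> ('i \<Rightarrow> 'p) \<Rightarrow> ('i \<Rightarrow> 'p \<Rightarrow> 'a) \<Rightarrow> bool" where
  "dual_basis R P I b \<phi> \<longleftrightarrow> b \<in> I \<rightarrow> carrier P \<and>
     (\<forall>i\<in>I. \<forall>x\<in>carrier P. \<phi> i x \<in> carrier R) \<and>
     (\<forall>i\<in>I. \<forall>x\<in>carrier P. \<forall>y\<in>carrier P. \<phi> i (x \<oplus>\<^bsub>P\<^esub> y) = \<phi> i x \<oplus>\<^bsub>R\<^esub> \<phi> i y) \<and>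
     (\<forall>i\<in>I. \<forall>a\<in>carrier R. \<forall>x\<in>carrier P. \<phi> i (a \<odot>\<^bsub>P\<^esub> x) = a \<otimes>\<^bsub>R\<^esub> \<phi> i x) \<and>
     (\<forall>x\<in>carrier P. finite {i\<in>I. \<phi> i x \<noteq> \<zero>\<^bsub>R\<^esub>} \<and> lin_comb R P I b (\<lambda>i. \<phi> i x) = x)"

lemma lin_comb_cong:
  assumes "left_module R M" "b \<in> I \<rightarrow> carrier M" "\<And>i. i \<in> I \<Longrightarrow> k i \<in> carrier R" "\<And>i. i \<in> I \<Longrightarrow> h i = k i"
  shows "lin_comb R M I b h = lin_comb R M I b k"
proof -
  interpret left_module R M by fact
  have "{i\<in>I. h i \<noteq> \<zero>\<^bsub>R\<^esub>} = {i\<in>I. k i \<noteq> \<zero>\<^bsub>R\<^esub>}" using assms(4) by auto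
  then show ?thesis unfolding lin_comb_def
    by (rule M.finsum_cong') (use assms in \<open>auto simp: Pi_iff\<close>)
qed

text \<open>Choose preimages u_i of the f(b_i) under g; then x |-> sum of \<phi>_i(x) u_i is a lift
  of f. Only the elements f(b_i) need preimages, so g need not be onto.\<close>

lemma dual_basis_lift:
  assumes db: "dual_basis R P I b \<phi>"
    and mods: "left_module R P" "left_module R U" "left_module R V"
    and g: "g \<in> mod_hom R U V" and f: "f \<in> mod_hom R P V" and img: "f ` carrier P \<subseteq> g ` carrier U"
  shows "\<exists>h\<in>mod_hom R P U. \<forall>x\<in>carrier P. g (h x) = f x"
proof -
  interpret P: left_module R P by fact
  interpret U: left_module R U by fact
  interpret V: left_module R V by fact
  note db' = db[unfolded dual_basis_def]
  have "\<exists>u. u \<in> carrier U \<and> g u = f (b i)" if "i \<in> I" for i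
  proof -
    have "b i \<in> carrier P" using db' that by (auto simp: Pi_iff)
    then have "f (b i) \<in> g ` carrier U" using img by blast
    then show ?thesis by (metis imageE)
  qed
  then obtain u where u: "\<And>i. i \<in> I \<Longrightarrow> u i \<in> carrier U \<and> g (u i) = f (b i)" by metis
  then have u': "u \<in> I \<rightarrow> carrier U" by auto
  define h where "h x = lin_comb R U I u (\<lambda>i. \<phi> i x)" for x
  have "restrict h (carrier P) \<in> mod_hom R P U"
  proof (rule mod_hom_restrictI[OF mods(1)])
    show "h x \<in> carrier U" if "x \<in> carrier P" for x
      unfolding h_def using that db' u' by (intro U.lin_comb_closed) auto
    show "h (x \<oplus>\<^bsub>P\<^esub> y) = h x \<oplus>\<^bsub>U\<^esub> h y" if "x \<in> carrier P" "y \<in> carrier P" for x y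
    proof -
      have "h (x \<oplus>\<^bsub>P\<^esub> y) = lin_comb R U I u (\<lambda>i. \<phi> i x \<oplus>\<^bsub>R\<^esub> \<phi> i y)"
        unfolding h_def by (rule lin_comb_cong[OF mods(2) u']) (use that db' in auto)
      then show ?thesis unfolding h_def using U.lin_comb_add[OF u'] that db' by simp
    qed
    show "h (a \<odot>\<^bsub>P\<^esub> x) = a \<odot>\<^bsub>U\<^esub> h x" if "a \<in> carrier R" "x \<in> carrier P" for a x
    proof -
      have "h (a \<odot>\<^bsub>P\<^esub> x) = lin_comb R U I u (\<lambda>i. a \<otimes>\<^bsub>R\<^esub> \<phi> i x)"
        unfolding h_def by (rule lin_comb_cong[OF mods(2) u']) (use that db' in auto)
      then show ?thesis unfolding h_def using U.lin_comb_smult[OF u'] that db' by simp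
    qed
  qed
  moreover have "g (h x) = f x" if x: "x \<in> carrier P" for x
  proof -
    let ?S = "{i\<in>I. \<phi> i x \<noteq> \<zero>\<^bsub>R\<^esub>}"
    have "g (h x) = finsum V (\<lambda>i. g (\<phi> i x \<odot>\<^bsub>U\<^esub> u i)) ?S"
      unfolding h_def lin_comb_def using x db' u' by (intro mod_hom_finsum[OF g mods(2,3)]) auto
    also have "\<dots> = finsum V (\<lambda>i. f (\<phi> i x \<odot>\<^bsub>P\<^esub> b i)) ?S"
      using x db' u by (intro V.finsum_cong') (auto simp: mod_homD[OF g] mod_homD[OF f] Pi_iff)
    also have "\<dots> = f (lin_comb R P I b (\<lambda>i. \<phi> i x))"
      unfolding lin_comb_def using x db' by (intro mod_hom_finsum[OF f mods(1,3), symmetric]) auto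
    finally show ?thesis using x db' by simp
  qed
  ultimately show ?thesis by (intro bexI[of _ "restrict h (carrier P)"]) auto
qed

lemma dual_basis_of_section:
  assumes "left_module R P" "b \<in> I \<rightarrow> carrier P"
    and h: "h \<in> mod_hom R P (free_module R I)" "\<And>x. x \<in> carrier P \<Longrightarrow> lin_comb R P I b (h x) = x"
  shows "dual_basis R P I b (\<lambda>i x. h x i)"
proof -
  have "h x \<in> carrier (free_module R I)" if "x \<in> carrier P" for x by (rule mod_homD(1)[OF h(1) that])
  then show ?thesis
    unfolding dual_basis_def using assms(2) h(2) mod_homD(3,4)[OF h(1)]
    by (auto simp: free_module_def)
qed

text \<open>The identity of P is lifted along the surjection from the free module on the carrier of
  P, a test that the types in \<open>projective_module\<close> permit. The coordinates of the
  resulting section form the dual basis.\<close>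

lemma projective_module_dual_basis:
  fixes R :: "('k, 'a) module" and P :: "('a, 'p) module"
  assumes "projective_module R P"
  shows "\<exists>\<phi>. dual_basis R P (carrier P) (\<lambda>x. x) \<phi>"
proof -
  have P: "left_module R P" using assms by (simp add: projective_module_def)
  interpret P: left_module R P by fact
  let ?F = "free_module R (carrier P)" and ?L = "lin_comb R P (carrier P) (\<lambda>x. x)"
  have F: "left_module R ?F" by (rule left_module_free_module[OF P.R.ring_axioms])
  have b: "(\<lambda>x. x) \<in> carrier P \<rightarrow> carrier P" by auto
  have surj: "restrict ?L (carrier ?F) ` carrier ?F = carrier P"
    using lin_comb_surj[OF P, of "\<lambda>x. x" "carrier P"] by (auto simp: spans_def)
  obtain h where h: "h \<in> mod_hom R P ?F" "\<And>x. x \<in> carrier P \<Longrightarrow> restrict ?L (carrier ?F) (h x) = x"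
  proof -
    have "\<exists>h\<in>mod_hom R P ?F. \<forall>x\<in>carrier P. restrict ?L (carrier ?F) (h x) = (\<lambda>x\<in>carrier P. x) x"
      using assms[unfolded projective_module_def, THEN conjunct2, rule_format,
          OF F P lin_comb_hom[OF P b] surj mod_hom_id[OF P]] by simp
    then show ?thesis using that by auto
  qed
  then have "?L (h x) = x" if "x \<in> carrier P" for x using that mod_homD(1)[OF h(1) that] h(2) by fastforce
  then show ?thesis using dual_basis_of_section[OF P b h(1)] by blast
qed

lemma projective_module_lift:
  assumes "projective_module R P" "left_module R U" "left_module R V"
    and "g \<in> mod_hom R U V" "f \<in> mod_hom R P V" "f ` carrier P \<subseteq> g ` carrier U"
  shows "\<exists>h\<in>mod_hom R P U. \<forall>x\<in>carrier P. g (h x) = f x"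
proof -
  obtain \<phi> where "dual_basis R P (carrier P) (\<lambda>x. x) \<phi>" using projective_module_dual_basis[OF assms(1)] by blast
  moreover have "left_module R P" using assms(1) by (simp add: projective_module_def)
  ultimately show ?thesis by (rule dual_basis_lift) fact+
qed

text \<open>A finite spanning set yields a finite dual basis. This is what later makes Hom(R_i, A_0)
  finite-dimensional.\<close>

lemma projective_module_dual_basis_spans:
  assumes "projective_module R P" "spans R P S"
  shows "\<exists>\<phi>. dual_basis R P S (\<lambda>x. x) \<phi>"
proof -
  have P: "left_module R P" using assms by (simp add: projective_module_def)
  interpret P: left_module R P by fact
  let ?F = "free_module R S" and ?L = "lin_comb R P S (\<lambda>x. x)"
  have F: "left_module R ?F" by (rule left_module_free_module[OF P.R.ring_axioms])
  have b: "(\<lambda>x. x) \<in> S \<rightarrow> carrier P" using assms(2) by (auto simp: spans_def)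
  have surj: "restrict ?L (carrier ?F) ` carrier ?F = carrier P"
    using lin_comb_surj[OF P, of "\<lambda>x. x" S] assms(2) by simp
  obtain h where h: "h \<in> mod_hom R P ?F" "\<And>x. x \<in> carrier P \<Longrightarrow> restrict ?L (carrier ?F) (h x) = x"
  proof -
    have "\<exists>h\<in>mod_hom R P ?F. \<forall>x\<in>carrier P. restrict ?L (carrier ?F) (h x) = (\<lambda>x\<in>carrier P. x) x"
      using surj by (intro projective_module_lift[OF assms(1) F P lin_comb_hom[OF P b] mod_hom_id[OF P]]) auto
    then show ?thesis using that by auto
  qed
  then have "?L (h x) = x" if "x \<in> carrier P" for x using that mod_homD(1)[OF h(1) that] h(2) by fastforce
  then show ?thesis using dual_basis_of_section[OF P b h(1)] by blast
qed

lemma dual_basis_projective: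
  fixes R :: "('k, 'a) module" and P :: "('a, 'p) module"
  assumes "dual_basis R P I b \<phi>" "left_module R P"
  shows "projective_module R P"
  unfolding projective_module_def
proof (intro conjI allI impI ballI assms(2))
  fix U :: "('a, 'p \<Rightarrow> 'a) module" and V :: "('a, 'p) module" and g f
  assume "left_module R U" "left_module R V" "g \<in> mod_hom R U V" "g ` carrier U = carrier V" "f \<in> mod_hom R P V"
  moreover from this have "f ` carrier P \<subseteq> g ` carrier U" by (auto simp: mod_homD(1))
  ultimately show "\<exists>h\<in>mod_hom R P U. \<forall>x\<in>carrier P. g (h x) = f x"
    by (intro dual_basis_lift[OF assms])
qed

subsection \<open>Convolution algebras\<close>

text \<open>Both sides sum \<open>F\<close> over the triangle j + k <= n; passing from n to n + 1
  adds the antidiagonal j + k = n + 1 to either side. This is the reindexing behind associativity of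
  convolution.\<close>

lemma (in abelian_monoid) finsum_triangle:
  assumes "\<And>j k. j + k \<le> n \<Longrightarrow> F j k \<in> carrier G"
  shows "(\<Oplus>i\<in>{..n::nat}. \<Oplus>j\<in>{..i}. F j (i - j)) = (\<Oplus>j\<in>{..n}. \<Oplus>k\<in>{..n - j}. F j k)"
  using assms
proof (induct n)
  case 0
  then show ?case by simp
next
  case (Suc n)
  let ?s = "\<lambda>j. \<Oplus>k\<in>{..n - j}. F j k"
  have F: "F j k \<in> carrier G" if "j + k \<le> Suc n" for j k using Suc.prems that by auto
  have eq: "(\<Oplus>k\<in>{..Suc n - j}. F j k) = F j (Suc n - j) \<oplus> ?s j" if "j \<le> n" for j
    using that F by (simp add: Suc_diff_le Pi_iff)
  have "(\<Oplus>j\<in>{..Suc n}. \<Oplus>k\<in>{..Suc n - j}. F j k)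
      = (\<Oplus>k\<in>{..0}. F (Suc n) k) \<oplus> (\<Oplus>j\<in>{..n}. \<Oplus>k\<in>{..Suc n - j}. F j k)"
    using F by (subst finsum_Suc) (auto intro!: finsum_closed)
  also have "(\<Oplus>j\<in>{..n}. \<Oplus>k\<in>{..Suc n - j}. F j k) = (\<Oplus>j\<in>{..n}. F j (Suc n - j) \<oplus> ?s j)"
    using F by (intro finsum_cong') (auto simp: eq intro!: finsum_closed a_closed)
  also have "\<dots> = (\<Oplus>j\<in>{..n}. F j (Suc n - j)) \<oplus> (\<Oplus>j\<in>{..n}. ?s j)"
    using F by (intro finsum_addf) (auto intro!: finsum_closed)
  also have "(\<Oplus>k\<in>{..0}. F (Suc n) k) = F (Suc n) 0" using F by simp
  finally have *: "(\<Oplus>j\<in>{..Suc n}. \<Oplus>k\<in>{..Suc n - j}. F j k)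
      = F (Suc n) 0 \<oplus> ((\<Oplus>j\<in>{..n}. F j (Suc n - j)) \<oplus> (\<Oplus>j\<in>{..n}. ?s j))" .
  have "(\<Oplus>i\<in>{..Suc n}. \<Oplus>j\<in>{..i}. F j (i - j))
      = (\<Oplus>j\<in>{..Suc n}. F j (Suc n - j)) \<oplus> (\<Oplus>i\<in>{..n}. \<Oplus>j\<in>{..i}. F j (i - j))"
    using F by (subst finsum_Suc) (auto intro!: finsum_closed)
  also have "(\<Oplus>i\<in>{..n}. \<Oplus>j\<in>{..i}. F j (i - j)) = (\<Oplus>j\<in>{..n}. ?s j)"
    using Suc by simp
  also have "(\<Oplus>j\<in>{..Suc n}. F j (Suc n - j)) = F (Suc n) 0 \<oplus> (\<Oplus>j\<in>{..n}. F j (Suc n - j))"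
    using F by (subst finsum_Suc) auto
  finally have "(\<Oplus>i\<in>{..Suc n}. \<Oplus>j\<in>{..i}. F j (i - j))
      = F (Suc n) 0 \<oplus> (\<Oplus>j\<in>{..n}. F j (Suc n - j)) \<oplus> (\<Oplus>j\<in>{..n}. ?s j)" .
  moreover have "F (Suc n) 0 \<oplus> (\<Oplus>j\<in>{..n}. F j (Suc n - j)) \<oplus> (\<Oplus>j\<in>{..n}. ?s j)
      = F (Suc n) 0 \<oplus> ((\<Oplus>j\<in>{..n}. F j (Suc n - j)) \<oplus> (\<Oplus>j\<in>{..n}. ?s j))"
    using F by (intro a_assoc) (auto intro!: finsum_closed)
  ultimately show ?case unfolding * by simp
qed

text \<open>Separates the formal passage from products between degrees to an algebra on the direct
  sum from the homological work on Yoneda products. All degrees share one type, so the degrees of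
  the factors are explicit arguments of \<open>m\<close>.\<close>

locale graded_product =
  fixes K :: "('k, 'z) ring_scheme" and E :: "nat \<Rightarrow> ('k, 'v) module"
    and m :: "nat \<Rightarrow> nat \<Rightarrow> 'v \<Rightarrow> 'v \<Rightarrow> 'v" and u :: 'v
  assumes K: "cring K" and E: "\<And>i. left_module K (E i)"
    and closed: "\<And>i j x y. \<lbrakk>x \<in> carrier (E i); y \<in> carrier (E j)\<rbrakk> \<Longrightarrow> m i j x y \<in> carrier (E (i + j))"
    and add_l: "\<And>i j x x' y. \<lbrakk>x \<in> carrier (E i); x' \<in> carrier (E i); y \<in> carrier (E j)\<rbrakk> \<Longrightarrow>
      m i j (x \<oplus>\<^bsub>E i\<^esub> x') y = m i j x y \<oplus>\<^bsub>E (i + j)\<^esub> m i j x' y"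
    and add_r: "\<And>i j x y y'. \<lbrakk>x \<in> carrier (E i); y \<in> carrier (E j); y' \<in> carrier (E j)\<rbrakk> \<Longrightarrow>
      m i j x (y \<oplus>\<^bsub>E j\<^esub> y') = m i j x y \<oplus>\<^bsub>E (i + j)\<^esub> m i j x y'"
    and smult_l: "\<And>i j c x y. \<lbrakk>c \<in> carrier K; x \<in> carrier (E i); y \<in> carrier (E j)\<rbrakk> \<Longrightarrow>
      m i j (c \<odot>\<^bsub>E i\<^esub> x) y = c \<odot>\<^bsub>E (i + j)\<^esub> m i j x y"
    and smult_r: "\<And>i j c x y. \<lbrakk>c \<in> carrier K; x \<in> carrier (E i); y \<in> carrier (E j)\<rbrakk> \<Longrightarrow>
      m i j x (c \<odot>\<^bsub>E j\<^esub> y) = c \<odot>\<^bsub>E (i + j)\<^esub> m i j x y"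
    and assoc: "\<And>i j k x y z. \<lbrakk>x \<in> carrier (E i); y \<in> carrier (E j); z \<in> carrier (E k)\<rbrakk> \<Longrightarrow>
      m (i + j) k (m i j x y) z = m i (j + k) x (m j k y z)"
    and u: "u \<in> carrier (E 0)"
    and unit_l: "\<And>i x. x \<in> carrier (E i) \<Longrightarrow> m 0 i u x = x"
    and unit_r: "\<And>i x. x \<in> carrier (E i) \<Longrightarrow> m i 0 x u = x"
begin

sublocale E: left_module K "E i" for i by (rule E)

lemma zero_l: "y \<in> carrier (E j) \<Longrightarrow> m i j \<zero>\<^bsub>E i\<^esub> y = \<zero>\<^bsub>E (i + j)\<^esub>"
  using smult_l[of "\<zero>\<^bsub>K\<^esub>" "\<zero>\<^bsub>E i\<^esub>" i y j] closed[of "\<zero>\<^bsub>E i\<^esub>" i y j] by simp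

lemma zero_r: "x \<in> carrier (E i) \<Longrightarrow> m i j x \<zero>\<^bsub>E j\<^esub> = \<zero>\<^bsub>E (i + j)\<^esub>"
  using smult_r[of "\<zero>\<^bsub>K\<^esub>" x i "\<zero>\<^bsub>E j\<^esub>" j] closed[of x i "\<zero>\<^bsub>E j\<^esub>" j] by simp

lemma closed': "\<lbrakk>x \<in> carrier (E i); y \<in> carrier (E (n - i)); i \<le> n\<rbrakk> \<Longrightarrow> m i (n - i) x y \<in> carrier (E n)"
  using closed[of x i y "n - i"] by simp

lemma sum_l:
  "\<lbrakk>finite S; f \<in> S \<rightarrow> carrier (E i); y \<in> carrier (E j)\<rbrakk> \<Longrightarrow>
   m i j (finsum (E i) f S) y = finsum (E (i + j)) (\<lambda>s. m i j (f s) y) S"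
  by (induct set: finite) (auto simp: zero_l add_l closed Pi_iff)

lemma sum_r:
  "\<lbrakk>finite S; f \<in> S \<rightarrow> carrier (E j); x \<in> carrier (E i)\<rbrakk> \<Longrightarrow>
   m i j x (finsum (E j) f S) = finsum (E (i + j)) (\<lambda>s. m i j x (f s)) S"
  by (induct set: finite) (auto simp: zero_r add_r closed Pi_iff)

definition conv :: "(nat \<Rightarrow> 'v) \<Rightarrow> (nat \<Rightarrow> 'v) \<Rightarrow> nat \<Rightarrow> 'v" where
  "conv x y n = finsum (E n) (\<lambda>i. m i (n - i) (x i) (y (n - i))) {..n}"

definition conv_algebra :: "('k, nat \<Rightarrow> 'v) module" where
  "conv_algebra = (dsum_module UNIV E)
     \<lparr>monoid.mult := conv, monoid.one := (\<lambda>i. if i = 0 then u else \<zero>\<^bsub>E i\<^esub>)\<rparr>"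

lemma carrier_conv_algebra:
  "x \<in> carrier conv_algebra \<longleftrightarrow> (\<forall>i. x i \<in> carrier (E i)) \<and> finite {i. x i \<noteq> \<zero>\<^bsub>E i\<^esub>}"
  by (auto simp: conv_algebra_def dsum_module_def)

lemma conv_algebra_simps [simp]:
  "\<zero>\<^bsub>conv_algebra\<^esub> = (\<lambda>i. \<zero>\<^bsub>E i\<^esub>)" "x \<oplus>\<^bsub>conv_algebra\<^esub> y = (\<lambda>i. x i \<oplus>\<^bsub>E i\<^esub> y i)"
  "c \<odot>\<^bsub>conv_algebra\<^esub> x = (\<lambda>i. c \<odot>\<^bsub>E i\<^esub> x i)" "x \<otimes>\<^bsub>conv_algebra\<^esub> y = conv x y"
  "\<one>\<^bsub>conv_algebra\<^esub> = (\<lambda>i. if i = 0 then u else \<zero>\<^bsub>E i\<^esub>)"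
  by (auto simp: conv_algebra_def dsum_module_def)

lemma left_module_conv_algebra: "left_module K conv_algebra"
proof (rule left_moduleI[OF cring.axioms(1)[OF K]])
  show "x \<oplus>\<^bsub>conv_algebra\<^esub> y \<in> carrier conv_algebra"
    if "x \<in> carrier conv_algebra" "y \<in> carrier conv_algebra" for x y
  proof -
    have "finite ({i. x i \<noteq> \<zero>\<^bsub>E i\<^esub>} \<union> {i. y i \<noteq> \<zero>\<^bsub>E i\<^esub>})" using that by (simp add: carrier_conv_algebra)
    then have "finite {i. x i \<oplus>\<^bsub>E i\<^esub> y i \<noteq> \<zero>\<^bsub>E i\<^esub>}" by (rule rev_finite_subset) auto
    then show ?thesis using that by (simp add: carrier_conv_algebra)
  qed
  show "c \<odot>\<^bsub>conv_algebra\<^esub> x \<in> carrier conv_algebra"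
    if "c \<in> carrier K" "x \<in> carrier conv_algebra" for c x
  proof -
    have "finite {i. x i \<noteq> \<zero>\<^bsub>E i\<^esub>}" using that by (simp add: carrier_conv_algebra)
    then have "finite {i. c \<odot>\<^bsub>E i\<^esub> x i \<noteq> \<zero>\<^bsub>E i\<^esub>}" by (rule rev_finite_subset) (use that in auto)
    then show ?thesis using that by (simp add: carrier_conv_algebra)
  qed
qed (auto simp: carrier_conv_algebra fun_eq_iff E.M.a_assoc E.smult_l_distr E.smult_r_distr E.smult_assoc1
      intro: E.M.a_comm)

lemma conv_closed:
  assumes "x \<in> carrier conv_algebra" "y \<in> carrier conv_algebra"
  shows "conv x y \<in> carrier conv_algebra"
proof -
  have x: "x i \<in> carrier (E i)" and y: "y i \<in> carrier (E i)" for i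
    using assms by (auto simp: carrier_conv_algebra)
  obtain a where a: "\<And>i. i > a \<Longrightarrow> x i = \<zero>\<^bsub>E i\<^esub>"
    using assms(1) finite_nat_set_iff_bounded_le[of "{i. x i \<noteq> \<zero>\<^bsub>E i\<^esub>}"]
    by (auto simp: carrier_conv_algebra) (metis not_le)
  obtain b where b: "\<And>i. i > b \<Longrightarrow> y i = \<zero>\<^bsub>E i\<^esub>"
    using assms(2) finite_nat_set_iff_bounded_le[of "{i. y i \<noteq> \<zero>\<^bsub>E i\<^esub>}"]
    by (auto simp: carrier_conv_algebra) (metis not_le)
  have "conv x y n = \<zero>\<^bsub>E n\<^esub>" if "n > a + b" for n
    unfolding conv_def
  proof (rule E.M.add.finprod_one_eqI)
    fix i assume i: "i \<in> {..n}"
    show "m i (n - i) (x i) (y (n - i)) = \<zero>\<^bsub>E n\<^esub>"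
    proof (cases "i > a")
      case True
      then show ?thesis using i a zero_l[OF y, of i "n - i"] by simp
    next
      case False
      then have "n - i > b" using that by auto
      then show ?thesis using i b zero_r[OF x, of i "n - i"] by simp
    qed
  qed
  then have "{n. conv x y n \<noteq> \<zero>\<^bsub>E n\<^esub>} \<subseteq> {..a + b}" by (auto simp: not_le[symmetric])
  moreover have "conv x y n \<in> carrier (E n)" for n
    unfolding conv_def using x y by (auto intro!: E.M.finsum_closed closed')
  ultimately show ?thesis by (auto simp: carrier_conv_algebra elim: finite_subset)
qed

lemma conv_assoc:
  assumes "x \<in> carrier conv_algebra" "y \<in> carrier conv_algebra" "z \<in> carrier conv_algebra"
  shows "conv (conv x y) z = conv x (conv y z)"
proof
  fix n
  have x: "x i \<in> carrier (E i)" and y: "y i \<in> carrier (E i)" and z: "z i \<in> carrier (E i)" for i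
    using assms by (auto simp: carrier_conv_algebra)
  \<comment> \<open>The triple product indexed by the degrees of x and y; the degree of z is what
    remains of n. Both bracketings become sums of these terms over the triangle j + k <= n.\<close>
  let ?F = "\<lambda>j k. m j (n - j) (x j) (m k (n - j - k) (y k) (z (n - j - k)))"
  have F: "?F j k \<in> carrier (E n)" if "j + k \<le> n" for j k
    using that x y z by (intro closed') auto
  have "conv (conv x y) z n = (\<Oplus>\<^bsub>E n\<^esub>i\<in>{..n}. \<Oplus>\<^bsub>E n\<^esub>j\<in>{..i}. ?F j (i - j))"
    unfolding conv_def[of _ z]
  proof (rule E.M.finsum_cong'[OF refl])
    show "(\<lambda>i. \<Oplus>\<^bsub>E n\<^esub>j\<in>{..i}. ?F j (i - j)) \<in> {..n} \<rightarrow> carrier (E n)"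
    proof (intro Pi_I E.M.finsum_closed)
      fix i j assume "i \<in> {..n}" "j \<in> {..i}"
      then show "?F j (i - j) \<in> carrier (E n)" using F[of j "i - j"] by simp
    qed
    fix i assume i: "i \<in> {..n}"
    have "m i (n - i) (conv x y i) (z (n - i))
        = (\<Oplus>\<^bsub>E (i + (n - i))\<^esub>j\<in>{..i}. m i (n - i) (m j (i - j) (x j) (y (i - j))) (z (n - i)))"
      unfolding conv_def using x y z by (intro sum_l) (auto intro!: closed')
    also have "\<dots> = (\<Oplus>\<^bsub>E n\<^esub>j\<in>{..i}. ?F j (i - j))"
    proof -
      have "m i (n - i) (m j (i - j) (x j) (y (i - j))) (z (n - i)) = ?F j (i - j)" if "j \<in> {..i}" for j
        using assoc[OF x[of j] y[of "i - j"] z[of "n - i"]] that i by simp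
      moreover have "?F j (i - j) \<in> carrier (E n)" if "j \<in> {..i}" for j using F[of j "i - j"] that i by simp
      ultimately have "(\<Oplus>\<^bsub>E n\<^esub>j\<in>{..i}. m i (n - i) (m j (i - j) (x j) (y (i - j))) (z (n - i)))
          = (\<Oplus>\<^bsub>E n\<^esub>j\<in>{..i}. ?F j (i - j))"
        by (intro E.M.finsum_cong') auto
      then show ?thesis using i by simp
    qed
    finally show "m i (n - i) (conv x y i) (z (n - i)) = (\<Oplus>\<^bsub>E n\<^esub>j\<in>{..i}. ?F j (i - j))" .
  qed
  also have "\<dots> = (\<Oplus>\<^bsub>E n\<^esub>j\<in>{..n}. \<Oplus>\<^bsub>E n\<^esub>k\<in>{..n - j}. ?F j k)"
    by (rule E.M.finsum_triangle) (rule F)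
  also have "\<dots> = conv x (conv y z) n"
    unfolding conv_def[of x]
  proof (rule E.M.finsum_cong'[OF refl])
    show "(\<lambda>i. m i (n - i) (x i) (conv y z (n - i))) \<in> {..n} \<rightarrow> carrier (E n)"
      using x conv_closed[OF assms(2,3)] by (auto intro!: closed' simp: carrier_conv_algebra)
    fix j assume j: "j \<in> {..n}"
    show "(\<Oplus>\<^bsub>E n\<^esub>k\<in>{..n - j}. ?F j k) = m j (n - j) (x j) (conv y z (n - j))"
    proof -
      have "(\<lambda>k. m k (n - j - k) (y k) (z (n - j - k))) \<in> {..n - j} \<rightarrow> carrier (E (n - j))"
        by (rule Pi_I, rule closed'[OF y z]) simp
      from sum_r[OF _ this x[of j]] show ?thesis using j by (simp add: conv_def)
    qed
  qed
  finally show "conv (conv x y) z n = conv x (conv y z) n" .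
qed

lemma conv_distrib:
  assumes "x \<in> carrier conv_algebra" "y \<in> carrier conv_algebra" "z \<in> carrier conv_algebra"
  shows "conv (x \<oplus>\<^bsub>conv_algebra\<^esub> y) z = conv x z \<oplus>\<^bsub>conv_algebra\<^esub> conv y z"
    and "conv z (x \<oplus>\<^bsub>conv_algebra\<^esub> y) = conv z x \<oplus>\<^bsub>conv_algebra\<^esub> conv z y"
proof -
  have x: "x i \<in> carrier (E i)" and y: "y i \<in> carrier (E i)" and z: "z i \<in> carrier (E i)" for i
    using assms by (auto simp: carrier_conv_algebra)
  show "conv (x \<oplus>\<^bsub>conv_algebra\<^esub> y) z = conv x z \<oplus>\<^bsub>conv_algebra\<^esub> conv y z"
  proof
    fix n
    have "conv (x \<oplus>\<^bsub>conv_algebra\<^esub> y) z n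
        = (\<Oplus>\<^bsub>E n\<^esub>i\<in>{..n}. m i (n - i) (x i) (z (n - i)) \<oplus>\<^bsub>E n\<^esub> m i (n - i) (y i) (z (n - i)))"
      unfolding conv_def using x y z add_l[OF x y z] by (intro E.M.finsum_cong') (auto intro!: closed')
    also have "\<dots> = (conv x z \<oplus>\<^bsub>conv_algebra\<^esub> conv y z) n"
      using x y z by (simp add: conv_def E.M.finsum_addf closed')
    finally show "conv (x \<oplus>\<^bsub>conv_algebra\<^esub> y) z n = (conv x z \<oplus>\<^bsub>conv_algebra\<^esub> conv y z) n" .
  qed
  show "conv z (x \<oplus>\<^bsub>conv_algebra\<^esub> y) = conv z x \<oplus>\<^bsub>conv_algebra\<^esub> conv z y"
  proof
    fix n
    have "conv z (x \<oplus>\<^bsub>conv_algebra\<^esub> y) n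
        = (\<Oplus>\<^bsub>E n\<^esub>i\<in>{..n}. m i (n - i) (z i) (x (n - i)) \<oplus>\<^bsub>E n\<^esub> m i (n - i) (z i) (y (n - i)))"
      unfolding conv_def using x y z add_r[OF z x y] by (intro E.M.finsum_cong') (auto intro!: closed')
    also have "\<dots> = (conv z x \<oplus>\<^bsub>conv_algebra\<^esub> conv z y) n"
      using x y z by (simp add: conv_def E.M.finsum_addf closed')
    finally show "conv z (x \<oplus>\<^bsub>conv_algebra\<^esub> y) n = (conv z x \<oplus>\<^bsub>conv_algebra\<^esub> conv z y) n" .
  qed
qed

lemma conv_smult:
  assumes "c \<in> carrier K" "x \<in> carrier conv_algebra" "y \<in> carrier conv_algebra"
  shows "conv (c \<odot>\<^bsub>conv_algebra\<^esub> x) y = c \<odot>\<^bsub>conv_algebra\<^esub> conv x y"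
    and "conv x (c \<odot>\<^bsub>conv_algebra\<^esub> y) = c \<odot>\<^bsub>conv_algebra\<^esub> conv x y"
proof -
  have x: "x i \<in> carrier (E i)" and y: "y i \<in> carrier (E i)" for i
    using assms by (auto simp: carrier_conv_algebra)
  have *: "c \<odot>\<^bsub>E n\<^esub> conv x y n = (\<Oplus>\<^bsub>E n\<^esub>i\<in>{..n}. c \<odot>\<^bsub>E n\<^esub> m i (n - i) (x i) (y (n - i)))" for n
    unfolding conv_def using x y assms(1) by (intro E.finsum_smult_ldistr) (auto intro!: closed')
  show "conv (c \<odot>\<^bsub>conv_algebra\<^esub> x) y = c \<odot>\<^bsub>conv_algebra\<^esub> conv x y"
    unfolding fun_eq_iff conv_algebra_simps *
    unfolding conv_def using x y assms(1) smult_l[OF assms(1) x y]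
    by (auto intro!: E.M.finsum_cong' closed')
  show "conv x (c \<odot>\<^bsub>conv_algebra\<^esub> y) = c \<odot>\<^bsub>conv_algebra\<^esub> conv x y"
    unfolding fun_eq_iff conv_algebra_simps *
    unfolding conv_def using x y assms(1) smult_r[OF assms(1) x y]
    by (auto intro!: E.M.finsum_cong' closed')
qed

lemma conv_homogeneous_l:
  assumes "a \<in> carrier (E 0)" "\<And>i. x i \<in> carrier (E i)"
  shows "conv (\<lambda>i. if i = 0 then a else \<zero>\<^bsub>E i\<^esub>) x n = m 0 n a (x n)"
proof -
  let ?f = "\<lambda>i. m i (n - i) (if i = 0 then a else \<zero>\<^bsub>E i\<^esub>) (x (n - i))"
  have "conv (\<lambda>i. if i = 0 then a else \<zero>\<^bsub>E i\<^esub>) x n = (\<Oplus>\<^bsub>E n\<^esub>i\<in>{..n}. if 0 = i then ?f i else \<zero>\<^bsub>E n\<^esub>)"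
    unfolding conv_def using assms zero_l[OF assms(2)] closed[OF assms(1) assms(2), of n]
    by (intro E.M.finsum_cong') (auto intro!: closed')
  also have "\<dots> = ?f 0"
    using assms closed[OF assms(1) assms(2), of n]
    by (intro E.M.add.finprod_singleton) (auto intro!: closed')
  finally show ?thesis by simp
qed

lemma conv_homogeneous_r:
  assumes "a \<in> carrier (E 0)" "\<And>i. x i \<in> carrier (E i)"
  shows "conv x (\<lambda>i. if i = 0 then a else \<zero>\<^bsub>E i\<^esub>) n = m n 0 (x n) a"
proof -
  let ?f = "\<lambda>i. m i (n - i) (x i) (if n - i = 0 then a else \<zero>\<^bsub>E (n - i)\<^esub>)"
  have "?f i = (if n = i then ?f i else \<zero>\<^bsub>E n\<^esub>)" if "i \<le> n" for i
    using that zero_r[OF assms(2), of i "n - i"] by auto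
  then have "conv x (\<lambda>i. if i = 0 then a else \<zero>\<^bsub>E i\<^esub>) n = (\<Oplus>\<^bsub>E n\<^esub>i\<in>{..n}. if n = i then ?f i else \<zero>\<^bsub>E n\<^esub>)"
    unfolding conv_def using assms
    by (intro E.M.finsum_cong') (auto intro!: closed'[of _ _ _ n] simp: closed'[of "x n" n a n, simplified])
  also have "\<dots> = ?f n"
    using assms by (intro E.M.add.finprod_singleton) (auto intro!: closed')
  finally show ?thesis by simp
qed

lemma homogeneous_closed: "a \<in> carrier (E 0) \<Longrightarrow> (\<lambda>i. if i = 0 then a else \<zero>\<^bsub>E i\<^esub>) \<in> carrier conv_algebra"
  by (auto simp: carrier_conv_algebra intro: finite_subset[of _ "{0}"])

lemma ring_conv_algebra: "ring conv_algebra"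
proof (rule ringI)
  interpret L: left_module K conv_algebra by (rule left_module_conv_algebra)
  show "abelian_group conv_algebra" by (rule L.M.abelian_group_axioms)
  show "monoid conv_algebra"
  proof (rule monoidI)
    fix x assume "x \<in> carrier conv_algebra"
    then have x: "x i \<in> carrier (E i)" for i by (simp add: carrier_conv_algebra)
    show "\<one>\<^bsub>conv_algebra\<^esub> \<otimes>\<^bsub>conv_algebra\<^esub> x = x" "x \<otimes>\<^bsub>conv_algebra\<^esub> \<one>\<^bsub>conv_algebra\<^esub> = x"
      using x by (auto simp: fun_eq_iff conv_homogeneous_l[OF u] conv_homogeneous_r[OF u] unit_l unit_r)
  qed (use homogeneous_closed[OF u] in \<open>auto simp: conv_closed conv_assoc\<close>)
qed (simp_all only: conv_algebra_simps(4) conv_distrib)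

lemma module_conv_algebra: "module K conv_algebra"
proof -
  interpret L: left_module K conv_algebra by (rule left_module_conv_algebra)
  show ?thesis
    by (rule moduleI[OF K L.M.abelian_group_axioms L.smult_closed L.smult_l_distr L.smult_r_distr
          L.smult_assoc1 L.smult_one])
qed

end

subsection \<open>Chain maps\<close>

lemma mod_hom_add:
  assumes "left_module R M" "left_module R N" "f \<in> mod_hom R M N" "g \<in> mod_hom R M N"
  shows "(\<lambda>x\<in>carrier M. f x \<oplus>\<^bsub>N\<^esub> g x) \<in> mod_hom R M N"
proof -
  interpret N: left_module R N by fact
  note f = mod_homD[OF assms(3)] and g = mod_homD[OF assms(4)]
  show ?thesis
    by (rule mod_hom_restrictI[OF assms(1)]) (simp_all add: f g N.M.a_ac N.smult_r_distr)
qed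

lemma mod_hom_uminus:
  assumes "left_module R M" "left_module R N" "f \<in> mod_hom R M N"
  shows "(\<lambda>x\<in>carrier M. \<ominus>\<^bsub>N\<^esub> f x) \<in> mod_hom R M N"
proof -
  interpret N: left_module R N by fact
  note f = mod_homD[OF assms(3)]
  show ?thesis
    by (rule mod_hom_restrictI[OF assms(1)]) (simp_all add: f N.M.minus_add N.smult_r_minus)
qed

lemma mod_hom_zero_map:
  assumes "left_module R M" "left_module R N"
  shows "(\<lambda>x\<in>carrier M. \<zero>\<^bsub>N\<^esub>) \<in> mod_hom R M N"
proof -
  interpret N: left_module R N by fact
  show ?thesis by (rule mod_hom_restrictI[OF assms(1)]) simp_all
qed

lemma projective_left_module: "projective_module R P \<Longrightarrow> left_module R P"
  by (simp add: projective_module_def)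

lemma projective_resolutionD:
  assumes "projective_resolution A N Q q \<eta>"
  shows "left_module A N" "\<And>i. projective_module A (Q i)" "\<And>i. left_module A (Q i)"
    "\<And>i. q i \<in> mod_hom A (Q (Suc i)) (Q i)" "\<eta> \<in> mod_hom A (Q 0) N" "\<eta> ` carrier (Q 0) = carrier N"
    "\<And>x. x \<in> q 0 ` carrier (Q (Suc 0)) \<longleftrightarrow> x \<in> carrier (Q 0) \<and> \<eta> x = \<zero>\<^bsub>N\<^esub>"
    "\<And>i x. x \<in> q (Suc i) ` carrier (Q (Suc (Suc i))) \<longleftrightarrow> x \<in> carrier (Q (Suc i)) \<and> q i x = \<zero>\<^bsub>Q i\<^esub>"
    "\<And>x. x \<in> carrier (Q (Suc 0)) \<Longrightarrow> \<eta> (q 0 x) = \<zero>\<^bsub>N\<^esub>"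
    "\<And>i x. x \<in> carrier (Q (Suc (Suc i))) \<Longrightarrow> q i (q (Suc i) x) = \<zero>\<^bsub>Q i\<^esub>"
proof -
  note r = assms[unfolded projective_resolution_def]
  show 1: "left_module A N" "\<And>i. projective_module A (Q i)" "\<And>i. q i \<in> mod_hom A (Q (Suc i)) (Q i)"
    "\<eta> \<in> mod_hom A (Q 0) N" "\<eta> ` carrier (Q 0) = carrier N"
    using r by auto
  show "\<And>i. left_module A (Q i)" using 1(2) projective_left_module by blast
  show 2: "x \<in> q 0 ` carrier (Q (Suc 0)) \<longleftrightarrow> x \<in> carrier (Q 0) \<and> \<eta> x = \<zero>\<^bsub>N\<^esub>" for x
    using r by (simp add: a_kernel_iff)
  show 3: "x \<in> q (Suc i) ` carrier (Q (Suc (Suc i))) \<longleftrightarrow> x \<in> carrier (Q (Suc i)) \<and> q i x = \<zero>\<^bsub>Q i\<^esub>" for i x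
    using r by (simp add: a_kernel_iff)
  show "\<eta> (q 0 x) = \<zero>\<^bsub>N\<^esub>" if "x \<in> carrier (Q (Suc 0))" for x using 2 that by blast
  show "q i (q (Suc i) x) = \<zero>\<^bsub>Q i\<^esub>" if "x \<in> carrier (Q (Suc (Suc i)))" for i x using 3 that by blast
qed

text \<open>The source is merely a complex of projectives, with neither exactness nor augmentation.
  This covers a resolution shifted by j, from which cocycles are lifted, as well as a full
  resolution of another module.\<close>

locale chain_map_setting =
  fixes A :: "('k, 'a) module" and S :: "nat \<Rightarrow> ('a, 's) module" and s :: "nat \<Rightarrow> 's \<Rightarrow> 's"
    and N :: "('a, 'n) module" and Q :: "nat \<Rightarrow> ('a, 'q) module" and q :: "nat \<Rightarrow> 'q \<Rightarrow> 'q" and \<eta> :: "'q \<Rightarrow> 'n"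
  assumes proj: "\<And>m. projective_module A (S m)"
    and s: "\<And>m. s m \<in> mod_hom A (S (Suc m)) (S m)"
    and ss: "\<And>m x. x \<in> carrier (S (Suc (Suc m))) \<Longrightarrow> s m (s (Suc m) x) = \<zero>\<^bsub>S m\<^esub>"
    and res: "projective_resolution A N Q q \<eta>"
begin

lemmas Q = projective_resolutionD[OF res]

lemma S: "left_module A (S m)" using proj by (rule projective_left_module)

lemma chain_map_exists:
  assumes g: "g \<in> mod_hom A (S 0) N" "\<And>x. x \<in> carrier (S (Suc 0)) \<Longrightarrow> g (s 0 x) = \<zero>\<^bsub>N\<^esub>"
  shows "\<exists>\<phi>. (\<forall>m. \<phi> m \<in> mod_hom A (S m) (Q m)) \<and> (\<forall>x\<in>carrier (S 0). \<eta> (\<phi> 0 x) = g x) \<and>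
    (\<forall>m. \<forall>x\<in>carrier (S (Suc m)). q m (\<phi> (Suc m) x) = \<phi> m (s m x))"
proof -
  \<comment> \<open>The last conjunct is the invariant that permits the next choice: the composite
    with the source differential lands in the image of the target differential, along which it is
    then lifted.\<close>
  let ?P = "\<lambda>m f. f \<in> mod_hom A (S m) (Q m) \<and> (m = 0 \<longrightarrow> (\<forall>x\<in>carrier (S 0). \<eta> (f x) = g x)) \<and>
    (\<forall>x\<in>carrier (S (Suc m)). f (s m x) \<in> q m ` carrier (Q (Suc m)))"
  let ?R = "\<lambda>m f f'. \<forall>x\<in>carrier (S (Suc m)). q m (f' x) = f (s m x)"
  have "\<exists>\<phi>. \<forall>m. ?P m (\<phi> m) \<and> ?R m (\<phi> m) (\<phi> (Suc m))"
  proof (rule dependent_nat_choice)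
    have "g ` carrier (S 0) \<subseteq> \<eta> ` carrier (Q 0)" using mod_homD(1)[OF g(1)] Q(6) by auto
    then obtain f where f: "f \<in> mod_hom A (S 0) (Q 0)" "\<forall>x\<in>carrier (S 0). \<eta> (f x) = g x"
      using projective_module_lift[OF proj Q(3,1,5) g(1)] by blast
    have "f (s 0 x) \<in> q 0 ` carrier (Q (Suc 0))" if "x \<in> carrier (S (Suc 0))" for x
      using that f g(2) mod_homD(1)[OF s] mod_homD(1)[OF f(1)] by (subst Q(7)) auto
    with f show "\<exists>f. ?P 0 f" by auto
  next
    fix f m assume f: "?P m f"
    let ?g = "compose (carrier (S (Suc m))) f (s m)"
    have "?g \<in> mod_hom A (S (Suc m)) (Q m)" using f by (intro mod_hom_compose[OF s _ S]) auto
    moreover have "?g ` carrier (S (Suc m)) \<subseteq> q m ` carrier (Q (Suc m))" using f by (auto simp: compose_def)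
    ultimately obtain f' where f': "f' \<in> mod_hom A (S (Suc m)) (Q (Suc m))"
        "\<forall>x\<in>carrier (S (Suc m)). q m (f' x) = ?g x"
      using projective_module_lift[OF proj Q(3) Q(3) Q(4)] by blast
    have f0: "f \<zero>\<^bsub>S m\<^esub> = \<zero>\<^bsub>Q m\<^esub>" using f by (intro mod_hom_zero[OF _ S Q(3)]) auto
    have "f' (s (Suc m) x) \<in> q (Suc m) ` carrier (Q (Suc (Suc m)))" if "x \<in> carrier (S (Suc (Suc m)))" for x
      using that f' ss f0 mod_homD(1)[OF s] mod_homD(1)[OF f'(1)] by (subst Q(8)) (auto simp: compose_def)
    with f' show "\<exists>f'. ?P (Suc m) f' \<and> ?R m f f'" by (intro exI[of _ f']) (auto simp: compose_def)
  qed
  then obtain \<phi> where \<phi>: "\<forall>m. ?P m (\<phi> m) \<and> ?R m (\<phi> m) (\<phi> (Suc m))" by blast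
  show ?thesis
    by (rule exI[of _ \<phi>], intro conjI) (use \<phi> in blast)+
qed

lemma null_homotopy_exists:
  assumes \<phi>: "\<And>m. \<phi> m \<in> mod_hom A (S m) (Q m)" "\<And>x. x \<in> carrier (S 0) \<Longrightarrow> \<eta> (\<phi> 0 x) = \<zero>\<^bsub>N\<^esub>"
    "\<And>m x. x \<in> carrier (S (Suc m)) \<Longrightarrow> q m (\<phi> (Suc m) x) = \<phi> m (s m x)"
  shows "\<exists>h. (\<forall>m. h m \<in> mod_hom A (S m) (Q (Suc m))) \<and> (\<forall>x\<in>carrier (S 0). \<phi> 0 x = q 0 (h 0 x)) \<and>
    (\<forall>m. \<forall>x\<in>carrier (S (Suc m)). \<phi> (Suc m) x = q (Suc m) (h (Suc m) x) \<oplus>\<^bsub>Q (Suc m)\<^esub> h m (s m x))"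
proof -
  \<comment> \<open>The last conjunct makes \<phi>_(m+1) - h s_m a cycle of the target, so that it
    can be lifted along q_(m+1) to the next component of the homotopy. It is restored at each step
    because s s = 0.\<close>
  let ?P = "\<lambda>m h. h \<in> mod_hom A (S m) (Q (Suc m)) \<and> (m = 0 \<longrightarrow> (\<forall>x\<in>carrier (S 0). \<phi> 0 x = q 0 (h x))) \<and>
    (\<forall>x\<in>carrier (S (Suc m)). q m (h (s m x)) = \<phi> m (s m x))"
  let ?R = "\<lambda>m h h'. \<forall>x\<in>carrier (S (Suc m)). \<phi> (Suc m) x = q (Suc m) (h' x) \<oplus>\<^bsub>Q (Suc m)\<^esub> h (s m x)"
  have "\<exists>h. \<forall>m. ?P m (h m) \<and> ?R m (h m) (h (Suc m))"
  proof (rule dependent_nat_choice)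
    have "\<phi> 0 ` carrier (S 0) \<subseteq> q 0 ` carrier (Q (Suc 0))"
      using \<phi>(2) mod_homD(1)[OF \<phi>(1)] Q(7) by auto
    then obtain h where "h \<in> mod_hom A (S 0) (Q (Suc 0))" "\<forall>x\<in>carrier (S 0). q 0 (h x) = \<phi> 0 x"
      using projective_module_lift[OF proj Q(3) Q(3) Q(4) \<phi>(1)] by blast
    then show "\<exists>h. ?P 0 h" using mod_homD(1)[OF s] by (intro exI[of _ h]) auto
  next
    fix h m assume h: "?P m h"
    interpret Qm: left_module A "Q m" by (rule Q)
    interpret Qs: left_module A "Q (Suc m)" by (rule Q)
    note hD = mod_homD[OF conjunct1[OF h]] and qD = mod_homD[OF Q(4)] and \<phi>D = mod_homD[OF \<phi>(1)] and sD = mod_homD[OF s]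
    let ?k = "compose (carrier (S (Suc m))) h (s m)"
    let ?g = "\<lambda>x\<in>carrier (S (Suc m)). \<phi> (Suc m) x \<oplus>\<^bsub>Q (Suc m)\<^esub>
      (\<lambda>x\<in>carrier (S (Suc m)). \<ominus>\<^bsub>Q (Suc m)\<^esub> ?k x) x"
    have k: "?k \<in> mod_hom A (S (Suc m)) (Q (Suc m))" using h by (intro mod_hom_compose[OF s _ S]) auto
    have g: "?g \<in> mod_hom A (S (Suc m)) (Q (Suc m))"
      by (rule mod_hom_add[OF S Q(3) \<phi>(1) mod_hom_uminus[OF S Q(3) k]])
    have gx: "?g x = \<phi> (Suc m) x \<oplus>\<^bsub>Q (Suc m)\<^esub> \<ominus>\<^bsub>Q (Suc m)\<^esub> h (s m x)" if "x \<in> carrier (S (Suc m))" for x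
      using that by (simp add: compose_def)
    have "?g x \<in> q (Suc m) ` carrier (Q (Suc (Suc m)))" if x: "x \<in> carrier (S (Suc m))" for x
    proof -
      have "q m (?g x) = \<phi> m (s m x) \<oplus>\<^bsub>Q m\<^esub> \<ominus>\<^bsub>Q m\<^esub> \<phi> m (s m x)"
        unfolding gx[OF x] using x h by (simp add: qD hD sD \<phi>D \<phi>(3) mod_hom_minus[OF Q(4) Q(3) Q(3)])
      also have "\<dots> = \<zero>\<^bsub>Q m\<^esub>" using x by (simp add: \<phi>D sD Qm.M.r_neg)
      finally show ?thesis using x mod_homD(1)[OF g x] Q(8) by blast
    qed
    then have "?g ` carrier (S (Suc m)) \<subseteq> q (Suc m) ` carrier (Q (Suc (Suc m)))" by blast
    then obtain h' where h': "h' \<in> mod_hom A (S (Suc m)) (Q (Suc (Suc m)))"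
        "\<And>x. x \<in> carrier (S (Suc m)) \<Longrightarrow> q (Suc m) (h' x) = ?g x"
      using projective_module_lift[OF proj Q(3) Q(3) Q(4) g] by blast
    have R: "\<phi> (Suc m) x = q (Suc m) (h' x) \<oplus>\<^bsub>Q (Suc m)\<^esub> h (s m x)" if "x \<in> carrier (S (Suc m))" for x
      unfolding h'(2)[OF that] gx[OF that] using that
      by (simp add: \<phi>D hD sD Qs.M.a_assoc Qs.M.l_neg)
    have h0: "h \<zero>\<^bsub>S m\<^esub> = \<zero>\<^bsub>Q (Suc m)\<^esub>" using h by (intro mod_hom_zero[OF _ S Q(3)]) auto
    have "q (Suc m) (h' (s (Suc m) x)) = \<phi> (Suc m) (s (Suc m) x)" if "x \<in> carrier (S (Suc (Suc m)))" for x
      using R[OF sD(1)[OF that]] that h0 by (simp add: ss sD qD mod_homD(1)[OF h'(1)])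
    then show "\<exists>h'. ?P (Suc m) h' \<and> ?R m h h'" using h'(1) R by (intro exI[of _ h']) auto
  qed
  then obtain h where h: "\<forall>m. ?P m (h m) \<and> ?R m (h m) (h (Suc m))" by blast
  show ?thesis
    by (rule exI[of _ h], intro conjI) (use h in blast)+
qed

end

subsection \<open>Hom spaces and Ext\<close>

locale fin_dim_algebra =
  fixes K :: "('k, 'z) ring_scheme" and A :: "('k, 'a) module"
  assumes alg: "fd_algebra K A"
begin

sublocale K: field K using alg by (simp add: fd_algebra_def)
sublocale A: ring A using alg by (simp add: fd_algebra_def)
sublocale KA: module K A using alg by (simp add: fd_algebra_def)

abbreviation sc :: "'k \<Rightarrow> 'a" where "sc c \<equiv> c \<odot>\<^bsub>A\<^esub> \<one>\<^bsub>A\<^esub>"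

lemma sc_closed [simp]: "c \<in> carrier K \<Longrightarrow> sc c \<in> carrier A" by simp

lemma sc_mult: "\<lbrakk>c \<in> carrier K; a \<in> carrier A\<rbrakk> \<Longrightarrow> sc c \<otimes>\<^bsub>A\<^esub> a = c \<odot>\<^bsub>A\<^esub> a"
  and mult_sc: "\<lbrakk>c \<in> carrier K; a \<in> carrier A\<rbrakk> \<Longrightarrow> a \<otimes>\<^bsub>A\<^esub> sc c = c \<odot>\<^bsub>A\<^esub> a"
  using alg by (auto simp: fd_algebra_def)

lemma sc_central: "\<lbrakk>c \<in> carrier K; a \<in> carrier A\<rbrakk> \<Longrightarrow> sc c \<otimes>\<^bsub>A\<^esub> a = a \<otimes>\<^bsub>A\<^esub> sc c"
  by (simp add: sc_mult mult_sc)

lemma sc_times: "\<lbrakk>c \<in> carrier K; c' \<in> carrier K\<rbrakk> \<Longrightarrow> sc (c \<otimes>\<^bsub>K\<^esub> c') = sc c \<otimes>\<^bsub>A\<^esub> sc c'"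
  by (simp add: sc_mult KA.smult_assoc1)

lemma left_module_restrict_scalars:
  assumes "left_module A M" shows "left_module K (restrict_scalars A M)"
proof -
  interpret M: left_module A M by fact
  show ?thesis
    by (rule left_moduleI[OF K.ring_axioms])
      (auto simp: restrict_scalars_def M.M.a_assoc M.smult_r_distr KA.smult_l_distr M.smult_l_distr
        sc_times M.smult_assoc1 intro: M.M.a_comm)
qed

lemma left_module_hom_space:
  assumes M: "left_module A M" and N: "left_module A N"
  shows "left_module K (hom_space A M N)"
proof -
  interpret M: left_module A M by fact
  interpret N: left_module A N by fact
  note D = mod_homD
  have ops: "f \<oplus>\<^bsub>hom_space A M N\<^esub> g = (\<lambda>x\<in>carrier M. f x \<oplus>\<^bsub>N\<^esub> g x)"
      "\<zero>\<^bsub>hom_space A M N\<^esub> = (\<lambda>x\<in>carrier M. \<zero>\<^bsub>N\<^esub>)"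
      "c \<odot>\<^bsub>hom_space A M N\<^esub> f = (\<lambda>x\<in>carrier M. sc c \<odot>\<^bsub>N\<^esub> f x)" for f g c
    by (simp_all add: hom_space_def)
  have val: "\<forall>x. (x \<in> carrier M \<longrightarrow> f x \<in> carrier N) \<and> (x \<notin> carrier M \<longrightarrow> f x = undefined)"
    if "f \<in> carrier (hom_space A M N)" for f
    using that D(1,2)[of f A M N] by (simp add: hom_space_def)
  show ?thesis
  proof (rule left_moduleI[OF K.ring_axioms])
    show "f \<oplus>\<^bsub>hom_space A M N\<^esub> g \<in> carrier (hom_space A M N)"
      if "f \<in> carrier (hom_space A M N)" "g \<in> carrier (hom_space A M N)" for f g
      using that mod_hom_add[OF M N] by (simp add: hom_space_def)
    show "\<zero>\<^bsub>hom_space A M N\<^esub> \<in> carrier (hom_space A M N)"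
      using mod_hom_zero_map[OF M N] by (simp add: hom_space_def)
    show "c \<odot>\<^bsub>hom_space A M N\<^esub> f \<in> carrier (hom_space A M N)"
      if c: "c \<in> carrier K" and f: "f \<in> carrier (hom_space A M N)" for c f
    proof -
      have f: "f \<in> mod_hom A M N" using f by (simp add: hom_space_def)
      have "(\<lambda>x\<in>carrier M. sc c \<odot>\<^bsub>N\<^esub> f x) \<in> mod_hom A M N"
      proof (rule mod_hom_restrictI[OF M])
        \<comment> \<open>A scalar multiple of an A-linear map is A-linear because scalars are
          central in A.\<close>
        show "sc c \<odot>\<^bsub>N\<^esub> f (a \<odot>\<^bsub>M\<^esub> x) = a \<odot>\<^bsub>N\<^esub> (sc c \<odot>\<^bsub>N\<^esub> f x)" if "a \<in> carrier A" "x \<in> carrier M" for a x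
          using that c D[OF f] sc_central[of c a] by (simp flip: N.smult_assoc1)
      qed (use c D[OF f] in \<open>auto simp: N.smult_r_distr\<close>)
      then show ?thesis by (simp add: hom_space_def)
    qed
  qed (auto dest!: val simp: ops fun_eq_iff restrict_def N.M.a_assoc N.smult_r_distr KA.smult_l_distr N.smult_l_distr
          sc_times N.smult_assoc1 intro: N.M.a_comm)
qed

end


locale ext_setting = fin_dim_algebra K A
  for K :: "('k, 'z) ring_scheme" and A :: "('k, 'a) module" +
  fixes M :: "('a, 'm) module" and P :: "nat \<Rightarrow> ('a, 'p) module" and d :: "nat \<Rightarrow> 'p \<Rightarrow> 'p" and \<epsilon> :: "'p \<Rightarrow> 'm"
  assumes res: "projective_resolution A M P d \<epsilon>"
begin

lemmas r = projective_resolutionD[OF res]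

sublocale M: left_module A M by (rule r)
sublocale P: left_module A "P i" for i by (rule r)

abbreviation "H i \<equiv> hom_space A (P i) M"
abbreviation "Z i \<equiv> cocycles A P d M i"
abbreviation "B i \<equiv> coboundaries A P d M i"
abbreviation "cl i \<equiv> ext_class A P d M i"
abbreviation "E i \<equiv> ext_space A P d M i"
abbreviation "cmp i f g \<equiv> compose (carrier (P i)) f g"

sublocale H: left_module K "H i" for i by (rule left_module_hom_space[OF r(3) r(1)])

lemma carrier_H [simp]: "carrier (H i) = mod_hom A (P i) M" by (simp add: hom_space_def)
lemma add_H: "f \<oplus>\<^bsub>H i\<^esub> g = (\<lambda>x\<in>carrier (P i). f x \<oplus>\<^bsub>M\<^esub> g x)" by (simp add: hom_space_def)
lemma zero_H: "\<zero>\<^bsub>H i\<^esub> = (\<lambda>x\<in>carrier (P i). \<zero>\<^bsub>M\<^esub>)" by (simp add: hom_space_def)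
lemma smult_H: "c \<odot>\<^bsub>H i\<^esub> f = (\<lambda>x\<in>carrier (P i). sc c \<odot>\<^bsub>M\<^esub> f x)" by (simp add: hom_space_def)

lemma d_closed [simp]: "x \<in> carrier (P (Suc i)) \<Longrightarrow> d i x \<in> carrier (P i)"
  by (rule mod_homD(1)[OF r(4)])

lemma Z_iff: "f \<in> Z i \<longleftrightarrow> f \<in> mod_hom A (P i) M \<and> (\<forall>x\<in>carrier (P (Suc i)). f (d i x) = \<zero>\<^bsub>M\<^esub>)"
  by (simp add: cocycles_def)

lemma submodule_Z: "submodule (Z i) K (H i)"
proof (rule H.submoduleI)
  show "Z i \<subseteq> carrier (H i)" by (auto simp: cocycles_def)
  show "\<zero>\<^bsub>H i\<^esub> \<in> Z i" using H.M.zero_closed[of i] by (simp add: Z_iff zero_H)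
  show "f \<oplus>\<^bsub>H i\<^esub> g \<in> Z i" if "f \<in> Z i" "g \<in> Z i" for f g
    using that H.M.a_closed[of f i g] by (simp add: Z_iff add_H)
  show "c \<odot>\<^bsub>H i\<^esub> f \<in> Z i" if "c \<in> carrier K" "f \<in> Z i" for c f
    using that H.smult_closed[of c f i] by (simp add: Z_iff smult_H)
qed

lemma B_0: "B 0 = {\<zero>\<^bsub>H 0\<^esub>}"
  by (simp add: coboundaries_def zero_H)

lemma B_Suc: "B (Suc i) = (\<lambda>f. cmp (Suc i) f (d i)) ` mod_hom A (P i) M"
  by (simp add: coboundaries_def)

lemma B_SucI: "\<lbrakk>h \<in> mod_hom A (P i) M; b \<in> extensional (carrier (P (Suc i)));
    \<And>x. x \<in> carrier (P (Suc i)) \<Longrightarrow> b x = h (d i x)\<rbrakk> \<Longrightarrow> b \<in> B (Suc i)"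
  unfolding B_Suc by (rule image_eqI[of _ _ h]) (auto simp: compose_def restrict_def extensional_def)

lemma B_subset_Z: "B i \<subseteq> Z i"
proof (cases i)
  case 0
  then show ?thesis using H.submoduleD(2)[OF submodule_Z] by (auto simp: B_0)
next
  case (Suc j)
  have "cmp (Suc j) f (d j) \<in> Z (Suc j)" if f: "f \<in> mod_hom A (P j) M" for f
    using mod_hom_compose[OF r(4) f r(3)] mod_hom_zero[OF f r(3) r(1)] r(10)
    by (auto simp: Z_iff compose_def)
  then show ?thesis using Suc by (auto simp: B_Suc)
qed

lemma submodule_B: "submodule (B i) K (H i)"
proof (cases i)
  case 0
  then show ?thesis by (auto intro!: H.submoduleI simp: B_0 simp del: carrier_H)
next
  case (Suc j)
  show ?thesis
  proof (rule H.submoduleI)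
    show "B i \<subseteq> carrier (H i)" using B_subset_Z[of i] by (auto simp: Z_iff)
    show "\<zero>\<^bsub>H i\<^esub> \<in> B i" unfolding Suc
      by (rule B_SucI[of "\<zero>\<^bsub>H j\<^esub>"]) (use H.M.zero_closed[of j] in \<open>auto simp: zero_H\<close>)
    fix f assume "f \<in> B i"
    then obtain f' where f': "f' \<in> mod_hom A (P j) M" "f = cmp i f' (d j)" by (auto simp: Suc B_Suc)
    show "c \<odot>\<^bsub>H i\<^esub> f \<in> B i" if "c \<in> carrier K" for c unfolding Suc
      by (rule B_SucI[of "c \<odot>\<^bsub>H j\<^esub> f'"])
        (use that f' H.smult_closed[of c f' j] Suc in \<open>auto simp: smult_H compose_def\<close>)
    fix g assume "g \<in> B i"
    then obtain g' where g': "g' \<in> mod_hom A (P j) M" "g = cmp i g' (d j)" by (auto simp: Suc B_Suc)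
    show "f \<oplus>\<^bsub>H i\<^esub> g \<in> B i" unfolding Suc
      by (rule B_SucI[of "f' \<oplus>\<^bsub>H j\<^esub> g'"])
        (use f' g' H.M.a_closed[of f' j g'] Suc in \<open>auto simp: add_H compose_def\<close>)
  qed
qed

lemma left_module_Z: "left_module K ((H i)\<lparr>carrier := Z i\<rparr>)"
  by (rule submodule_left_module[OF left_module_hom_space[OF r(3) r(1)] submodule_Z])

lemma submodule_B_Z: "submodule (B i) K ((H i)\<lparr>carrier := Z i\<rparr>)"
proof -
  interpret Zi: left_module K "(H i)\<lparr>carrier := Z i\<rparr>" by (rule left_module_Z)
  show ?thesis
    by (rule Zi.submoduleI) (use B_subset_Z H.submoduleD[OF submodule_B[of i]] in auto)
qed

sublocale E: module_quotient K "(H i)\<lparr>carrier := Z i\<rparr>" "B i"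
  rewrites "quot_module ((H i)\<lparr>carrier := Z i\<rparr>) (B i) = E i" for i
  by (rule module_quotientI[OF left_module_Z submodule_B_Z]) (simp add: ext_space_def)

lemma carrier_E: "carrier (E i) = cl i ` Z i"
  by (simp add: ext_space_def carrier_quot_module ext_class_def)

lemma cl_closed [simp]: "f \<in> Z i \<Longrightarrow> cl i f \<in> carrier (E i)"
  by (simp add: carrier_E)

lemma zero_E: "\<zero>\<^bsub>E i\<^esub> = B i" by (simp add: ext_space_def)

lemma cl_add: "\<lbrakk>f \<in> Z i; g \<in> Z i\<rbrakk> \<Longrightarrow> cl i f \<oplus>\<^bsub>E i\<^esub> cl i g = cl i (f \<oplus>\<^bsub>H i\<^esub> g)"
  using E.add_coset[of f i g] by (simp add: ext_class_def)

lemma cl_smult: "\<lbrakk>c \<in> carrier K; f \<in> Z i\<rbrakk> \<Longrightarrow> c \<odot>\<^bsub>E i\<^esub> cl i f = cl i (c \<odot>\<^bsub>H i\<^esub> f)"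
  using E.smult_coset[of c f i] by (simp add: ext_class_def)

lemma cl_zero_iff: "f \<in> Z i \<Longrightarrow> cl i f = \<zero>\<^bsub>E i\<^esub> \<longleftrightarrow> f \<in> B i"
  using E.coset_zero_iff[of f i] by (simp add: ext_class_def zero_E)

lemma cl_memD:
  assumes "f \<in> Z i" "f' \<in> cl i f"
  shows "f' \<in> Z i" "\<exists>b\<in>B i. f' = b \<oplus>\<^bsub>H i\<^esub> f"
  using E.coset_memD(1)[of f i f'] assms by (auto simp: ext_class_def a_r_coset_def')

lemma cl_self: "f \<in> Z i \<Longrightarrow> f \<in> cl i f"
  using E.coset_self[of f i] by (simp add: ext_class_def)

lemma cl_eqI:
  assumes "f \<in> Z i" "b \<in> B i" "f' = b \<oplus>\<^bsub>H i\<^esub> f"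
  shows "cl i f' = cl i f"
proof -
  have "f' \<in> cl i f" using assms by (auto simp: ext_class_def a_r_coset_def')
  then show ?thesis using E.coset_memD(2)[of f i f'] assms(1) by (simp add: ext_class_def)
qed

end

subsection \<open>The Yoneda product\<close>

context ext_setting
begin

lemma chain_liftD:
  assumes "chain_lift A P d \<epsilon> j g \<phi>"
  shows "\<And>m. \<phi> m \<in> mod_hom A (P (j + m)) (P m)"
    and "\<And>x. x \<in> carrier (P j) \<Longrightarrow> \<epsilon> (\<phi> 0 x) = g x"
    and "\<And>m x. x \<in> carrier (P (Suc (j + m))) \<Longrightarrow> d m (\<phi> (Suc m) x) = \<phi> m (d (j + m) x)"
    and "\<And>m x. x \<in> carrier (P (j + m)) \<Longrightarrow> \<phi> m x \<in> carrier (P m)"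
proof -
  show *: "\<And>m. \<phi> m \<in> mod_hom A (P (j + m)) (P m)" using assms by (simp add: chain_lift_def)
  show "\<And>m x. x \<in> carrier (P (j + m)) \<Longrightarrow> \<phi> m x \<in> carrier (P m)" using mod_homD(1)[OF *] by blast
qed (use assms in \<open>auto simp: chain_lift_def\<close>)

text \<open>A \<open>chain_lift\<close> of a cocycle of degree j is a chain map out of the
  resolution shifted by j; this identification supplies existence of lifts and homotopies between
  them.\<close>

lemma shifted_setting: "chain_map_setting A (\<lambda>m. P (j + m)) (\<lambda>m. d (j + m)) M P d \<epsilon>"
  by unfold_locales (use r(2) r(4) r(10) res in auto)

lemma chain_lift_exists:
  assumes "g \<in> Z j" shows "\<exists>\<phi>. chain_lift A P d \<epsilon> j g \<phi>"
  using chain_map_setting.chain_map_exists[OF shifted_setting, of g j] assms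
  by (simp add: chain_lift_def Z_iff)

lemma cmp_Z:
  assumes "f \<in> Z i" "chain_lift A P d \<epsilon> j g \<phi>"
  shows "cmp (i + j) f (\<phi> i) \<in> Z (i + j)"
proof -
  note \<phi> = chain_liftD[OF assms(2)]
  have f: "f \<in> mod_hom A (P i) M" "\<And>x. x \<in> carrier (P (Suc i)) \<Longrightarrow> f (d i x) = \<zero>\<^bsub>M\<^esub>"
    using assms(1) by (auto simp: Z_iff)
  have "f (\<phi> i (d (i + j) x)) = \<zero>\<^bsub>M\<^esub>" if "x \<in> carrier (P (Suc (i + j)))" for x
  proof -
    have "x \<in> carrier (P (Suc (j + i)))" "x \<in> carrier (P (j + Suc i))" using that by (simp_all add: add.commute)
    then show ?thesis
      using \<phi>(3)[of x i] f(2)[of "\<phi> (Suc i) x"] \<phi>(4)[of x "Suc i"] by (simp add: add.commute)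
  qed
  moreover have "\<phi> i \<in> mod_hom A (P (i + j)) (P i)" using \<phi>(1)[of i] by (simp add: add.commute)
  ultimately show ?thesis using mod_hom_compose[OF _ f(1) r(3)] by (simp add: Z_iff compose_def)
qed

text \<open>If b = h d then b \<phi>_i = h d \<phi>_i = (h \<phi>_(i-1)) d. In degree 0 the only
  coboundary is zero.\<close>

lemma cmp_B:
  assumes "b \<in> B i" "chain_lift A P d \<epsilon> j g \<phi>"
  shows "cmp (i + j) b (\<phi> i) \<in> B (i + j)"
proof (cases i)
  case 0
  then have "cmp (i + j) b (\<phi> i) = \<zero>\<^bsub>H j\<^esub>"
    using assms(1) chain_liftD(4)[OF assms(2), of _ 0] by (auto simp: B_0 zero_H compose_def restrict_def fun_eq_iff)
  then show ?thesis using 0 H.submoduleD(2)[OF submodule_B[of j]] by simp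
next
  case (Suc i')
  note \<phi> = chain_liftD[OF assms(2)]
  obtain h where h: "h \<in> mod_hom A (P i') M" "b = cmp i h (d i')"
    using assms(1) Suc by (auto simp: B_Suc)
  have \<phi>': "\<phi> i' \<in> mod_hom A (P (i' + j)) (P i')" using \<phi>(1)[of i'] by (simp add: add.commute)
  show ?thesis unfolding Suc add_Suc
  proof (rule B_SucI)
    show "cmp (i' + j) h (\<phi> i') \<in> mod_hom A (P (i' + j)) M" by (rule mod_hom_compose[OF \<phi>' h(1) r(3)])
    fix x assume x: "x \<in> carrier (P (Suc (i' + j)))"
    then have "d i' (\<phi> (Suc i') x) = \<phi> i' (d (i' + j) x)" "\<phi> (Suc i') x \<in> carrier (P (Suc i'))"
      using \<phi>(3)[of x i'] \<phi>(4)[of x "Suc i'"] by (simp_all add: add.commute)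
    then show "cmp (Suc (i' + j)) b (\<phi> (Suc i')) x = cmp (i' + j) h (\<phi> i') (d (i' + j) x)"
      using x h Suc by (simp add: compose_def)
  qed (simp add: compose_def)
qed

text \<open>A lift of the zero cocycle is null-homotopic, \<phi> = d h + h d. The cocycle f kills
  the first summand, and f h d is a coboundary.\<close>

lemma cmp_null_lift:
  assumes f: "f \<in> Z i" and lift: "chain_lift A P d \<epsilon> j g \<phi>" and g: "\<And>x. x \<in> carrier (P j) \<Longrightarrow> g x = \<zero>\<^bsub>M\<^esub>"
  shows "cmp (i + j) f (\<phi> i) \<in> B (i + j)"
proof -
  note \<phi> = chain_liftD[OF lift]
  have fh: "f \<in> mod_hom A (P i) M" and f0: "\<And>x. x \<in> carrier (P (Suc i)) \<Longrightarrow> f (d i x) = \<zero>\<^bsub>M\<^esub>"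
    using f by (auto simp: Z_iff)
  have "\<exists>h. (\<forall>m. h m \<in> mod_hom A (P (j + m)) (P (Suc m))) \<and> (\<forall>x\<in>carrier (P (j + 0)). \<phi> 0 x = d 0 (h 0 x)) \<and>
    (\<forall>m. \<forall>x\<in>carrier (P (j + Suc m)). \<phi> (Suc m) x = d (Suc m) (h (Suc m) x) \<oplus>\<^bsub>P (Suc m)\<^esub> h m (d (j + m) x))"
    by (rule chain_map_setting.null_homotopy_exists[OF shifted_setting]) (use \<phi> g in auto)
  then obtain h where hh: "\<forall>m. h m \<in> mod_hom A (P (j + m)) (P (Suc m))" "\<forall>x\<in>carrier (P (j + 0)). \<phi> 0 x = d 0 (h 0 x)"
    "\<forall>m. \<forall>x\<in>carrier (P (j + Suc m)). \<phi> (Suc m) x = d (Suc m) (h (Suc m) x) \<oplus>\<^bsub>P (Suc m)\<^esub> h m (d (j + m) x)"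
    by blast
  have h: "\<And>m. h m \<in> mod_hom A (P (j + m)) (P (Suc m))" "\<And>x. x \<in> carrier (P j) \<Longrightarrow> \<phi> 0 x = d 0 (h 0 x)"
    "\<And>m x. x \<in> carrier (P (Suc (j + m))) \<Longrightarrow>
       \<phi> (Suc m) x = d (Suc m) (h (Suc m) x) \<oplus>\<^bsub>P (Suc m)\<^esub> h m (d (j + m) x)"
    using hh by simp_all
  show ?thesis
  proof (cases i)
    case 0
    have "f (\<phi> 0 x) = \<zero>\<^bsub>M\<^esub>" if "x \<in> carrier (P j)" for x
      using that h(2) f0 0 mod_homD(1)[OF h(1)[of 0]] by simp
    then have "cmp (i + j) f (\<phi> i) = \<zero>\<^bsub>H j\<^esub>"
      using 0 by (auto simp: zero_H compose_def restrict_def fun_eq_iff)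
    then show ?thesis using 0 H.submoduleD(2)[OF submodule_B[of j]] by simp
  next
    case (Suc n)
    have hn: "h n \<in> mod_hom A (P (n + j)) (P i)" using h(1)[of n] Suc by (simp add: add.commute)
    show ?thesis unfolding Suc add_Suc
    proof (rule B_SucI)
      show "cmp (n + j) f (h n) \<in> mod_hom A (P (n + j)) M" by (rule mod_hom_compose[OF hn fh r(3)])
      fix x assume x: "x \<in> carrier (P (Suc (n + j)))"
      have "h (Suc n) x \<in> carrier (P (Suc (Suc n)))"
        using x mod_homD(1)[OF h(1)[of "Suc n"]] by (simp add: add.commute)
      then have "d (Suc n) (h (Suc n) x) \<in> carrier (P (Suc n))" "f (d (Suc n) (h (Suc n) x)) = \<zero>\<^bsub>M\<^esub>"
        using f0 Suc by auto
      moreover have "h n (d (n + j) x) \<in> carrier (P (Suc n))" using x mod_homD(1)[OF hn] Suc by simp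
      ultimately have "f (\<phi> (Suc n) x) = f (h n (d (n + j) x))"
        using h(3)[of x n] x mod_homD[OF fh] Suc by (simp add: add.commute)
      then show "cmp (Suc (n + j)) f (\<phi> (Suc n)) x = cmp (n + j) f (h n) (d (n + j) x)"
        using x by (simp add: compose_def)
    qed (simp add: compose_def)
  qed
qed

text \<open>One form for three uses: a = 1 gives lifts of sums, the zero lift as second lift gives
  scalar multiples, and a = -1 gives the difference of two lifts.\<close>

lemma chain_lift_lin:
  assumes "a \<in> carrier K" "chain_lift A P d \<epsilon> j g \<phi>" "chain_lift A P d \<epsilon> j g' \<phi>'"
    and "\<And>x. x \<in> carrier (P j) \<Longrightarrow> g'' x = sc a \<odot>\<^bsub>M\<^esub> g x \<oplus>\<^bsub>M\<^esub> g' x"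
  shows "chain_lift A P d \<epsilon> j g'' (\<lambda>m. \<lambda>x\<in>carrier (P (j + m)). sc a \<odot>\<^bsub>P m\<^esub> \<phi> m x \<oplus>\<^bsub>P m\<^esub> \<phi>' m x)"
proof -
  note \<phi> = chain_liftD[OF assms(2)] and \<phi>' = chain_liftD[OF assms(3)]
  note dD = mod_homD[OF r(4)] and eD = mod_homD[OF r(5)]
  have "(\<lambda>x\<in>carrier (P (j + m)). sc a \<odot>\<^bsub>P m\<^esub> \<phi> m x \<oplus>\<^bsub>P m\<^esub> \<phi>' m x) \<in> mod_hom A (P (j + m)) (P m)" for m
  proof (rule mod_hom_restrictI[OF r(3)])
    note D = mod_homD[OF \<phi>(1)] mod_homD[OF \<phi>'(1)]
    fix x y assume x: "x \<in> carrier (P (j + m))"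
    show "sc a \<odot>\<^bsub>P m\<^esub> \<phi> m x \<oplus>\<^bsub>P m\<^esub> \<phi>' m x \<in> carrier (P m)" using x assms(1) by (simp add: D)
    show "sc a \<odot>\<^bsub>P m\<^esub> \<phi> m (x \<oplus>\<^bsub>P (j + m)\<^esub> y) \<oplus>\<^bsub>P m\<^esub> \<phi>' m (x \<oplus>\<^bsub>P (j + m)\<^esub> y) =
        (sc a \<odot>\<^bsub>P m\<^esub> \<phi> m x \<oplus>\<^bsub>P m\<^esub> \<phi>' m x) \<oplus>\<^bsub>P m\<^esub> (sc a \<odot>\<^bsub>P m\<^esub> \<phi> m y \<oplus>\<^bsub>P m\<^esub> \<phi>' m y)"
      if "y \<in> carrier (P (j + m))"
      using x that assms(1) by (simp add: D P.smult_r_distr P.M.a_ac)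
    show "sc a \<odot>\<^bsub>P m\<^esub> \<phi> m (b \<odot>\<^bsub>P (j + m)\<^esub> x) \<oplus>\<^bsub>P m\<^esub> \<phi>' m (b \<odot>\<^bsub>P (j + m)\<^esub> x) =
        b \<odot>\<^bsub>P m\<^esub> (sc a \<odot>\<^bsub>P m\<^esub> \<phi> m x \<oplus>\<^bsub>P m\<^esub> \<phi>' m x)" if "b \<in> carrier A" for b
    proof -
      have "sc a \<odot>\<^bsub>P m\<^esub> (b \<odot>\<^bsub>P m\<^esub> \<phi> m x) = b \<odot>\<^bsub>P m\<^esub> (sc a \<odot>\<^bsub>P m\<^esub> \<phi> m x)"
        using x that assms(1) \<phi>(4) sc_central[of a b] by (simp flip: P.smult_assoc1)
      then show ?thesis using x that assms(1) by (simp add: D P.smult_r_distr)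
    qed
  qed
  moreover have "\<epsilon> (sc a \<odot>\<^bsub>P 0\<^esub> \<phi> 0 x \<oplus>\<^bsub>P 0\<^esub> \<phi>' 0 x) = g'' x" if "x \<in> carrier (P j)" for x
    using that assms(1,4) \<phi>(2,4)[of x] \<phi>'(2,4)[of x] \<phi>(4)[of x 0] \<phi>'(4)[of x 0] by (simp add: eD)
  moreover have "d m (sc a \<odot>\<^bsub>P (Suc m)\<^esub> \<phi> (Suc m) x \<oplus>\<^bsub>P (Suc m)\<^esub> \<phi>' (Suc m) x)
      = sc a \<odot>\<^bsub>P m\<^esub> \<phi> m (d (j + m) x) \<oplus>\<^bsub>P m\<^esub> \<phi>' m (d (j + m) x)" if "x \<in> carrier (P (Suc (j + m)))" for m x
    using that assms(1) \<phi>(3)[of x m] \<phi>'(3)[of x m] \<phi>(4)[of x "Suc m"] \<phi>'(4)[of x "Suc m"] by (simp add: dD)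
  ultimately show ?thesis by (simp add: chain_lift_def)
qed

text \<open>Write g = h d and lift h to t with values in P_0. Subtracting t d from \<phi>_0 alone
  gives a lift of zero; compatibility with the differentials survives because t d d = 0. The
  correction matters only for i = 0, where it contributes the coboundary f t d.\<close>

lemma cmp_lift_coboundary:
  assumes f: "f \<in> Z i" and lift: "chain_lift A P d \<epsilon> j g \<phi>" and g: "g \<in> B j"
  shows "cmp (i + j) f (\<phi> i) \<in> B (i + j)"
proof (cases j)
  case 0
  then show ?thesis using cmp_null_lift[OF f lift] g by (auto simp: B_0 zero_H)
next
  case (Suc j')
  obtain h where h: "h \<in> mod_hom A (P j') M" "g = cmp j h (d j')" using g Suc by (auto simp: B_Suc)
  have "h ` carrier (P j') \<subseteq> \<epsilon> ` carrier (P 0)" using mod_homD(1)[OF h(1)] r(6) by auto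
  then obtain t where t: "t \<in> mod_hom A (P j') (P 0)" "\<And>x. x \<in> carrier (P j') \<Longrightarrow> \<epsilon> (t x) = h x"
    using projective_module_lift[OF r(2) r(3) r(1) r(5) h(1)] by blast
  note \<phi> = chain_liftD[OF lift]
  have td: "cmp j t (d j') \<in> mod_hom A (P j) (P 0)" unfolding Suc by (rule mod_hom_compose[OF r(4) t(1) r(3)])
  have td': "(\<lambda>x\<in>carrier (P j). \<ominus>\<^bsub>P 0\<^esub> cmp j t (d j') x) \<in> mod_hom A (P j) (P 0)"
    by (rule mod_hom_uminus[OF r(3) r(3) td])
  define \<psi>0 where "\<psi>0 = (\<lambda>x\<in>carrier (P j). \<phi> 0 x \<oplus>\<^bsub>P 0\<^esub> (\<lambda>x\<in>carrier (P j). \<ominus>\<^bsub>P 0\<^esub> cmp j t (d j') x) x)"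
  have \<psi>0_hom: "\<psi>0 \<in> mod_hom A (P j) (P 0)"
    unfolding \<psi>0_def using \<phi>(1)[of 0] by (intro mod_hom_add[OF r(3) r(3) _ td']) simp
  have \<phi>0: "\<phi> 0 x \<in> carrier (P 0)" if "x \<in> carrier (P j)" for x using \<phi>(4)[of x 0] that by simp
  have tdx: "t (d j' x) \<in> carrier (P 0)" if "x \<in> carrier (P j)" for x
    using mod_homD(1)[OF t(1)] that Suc by simp
  have \<psi>0: "\<psi>0 x = \<phi> 0 x \<ominus>\<^bsub>P 0\<^esub> t (d j' x)" if "x \<in> carrier (P j)" for x
    using that by (simp add: \<psi>0_def compose_def a_minus_def)
  define \<psi> where "\<psi> m = (if m = 0 then \<psi>0 else \<phi> m)" for m
  have "chain_lift A P d \<epsilon> j (\<lambda>x. \<zero>\<^bsub>M\<^esub>) \<psi>"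
    unfolding chain_lift_def
  proof (intro conjI allI ballI)
    show "\<psi> m \<in> mod_hom A (P (j + m)) (P m)" for m using \<psi>0_hom \<phi>(1) by (simp add: \<psi>_def)
    fix x assume x: "x \<in> carrier (P j)"
    have "\<epsilon> (\<psi>0 x) = g x \<ominus>\<^bsub>M\<^esub> h (d j' x)"
      unfolding \<psi>0[OF x] a_minus_def using x Suc \<phi>0[OF x] tdx[OF x] \<phi>(2)[OF x] t(2)[of "d j' x"]
      by (simp add: mod_homD[OF r(5)] mod_hom_minus[OF r(5) r(3) r(1)])
    also have "\<dots> = \<zero>\<^bsub>M\<^esub>" using x h Suc mod_homD(1)[OF h(1), of "d j' x"] by (simp add: compose_def a_minus_def M.M.r_neg)
    finally show "\<epsilon> (\<psi> 0 x) = \<zero>\<^bsub>M\<^esub>" by (simp add: \<psi>_def)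
  next
    fix m x assume x: "x \<in> carrier (P (Suc (j + m)))"
    show "d m (\<psi> (Suc m) x) = \<psi> m (d (j + m) x)"
    proof (cases "m = 0")
      case True
      have dx: "d j x \<in> carrier (P j)" using x True by simp
      have "t (d j' (d j x)) = \<zero>\<^bsub>P 0\<^esub>"
        using r(10)[of x j'] x True Suc mod_hom_zero[OF t(1) r(3) r(3)] by simp
      moreover have "\<phi> 0 (d j x) \<ominus>\<^bsub>P 0\<^esub> \<zero>\<^bsub>P 0\<^esub> = \<phi> 0 (d j x)"
      proof -
        have "\<ominus>\<^bsub>P 0\<^esub> \<zero>\<^bsub>P 0\<^esub> = \<zero>\<^bsub>P 0\<^esub>" by (rule P.M.minus_equality) auto
        then show ?thesis using \<phi>0[OF dx] by (simp only: a_minus_def P.M.r_zero)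
      qed
      ultimately have "\<psi>0 (d j x) = \<phi> 0 (d j x)" using \<psi>0[OF dx] by simp
      then show ?thesis using True \<phi>(3)[of x 0] x by (simp add: \<psi>_def)
    qed (use \<phi>(3)[of x m] x in \<open>simp add: \<psi>_def\<close>)
  qed
  then have b: "cmp (i + j) f (\<psi> i) \<in> B (i + j)" by (rule cmp_null_lift[OF f]) simp
  show ?thesis
  proof (cases "i = 0")
    case True
    have fh: "f \<in> mod_hom A (P 0) M" using f True by (simp add: Z_iff)
    have ft: "cmp j' f t \<in> mod_hom A (P j') M" by (rule mod_hom_compose[OF t(1) fh r(3)])
    then have c: "cmp j (cmp j' f t) (d j') \<in> B j" using Suc by (auto simp: B_Suc)
    have "f (\<phi> 0 x) = f (\<psi>0 x) \<oplus>\<^bsub>M\<^esub> f (t (d j' x))" if x: "x \<in> carrier (P j)" for x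
    proof -
      have "\<phi> 0 x = \<psi>0 x \<oplus>\<^bsub>P 0\<^esub> t (d j' x)"
        using \<psi>0[OF x] \<phi>0[OF x] tdx[OF x] by (simp add: a_minus_def P.M.a_assoc P.M.l_neg)
      then show ?thesis using mod_homD(3)[OF fh mod_homD(1)[OF \<psi>0_hom x] tdx[OF x]] by simp
    qed
    then have "cmp (i + j) f (\<phi> i) = cmp j f (\<psi> 0) \<oplus>\<^bsub>H j\<^esub> cmp j (cmp j' f t) (d j')"
      using True Suc by (auto simp: add_H compose_def fun_eq_iff restrict_def \<psi>_def)
    then show ?thesis using b c True H.submoduleD(3)[OF submodule_B[of j]] by simp
  next
    case False
    then show ?thesis using b by (simp add: \<psi>_def)
  qed
qed

text \<open>The product is a union over all representatives and all lifts, so every coset in it has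
  to be the same. This follows from f' \<phi>' = f' (\<phi>' - \<phi>) + (f' - f) \<phi> + f \<phi>,
  where the first two terms are coboundaries.\<close>

lemma yoneda_product_cl:
  assumes f: "f \<in> Z i" and g: "g \<in> Z j" and lift: "chain_lift A P d \<epsilon> j g \<phi>"
  shows "yoneda_product A P d \<epsilon> M i j (cl i f) (cl j g) = cl (i + j) (cmp (i + j) f (\<phi> i))"
proof -
  have eq: "cl (i + j) (cmp (i + j) f' (\<phi>' i)) = cl (i + j) (cmp (i + j) f (\<phi> i))"
    if f': "f' \<in> cl i f" and g': "g' \<in> cl j g" and lift': "chain_lift A P d \<epsilon> j g' \<phi>'" for f' g' \<phi>'
  proof -
    obtain b where b: "b \<in> B i" "f' = b \<oplus>\<^bsub>H i\<^esub> f" using cl_memD[OF f f'] by blast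
    obtain c where c: "c \<in> B j" "g' = c \<oplus>\<^bsub>H j\<^esub> g" using cl_memD[OF g g'] by blast
    have f'Z: "f' \<in> Z i" using cl_memD[OF f f'] by blast
    have fh: "f \<in> mod_hom A (P i) M" "b \<in> mod_hom A (P i) M" "c \<in> mod_hom A (P j) M" "g \<in> mod_hom A (P j) M"
      using f g subsetD[OF B_subset_Z b(1)] subsetD[OF B_subset_Z c(1)] by (auto simp: Z_iff)
    note gx = mod_homD(1)[OF fh(4)] and cx = mod_homD(1)[OF fh(3)]
    note \<phi> = chain_liftD[OF lift] and \<phi>' = chain_liftD[OF lift']
    \<comment> \<open>The difference \<phi>' - \<phi> of the lifts is a lift of the coboundary c =
      g' - g.\<close>
    let ?\<psi> = "\<lambda>m. \<lambda>x\<in>carrier (P (j + m)). sc (\<ominus>\<^bsub>K\<^esub> \<one>\<^bsub>K\<^esub>) \<odot>\<^bsub>P m\<^esub> \<phi> m x \<oplus>\<^bsub>P m\<^esub> \<phi>' m x"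
    have "sc (\<ominus>\<^bsub>K\<^esub> \<one>\<^bsub>K\<^esub>) = \<ominus>\<^bsub>A\<^esub> \<one>\<^bsub>A\<^esub>" by (simp add: KA.smult_l_minus)
    then have neg: "sc (\<ominus>\<^bsub>K\<^esub> \<one>\<^bsub>K\<^esub>) \<odot>\<^bsub>P m\<^esub> x = \<ominus>\<^bsub>P m\<^esub> x" if "x \<in> carrier (P m)" for m x
      using that by (simp add: P.smult_l_minus)
    have negM: "sc (\<ominus>\<^bsub>K\<^esub> \<one>\<^bsub>K\<^esub>) \<odot>\<^bsub>M\<^esub> x = \<ominus>\<^bsub>M\<^esub> x" if "x \<in> carrier M" for x
      using that by (simp add: KA.smult_l_minus M.smult_l_minus)
    have "chain_lift A P d \<epsilon> j c ?\<psi>"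
    proof (rule chain_lift_lin[OF _ lift lift'])
      fix x assume x: "x \<in> carrier (P j)"
      have "\<ominus>\<^bsub>M\<^esub> g x \<oplus>\<^bsub>M\<^esub> (c x \<oplus>\<^bsub>M\<^esub> g x) = c x"
        using gx[OF x] cx[OF x] by (simp add: M.M.a_lcomm M.M.l_neg)
      then show "c x = sc (\<ominus>\<^bsub>K\<^esub> \<one>\<^bsub>K\<^esub>) \<odot>\<^bsub>M\<^esub> g x \<oplus>\<^bsub>M\<^esub> g' x"
        using x gx[OF x] by (simp only: negM) (simp add: c add_H)
    qed simp
    then have B1: "cmp (i + j) f' (?\<psi> i) \<in> B (i + j)" by (rule cmp_lift_coboundary[OF f'Z _ c(1)])
    have B2: "cmp (i + j) b (\<phi> i) \<in> B (i + j)" by (rule cmp_B[OF b(1) lift])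
    have "f' (\<phi>' i x) = (f' (?\<psi> i x) \<oplus>\<^bsub>M\<^esub> b (\<phi> i x)) \<oplus>\<^bsub>M\<^esub> f (\<phi> i x)"
      if x: "x \<in> carrier (P (i + j))" for x
    proof -
      have x': "x \<in> carrier (P (j + i))" using x by (simp add: add.commute)
      note v = \<phi>(4)[OF x'] \<phi>'(4)[OF x']
      have f'h: "f' \<in> mod_hom A (P i) M" using f'Z by (simp add: Z_iff)
      have "\<phi>' i x = (\<ominus>\<^bsub>P i\<^esub> \<phi> i x \<oplus>\<^bsub>P i\<^esub> \<phi>' i x) \<oplus>\<^bsub>P i\<^esub> \<phi> i x"
        using v by (metis P.M.a_inv_closed P.M.a_ac(1,2) P.M.l_neg P.M.r_zero P.M.a_comm P.M.l_zero)
      then have "\<phi>' i x = ?\<psi> i x \<oplus>\<^bsub>P i\<^esub> \<phi> i x" using x' v by (simp only: neg restrict_apply if_True)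
      moreover have "?\<psi> i x \<in> carrier (P i)" using x' v by simp
      ultimately have "f' (\<phi>' i x) = f' (?\<psi> i x) \<oplus>\<^bsub>M\<^esub> f' (\<phi> i x)"
        using mod_homD(3)[OF f'h, of "?\<psi> i x" "\<phi> i x"] v by simp
      also have "f' (\<phi> i x) = b (\<phi> i x) \<oplus>\<^bsub>M\<^esub> f (\<phi> i x)" using v by (simp add: b add_H)
      finally show ?thesis
        using v mod_homD(1)[OF fh(1)] mod_homD(1)[OF fh(2)] mod_homD(1)[OF f'h] \<open>?\<psi> i x \<in> carrier (P i)\<close>
        by (simp only: M.M.a_assoc)
    qed
    then have "cmp (i + j) f' (\<phi>' i)
        = (cmp (i + j) f' (?\<psi> i) \<oplus>\<^bsub>H (i + j)\<^esub> cmp (i + j) b (\<phi> i)) \<oplus>\<^bsub>H (i + j)\<^esub> cmp (i + j) f (\<phi> i)"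
      by (simp add: add_H compose_def fun_eq_iff restrict_def)
    then show ?thesis
      using cl_eqI[OF cmp_Z[OF f lift] H.submoduleD(3)[OF submodule_B B1 B2]] by simp
  qed
  show ?thesis unfolding yoneda_product_def using eq cl_self[OF f] cl_self[OF g] lift
    by (intro equalityI subsetI) (blast, blast)
qed

text \<open>The composite of a lift of g with a lift of f lifts the cocycle that represents the
  product of their classes. Associativity of the Yoneda product rests on this choice.\<close>

lemma chain_lift_comp:
  assumes f: "f \<in> Z i" and lift: "chain_lift A P d \<epsilon> j g \<phi>" and lift': "chain_lift A P d \<epsilon> i f \<psi>"
  shows "chain_lift A P d \<epsilon> (i + j) (cmp (i + j) f (\<phi> i)) (\<lambda>m. cmp (i + j + m) (\<psi> m) (\<phi> (i + m)))"
proof -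
  note \<phi> = chain_liftD[OF lift] and \<psi> = chain_liftD[OF lift']
  have 1: "j + (i + m) = i + j + m" for m by simp
  have hom: "\<phi> (i + m) \<in> mod_hom A (P (i + j + m)) (P (i + m))" for m
    using \<phi>(1)[of "i + m"] unfolding 1 .
  have val: "\<phi> (i + m) x \<in> carrier (P (i + m))" if "x \<in> carrier (P (i + j + m))" for m x
    using mod_homD(1)[OF hom that] .
  show ?thesis
    unfolding chain_lift_def
  proof (intro conjI allI ballI)
    show "cmp (i + j + m) (\<psi> m) (\<phi> (i + m)) \<in> mod_hom A (P (i + j + m)) (P m)" for m
      by (rule mod_hom_compose[OF hom \<psi>(1) r(3)])
    show "\<epsilon> (cmp (i + j + 0) (\<psi> 0) (\<phi> (i + 0)) x) = cmp (i + j) f (\<phi> i) x" if "x \<in> carrier (P (i + j))" for x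
      using that \<psi>(2) val[of x 0] by (simp add: compose_def)
    fix m x assume x: "x \<in> carrier (P (Suc (i + j + m)))"
    have "d (i + m) (\<phi> (Suc (i + m)) x) = \<phi> (i + m) (d (i + j + m) x)"
      using \<phi>(3)[of x "i + m"] x unfolding 1 by simp
    moreover have "\<phi> (Suc (i + m)) x \<in> carrier (P (Suc (i + m)))" using val[of x "Suc m"] x by simp
    ultimately show "d m (cmp (i + j + Suc m) (\<psi> (Suc m)) (\<phi> (i + Suc m)) x)
        = cmp (i + j + m) (\<psi> m) (\<phi> (i + m)) (d (i + j + m) x)"
      using x \<psi>(3)[of "\<phi> (Suc (i + m)) x" m] by (simp add: compose_def)
  qed
qed

lemma chain_lift_zero: "chain_lift A P d \<epsilon> j (\<lambda>x. \<zero>\<^bsub>M\<^esub>) (\<lambda>m. \<lambda>x\<in>carrier (P (j + m)). \<zero>\<^bsub>P m\<^esub>)"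
  using mod_hom_zero_map[OF r(3) r(3)] mod_hom_zero[OF r(5) r(3) r(1)] mod_hom_zero[OF r(4) r(3) r(3)]
  by (simp add: chain_lift_def)

lemma chain_lift_id: "chain_lift A P d \<epsilon> 0 (cmp 0 (\<lambda>x\<in>carrier M. x) \<epsilon>) (\<lambda>m. \<lambda>x\<in>carrier (P m). x)"
  using mod_hom_id[OF r(3)] mod_homD(1)[OF r(5)] by (simp add: chain_lift_def compose_def)

lemma endo_Z:
  assumes h: "h \<in> mod_hom A M M" shows "cmp 0 h \<epsilon> \<in> Z 0"
  using mod_hom_compose[OF r(5) h r(3)] r(9) mod_hom_zero[OF h r(1) r(1)] by (simp add: Z_iff compose_def)

text \<open>Only the bottom component of a lift enters: h \<epsilon> \<phi>_0 = h g. Left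
  multiplication by an endomorphism class is thus plain composition of representatives.\<close>

lemma yoneda_endo_l:
  assumes h: "h \<in> mod_hom A M M" and g: "g \<in> Z j"
  shows "yoneda_product A P d \<epsilon> M 0 j (cl 0 (cmp 0 h \<epsilon>)) (cl j g) = cl j (cmp j h g)"
proof -
  obtain \<phi> where \<phi>: "chain_lift A P d \<epsilon> j g \<phi>" using chain_lift_exists[OF g] by blast
  have "cmp j (cmp 0 h \<epsilon>) (\<phi> 0) = cmp j h g"
    using chain_liftD(2)[OF \<phi>] chain_liftD(4)[OF \<phi>, of _ 0] by (auto simp: compose_def restrict_def fun_eq_iff)
  then show ?thesis using yoneda_product_cl[OF endo_Z[OF h] g \<phi>] by simp
qed

lemma graded_product_ext:
  "graded_product K E (yoneda_product A P d \<epsilon> M) (cl 0 (cmp 0 (\<lambda>x\<in>carrier M. x) \<epsilon>))"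
proof (rule graded_product.intro)
  show "cring K" by (rule K.is_cring)
  show "left_module K (E i)" for i by (rule E.left_module_quot)
  let ?m = "yoneda_product A P d \<epsilon> M"
  have idM: "(\<lambda>x\<in>carrier M. x) \<in> mod_hom A M M" by (rule mod_hom_id[OF r(1)])
  have Zh: "f \<in> mod_hom A (P i) M" if "f \<in> Z i" for f i using that by (simp add: Z_iff)
  have Zadd: "f \<oplus>\<^bsub>H i\<^esub> g \<in> Z i" if "f \<in> Z i" "g \<in> Z i" for f g i
    by (rule H.submoduleD(3)[OF submodule_Z that])
  have Zsm: "c \<odot>\<^bsub>H i\<^esub> f \<in> Z i" if "c \<in> carrier K" "f \<in> Z i" for c f i
    by (rule H.submoduleD(5)[OF submodule_Z that])
  show "cl 0 (cmp 0 (\<lambda>x\<in>carrier M. x) \<epsilon>) \<in> carrier (E 0)" using endo_Z[OF idM] by simp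
  fix i x assume "x \<in> carrier (E i)"
  then obtain f where f: "f \<in> Z i" "x = cl i f" by (auto simp: carrier_E)
  have fx: "f y \<in> carrier M" if "y \<in> carrier (P i)" for y by (rule mod_homD(1)[OF Zh[OF f(1)] that])
  have fu: "f y = undefined" if "y \<notin> carrier (P i)" for y by (rule mod_homD(2)[OF Zh[OF f(1)] that])
  have "cmp i (\<lambda>x\<in>carrier M. x) f = f" using fx fu by (auto simp: compose_def restrict_def fun_eq_iff)
  then show "?m 0 i (cl 0 (cmp 0 (\<lambda>x\<in>carrier M. x) \<epsilon>)) x = x"
    using yoneda_endo_l[OF idM f(1)] f by simp
  have "cmp i f (\<lambda>x\<in>carrier (P i). x) = f" using fu by (auto simp: compose_def restrict_def fun_eq_iff)
  then show "?m i 0 x (cl 0 (cmp 0 (\<lambda>x\<in>carrier M. x) \<epsilon>)) = x"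
    using yoneda_product_cl[OF f(1) endo_Z[OF idM] chain_lift_id] f by simp
  fix j y assume "y \<in> carrier (E j)"
  then obtain g where g: "g \<in> Z j" "y = cl j g" by (auto simp: carrier_E)
  obtain \<phi> where \<phi>: "chain_lift A P d \<epsilon> j g \<phi>" using chain_lift_exists[OF g(1)] by blast
  note \<phi>D = chain_liftD[OF \<phi>]
  have \<phi>i: "\<phi> i y \<in> carrier (P i)" if "y \<in> carrier (P (i + j))" for y
    using \<phi>D(4)[of y i] that by (simp add: add.commute)
  note xy = yoneda_product_cl[OF f(1) g(1) \<phi>]
  have Zf: "cmp (i + j) f (\<phi> i) \<in> Z (i + j)" by (rule cmp_Z[OF f(1) \<phi>])
  show "?m i j x y \<in> carrier (E (i + j))" using Zf by (simp add: xy f g)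
  {
    fix x' assume "x' \<in> carrier (E i)"
    then obtain f' where f': "f' \<in> Z i" "x' = cl i f'" by (auto simp: carrier_E)
    have "cmp (i + j) (f \<oplus>\<^bsub>H i\<^esub> f') (\<phi> i) = cmp (i + j) f (\<phi> i) \<oplus>\<^bsub>H (i + j)\<^esub> cmp (i + j) f' (\<phi> i)"
      using \<phi>i by (auto simp: add_H compose_def restrict_def fun_eq_iff)
    then show "?m i j (x \<oplus>\<^bsub>E i\<^esub> x') y = ?m i j x y \<oplus>\<^bsub>E (i + j)\<^esub> ?m i j x' y"
      using yoneda_product_cl[OF f'(1) g(1) \<phi>] yoneda_product_cl[OF Zadd[OF f(1) f'(1)] g(1) \<phi>] f f' g
      by (simp add: xy cl_add Zf cmp_Z[OF f'(1) \<phi>])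
  next
    fix y' assume "y' \<in> carrier (E j)"
    then obtain g' where g': "g' \<in> Z j" "y' = cl j g'" by (auto simp: carrier_E)
    obtain \<phi>' where \<phi>': "chain_lift A P d \<epsilon> j g' \<phi>'" using chain_lift_exists[OF g'(1)] by blast
    have \<phi>'i: "\<phi>' i y \<in> carrier (P i)" if "y \<in> carrier (P (i + j))" for y
      using chain_liftD(4)[OF \<phi>', of y i] that by (simp add: add.commute)
    have lift: "chain_lift A P d \<epsilon> j (g \<oplus>\<^bsub>H j\<^esub> g')
        (\<lambda>m. \<lambda>x\<in>carrier (P (j + m)). sc \<one>\<^bsub>K\<^esub> \<odot>\<^bsub>P m\<^esub> \<phi> m x \<oplus>\<^bsub>P m\<^esub> \<phi>' m x)" (is "chain_lift _ _ _ _ _ _ ?\<psi>")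
      by (rule chain_lift_lin[OF _ \<phi> \<phi>']) (use mod_homD(1)[OF Zh[OF g(1)]] in \<open>simp_all add: add_H\<close>)
    have "cmp (i + j) f (?\<psi> i) = cmp (i + j) f (\<phi> i) \<oplus>\<^bsub>H (i + j)\<^esub> cmp (i + j) f (\<phi>' i)"
      using \<phi>i \<phi>'i mod_homD(3)[OF Zh[OF f(1)]] by (auto simp: add_H compose_def restrict_def fun_eq_iff add.commute)
    then show "?m i j x (y \<oplus>\<^bsub>E j\<^esub> y') = ?m i j x y \<oplus>\<^bsub>E (i + j)\<^esub> ?m i j x y'"
      using yoneda_product_cl[OF f(1) g'(1) \<phi>'] yoneda_product_cl[OF f(1) Zadd[OF g(1) g'(1)] lift] f g' g
      by (simp add: xy cl_add Zf cmp_Z[OF f(1) \<phi>'])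
  next
    fix c assume c: "c \<in> carrier K"
    have "cmp (i + j) (c \<odot>\<^bsub>H i\<^esub> f) (\<phi> i) = c \<odot>\<^bsub>H (i + j)\<^esub> cmp (i + j) f (\<phi> i)"
      using \<phi>i by (auto simp: smult_H compose_def restrict_def fun_eq_iff)
    then show "?m i j (c \<odot>\<^bsub>E i\<^esub> x) y = c \<odot>\<^bsub>E (i + j)\<^esub> ?m i j x y"
      using yoneda_product_cl[OF Zsm[OF c f(1)] g(1) \<phi>] f g c by (simp add: xy cl_smult Zf)
    have lift: "chain_lift A P d \<epsilon> j (c \<odot>\<^bsub>H j\<^esub> g)
        (\<lambda>m. \<lambda>x\<in>carrier (P (j + m)). sc c \<odot>\<^bsub>P m\<^esub> \<phi> m x \<oplus>\<^bsub>P m\<^esub> (\<lambda>x\<in>carrier (P (j + m)). \<zero>\<^bsub>P m\<^esub>) x)"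
        (is "chain_lift _ _ _ _ _ _ ?\<psi>")
      by (rule chain_lift_lin[OF c \<phi> chain_lift_zero]) (use c mod_homD(1)[OF Zh[OF g(1)]] in \<open>simp add: smult_H\<close>)
    have "cmp (i + j) f (?\<psi> i) = c \<odot>\<^bsub>H (i + j)\<^esub> cmp (i + j) f (\<phi> i)"
      using c \<phi>i mod_homD(4)[OF Zh[OF f(1)]] by (auto simp: smult_H compose_def restrict_def fun_eq_iff add.commute)
    then show "?m i j x (c \<odot>\<^bsub>E j\<^esub> y) = c \<odot>\<^bsub>E (i + j)\<^esub> ?m i j x y"
      using yoneda_product_cl[OF f(1) Zsm[OF c g(1)] lift] f g c by (simp add: xy cl_smult Zf)
  next
    fix k z assume "z \<in> carrier (E k)"
    then obtain h where h: "h \<in> Z k" "z = cl k h" by (auto simp: carrier_E)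
    obtain \<chi> where \<chi>: "chain_lift A P d \<epsilon> k h \<chi>" using chain_lift_exists[OF h(1)] by blast
    note yz = yoneda_product_cl[OF g(1) h(1) \<chi>]
    have "\<chi> (i + j) x \<in> carrier (P (i + j))" if "x \<in> carrier (P (i + j + k))" for x
      using chain_liftD(4)[OF \<chi>, of x "i + j"] that by (simp add: add.commute add.left_commute)
    then have "cmp (i + j + k) (cmp (i + j) f (\<phi> i)) (\<chi> (i + j))
        = cmp (i + (j + k)) f (cmp (j + k + i) (\<phi> i) (\<chi> (j + i)))"
      by (auto simp: compose_def restrict_def fun_eq_iff add.commute add.left_commute)
    then show "?m (i + j) k (?m i j x y) z = ?m i (j + k) x (?m j k y z)"
      using yoneda_product_cl[OF Zf h(1) \<chi>] yoneda_product_cl[OF f(1) cmp_Z[OF g(1) \<chi>] chain_lift_comp[OF g(1) \<chi> \<phi>]] h f g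
      by (simp add: xy yz add.assoc)
  }
qed

sublocale GP: graded_product K E "yoneda_product A P d \<epsilon> M" "cl 0 (cmp 0 (\<lambda>x\<in>carrier M. x) \<epsilon>)"
  by (rule graded_product_ext)

lemma ext_of_endo_eq:
  "ext_of_endo A P d \<epsilon> M h = (\<lambda>i. if i = 0 then cl 0 (cmp 0 h \<epsilon>) else \<zero>\<^bsub>E i\<^esub>)"
  by (auto simp: ext_of_endo_def fun_eq_iff)

lemma ext_algebra_eq: "ext_algebra A P d \<epsilon> M = GP.conv_algebra"
  by (simp add: ext_algebra_def GP.conv_algebra_def GP.conv_def[abs_def] ext_of_endo_eq)

end

subsection \<open>Homogeneous components\<close>

definition hcs :: "('m, 'r) ring_scheme \<Rightarrow> ('i \<Rightarrow> 'm set) \<Rightarrow> 'm \<Rightarrow> 'i \<Rightarrow> 'm" where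
  "hcs M G x = (THE f. (\<forall>i. f i \<in> G i) \<and> finite {i. f i \<noteq> \<zero>\<^bsub>M\<^esub>} \<and> x = finsum M f {i. f i \<noteq> \<zero>\<^bsub>M\<^esub>})"

abbreviation hc :: "('m, 'r) ring_scheme \<Rightarrow> ('i \<Rightarrow> 'm set) \<Rightarrow> 'i \<Rightarrow> 'm \<Rightarrow> 'm" where
  "hc M G i x \<equiv> hcs M G x i"

locale graded_group = abelian_group M for M (structure) +
  fixes G :: "'i \<Rightarrow> 'a set"
  assumes dsum: "internal_dsum M G"
begin

sublocale G: additive_subgroup "G i" M for i
  using dsum by (simp add: internal_dsum_def)

lemma hcs_unique:
  assumes "x \<in> carrier M"
  shows "\<exists>!f. (\<forall>i. f i \<in> G i) \<and> finite {i. f i \<noteq> \<zero>} \<and> x = finsum M f {i. f i \<noteq> \<zero>}"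
  using dsum assms unfolding internal_dsum_def by blast

lemma hcs_props:
  assumes "x \<in> carrier M"
  shows "hc M G i x \<in> G i" "finite {i. hc M G i x \<noteq> \<zero>}" "finsum M (hcs M G x) {i. hc M G i x \<noteq> \<zero>} = x"
proof -
  have "(\<forall>i. hc M G i x \<in> G i) \<and> finite {i. hc M G i x \<noteq> \<zero>} \<and> x = finsum M (hcs M G x) {i. hc M G i x \<noteq> \<zero>}"
    unfolding hcs_def by (rule theI'[OF hcs_unique[OF assms]])
  then show "hc M G i x \<in> G i" "finite {i. hc M G i x \<noteq> \<zero>}" "finsum M (hcs M G x) {i. hc M G i x \<noteq> \<zero>} = x"
    by simp_all
qed

lemma hc_carrier [simp]: "x \<in> carrier M \<Longrightarrow> hc M G i x \<in> carrier M"
  using hcs_props(1) G.a_subset by blast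

lemma G_carrier: "x \<in> G i \<Longrightarrow> x \<in> carrier M"
  using G.a_subset by blast

lemma hcs_eqI:
  assumes f: "\<And>i. f i \<in> G i" and F: "finite F" "\<And>i. i \<notin> F \<Longrightarrow> f i = \<zero>" and x: "x = finsum M f F"
  shows "hcs M G x = f"
proof -
  have fc: "f i \<in> carrier M" for i using f G_carrier by blast
  have sub: "{i. f i \<noteq> \<zero>} \<subseteq> F" using F by blast
  have "finsum M f {i. f i \<noteq> \<zero>} = finsum M f F"
    by (rule add.finprod_mono_neutral_cong_left) (use F sub fc in auto)
  moreover have "x \<in> carrier M" using fc by (simp add: x)
  moreover have "finite {i. f i \<noteq> \<zero>}" using sub F(1) by (rule finite_subset)
  ultimately show ?thesis
    unfolding hcs_def using f x by (intro the1_equality[OF hcs_unique]) auto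
qed

lemma sum_hcs:
  assumes "x \<in> carrier M" "finite F" "{i. hc M G i x \<noteq> \<zero>} \<subseteq> F"
  shows "finsum M (hcs M G x) F = x"
proof -
  have "finsum M (hcs M G x) {i. hc M G i x \<noteq> \<zero>} = finsum M (hcs M G x) F"
    by (rule add.finprod_mono_neutral_cong_left) (use assms in auto)
  then show ?thesis using hcs_props(3)[OF assms(1)] by simp
qed

lemma hc_homogeneous: "x \<in> G i \<Longrightarrow> hc M G j x = (if j = i then x else \<zero>)"
proof -
  assume x: "x \<in> G i"
  have "x = finsum M (\<lambda>j. if j = i then x else \<zero>) {i}" using G_carrier[OF x] by simp
  then have "hcs M G x = (\<lambda>j. if j = i then x else \<zero>)" by (intro hcs_eqI[of _ "{i}"]) (use x in auto)
  then show ?thesis by simp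
qed

lemma hc_zero [simp]: "hc M G i \<zero> = \<zero>"
  using hc_homogeneous[of \<zero> i i] by simp

lemma hc_add: assumes "x \<in> carrier M" "y \<in> carrier M" shows "hc M G i (x \<oplus> y) = hc M G i x \<oplus> hc M G i y"
proof -
  let ?F = "{i. hc M G i x \<noteq> \<zero>} \<union> {i. hc M G i y \<noteq> \<zero>}"
  have F: "finite ?F" using hcs_props(2) assms by simp
  have "x \<oplus> y = finsum M (\<lambda>i. hc M G i x \<oplus> hc M G i y) ?F"
    using sum_hcs[OF assms(1) F] sum_hcs[OF assms(2) F] assms by (simp add: finsum_addf)
  then have "hcs M G (x \<oplus> y) = (\<lambda>i. hc M G i x \<oplus> hc M G i y)"
    using F assms by (intro hcs_eqI[of _ ?F]) (auto intro: hcs_props)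
  then show ?thesis by simp
qed

lemma hc_finsum:
  "f \<in> S \<rightarrow> carrier M \<Longrightarrow> hc M G i (finsum M f S) = finsum M (\<lambda>s. hc M G i (f s)) S"
  by (induct S rule: infinite_finite_induct) (auto simp: hc_add Pi_iff)

end

text \<open>The injection \<sigma> records how T moves degrees. It is a shift for right
  multiplication by a homogeneous element, the identity for graded homomorphisms, and the shifted
  embedding of \<open>nat\<close> into \<open>int\<close> for the action on a homogeneous element;
  degrees outside its range receive nothing.\<close>

lemma hc_map:
  assumes M: "graded_group M G" and N: "graded_group N G'" and x: "x \<in> carrier M"
    and T: "\<And>x. x \<in> carrier M \<Longrightarrow> T x \<in> carrier N"
      "\<And>x y. \<lbrakk>x \<in> carrier M; y \<in> carrier M\<rbrakk> \<Longrightarrow> T (x \<oplus>\<^bsub>M\<^esub> y) = T x \<oplus>\<^bsub>N\<^esub> T y"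
      "\<And>i x. x \<in> G i \<Longrightarrow> T x \<in> G' (\<sigma> i)"
    and \<sigma>: "inj \<sigma>"
  shows "hc N G' (\<sigma> i) (T x) = T (hc M G i x)" "k \<notin> range \<sigma> \<Longrightarrow> hc N G' k (T x) = \<zero>\<^bsub>N\<^esub>"
proof -
  interpret M: graded_group M G by fact
  interpret N: graded_group N G' by fact
  have T0: "T \<zero>\<^bsub>M\<^esub> = \<zero>\<^bsub>N\<^esub>"
    using T(2)[of "\<zero>\<^bsub>M\<^esub>" "\<zero>\<^bsub>M\<^esub>"] T(1)[of "\<zero>\<^bsub>M\<^esub>"] by (metis M.l_zero M.zero_closed N.add.r_cancel_one')
  let ?F = "insert i {j. hc M G j x \<noteq> \<zero>\<^bsub>M\<^esub>}"
  have F: "finite ?F" using M.hcs_props(2)[OF x] by simp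
  have Tsum: "T (finsum M f S) = finsum N (\<lambda>s. T (f s)) S" if "finite S" "f \<in> S \<rightarrow> carrier M" for f and S :: "'c set"
    using that by (induct S) (auto simp: T T0 Pi_iff)
  have "T x = T (finsum M (hcs M G x) ?F)" using M.sum_hcs[OF x F subset_insertI] by simp
  also have "\<dots> = finsum N (\<lambda>j. T (hc M G j x)) ?F" using x by (intro Tsum[OF F]) auto
  finally have *: "hc N G' k (T x) = finsum N (\<lambda>j. hc N G' k (T (hc M G j x))) ?F" for k
    using x T(1) by (simp only:) (rule N.hc_finsum, auto)
  have hom: "hc N G' k (T (hc M G j x)) = (if k = \<sigma> j then T (hc M G j x) else \<zero>\<^bsub>N\<^esub>)" for j k
    by (rule N.hc_homogeneous[OF T(3)[OF M.hcs_props(1)[OF x]]])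
  have "hc N G' (\<sigma> i) (T x) = finsum N (\<lambda>j. if i = j then T (hc M G j x) else \<zero>\<^bsub>N\<^esub>) ?F"
    unfolding * hom using \<sigma> x T(1) by (intro N.finsum_cong') (auto simp: inj_eq)
  also have "\<dots> = T (hc M G i x)"
    using F x T(1) by (intro N.add.finprod_singleton) auto
  finally show "hc N G' (\<sigma> i) (T x) = T (hc M G i x)" .
  show "hc N G' k (T x) = \<zero>\<^bsub>N\<^esub>" if "k \<notin> range \<sigma>"
    unfolding * hom using that by (intro N.add.finprod_one_eqI) auto
qed

subsection \<open>Graded algebras\<close>

text \<open>That the unit has degree 0 is an assumption here; it is obtained in the final theorem
  from the idempotents of degree 0.\<close>

locale graded_fd_algebra = fin_dim_algebra K A
  for K :: "('k, 'z) ring_scheme" and A :: "('k, 'a) module" +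
  fixes \<A> :: "nat \<Rightarrow> 'a set"
  assumes graded: "graded_algebra K A \<A>" and one_degree: "\<one>\<^bsub>A\<^esub> \<in> \<A> 0"
begin

sublocale GA: graded_group A \<A>
  using graded A.abelian_group_axioms
  by (simp add: graded_algebra_def graded_group_def graded_group_axioms_def)

abbreviation "hA \<equiv> hc A \<A>"
abbreviation "J \<equiv> positive_part A \<A>"
abbreviation "A0 \<equiv> degree_zero_ring A \<A>"

lemma \<A>_carrier: "a \<in> \<A> i \<Longrightarrow> a \<in> carrier A" by (rule GA.G_carrier)

lemma \<A>_mult: "\<lbrakk>a \<in> \<A> i; b \<in> \<A> j\<rbrakk> \<Longrightarrow> a \<otimes>\<^bsub>A\<^esub> b \<in> \<A> (i + j)"
  using graded by (simp add: graded_algebra_def)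

lemma \<A>_mult_0: "\<lbrakk>a \<in> \<A> 0; b \<in> \<A> 0\<rbrakk> \<Longrightarrow> a \<otimes>\<^bsub>A\<^esub> b \<in> \<A> 0"
  using \<A>_mult[of a 0 b 0] by simp

lemma \<A>_submodule: "submodule (\<A> i) K A"
  using graded by (simp add: graded_algebra_def)

lemma sc_degree: "c \<in> carrier K \<Longrightarrow> sc c \<in> \<A> 0"
  using KA.submoduleE(4)[OF \<A>_submodule _ one_degree] by blast

lemma \<A>_zero [simp]: "\<zero>\<^bsub>A\<^esub> \<in> \<A> i" by (rule GA.G.zero_closed)

lemma \<A>_add: "\<lbrakk>a \<in> \<A> i; b \<in> \<A> i\<rbrakk> \<Longrightarrow> a \<oplus>\<^bsub>A\<^esub> b \<in> \<A> i" by (rule GA.G.a_closed)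

lemma \<A>_minus: "a \<in> \<A> i \<Longrightarrow> \<ominus>\<^bsub>A\<^esub> a \<in> \<A> i" by (rule GA.G.a_inv_closed)

lemma hA_degree: "a \<in> carrier A \<Longrightarrow> hA i a \<in> \<A> i" by (rule GA.hcs_props)

lemma hA_mult_r: "\<lbrakk>a \<in> carrier A; b \<in> \<A> j\<rbrakk> \<Longrightarrow> hA (i + j) (a \<otimes>\<^bsub>A\<^esub> b) = hA i a \<otimes>\<^bsub>A\<^esub> b"
  by (rule hc_map(1)[OF GA.graded_group_axioms GA.graded_group_axioms, where \<sigma> = "\<lambda>i. i + j"])
    (auto simp: A.l_distr \<A>_mult \<A>_carrier intro: injI)

lemma hA_0_mult_positive: "\<lbrakk>a \<in> carrier A; b \<in> \<A> j; 0 < j\<rbrakk> \<Longrightarrow> hA 0 (a \<otimes>\<^bsub>A\<^esub> b) = \<zero>\<^bsub>A\<^esub>"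
  by (rule hc_map(2)[OF GA.graded_group_axioms GA.graded_group_axioms, where \<sigma> = "\<lambda>i. i + j"])
    (auto simp: A.l_distr \<A>_mult \<A>_carrier intro: injI)

text \<open>Degrees are nonnegative, so of the summands a b_i only the one with i = 0 reaches degree
  0. The degree-zero projection is therefore multiplicative.\<close>

lemma hA_0_mult:
  assumes "a \<in> carrier A" "b \<in> carrier A" shows "hA 0 (a \<otimes>\<^bsub>A\<^esub> b) = hA 0 a \<otimes>\<^bsub>A\<^esub> hA 0 b"
proof -
  let ?F = "insert 0 {i. hA i b \<noteq> \<zero>\<^bsub>A\<^esub>}"
  have F: "finite ?F" using GA.hcs_props(2)[OF assms(2)] by simp
  have "a \<otimes>\<^bsub>A\<^esub> b = a \<otimes>\<^bsub>A\<^esub> finsum A (hcs A \<A> b) ?F" using GA.sum_hcs[OF assms(2) F subset_insertI] by simp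
  also have "\<dots> = finsum A (\<lambda>i. a \<otimes>\<^bsub>A\<^esub> hA i b) ?F" using assms by (intro A.finsum_rdistr[OF F]) auto
  finally have "hA 0 (a \<otimes>\<^bsub>A\<^esub> b) = finsum A (\<lambda>i. hA 0 (a \<otimes>\<^bsub>A\<^esub> hA i b)) ?F"
    using assms by (simp only:) (rule GA.hc_finsum, auto)
  also have "\<dots> = finsum A (\<lambda>i. if 0 = i then hA 0 a \<otimes>\<^bsub>A\<^esub> hA i b else \<zero>\<^bsub>A\<^esub>) ?F"
    using assms hA_mult_r[OF assms(1) hA_degree[OF assms(2)], of 0 0]
      hA_0_mult_positive[OF assms(1) hA_degree[OF assms(2)]]
    by (intro A.finsum_cong') auto
  also have "\<dots> = hA 0 a \<otimes>\<^bsub>A\<^esub> hA 0 b" using F assms by (intro A.add.finprod_singleton) auto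
  finally show ?thesis .
qed

text \<open>With \<open>J\<close> described as the kernel of the degree-zero projection, its being a
  two-sided ideal becomes a consequence of \<open>hA_0_mult\<close>.\<close>

lemma J_iff: "a \<in> J \<longleftrightarrow> a \<in> carrier A \<and> hA 0 a = \<zero>\<^bsub>A\<^esub>"
proof
  have sub: "(\<Union>i\<in>{1..}. \<A> i) \<subseteq> carrier A" using \<A>_carrier by blast
  assume a: "a \<in> J"
  then have "a \<in> carrier A" using A.add_span_carrier[OF sub] by (auto simp: positive_part_def)
  moreover have "hA 0 a \<in> {\<zero>\<^bsub>A\<^esub>}"
    by (rule add_span_image[OF A.abelian_group_axioms A.abelian_group_axioms sub a[unfolded positive_part_def]])
      (auto simp: GA.hc_add GA.hc_homogeneous intro!: A.additive_subgroupI')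
  ultimately show "a \<in> carrier A \<and> hA 0 a = \<zero>\<^bsub>A\<^esub>" by simp
next
  assume a: "a \<in> carrier A \<and> hA 0 a = \<zero>\<^bsub>A\<^esub>"
  have sub: "(\<Union>i\<in>{1..}. \<A> i) \<subseteq> carrier A" using \<A>_carrier by blast
  have "finsum A (hcs A \<A> a) {i. hA i a \<noteq> \<zero>\<^bsub>A\<^esub>} \<in> J"
    unfolding positive_part_def
  proof (rule A.finsum_in_additive_subgroup[OF A.additive_subgroup_add_span[OF sub] add_span_incl])
    fix i assume "i \<in> {i. hA i a \<noteq> \<zero>\<^bsub>A\<^esub>}"
    then have "1 \<le> i" using a by (cases i) auto
    then show "hA i a \<in> (\<Union>i\<in>{1..}. \<A> i)" using a hA_degree by blast
  qed
  then show "a \<in> J" using a GA.hcs_props(3) by simp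
qed

lemma hA_0_homogeneous: "a \<in> \<A> 0 \<Longrightarrow> hA 0 a = a"
  by (simp add: GA.hc_homogeneous)

lemma J_carrier: "a \<in> J \<Longrightarrow> a \<in> carrier A" by (simp add: J_iff)

lemma J_mult_l: "\<lbrakk>a \<in> carrier A; b \<in> J\<rbrakk> \<Longrightarrow> a \<otimes>\<^bsub>A\<^esub> b \<in> J"
  and J_mult_r: "\<lbrakk>a \<in> J; b \<in> carrier A\<rbrakk> \<Longrightarrow> a \<otimes>\<^bsub>A\<^esub> b \<in> J"
  by (simp_all add: J_iff hA_0_mult)

lemma J_add: "\<lbrakk>a \<in> J; b \<in> J\<rbrakk> \<Longrightarrow> a \<oplus>\<^bsub>A\<^esub> b \<in> J"
  by (simp add: J_iff GA.hc_add)

lemma J_zero [simp]: "\<zero>\<^bsub>A\<^esub> \<in> J" by (simp add: J_iff)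

lemma J_degree_0: "\<lbrakk>a \<in> J; a \<in> \<A> 0\<rbrakk> \<Longrightarrow> a = \<zero>\<^bsub>A\<^esub>"
  by (simp add: J_iff hA_0_homogeneous)

lemma \<A>_subset_J: "a \<in> \<A> i \<Longrightarrow> 0 < i \<Longrightarrow> a \<in> J"
  by (simp add: J_iff \<A>_carrier GA.hc_homogeneous)

lemma minus_hA_0_in_J: "a \<in> carrier A \<Longrightarrow> a \<ominus>\<^bsub>A\<^esub> hA 0 a \<in> J"
  using GA.hc_add[of a "\<ominus>\<^bsub>A\<^esub> hA 0 a" 0] GA.hc_homogeneous[OF \<A>_minus[OF hA_degree], of a 0 0]
  by (simp add: J_iff a_minus_def A.r_neg)

lemma ring_A0: "ring A0"
proof (rule ringI)
  show "abelian_group A0"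
  proof (rule abelian_groupI)
    fix x assume "x \<in> carrier A0"
    then show "\<exists>y\<in>carrier A0. y \<oplus>\<^bsub>A0\<^esub> x = \<zero>\<^bsub>A0\<^esub>"
      using \<A>_minus[of x 0] \<A>_carrier[of x 0] by (auto simp: degree_zero_ring_def A.l_neg intro!: bexI[of _ "\<ominus>\<^bsub>A\<^esub> x"])
  qed (auto simp: degree_zero_ring_def \<A>_add \<A>_carrier A.a_assoc intro: A.a_comm)
  show "monoid A0"
    by (rule monoidI) (auto simp: degree_zero_ring_def \<A>_mult_0 \<A>_carrier A.m_assoc one_degree)
qed (auto simp: degree_zero_ring_def \<A>_carrier A.l_distr A.r_distr)

lemma carrier_A0 [simp]: "carrier A0 = \<A> 0"
  and A0_simps [simp]: "\<one>\<^bsub>A0\<^esub> = \<one>\<^bsub>A\<^esub>" "\<zero>\<^bsub>A0\<^esub> = \<zero>\<^bsub>A\<^esub>" "a \<otimes>\<^bsub>A0\<^esub> b = a \<otimes>\<^bsub>A\<^esub> b" "a \<oplus>\<^bsub>A0\<^esub> b = a \<oplus>\<^bsub>A\<^esub> b"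
  by (auto simp: degree_zero_ring_def)

lemma left_module_A0:
  assumes "left_module A M" "additive_subgroup H M" "\<And>a x. \<lbrakk>a \<in> \<A> 0; x \<in> H\<rbrakk> \<Longrightarrow> a \<odot>\<^bsub>M\<^esub> x \<in> H"
  shows "left_module A0 (M\<lparr>carrier := H\<rparr>)"
proof -
  interpret M: left_module A M by fact
  interpret H: additive_subgroup H M by fact
  have H: "x \<in> carrier M" if "x \<in> H" for x using that H.a_subset by blast
  show ?thesis
    by (rule left_moduleI[OF ring_A0])
      (use assms(3) H in \<open>auto simp: M.M.a_assoc M.smult_l_distr M.smult_r_distr M.smult_assoc1 \<A>_carrier intro: M.M.a_comm\<close>)
qed

lemma left_module_regular: "left_module A (regular_module A)"
  by (rule left_module_regular_module[OF A.ring_axioms])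

lemma regular_module_simps [simp]:
  "carrier (regular_module A) = carrier A" "\<zero>\<^bsub>regular_module A\<^esub> = \<zero>\<^bsub>A\<^esub>"
  "x \<oplus>\<^bsub>regular_module A\<^esub> y = x \<oplus>\<^bsub>A\<^esub> y" "a \<odot>\<^bsub>regular_module A\<^esub> x = a \<otimes>\<^bsub>A\<^esub> x"
  by (auto simp: regular_module_def)

lemma submodule_J: "submodule J A (regular_module A)"
proof -
  interpret left_module A "regular_module A" by (rule left_module_regular)
  show ?thesis by (rule submoduleI) (auto simp: J_add J_mult_l J_carrier)
qed

abbreviation D0 :: "('a, 'a set) module" where "D0 \<equiv> degree_zero_module A \<A>"
abbreviation q :: "'a \<Rightarrow> 'a set" where "q a \<equiv> J +>\<^bsub>A\<^esub> a"

lemma a_r_coset_regular: "N +>\<^bsub>regular_module A\<^esub> x = N +>\<^bsub>A\<^esub> x"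
  by (simp add: a_r_coset_def')

lemma minus_regular: "x \<in> carrier A \<Longrightarrow> y \<in> carrier A \<Longrightarrow> x \<ominus>\<^bsub>regular_module A\<^esub> y = x \<ominus>\<^bsub>A\<^esub> y"
  by (simp add: a_minus_def a_inv_def m_inv_def)

interpretation D0Q: module_quotient A "regular_module A" J
  by (rule module_quotientI[OF left_module_regular submodule_J])

lemma left_module_D0: "left_module A D0"
  using D0Q.left_module_quot by (simp add: degree_zero_module_def)

lemma carrier_D0: "carrier D0 = q ` carrier A"
  by (simp add: degree_zero_module_def carrier_quot_module a_r_coset_regular)

lemma q_closed [simp]: "a \<in> carrier A \<Longrightarrow> q a \<in> carrier D0"
  by (simp add: carrier_D0)

lemma q_eq_iff: "\<lbrakk>a \<in> carrier A; b \<in> carrier A\<rbrakk> \<Longrightarrow> q a = q b \<longleftrightarrow> a \<ominus>\<^bsub>A\<^esub> b \<in> J"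
  using D0Q.coset_eq_iff[of a b] by (simp add: a_r_coset_regular minus_regular)

lemma zero_D0: "\<zero>\<^bsub>D0\<^esub> = J"
  by (simp add: degree_zero_module_def)

lemma q_zero_iff: "a \<in> carrier A \<Longrightarrow> q a = \<zero>\<^bsub>D0\<^esub> \<longleftrightarrow> a \<in> J"
  using D0Q.coset_zero_iff[of a] by (simp add: a_r_coset_regular zero_D0)

lemma q_add: "\<lbrakk>a \<in> carrier A; b \<in> carrier A\<rbrakk> \<Longrightarrow> q a \<oplus>\<^bsub>D0\<^esub> q b = q (a \<oplus>\<^bsub>A\<^esub> b)"
  using D0Q.add_coset[of a b] by (simp add: a_r_coset_regular degree_zero_module_def)

lemma q_smult: "\<lbrakk>a \<in> carrier A; b \<in> carrier A\<rbrakk> \<Longrightarrow> a \<odot>\<^bsub>D0\<^esub> q b = q (a \<otimes>\<^bsub>A\<^esub> b)"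
  using D0Q.smult_coset[of a b] by (simp add: a_r_coset_regular degree_zero_module_def)

lemma q_hA_0: "a \<in> carrier A \<Longrightarrow> q (hA 0 a) = q a"
  using minus_hA_0_in_J[of a] by (subst eq_commute, subst q_eq_iff) auto

text \<open>\<open>J\<close> meets \<open>\<A> 0\<close> only in zero. Elements of degree 0 are thus
  canonical representatives of the classes in \<open>D0\<close>, which later allows maps out of
  \<open>D0\<close> to be defined by \<open>THE\<close>.\<close>

lemma q_inj: assumes "a \<in> \<A> 0" "b \<in> \<A> 0" "q a = q b" shows "a = b"
proof -
  have "a \<ominus>\<^bsub>A\<^esub> b \<in> J" using q_eq_iff[OF \<A>_carrier \<A>_carrier] assms by blast
  moreover have "a \<ominus>\<^bsub>A\<^esub> b \<in> \<A> 0" using \<A>_add[OF assms(1) \<A>_minus[OF assms(2)]] by (simp add: a_minus_def)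
  ultimately have "a \<ominus>\<^bsub>A\<^esub> b = \<zero>\<^bsub>A\<^esub>" by (rule J_degree_0)
  then show ?thesis using assms(1,2) \<A>_carrier by simp
qed

lemma D0_elt: assumes "x \<in> carrier D0" obtains a where "a \<in> \<A> 0" "x = q a"
proof -
  obtain a where "a \<in> carrier A" "x = q a" using assms by (auto simp: carrier_D0)
  then show ?thesis using that[of "hA 0 a"] hA_degree[of a 0] q_hA_0[of a] by simp
qed

lemma J_smult_D0: assumes "a \<in> J" "x \<in> carrier D0" shows "a \<odot>\<^bsub>D0\<^esub> x = \<zero>\<^bsub>D0\<^esub>"
proof -
  obtain b where "b \<in> carrier A" "x = q b" using assms(2) by (auto simp: carrier_D0)
  then show ?thesis using assms(1) J_carrier J_mult_r[OF assms(1)] by (simp add: q_smult q_zero_iff)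
qed

end

subsection \<open>Graded modules and linear resolutions\<close>

locale graded_mod = graded_fd_algebra K A \<A>
  for K :: "('k, 'z) ring_scheme" and A :: "('k, 'a) module" and \<A> :: "nat \<Rightarrow> 'a set" +
  fixes M :: "('a, 'm) module" and G :: "int \<Rightarrow> 'm set"
  assumes gm: "graded_module K A \<A> M G"
begin

sublocale M: left_module A M using gm by (simp add: graded_module_def)
sublocale GM: graded_group M G
  using gm M.M.abelian_group_axioms by (simp add: graded_module_def graded_group_def graded_group_axioms_def)

lemma G_smult: "\<lbrakk>a \<in> \<A> i; x \<in> G j\<rbrakk> \<Longrightarrow> a \<odot>\<^bsub>M\<^esub> x \<in> G (int i + j)"
  using gm by (simp add: graded_module_def)

lemma G_smult_0: "\<lbrakk>a \<in> \<A> 0; x \<in> G j\<rbrakk> \<Longrightarrow> a \<odot>\<^bsub>M\<^esub> x \<in> G j"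
  using G_smult[of a 0 x j] by simp

lemma left_module_G: "left_module A0 (M\<lparr>carrier := G j\<rparr>)"
  by (rule left_module_A0[OF M.left_module_axioms GM.G.additive_subgroup_axioms G_smult_0])

lemma hc_smult_homogeneous:
  assumes "a \<in> carrier A" "x \<in> G j"
  shows "hc M G (int n + j) (a \<odot>\<^bsub>M\<^esub> x) = hA n a \<odot>\<^bsub>M\<^esub> x" "k < j \<Longrightarrow> hc M G k (a \<odot>\<^bsub>M\<^esub> x) = \<zero>\<^bsub>M\<^esub>"
proof -
  have x: "x \<in> carrier M" by (rule GM.G_carrier[OF assms(2)])
  have inj: "inj (\<lambda>n. int n + j)" by (auto intro: injI)
  note * = hc_map[OF GA.graded_group_axioms GM.graded_group_axioms assms(1), where T = "\<lambda>a. a \<odot>\<^bsub>M\<^esub> x" and \<sigma> = "\<lambda>n. int n + j", OF _ _ _ inj]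
  show "hc M G (int n + j) (a \<odot>\<^bsub>M\<^esub> x) = hA n a \<odot>\<^bsub>M\<^esub> x"
    by (rule *(1)) (use x assms in \<open>auto simp: M.smult_l_distr G_smult\<close>)
  show "hc M G k (a \<odot>\<^bsub>M\<^esub> x) = \<zero>\<^bsub>M\<^esub>" if "k < j"
    by (rule *(2)) (use x assms that in \<open>auto simp: M.smult_l_distr G_smult\<close>)
qed

lemma generated_low:
  assumes gen: "generated_in_degree A M G s" and j: "j < s" and x: "x \<in> G j"
  shows "x = \<zero>\<^bsub>M\<^esub>"
proof -
  let ?S = "{a \<odot>\<^bsub>M\<^esub> x | a x. a \<in> carrier A \<and> x \<in> G s}"
  have S: "?S \<subseteq> carrier M" using GM.G_carrier by auto
  have "x \<in> add_span M ?S" using gen GM.G_carrier[OF x] by (simp add: generated_in_degree_def)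
  then have "hc M G j x \<in> {\<zero>\<^bsub>M\<^esub>}"
    by (rule add_span_image[OF M.M.abelian_group_axioms M.M.abelian_group_axioms S])
      (auto simp: GM.hc_add hc_smult_homogeneous(2)[OF _ _ j] intro!: M.M.additive_subgroupI')
  then show ?thesis using x by (simp add: GM.hc_homogeneous)
qed

text \<open>Taking the component of degree n + s of a generator a x, with x of degree s, replaces a
  by its component of degree n.\<close>

lemma generated_degree:
  assumes gen: "generated_in_degree A M G s" and x: "x \<in> G (int n + s)"
  shows "x \<in> add_span M {a \<odot>\<^bsub>M\<^esub> y | a y. a \<in> \<A> n \<and> y \<in> G s}"
proof -
  let ?S = "{a \<odot>\<^bsub>M\<^esub> x | a x. a \<in> carrier A \<and> x \<in> G s}"
  let ?T = "{a \<odot>\<^bsub>M\<^esub> y | a y. a \<in> \<A> n \<and> y \<in> G s}"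
  have S: "?S \<subseteq> carrier M" using GM.G_carrier by auto
  have T: "?T \<subseteq> carrier M" using GM.G_carrier \<A>_carrier by auto
  have "x \<in> add_span M ?S" using gen GM.G_carrier[OF x] by (simp add: generated_in_degree_def)
  then have "hc M G (int n + s) x \<in> add_span M ?T"
  proof (rule add_span_image[OF M.M.abelian_group_axioms M.M.abelian_group_axioms S])
    fix y assume "y \<in> ?S"
    then obtain a z where "a \<in> carrier A" "z \<in> G s" "y = a \<odot>\<^bsub>M\<^esub> z" by auto
    then show "hc M G (int n + s) y \<in> add_span M ?T"
      using hA_degree by (intro add_span_incl) (auto simp: hc_smult_homogeneous)
  qed (auto simp: GM.hc_add M.M.additive_subgroup_add_span[OF T])
  then show ?thesis using x by (simp add: GM.hc_homogeneous)
qed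

text \<open>Nothing lives below degree s, so the component of degree s of a y only sees the part of
  a in degree 0 and the part of y in degree s. Bottom components are thus linear along the
  projection of A onto A_0.\<close>

lemma hc_bottom:
  assumes gen: "generated_in_degree A M G s" and "a \<in> carrier A" "y \<in> carrier M"
  shows "hc M G s (a \<odot>\<^bsub>M\<^esub> y) = hA 0 a \<odot>\<^bsub>M\<^esub> hc M G s y"
proof -
  let ?F = "insert s {i. hc M G i y \<noteq> \<zero>\<^bsub>M\<^esub>}"
  have F: "finite ?F" using GM.hcs_props(2)[OF assms(3)] by simp
  have "a \<odot>\<^bsub>M\<^esub> y = a \<odot>\<^bsub>M\<^esub> finsum M (hcs M G y) ?F" using GM.sum_hcs[OF assms(3) F subset_insertI] by simp
  also have "\<dots> = finsum M (\<lambda>i. a \<odot>\<^bsub>M\<^esub> hc M G i y) ?F" using assms by (intro M.finsum_smult_ldistr[OF F]) auto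
  finally have "hc M G s (a \<odot>\<^bsub>M\<^esub> y) = finsum M (\<lambda>i. hc M G s (a \<odot>\<^bsub>M\<^esub> hc M G i y)) ?F"
    using assms by (simp only:) (rule GM.hc_finsum, auto)
  also have "\<dots> = finsum M (\<lambda>i. if s = i then hA 0 a \<odot>\<^bsub>M\<^esub> hc M G i y else \<zero>\<^bsub>M\<^esub>) ?F"
  proof (rule M.M.finsum_cong'[OF refl])
    fix i
    have yi: "hc M G i y \<in> G i" by (rule GM.hcs_props[OF assms(3)])
    consider "i < s" | "i = s" | "s < i" by linarith
    then show "hc M G s (a \<odot>\<^bsub>M\<^esub> hc M G i y) = (if s = i then hA 0 a \<odot>\<^bsub>M\<^esub> hc M G i y else \<zero>\<^bsub>M\<^esub>)"
    proof cases
      case 1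
      then have "hc M G i y = \<zero>\<^bsub>M\<^esub>" using generated_low[OF gen _ yi] by simp
      then show ?thesis using 1 assms(2) by simp
    next
      case 2
      then show ?thesis using hc_smult_homogeneous(1)[OF assms(2) yi, of 0] by simp
    next
      case 3
      then show ?thesis using hc_smult_homogeneous(2)[OF assms(2) yi] by simp
    qed
  qed (use assms in auto)
  also have "\<dots> = hA 0 a \<odot>\<^bsub>M\<^esub> hc M G s y" using F assms by (intro M.M.add.finprod_singleton) auto
  finally show ?thesis .
qed

text \<open>The bottom component of the identity x = sum of \<phi>_y(x) y is, by
  \<open>hc_bottom\<close>, the same identity with the coordinates projected to A_0 and the elements
  y projected to G s. A dual basis over A thus descends to one over A_0.\<close>

lemma bottom_projective:
  assumes gen: "generated_in_degree A M G s" and proj: "projective_module A M"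
  shows "projective_module A0 (M\<lparr>carrier := G s\<rparr>)"
proof -
  obtain \<phi> where \<phi>: "dual_basis A M (carrier M) (\<lambda>x. x) \<phi>" using projective_module_dual_basis[OF proj] by blast
  note D = \<phi>[unfolded dual_basis_def]
  let ?N = "M\<lparr>carrier := G s\<rparr>"
  have "dual_basis A0 ?N (carrier M) (hc M G s) (\<lambda>y x. hA 0 (\<phi> y x))"
    unfolding dual_basis_def
  proof (intro conjI ballI)
    show "hc M G s \<in> carrier M \<rightarrow> carrier ?N" using GM.hcs_props(1) by auto
    fix x assume "x \<in> carrier ?N"
    then have x: "x \<in> G s" "x \<in> carrier M" using GM.G_carrier by auto
    let ?S = "{y\<in>carrier M. \<phi> y x \<noteq> \<zero>\<^bsub>A\<^esub>}" and ?T = "{y\<in>carrier M. hA 0 (\<phi> y x) \<noteq> \<zero>\<^bsub>A0\<^esub>}"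
    have S: "finite ?S" using D x by blast
    have sub: "?T \<subseteq> ?S" by auto
    then show "finite ?T" using S by (rule finite_subset)
    have \<phi>x: "\<phi> y x \<in> carrier A" if "y \<in> carrier M" for y using D x that by blast
    have fc: "(\<lambda>y. hA 0 (\<phi> y x) \<odot>\<^bsub>M\<^esub> hc M G s y) \<in> carrier M \<rightarrow> G s"
      using \<phi>x hA_degree GM.hcs_props(1) G_smult_0 by auto
    then have fc': "hA 0 (\<phi> y x) \<odot>\<^bsub>M\<^esub> hc M G s y \<in> G s" if "y \<in> carrier M" for y using that by blast
    have "lin_comb A0 ?N (carrier M) (hc M G s) (\<lambda>y. hA 0 (\<phi> y x))
        = finsum ?N (\<lambda>y. hA 0 (\<phi> y x) \<odot>\<^bsub>M\<^esub> hc M G s y) ?T"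
      by (simp add: lin_comb_def)
    also have "\<dots> = finsum M (\<lambda>y. hA 0 (\<phi> y x) \<odot>\<^bsub>M\<^esub> hc M G s y) ?T"
      using fc' left_module_G[of s] GM.G_carrier
      by (intro finsum_carrier_update M.M.abelian_group_axioms) (auto simp: left_module_def)
    also have "\<dots> = finsum M (\<lambda>y. hA 0 (\<phi> y x) \<odot>\<^bsub>M\<^esub> hc M G s y) ?S"
    proof (rule M.M.add.finprod_mono_neutral_cong_left[OF S sub])
      show "hA 0 (\<phi> y x) \<odot>\<^bsub>M\<^esub> hc M G s y = \<zero>\<^bsub>M\<^esub>" if "y \<in> ?S - ?T" for y using that by auto
      show "(\<lambda>y. hA 0 (\<phi> y x) \<odot>\<^bsub>M\<^esub> hc M G s y) \<in> ?S \<rightarrow> carrier M" using fc' GM.G_carrier by blast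
    qed simp
    also have "\<dots> = finsum M (\<lambda>y. hc M G s (\<phi> y x \<odot>\<^bsub>M\<^esub> y)) ?S"
      using \<phi>x by (intro M.M.finsum_cong') (auto simp: hc_bottom[OF gen])
    also have "\<dots> = hc M G s (lin_comb A M (carrier M) (\<lambda>x. x) (\<lambda>y. \<phi> y x))"
      unfolding lin_comb_def using \<phi>x by (intro GM.hc_finsum[symmetric]) auto
    also have "\<dots> = x" using D x by (simp add: GM.hc_homogeneous)
    finally show "lin_comb A0 ?N (carrier M) (hc M G s) (\<lambda>y. hA 0 (\<phi> y x)) = x" .
  next
    fix y x assume y: "y \<in> carrier M" and x: "x \<in> carrier ?N"
    then have x': "x \<in> carrier M" using GM.G_carrier by auto
    show "hA 0 (\<phi> y x) \<in> carrier A0" using D x' y hA_degree by simp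
    show "hA 0 (\<phi> y (x \<oplus>\<^bsub>?N\<^esub> z)) = hA 0 (\<phi> y x) \<oplus>\<^bsub>A0\<^esub> hA 0 (\<phi> y z)" if "z \<in> carrier ?N" for z
      using that D x' y GM.G_carrier[of z s] by (simp add: GA.hc_add)
  next
    fix y a x assume y: "y \<in> carrier M" and a: "a \<in> carrier A0" and x: "x \<in> carrier ?N"
    then have x': "x \<in> carrier M" "a \<in> carrier A" using GM.G_carrier \<A>_carrier by auto
    then have "\<phi> y (a \<odot>\<^bsub>M\<^esub> x) = a \<otimes>\<^bsub>A\<^esub> \<phi> y x" "\<phi> y x \<in> carrier A" using D y by auto
    then show "hA 0 (\<phi> y (a \<odot>\<^bsub>?N\<^esub> x)) = a \<otimes>\<^bsub>A0\<^esub> hA 0 (\<phi> y x)"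
      using a x' by (simp add: hA_0_mult hA_0_homogeneous)
  qed
  then show ?thesis by (rule dual_basis_projective[OF _ left_module_G])
qed

end

lemma hc_hom:
  assumes "graded_mod K A \<A> M G" "graded_mod K A \<A> N G'" "f \<in> mod_hom A M N" "\<And>j. f ` G j \<subseteq> G' j" "x \<in> carrier M"
  shows "hc N G' j (f x) = f (hc M G j x)"
proof -
  interpret M: graded_mod K A \<A> M G by fact
  interpret N: graded_mod K A \<A> N G' by fact
  show ?thesis
    using hc_map(1)[OF M.GM.graded_group_axioms N.GM.graded_group_axioms assms(5), of f "\<lambda>i. i" j]
      mod_homD[OF assms(3)] image_subset_iff[THEN iffD1, OF assms(4)] by auto
qed

text \<open>Names the resolution whose existence \<open>koszul_module\<close> asserts, so that its
  generators in degree i can be studied.\<close>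

locale linear_resolution = graded_mod K A \<A> M G
  for K :: "('k, 'z) ring_scheme" and A :: "('k, 'a) module" and \<A> :: "nat \<Rightarrow> 'a set"
    and M :: "('a, 'm) module" and G :: "int \<Rightarrow> 'm set" +
  fixes R :: "nat \<Rightarrow> ('a, nat \<Rightarrow> 'a) module" and Q :: "nat \<Rightarrow> int \<Rightarrow> (nat \<Rightarrow> 'a) set"
    and \<delta> :: "nat \<Rightarrow> (nat \<Rightarrow> 'a) \<Rightarrow> nat \<Rightarrow> 'a" and \<eta> :: "(nat \<Rightarrow> 'a) \<Rightarrow> 'm"
  assumes lres: "projective_resolution A M R \<delta> \<eta>"
    and R_graded: "\<And>i. graded_module K A \<A> (R i) (Q i)"
    and R_generated: "\<And>i. generated_in_degree A (R i) (Q i) (int i)"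
    and \<eta>_degree: "\<And>j. \<eta> ` Q 0 j \<subseteq> G j"
    and \<delta>_degree: "\<And>i j. \<delta> i ` Q (Suc i) j \<subseteq> Q i j"
begin

lemmas lr = projective_resolutionD[OF lres]

sublocale R: graded_mod K A \<A> "R deg" "Q deg" for deg
  by unfold_locales (rule R_graded)

text \<open>The kernel of \<delta>_i is the image of a module generated in degree i + 2, which has
  no component in degree i + 1. By exactness \<delta>_i is injective on the generators of
  R_(i+1).\<close>

lemma \<delta>_inj:
  assumes x: "x \<in> Q (Suc i) (int (Suc i))" and 0: "\<delta> i x = \<zero>\<^bsub>R i\<^esub>"
  shows "x = \<zero>\<^bsub>R (Suc i)\<^esub>"
proof -
  obtain y where y: "y \<in> carrier (R (Suc (Suc i)))" "x = \<delta> (Suc i) y"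
    using lr(8)[of x i] R.GM.G_carrier[OF x] 0 by blast
  let ?y = "hc (R (Suc (Suc i))) (Q (Suc (Suc i))) (int (Suc i)) y"
  have "?y = \<zero>\<^bsub>R (Suc (Suc i))\<^esub>"
    by (rule R.generated_low[OF R_generated _ R.GM.hcs_props(1)[OF y(1)]]) simp
  then have "hc (R (Suc i)) (Q (Suc i)) (int (Suc i)) x = \<delta> (Suc i) \<zero>\<^bsub>R (Suc (Suc i))\<^esub>"
    using hc_hom[OF R.graded_mod_axioms R.graded_mod_axioms lr(4) \<delta>_degree y(1)] y(2) by simp
  then show ?thesis using x by (simp add: R.GM.hc_homogeneous mod_hom_zero[OF lr(4) lr(3) lr(3)])
qed

text \<open>The kernel of \<eta> is the image of R_1, which starts in degree 1 and so has no
  component in degree 0.\<close>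

lemma \<eta>_inj:
  assumes x: "x \<in> Q 0 0" and 0: "\<eta> x = \<zero>\<^bsub>M\<^esub>"
  shows "x = \<zero>\<^bsub>R 0\<^esub>"
proof -
  obtain y where y: "y \<in> carrier (R (Suc 0))" "x = \<delta> 0 y"
    using lr(7)[of x] R.GM.G_carrier[OF x] 0 by blast
  have "hc (R (Suc 0)) (Q (Suc 0)) 0 y = \<zero>\<^bsub>R (Suc 0)\<^esub>"
    by (rule R.generated_low[OF R_generated _ R.GM.hcs_props(1)[OF y(1)]]) simp
  then have "hc (R 0) (Q 0) 0 x = \<delta> 0 \<zero>\<^bsub>R (Suc 0)\<^esub>"
    using hc_hom[OF R.graded_mod_axioms R.graded_mod_axioms lr(4) \<delta>_degree y(1)] y(2) by simp
  then show ?thesis using x by (simp add: R.GM.hc_homogeneous mod_hom_zero[OF lr(4) lr(3) lr(3)])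
qed

lemma \<eta>_surj:
  assumes "x \<in> G 0" shows "\<exists>y\<in>Q 0 0. \<eta> y = x"
proof -
  obtain y where y: "y \<in> carrier (R 0)" "x = \<eta> y" using lr(6) GM.G_carrier[OF assms] by blast
  then have "\<eta> (hc (R 0) (Q 0) 0 y) = x"
    using hc_hom[OF R.graded_mod_axioms graded_mod_axioms lr(5) \<eta>_degree y(1), of 0] assms
    by (simp add: GM.hc_homogeneous)
  then show ?thesis using R.GM.hcs_props(1)[OF y(1)] by blast
qed

text \<open>
  This is where self-injectivity enters: the bottom degree of each term is projective over the
  degree-zero ring, hence injective, so the embedding into the previous term splits.
\<close>

lemma \<delta>_split:
  assumes self: "self_injective A0"
  shows "\<exists>g\<in>mod_hom A0 ((R i)\<lparr>carrier := Q i (int (Suc i))\<rparr>) ((R (Suc i))\<lparr>carrier := Q (Suc i) (int (Suc i))\<rparr>).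
    \<forall>x\<in>Q (Suc i) (int (Suc i)). g (\<delta> i x) = x"
proof -
  let ?U = "(R (Suc i))\<lparr>carrier := Q (Suc i) (int (Suc i))\<rparr>" and ?V = "(R i)\<lparr>carrier := Q i (int (Suc i))\<rparr>"
  let ?\<delta> = "restrict (\<delta> i) (carrier ?U)"
  have U: "left_module A0 ?U" and V: "left_module A0 ?V" by (rule R.left_module_G)+
  have inj: "injective_module A0 ?U"
    using self R.bottom_projective[OF R_generated lr(2), of "Suc i"] unfolding self_injective_def by blast
  note D = mod_homD[OF lr(4)[of i]]
  have \<delta>: "?\<delta> \<in> mod_hom A0 ?U ?V"
    by (rule mod_hom_restrictI[OF U]) (use D image_subset_iff[THEN iffD1, OF \<delta>_degree] R.GM.G_carrier \<A>_carrier in auto)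
  have "inj_on ?\<delta> (carrier ?U)"
  proof (rule inj_onI)
    fix x y assume xy: "x \<in> carrier ?U" "y \<in> carrier ?U" "?\<delta> x = ?\<delta> y"
    then have x: "x \<in> Q (Suc i) (int (Suc i))" "x \<in> carrier (R (Suc i))"
      and y: "y \<in> Q (Suc i) (int (Suc i))" "y \<in> carrier (R (Suc i))" using R.GM.G_carrier by auto
    have "x \<ominus>\<^bsub>R (Suc i)\<^esub> y \<in> Q (Suc i) (int (Suc i))" using x(1) y(1) by (simp add: a_minus_def)
    moreover have "\<delta> i (x \<ominus>\<^bsub>R (Suc i)\<^esub> y) = \<zero>\<^bsub>R i\<^esub>"
      using xy x y D by (simp add: a_minus_def mod_hom_minus[OF lr(4) lr(3) lr(3)] R.M.M.r_neg)
    ultimately have "x \<ominus>\<^bsub>R (Suc i)\<^esub> y = \<zero>\<^bsub>R (Suc i)\<^esub>" by (rule \<delta>_inj)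
    then show "x = y" by (metis R.M.M.add.inv_solve_right' R.M.M.l_zero a_minus_def x(2) y(2) R.M.M.zero_closed)
  qed
  then have "\<exists>g\<in>mod_hom A0 ?V ?U. \<forall>x\<in>carrier ?U. g (?\<delta> x) = (\<lambda>x\<in>carrier ?U. x) x"
    using inj U V \<delta> mod_hom_id[OF U] unfolding injective_module_def by blast
  then show ?thesis by auto
qed

end

subsection \<open>Left ideals and standard modules\<close>

text \<open>A form without subtraction: \<open>\<ominus>\<close> is defined relative to the carrier,
  so after a change of carrier it is not literally the operation of the ambient module, whereas
  addition is.\<close>

lemma (in module_quotient) coset_eq_iff':
  assumes "x \<in> carrier M" "y \<in> carrier M"
  shows "N +>\<^bsub>M\<^esub> x = N +>\<^bsub>M\<^esub> y \<longleftrightarrow> (\<exists>n\<in>N. x = n \<oplus>\<^bsub>M\<^esub> y)"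
proof
  assume "N +>\<^bsub>M\<^esub> x = N +>\<^bsub>M\<^esub> y"
  then have "x \<in> N +>\<^bsub>M\<^esub> y" using coset_self[OF assms(1)] by simp
  then show "\<exists>n\<in>N. x = n \<oplus>\<^bsub>M\<^esub> y" by (auto simp: a_r_coset_def')
next
  assume "\<exists>n\<in>N. x = n \<oplus>\<^bsub>M\<^esub> y"
  then have "x \<in> N +>\<^bsub>M\<^esub> y" by (auto simp: a_r_coset_def')
  then show "N +>\<^bsub>M\<^esub> x = N +>\<^bsub>M\<^esub> y" by (rule coset_memD(2)[OF assms(2)])
qed

context graded_fd_algebra
begin

abbreviation lideal :: "'a set \<Rightarrow> bool" where "lideal S \<equiv> submodule S A (regular_module A)"
abbreviation L :: "'a set \<Rightarrow> ('a, 'a) module" where "L S \<equiv> (regular_module A)\<lparr>carrier := S\<rparr>"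

interpretation reg: left_module A "regular_module A" by (rule left_module_regular)

lemma uminus_regular: "\<ominus>\<^bsub>regular_module A\<^esub> x = \<ominus>\<^bsub>A\<^esub> x"
  by (simp add: a_inv_def m_inv_def)

lemma lidealD:
  assumes "lideal S"
  shows "x \<in> S \<Longrightarrow> x \<in> carrier A" "\<zero>\<^bsub>A\<^esub> \<in> S" "\<lbrakk>x \<in> S; y \<in> S\<rbrakk> \<Longrightarrow> x \<oplus>\<^bsub>A\<^esub> y \<in> S"
    "\<lbrakk>a \<in> carrier A; x \<in> S\<rbrakk> \<Longrightarrow> a \<otimes>\<^bsub>A\<^esub> x \<in> S"
  using reg.submoduleD[OF assms] by auto

lemma lideal_minus: "\<lbrakk>lideal S; x \<in> S\<rbrakk> \<Longrightarrow> \<ominus>\<^bsub>A\<^esub> x \<in> S"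
  using lidealD(4)[of S "\<ominus>\<^bsub>A\<^esub> \<one>\<^bsub>A\<^esub>" x] lidealD(1)[of S x] by (simp add: A.l_minus)

lemma lidealI:
  assumes "\<And>x. x \<in> S \<Longrightarrow> x \<in> carrier A" "\<zero>\<^bsub>A\<^esub> \<in> S" "\<And>x y. \<lbrakk>x \<in> S; y \<in> S\<rbrakk> \<Longrightarrow> x \<oplus>\<^bsub>A\<^esub> y \<in> S"
    "\<And>a x. \<lbrakk>a \<in> carrier A; x \<in> S\<rbrakk> \<Longrightarrow> a \<otimes>\<^bsub>A\<^esub> x \<in> S"
  shows "lideal S"
  by (rule reg.submoduleI) (use assms in auto)

lemma left_module_L: "lideal S \<Longrightarrow> left_module A (L S)"
  by (rule submodule_left_module[OF left_module_regular])

lemma submodule_L: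
  assumes "lideal S" "submodule T A (L S)"
  shows "lideal T" "T \<subseteq> S"
proof -
  interpret S: left_module A "L S" by (rule left_module_L) fact
  note T = S.submoduleD[OF assms(2)]
  show "T \<subseteq> S" using T(1) by simp
  then show "lideal T" by (intro lidealI) (use T lidealD[OF assms(1)] in auto)
qed

lemma quotient_L:
  assumes "lideal S" "lideal T" "T \<subseteq> S"
  shows "module_quotient A (L S) T"
proof (rule module_quotientI[OF left_module_L[OF assms(1)]])
  interpret S: left_module A "L S" by (rule left_module_L) fact
  show "submodule T A (L S)"
    by (rule S.submoduleI) (use assms lidealD[OF assms(2)] in auto)
qed

end

section \<open>Stratified graded algebras whose standard modules are Koszul and concentrated in
  degree 0\<close>

locale stratified_algebra = graded_fd_algebra K A \<A>
  for K :: "('k, 'z) ring_scheme" and A :: "('k, 'a) module" and \<A> :: "nat \<Rightarrow> 'a set" +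
  fixes \<Lambda> :: "'l set" and e :: "'l \<Rightarrow> 'a" and r :: "'l rel"
  assumes cpi: "complete_primitive_idempotents A \<Lambda> e"
    and e_degree: "\<And>l. l \<in> \<Lambda> \<Longrightarrow> e l \<in> \<A> 0"
    and basic: "basic_algebra A \<Lambda> e"
    and po: "partial_order_on \<Lambda> r"
    and strat: "standardly_stratified K A \<Lambda> e r"
    and conc: "\<And>l. l \<in> \<Lambda> \<Longrightarrow> concentrated_in_degree_zero (std_module A \<Lambda> e r l) (std_grading A \<A> \<Lambda> e r l)"
    and koszul: "\<And>l. l \<in> \<Lambda> \<Longrightarrow> koszul_module K A \<A> (std_module A \<Lambda> e r l) (std_grading A \<A> \<Lambda> e r l)"
    and self: "self_injective (degree_zero_ring A \<A>)"
begin

lemma e_closed [simp]: "l \<in> \<Lambda> \<Longrightarrow> e l \<in> carrier A"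
  using e_degree \<A>_carrier by blast

lemma e_idem [simp]: "l \<in> \<Lambda> \<Longrightarrow> e l \<otimes>\<^bsub>A\<^esub> e l = e l"
  and e_nonzero: "l \<in> \<Lambda> \<Longrightarrow> e l \<noteq> \<zero>\<^bsub>A\<^esub>"
  and e_orth: "\<lbrakk>l \<in> \<Lambda>; m \<in> \<Lambda>; l \<noteq> m\<rbrakk> \<Longrightarrow> e l \<otimes>\<^bsub>A\<^esub> e m = \<zero>\<^bsub>A\<^esub>"
  and e_sum: "finsum A e \<Lambda> = \<one>\<^bsub>A\<^esub>"
  and \<Lambda>_finite: "finite \<Lambda>"
  using cpi by (auto simp: complete_primitive_idempotents_def primitive_idempotent_def idempotent_elt_def)

text \<open>An idempotent u of e_l A e_l is orthogonal to the idempotent e_l - u, and the two sum to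
  e_l.\<close>

lemma e_primitive:
  assumes l: "l \<in> \<Lambda>" and u: "u \<in> carrier A" "u \<otimes>\<^bsub>A\<^esub> u = u" "e l \<otimes>\<^bsub>A\<^esub> u = u" "u \<otimes>\<^bsub>A\<^esub> e l = u"
  shows "u = \<zero>\<^bsub>A\<^esub> \<or> u = e l"
proof -
  let ?g = "e l \<ominus>\<^bsub>A\<^esub> u"
  have g: "?g \<in> carrier A" using l u by simp
  have "u \<oplus>\<^bsub>A\<^esub> (e l \<oplus>\<^bsub>A\<^esub> \<ominus>\<^bsub>A\<^esub> u) = e l \<oplus>\<^bsub>A\<^esub> (u \<oplus>\<^bsub>A\<^esub> \<ominus>\<^bsub>A\<^esub> u)"
    using l u by (intro A.a_lcomm) auto
  then have "e l = u \<oplus>\<^bsub>A\<^esub> ?g" using l u by (simp add: a_minus_def A.r_neg)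
  moreover have "?g \<otimes>\<^bsub>A\<^esub> ?g = ?g" "u \<otimes>\<^bsub>A\<^esub> ?g = \<zero>\<^bsub>A\<^esub>" "?g \<otimes>\<^bsub>A\<^esub> u = \<zero>\<^bsub>A\<^esub>"
    using l u by (simp_all add: a_minus_def A.l_distr A.r_distr A.l_minus A.r_minus A.r_neg A.l_neg)
  moreover have "primitive_idempotent A (e l)" using cpi l by (simp add: complete_primitive_idempotents_def)
  ultimately have "u = \<zero>\<^bsub>A\<^esub> \<or> ?g = \<zero>\<^bsub>A\<^esub>"
    using u g unfolding primitive_idempotent_def idempotent_elt_def by blast
  then show ?thesis using l u by auto
qed

abbreviation Ae :: "'l \<Rightarrow> 'a set" where "Ae l \<equiv> (\<lambda>b. b \<otimes>\<^bsub>A\<^esub> e l) ` carrier A"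
abbreviation N :: "'l \<Rightarrow> 'a set" where "N l \<equiv> std_kernel A \<Lambda> e r l"
abbreviation \<Delta> :: "'l \<Rightarrow> ('a, 'a set) module" where "\<Delta> l \<equiv> std_module A \<Lambda> e r l"
abbreviation \<pi> :: "'l \<Rightarrow> 'a \<Rightarrow> 'a set" where "\<pi> l a \<equiv> N l +>\<^bsub>A\<^esub> a"

lemma proj_mod_eq: "proj_mod A e l = L (Ae l)" by (simp add: proj_mod_def)

lemma Ae_iff: "l \<in> \<Lambda> \<Longrightarrow> x \<in> Ae l \<longleftrightarrow> x \<in> carrier A \<and> x \<otimes>\<^bsub>A\<^esub> e l = x"
  by (auto simp: A.m_assoc) (metis image_eqI)

lemma Ae_mult: "\<lbrakk>l \<in> \<Lambda>; a \<in> carrier A\<rbrakk> \<Longrightarrow> a \<otimes>\<^bsub>A\<^esub> e l \<in> Ae l"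
  by blast

lemma lideal_Ae: "l \<in> \<Lambda> \<Longrightarrow> lideal (Ae l)"
  by (rule lidealI) (auto simp: Ae_iff A.l_distr A.m_assoc simp del: image_iff)

lemma right_mult_hom:
  assumes "l \<in> \<Lambda>" "m \<in> \<Lambda>" "b \<in> Ae m"
  shows "(\<lambda>x\<in>Ae l. x \<otimes>\<^bsub>A\<^esub> b) \<in> mod_hom A (L (Ae l)) (L (Ae m))"
proof -
  have b: "b \<in> carrier A" "b \<otimes>\<^bsub>A\<^esub> e m = b" using assms(2,3) Ae_iff by auto
  have "restrict (\<lambda>x. x \<otimes>\<^bsub>A\<^esub> b) (carrier (L (Ae l))) \<in> mod_hom A (L (Ae l)) (L (Ae m))"
    by (rule mod_hom_restrictI[OF left_module_L[OF lideal_Ae[OF assms(1)]]])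
      (use assms(1,2) b in \<open>auto simp: Ae_iff A.l_distr A.m_assoc simp del: image_iff\<close>)
  then show ?thesis by simp
qed

lemma trace_smult:
  assumes "l \<in> \<Lambda>" "m \<in> \<Lambda>"
  shows "submodule (trace_module A (L (Ae m)) (L (Ae l))) A (L (Ae l))"
proof -
  interpret left_module A "L (Ae l)" by (rule left_module_L[OF lideal_Ae[OF assms(1)]])
  show ?thesis
    unfolding trace_module_def
  proof (rule submodule_add_span)
    show "(\<Union>f\<in>mod_hom A (L (Ae m)) (L (Ae l)). f ` carrier (L (Ae m))) \<subseteq> carrier (L (Ae l))"
      using mod_homD(1) by fast
    fix a x assume a: "a \<in> carrier A" and "x \<in> (\<Union>f\<in>mod_hom A (L (Ae m)) (L (Ae l)). f ` carrier (L (Ae m)))"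
    then obtain f y where f: "f \<in> mod_hom A (L (Ae m)) (L (Ae l))" "y \<in> Ae m" "x = f y" by auto
    then have "a \<otimes>\<^bsub>A\<^esub> y \<in> Ae m" using lidealD(4)[OF lideal_Ae[OF assms(2)] a] by simp
    moreover have "f (a \<otimes>\<^bsub>A\<^esub> y) = a \<odot>\<^bsub>L (Ae l)\<^esub> x" using mod_homD(4)[OF f(1) a, of y] f by simp
    ultimately show "a \<odot>\<^bsub>L (Ae l)\<^esub> x \<in> (\<Union>f\<in>mod_hom A (L (Ae m)) (L (Ae l)). f ` carrier (L (Ae m)))"
      using f(1) by (intro UN_I[of f]) (auto intro!: image_eqI[of _ f "a \<otimes>\<^bsub>A\<^esub> y"])
  qed
qed

lemma N_submodule:
  assumes "l \<in> \<Lambda>" shows "submodule (N l) A (L (Ae l))"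
proof -
  interpret left_module A "L (Ae l)" by (rule left_module_L[OF lideal_Ae[OF assms(1)]])
  have t: "submodule (trace_module A (L (Ae m)) (L (Ae l))) A (L (Ae l))" if "m \<in> \<Lambda>" for m
    by (rule trace_smult[OF assms that])
  show ?thesis
    unfolding std_kernel_def proj_mod_eq
  proof (rule submodule_add_span)
    show "(\<Union>m\<in>{m\<in>\<Lambda>. (m, l) \<notin> r}. trace_module A (L (Ae m)) (L (Ae l))) \<subseteq> carrier (L (Ae l))"
      by (rule UN_least) (rule submoduleD(1)[OF t], simp)
    fix a x assume a: "a \<in> carrier A" and x: "x \<in> (\<Union>m\<in>{m\<in>\<Lambda>. (m, l) \<notin> r}. trace_module A (L (Ae m)) (L (Ae l)))"
    from x obtain m where "m \<in> {m\<in>\<Lambda>. (m, l) \<notin> r}" "x \<in> trace_module A (L (Ae m)) (L (Ae l))" by (rule UN_E)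
    then show "a \<odot>\<^bsub>L (Ae l)\<^esub> x \<in> (\<Union>m\<in>{m\<in>\<Lambda>. (m, l) \<notin> r}. trace_module A (L (Ae m)) (L (Ae l)))"
      by (intro UN_I[of m] submoduleD(5)[OF t a]) simp_all
  qed
qed

lemma lideal_N: "l \<in> \<Lambda> \<Longrightarrow> lideal (N l)"
  and N_subset: "l \<in> \<Lambda> \<Longrightarrow> N l \<subseteq> Ae l"
  using submodule_L[OF lideal_Ae N_submodule] by auto

text \<open>Right multiplication by b e_l is a homomorphism A e_m -> A e_l that sends e_m to the
  element in question.\<close>

lemma trace_in_N:
  assumes "l \<in> \<Lambda>" "m \<in> \<Lambda>" "(m, l) \<notin> r" "b \<in> carrier A"
  shows "e m \<otimes>\<^bsub>A\<^esub> b \<otimes>\<^bsub>A\<^esub> e l \<in> N l"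
proof -
  let ?f = "\<lambda>x\<in>Ae m. x \<otimes>\<^bsub>A\<^esub> (b \<otimes>\<^bsub>A\<^esub> e l)"
  have f: "?f \<in> mod_hom A (L (Ae m)) (L (Ae l))" using assms by (intro right_mult_hom) auto
  have em: "e m \<in> Ae m" using assms by (simp add: Ae_iff del: image_iff)
  have "?f (e m) = e m \<otimes>\<^bsub>A\<^esub> b \<otimes>\<^bsub>A\<^esub> e l" using em assms by (simp add: A.m_assoc del: image_iff)
  then have "e m \<otimes>\<^bsub>A\<^esub> b \<otimes>\<^bsub>A\<^esub> e l \<in> ?f ` carrier (L (Ae m))"
    using em by (intro image_eqI[of _ ?f "e m"]) simp_all
  then have "e m \<otimes>\<^bsub>A\<^esub> b \<otimes>\<^bsub>A\<^esub> e l \<in> trace_module A (L (Ae m)) (L (Ae l))"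
    unfolding trace_module_def by (rule add_span_incl[OF UN_I[OF f]])
  then show ?thesis
    unfolding std_kernel_def proj_mod_eq using assms(2,3) by (intro add_span_incl UN_I[of m]) simp_all
qed

lemma \<Delta>_eq: "\<Delta> l = quot_module (L (Ae l)) (N l)"
  by (simp add: std_module_def proj_mod_eq)

lemmas coset_L = a_r_coset_regular

lemma \<Delta>_quotient: "l \<in> \<Lambda> \<Longrightarrow> module_quotient A (L (Ae l)) (N l)"
  by (rule quotient_L[OF lideal_Ae lideal_N N_subset])

lemma left_module_\<Delta>: "l \<in> \<Lambda> \<Longrightarrow> left_module A (\<Delta> l)"
  unfolding \<Delta>_eq by (rule module_quotient.left_module_quot[OF \<Delta>_quotient])

lemma carrier_\<Delta>: "carrier (\<Delta> l) = \<pi> l ` Ae l"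
  by (simp add: \<Delta>_eq carrier_quot_module coset_L)

lemma \<pi>_add: "\<lbrakk>l \<in> \<Lambda>; a \<in> Ae l; b \<in> Ae l\<rbrakk> \<Longrightarrow> \<pi> l a \<oplus>\<^bsub>\<Delta> l\<^esub> \<pi> l b = \<pi> l (a \<oplus>\<^bsub>A\<^esub> b)"
  using module_quotient.add_coset[OF \<Delta>_quotient, of l a b] by (simp add: \<Delta>_eq coset_L del: image_iff)

lemma \<pi>_smult: "\<lbrakk>l \<in> \<Lambda>; a \<in> carrier A; b \<in> Ae l\<rbrakk> \<Longrightarrow> a \<odot>\<^bsub>\<Delta> l\<^esub> \<pi> l b = \<pi> l (a \<otimes>\<^bsub>A\<^esub> b)"
  using module_quotient.smult_coset[OF \<Delta>_quotient, of l a b] by (simp add: \<Delta>_eq coset_L del: image_iff)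

lemma zero_\<Delta>: "\<zero>\<^bsub>\<Delta> l\<^esub> = N l" by (simp add: \<Delta>_eq)

lemma \<pi>_zero_iff: "\<lbrakk>l \<in> \<Lambda>; a \<in> Ae l\<rbrakk> \<Longrightarrow> \<pi> l a = \<zero>\<^bsub>\<Delta> l\<^esub> \<longleftrightarrow> a \<in> N l"
  using module_quotient.coset_zero_iff[OF \<Delta>_quotient, of l a] by (simp add: zero_\<Delta> coset_L del: image_iff)

lemma \<pi>_eq_iff:
  assumes "l \<in> \<Lambda>" "a \<in> Ae l" "b \<in> Ae l"
  shows "\<pi> l a = \<pi> l b \<longleftrightarrow> (\<exists>n\<in>N l. a = n \<oplus>\<^bsub>A\<^esub> b)"
proof -
  have "a \<in> carrier (L (Ae l))" "b \<in> carrier (L (Ae l))" using assms by simp_all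
  from module_quotient.coset_eq_iff'[OF \<Delta>_quotient[OF assms(1)] this]
  show ?thesis by (simp add: coset_L del: image_iff)
qed

lemma \<pi>_eqD:
  assumes "l \<in> \<Lambda>" "a \<in> Ae l" "b \<in> Ae l" "\<pi> l a = \<pi> l b" shows "a \<ominus>\<^bsub>A\<^esub> b \<in> N l"
proof -
  have c: "a \<in> carrier A" "b \<in> carrier A" using assms Ae_iff by auto
  obtain n where n: "n \<in> N l" "a = n \<oplus>\<^bsub>A\<^esub> b" using \<pi>_eq_iff assms by blast
  then have "n \<in> carrier A" using lidealD(1)[OF lideal_N[OF assms(1)]] by blast
  then have "a \<ominus>\<^bsub>A\<^esub> b = n" using n c by (simp add: a_minus_def A.a_assoc A.r_neg)
  then show ?thesis using n by simp
qed

lemma std_grading_0: "std_grading A \<A> \<Lambda> e r l 0 = (\<lambda>a. \<pi> l (a \<otimes>\<^bsub>A\<^esub> e l)) ` \<A> 0"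
  by (simp add: std_grading_def proj_mod_eq coset_L)

text \<open>Concentration in degree 0 says that the classes of A_i e_l vanish in
  \<open>\<Delta> l\<close> for i >= 1, which means that these spaces lie in the kernel.\<close>

lemma J_in_N:
  assumes l: "l \<in> \<Lambda>" and x: "x \<in> J" shows "x \<otimes>\<^bsub>A\<^esub> e l \<in> N l"
proof -
  have sub: "(\<Union>i\<in>{1..}. \<A> i) \<subseteq> carrier A" using \<A>_carrier by blast
  have H: "additive_subgroup (N l) A"
    by (rule A.additive_subgroupI') (use lidealD[OF lideal_N[OF l]] lideal_minus[OF lideal_N[OF l]] in auto)
  show ?thesis
  proof (rule add_span_image[OF A.abelian_group_axioms A.abelian_group_axioms sub x[unfolded positive_part_def] _ _ _ H])
    fix y assume "y \<in> (\<Union>i\<in>{1..}. \<A> i)"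
    then obtain i where i: "1 \<le> i" "y \<in> \<A> i" by auto
    have "std_grading A \<A> \<Lambda> e r l (int i) = {\<zero>\<^bsub>\<Delta> l\<^esub>}"
      using conc[OF l] i by (simp add: concentrated_in_degree_zero_def)
    then have "\<pi> l (y \<otimes>\<^bsub>A\<^esub> e l) = \<zero>\<^bsub>\<Delta> l\<^esub>"
      using i by (simp add: std_grading_def proj_mod_eq coset_L) blast
    then show "y \<otimes>\<^bsub>A\<^esub> e l \<in> N l" using \<pi>_zero_iff[OF l] \<A>_carrier[OF i(2)] by simp
  qed (use l in \<open>auto simp: A.l_distr\<close>)
qed

text \<open>By \<open>J_in_N\<close>, a representative may be replaced by its component of degree 0.
  Uniqueness of that component is not yet available; it comes with
  \<open>N_degree_0\<close>.\<close>

lemma \<Delta>_elt: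
  assumes l: "l \<in> \<Lambda>" and x: "x \<in> carrier (\<Delta> l)"
  obtains a where "a \<in> \<A> 0" "a \<otimes>\<^bsub>A\<^esub> e l = a" "x = \<pi> l a"
proof -
  obtain b where "b \<in> Ae l" "x = \<pi> l b" using x unfolding carrier_\<Delta> by (rule imageE)
  then have b: "b \<in> carrier A" "b \<otimes>\<^bsub>A\<^esub> e l = b" "x = \<pi> l b" using Ae_iff[OF l] by blast+
  have 0: "hA 0 b \<otimes>\<^bsub>A\<^esub> e l = hA 0 b"
    using hA_0_mult[OF b(1) e_closed[OF l]] b(2) hA_0_homogeneous[OF e_degree[OF l]] by simp
  have "(b \<ominus>\<^bsub>A\<^esub> hA 0 b) \<otimes>\<^bsub>A\<^esub> e l = b \<ominus>\<^bsub>A\<^esub> hA 0 b"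
    using b 0 l by (simp add: a_minus_def A.l_distr A.l_minus)
  then have "b \<ominus>\<^bsub>A\<^esub> hA 0 b \<in> N l" using J_in_N[OF l minus_hA_0_in_J[OF b(1)]] by simp
  moreover have "b = (b \<ominus>\<^bsub>A\<^esub> hA 0 b) \<oplus>\<^bsub>A\<^esub> hA 0 b" using b by (simp add: a_minus_def A.a_assoc A.l_neg)
  moreover have "b \<in> Ae l" "hA 0 b \<in> Ae l" using b 0 l by (simp_all add: Ae_iff del: image_iff)
  ultimately have "\<pi> l b = \<pi> l (hA 0 b)"
    using \<pi>_eq_iff[OF l] by blast
  then show ?thesis using that[of "hA 0 b"] b 0 hA_degree by simp
qed

lemma linear_resolution_\<Delta>:
  assumes "l \<in> \<Lambda>"
  shows "\<exists>R Q \<delta> \<eta>. linear_resolution K A \<A> (\<Delta> l) (std_grading A \<A> \<Lambda> e r l) R Q \<delta> \<eta>"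
proof -
  note k = koszul[OF assms, unfolded koszul_module_def]
  obtain R :: "nat \<Rightarrow> ('a, nat \<Rightarrow> 'a) module" and Q \<delta> \<eta> where c:
    "projective_resolution A (\<Delta> l) R \<delta> \<eta> \<and>
      (\<forall>i. graded_module K A \<A> (R i) (Q i) \<and> generated_in_degree A (R i) (Q i) (int i)) \<and>
      (\<forall>j. \<eta> ` Q 0 j \<subseteq> std_grading A \<A> \<Lambda> e r l j) \<and> (\<forall>i j. \<delta> i ` Q (Suc i) j \<subseteq> Q i j)"
    using k[THEN conjunct2, THEN conjunct2] by (elim exE)
  have "linear_resolution K A \<A> (\<Delta> l) (std_grading A \<A> \<Lambda> e r l) R Q \<delta> \<eta>"
    using c conjunct1[OF k]
    by (intro linear_resolution.intro graded_mod.intro graded_fd_algebra_axioms graded_mod_axioms.intro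
        linear_resolution_axioms.intro) simp_all
  then show ?thesis by (intro exI)
qed

text \<open>
  The degree-zero part of the projective cover of \<open>\<Delta> l\<close> is \<open>\<Delta> l\<close> and is projective over \<open>A\<^sub>0\<close>,
  so \<open>A\<^sub>0 e l \<rightarrow> \<Delta> l\<close> splits; the section produces an idempotent of \<open>e l A\<^sub>0 e l\<close>.
\<close>

lemma N_degree_0_or_total:
  assumes l: "l \<in> \<Lambda>"
  shows "(\<forall>n\<in>N l. n \<in> \<A> 0 \<longrightarrow> n = \<zero>\<^bsub>A\<^esub>) \<or> e l \<in> N l"
proof -
  let ?G = "std_grading A \<A> \<Lambda> e r l"
  obtain R Q \<delta> \<eta> where "linear_resolution K A \<A> (\<Delta> l) ?G R Q \<delta> \<eta>"
    using linear_resolution_\<Delta>[OF l] by blast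
  then interpret LR: linear_resolution K A \<A> "\<Delta> l" ?G R Q \<delta> \<eta> .
  \<comment> \<open>All three modules are over A_0: \<open>?U\<close> is projective and maps
    isomorphically to \<open>?V\<close>, and \<open>?E\<close> is A_0 e_l, which maps onto
    \<open>?V\<close>. The lift h of \<eta> through \<open>?E\<close> is the section sought.\<close>
  let ?U = "(R 0)\<lparr>carrier := Q 0 0\<rparr>" and ?V = "(\<Delta> l)\<lparr>carrier := ?G 0\<rparr>"
  let ?E = "{a \<in> \<A> 0. a \<otimes>\<^bsub>A\<^esub> e l = a}"
  have E: "left_module A0 (L ?E)"
  proof (rule left_module_A0[OF left_module_regular])
    interpret reg: left_module A "regular_module A" by (rule left_module_regular)
    show "additive_subgroup ?E (regular_module A)"
    proof (rule reg.M.additive_subgroupI')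
      show "\<ominus>\<^bsub>regular_module A\<^esub> x \<in> ?E" if "x \<in> ?E" for x
        using that \<A>_carrier[of x 0] \<A>_minus[of x 0] l
        by (simp add: A.l_minus uminus_regular)
    qed (use l \<A>_carrier in \<open>auto simp: \<A>_add A.l_distr\<close>)
  qed (use l \<A>_carrier in \<open>auto simp: \<A>_mult_0 A.m_assoc\<close>)
  have EAe: "a \<in> Ae l" "a \<in> carrier A" if "a \<in> ?E" for a using that \<A>_carrier l by (auto simp: Ae_iff simp del: image_iff)
  have U: "left_module A0 ?U" by (rule LR.R.left_module_G)
  have V: "left_module A0 ?V" by (rule LR.left_module_G)
  have proj: "projective_module A0 ?U" using LR.R.bottom_projective[OF LR.R_generated LR.lr(2), of 0] by simp
  have \<pi>: "restrict (\<pi> l) (carrier (L ?E)) \<in> mod_hom A0 (L ?E) ?V"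
    by (rule mod_hom_restrictI[OF E]) (use EAe l \<A>_carrier in \<open>auto simp: std_grading_0 \<pi>_add \<pi>_smult simp del: image_iff intro: rev_image_eqI\<close>)
  have \<eta>: "restrict \<eta> (carrier ?U) \<in> mod_hom A0 ?U ?V"
    by (rule mod_hom_restrictI[OF U])
      (use image_subset_iff[THEN iffD1, OF LR.\<eta>_degree[of 0]] LR.R.GM.G_carrier \<A>_carrier mod_homD[OF LR.lr(5)] in auto)
  have "?G 0 \<subseteq> \<pi> l ` ?E"
  proof
    fix x assume "x \<in> ?G 0"
    then have "x \<in> carrier (\<Delta> l)" by (rule LR.GM.G_carrier)
    then show "x \<in> \<pi> l ` ?E" by (rule \<Delta>_elt[OF l]) auto
  qed
  then have img: "restrict \<eta> (carrier ?U) ` carrier ?U \<subseteq> restrict (\<pi> l) (carrier (L ?E)) ` carrier (L ?E)"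
    using LR.\<eta>_degree[of 0] by auto
  obtain h where h: "h \<in> mod_hom A0 ?U (L ?E)"
    "\<forall>x\<in>carrier ?U. restrict (\<pi> l) (carrier (L ?E)) (h x) = restrict \<eta> (carrier ?U) x"
    using projective_module_lift[OF proj E V \<pi> \<eta> img] by blast
  have hE: "h x \<in> ?E" if "x \<in> Q 0 0" for x using mod_homD(1)[OF h(1)] that by simp
  have \<pi>h: "\<pi> l (h x) = \<eta> x" if "x \<in> Q 0 0" for x
  proof -
    have x: "x \<in> carrier ?U" using that by simp
    have hx: "h x \<in> carrier (L ?E)" using hE[OF that] by simp
    from bspec[OF h(2) x] show ?thesis unfolding restrict_apply'[OF x] restrict_apply'[OF hx] .
  qed
  have hs: "h (a \<odot>\<^bsub>R 0\<^esub> x) = a \<otimes>\<^bsub>A\<^esub> h x" if "a \<in> \<A> 0" "x \<in> Q 0 0" for a x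
    using mod_homD(4)[OF h(1), of a x] that by simp
  have h0: "h \<zero>\<^bsub>R 0\<^esub> = \<zero>\<^bsub>A\<^esub>" using mod_hom_zero[OF h(1) U E] by simp
  have el: "e l \<in> ?E" using l e_degree by simp
  then have "\<pi> l (e l) \<in> ?G 0" by (auto simp: std_grading_0 intro!: image_eqI[of _ _ "e l"])
  then obtain y where y: "y \<in> Q 0 0" "\<eta> y = \<pi> l (e l)" using LR.\<eta>_surj by blast
  have \<eta>s: "\<eta> (a \<odot>\<^bsub>R 0\<^esub> y) = \<pi> l a" if "a \<in> ?E" for a
    using mod_homD(4)[OF LR.lr(5), of a y] LR.R.GM.G_carrier[OF y(1)] that EAe[OF that] EAe[OF el] l y
    by (simp add: \<pi>_smult del: image_iff)
  have \<eta>eq: "x = x'" if "x \<in> Q 0 0" "x' \<in> Q 0 0" "\<eta> x = \<eta> x'" for x x'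
  proof -
    have c: "x \<in> carrier (R 0)" "x' \<in> carrier (R 0)" using that LR.R.GM.G_carrier by auto
    have "x \<ominus>\<^bsub>R 0\<^esub> x' \<in> Q 0 0" using that by (simp add: a_minus_def)
    moreover have "\<eta> (x \<ominus>\<^bsub>R 0\<^esub> x') = \<zero>\<^bsub>\<Delta> l\<^esub>"
      using c that mod_homD[OF LR.lr(5)] by (simp add: a_minus_def mod_hom_minus[OF LR.lr(5,3,1)] LR.M.M.r_neg)
    ultimately have "x \<ominus>\<^bsub>R 0\<^esub> x' = \<zero>\<^bsub>R 0\<^esub>" by (rule LR.\<eta>_inj)
    then show "x = x'"
      by (metis LR.R.M.M.add.inv_solve_right' LR.R.M.M.l_zero a_minus_def c LR.R.M.M.zero_closed)
  qed
  \<comment> \<open>The element u is the value of the section at the class of e_l. Injectivity of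
    \<eta> in degree 0 gives u y = y and e_l y = y, and applying h turns these into u u = u and e_l
    u = u.\<close>
  define u where "u = h y"
  have u: "u \<in> ?E" using hE[OF y(1)] by (simp add: u_def)
  have \<pi>u: "\<pi> l u = \<pi> l (e l)" using \<pi>h[OF y(1)] y(2) by (simp add: u_def)
  have sm: "a \<odot>\<^bsub>R 0\<^esub> y \<in> Q 0 0" if "a \<in> \<A> 0" for a using LR.R.G_smult_0[OF that y(1)] .
  have "u \<odot>\<^bsub>R 0\<^esub> y = y" using \<eta>eq[OF sm y(1)] \<eta>s[OF u] u \<pi>u y(2) by simp
  then have uu: "u \<otimes>\<^bsub>A\<^esub> u = u" using hs[of u y] u y(1) by (simp add: u_def[symmetric])
  have "e l \<odot>\<^bsub>R 0\<^esub> y = y" using \<eta>eq[OF sm y(1)] \<eta>s[OF el] el y(2) by simp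
  then have eu: "e l \<otimes>\<^bsub>A\<^esub> u = u" using hs[of "e l" y] el y(1) by (simp add: u_def[symmetric])
  have "u = \<zero>\<^bsub>A\<^esub> \<or> u = e l" using e_primitive[OF l _ uu eu] u EAe by blast
  then show ?thesis
  proof
    assume "u = \<zero>\<^bsub>A\<^esub>"
    then have "\<pi> l (e l) = \<zero>\<^bsub>\<Delta> l\<^esub>"
      using \<pi>u \<pi>_zero_iff[OF l EAe(1)[OF u]] lidealD(2)[OF lideal_N[OF l]] by simp
    then show ?thesis using \<pi>_zero_iff[OF l EAe(1)[OF el]] by simp
  next
    assume ue: "u = e l"
    \<comment> \<open>An element n of the kernel in degree 0 kills y, hence also h(y) = e_l, and n =
      n e_l.\<close>
    have "n = \<zero>\<^bsub>A\<^esub>" if n: "n \<in> N l" "n \<in> \<A> 0" for n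
    proof -
      have "n \<in> Ae l" using n N_subset[OF l] by blast
      then have nE: "n \<in> ?E" using n Ae_iff[OF l] by blast
      have "\<eta> (n \<odot>\<^bsub>R 0\<^esub> y) = \<zero>\<^bsub>\<Delta> l\<^esub>" using \<eta>s[OF nE] \<pi>_zero_iff[OF l EAe(1)[OF nE]] n by simp
      then have "n \<odot>\<^bsub>R 0\<^esub> y = \<zero>\<^bsub>R 0\<^esub>" by (rule LR.\<eta>_inj[OF sm[OF n(2)]])
      then have "n \<otimes>\<^bsub>A\<^esub> u = \<zero>\<^bsub>A\<^esub>" using hs[OF n(2) y(1)] h0 by (simp add: u_def)
      then show ?thesis using nE ue by simp
    qed
    then show ?thesis by blast
  qed
qed

end

section \<open>Nonvanishing of the standard modules and the isomorphism of A_0 with their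
  sum\<close>

context stratified_algebra
begin

lemma filtration:
  assumes l: "l \<in> \<Lambda>"
  obtains n and F :: "nat \<Rightarrow> 'a set" where
    "F 0 = {\<zero>\<^bsub>A\<^esub>}" "F n = N l" "\<And>i. i \<le> n \<Longrightarrow> lideal (F i)" "\<And>i. i \<le> n \<Longrightarrow> F i \<subseteq> N l"
    "\<And>i. i < n \<Longrightarrow> F i \<subseteq> F (Suc i)"
    "\<And>i. i < n \<Longrightarrow> \<exists>k\<in>\<Lambda>. (l, k) \<in> r \<and> k \<noteq> l \<and> mod_iso A (quot_module (L (F (Suc i))) (F i)) (\<Delta> k)"
proof -
  have "has_filtration A ((proj_mod A e l)\<lparr>carrier := N l\<rparr>) \<Delta> {m \<in> \<Lambda>. (l, m) \<in> r \<and> m \<noteq> l}"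
    using strat l unfolding standardly_stratified_def by blast
  then have "has_filtration A (L (N l)) \<Delta> {m \<in> \<Lambda>. (l, m) \<in> r \<and> m \<noteq> l}"
    by (simp add: proj_mod_eq)
  then obtain n and F :: "nat \<Rightarrow> 'a set" where F: "F 0 = {\<zero>\<^bsub>L (N l)\<^esub>}" "F n = carrier (L (N l))"
      "\<forall>i\<le>n. submodule (F i) A (L (N l))"
      "\<forall>i<n. F i \<subseteq> F (Suc i) \<and> (\<exists>m\<in>{m \<in> \<Lambda>. (l, m) \<in> r \<and> m \<noteq> l}.
         mod_iso A (quot_module ((L (N l))\<lparr>carrier := F (Suc i)\<rparr>) (F i)) (\<Delta> m))"
    unfolding has_filtration_def by (elim exE conjE)
  have s: "submodule (F i) A (L (N l))" if "i \<le> n" for i using F(3) that by blast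
  show thesis
  proof (rule that[of F n])
    show "lideal (F i)" "F i \<subseteq> N l" if "i \<le> n" for i
      using submodule_L[OF lideal_N[OF l] s[OF that]] by auto
    show "\<exists>k\<in>\<Lambda>. (l, k) \<in> r \<and> k \<noteq> l \<and> mod_iso A (quot_module (L (F (Suc i))) (F i)) (\<Delta> k)" if "i < n" for i
      using F(4) that by auto
  qed (use F in auto)
qed

text \<open>Translates an isomorphism between a filtration factor and a standard module into
  statements about representatives in A, so that later computations take place in the
  algebra.\<close>

lemma quot_iso:
  assumes S: "lideal S" and T: "lideal T" and TS: "T \<subseteq> S" and k: "k \<in> \<Lambda>"
    and f: "f \<in> mod_hom A (quot_module (L S) T) (\<Delta> k)"
    and bij: "bij_betw f (carrier (quot_module (L S) T)) (carrier (\<Delta> k))"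
  shows "\<And>x. x \<in> S \<Longrightarrow> f (T +>\<^bsub>A\<^esub> x) \<in> carrier (\<Delta> k)"
    and "\<And>y. y \<in> carrier (\<Delta> k) \<Longrightarrow> \<exists>x\<in>S. f (T +>\<^bsub>A\<^esub> x) = y"
    and "\<And>a x. \<lbrakk>a \<in> carrier A; x \<in> S\<rbrakk> \<Longrightarrow> f (T +>\<^bsub>A\<^esub> (a \<otimes>\<^bsub>A\<^esub> x)) = a \<odot>\<^bsub>\<Delta> k\<^esub> f (T +>\<^bsub>A\<^esub> x)"
    and "\<And>x y. \<lbrakk>x \<in> S; y \<in> S; f (T +>\<^bsub>A\<^esub> x) = f (T +>\<^bsub>A\<^esub> y)\<rbrakk> \<Longrightarrow> \<exists>t\<in>T. x = t \<oplus>\<^bsub>A\<^esub> y"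
    and "\<And>x. \<lbrakk>x \<in> S; f (T +>\<^bsub>A\<^esub> x) = \<zero>\<^bsub>\<Delta> k\<^esub>\<rbrakk> \<Longrightarrow> x \<in> T"
proof -
  interpret Q: module_quotient A "L S" T by (rule quotient_L[OF S T TS])
  have car: "carrier (quot_module (L S) T) = (\<lambda>x. T +>\<^bsub>A\<^esub> x) ` S"
    by (simp add: carrier_quot_module coset_L)
  have inj: "inj_on f (carrier (quot_module (L S) T))" and img: "f ` carrier (quot_module (L S) T) = carrier (\<Delta> k)"
    using bij by (auto simp: bij_betw_def)
  show "\<And>x. x \<in> S \<Longrightarrow> f (T +>\<^bsub>A\<^esub> x) \<in> carrier (\<Delta> k)" using mod_homD(1)[OF f] car by blast
  show "\<exists>x\<in>S. f (T +>\<^bsub>A\<^esub> x) = y" if "y \<in> carrier (\<Delta> k)" for y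
    using that unfolding img[symmetric] car by blast
  show sm: "f (T +>\<^bsub>A\<^esub> (a \<otimes>\<^bsub>A\<^esub> x)) = a \<odot>\<^bsub>\<Delta> k\<^esub> f (T +>\<^bsub>A\<^esub> x)" if "a \<in> carrier A" "x \<in> S" for a x
  proof -
    have "a \<odot>\<^bsub>quot_module (L S) T\<^esub> (T +>\<^bsub>A\<^esub> x) = T +>\<^bsub>A\<^esub> (a \<otimes>\<^bsub>A\<^esub> x)"
      using Q.smult_coset[of a x] that by (simp add: coset_L)
    then show ?thesis using mod_homD(4)[OF f that(1), of "T +>\<^bsub>A\<^esub> x"] that(2) car by simp
  qed
  show eq: "\<exists>t\<in>T. x = t \<oplus>\<^bsub>A\<^esub> y" if "x \<in> S" "y \<in> S" "f (T +>\<^bsub>A\<^esub> x) = f (T +>\<^bsub>A\<^esub> y)" for x y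
  proof -
    have "T +>\<^bsub>A\<^esub> x = T +>\<^bsub>A\<^esub> y" using inj_onD[OF inj that(3)] car that by blast
    then show ?thesis using Q.coset_eq_iff'[of x y] that(1,2) by (simp add: coset_L)
  qed
  show "x \<in> T" if x: "x \<in> S" "f (T +>\<^bsub>A\<^esub> x) = \<zero>\<^bsub>\<Delta> k\<^esub>" for x
  proof -
    have "f (T +>\<^bsub>A\<^esub> \<zero>\<^bsub>A\<^esub>) = \<zero>\<^bsub>\<Delta> k\<^esub>"
      using mod_hom_zero[OF f Q.left_module_quot left_module_\<Delta>[OF k]] Q.coset_zero by (simp add: coset_L)
    then obtain t where "t \<in> T" "x = t \<oplus>\<^bsub>A\<^esub> \<zero>\<^bsub>A\<^esub>" using eq[OF x(1) lidealD(2)[OF S]] x(2) by auto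
    then show ?thesis using lidealD(1)[OF T] by simp
  qed
qed

lemma e_in_Ae: "l \<in> \<Lambda> \<Longrightarrow> e l \<in> Ae l" by (simp add: Ae_iff del: image_iff)

lemma mod_iso_of_factorization:
  assumes l: "l \<in> \<Lambda>" and m: "m \<in> \<Lambda>"
    and z: "z \<in> carrier A" "e l \<otimes>\<^bsub>A\<^esub> z = z" "z \<otimes>\<^bsub>A\<^esub> e m = z"
    and w: "w \<in> carrier A" "e m \<otimes>\<^bsub>A\<^esub> w = w" "w \<otimes>\<^bsub>A\<^esub> e l = w"
    and zw: "z \<otimes>\<^bsub>A\<^esub> w = e l" "w \<otimes>\<^bsub>A\<^esub> z = e m"
  shows "mod_iso A (proj_mod A e l) (proj_mod A e m)"
proof -
  let ?f = "\<lambda>x\<in>Ae l. x \<otimes>\<^bsub>A\<^esub> z" and ?g = "\<lambda>x\<in>Ae m. x \<otimes>\<^bsub>A\<^esub> w"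
  have zA: "z \<in> Ae m" and wA: "w \<in> Ae l" using z w l m by (simp_all add: Ae_iff del: image_iff)
  have f: "?f \<in> mod_hom A (L (Ae l)) (L (Ae m))" by (rule right_mult_hom[OF l m zA])
  have g: "?g \<in> mod_hom A (L (Ae m)) (L (Ae l))" by (rule right_mult_hom[OF m l wA])
  have 1: "x \<otimes>\<^bsub>A\<^esub> z \<in> Ae m" "x \<otimes>\<^bsub>A\<^esub> z \<otimes>\<^bsub>A\<^esub> w = x" if "x \<in> Ae l" for x
  proof -
    have x: "x \<in> carrier A" "x \<otimes>\<^bsub>A\<^esub> e l = x" using that Ae_iff[OF l] by blast+
    then show "x \<otimes>\<^bsub>A\<^esub> z \<in> Ae m" "x \<otimes>\<^bsub>A\<^esub> z \<otimes>\<^bsub>A\<^esub> w = x"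
      using z w m zw by (simp_all add: Ae_iff A.m_assoc del: image_iff)
  qed
  have 2: "x \<otimes>\<^bsub>A\<^esub> w \<in> Ae l" "x \<otimes>\<^bsub>A\<^esub> w \<otimes>\<^bsub>A\<^esub> z = x" if "x \<in> Ae m" for x
  proof -
    have x: "x \<in> carrier A" "x \<otimes>\<^bsub>A\<^esub> e m = x" using that Ae_iff[OF m] by blast+
    then show "x \<otimes>\<^bsub>A\<^esub> w \<in> Ae l" "x \<otimes>\<^bsub>A\<^esub> w \<otimes>\<^bsub>A\<^esub> z = x"
      using z w l zw by (simp_all add: Ae_iff A.m_assoc del: image_iff)
  qed
  have "bij_betw ?f (Ae l) (Ae m)"
    by (rule bij_betw_byWitness[where f' = ?g]) (use 1 2 in \<open>simp_all add: image_subset_iff del: image_iff\<close>)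
  then show ?thesis unfolding mod_iso_def proj_mod_eq using f by (intro bexI[of _ ?f]) simp_all
qed

text \<open>
  If \<open>\<Delta> l\<close> vanished, its filtration would yield an epimorphism from \<open>A e l\<close> onto a nonzero
  \<open>\<Delta> m = A\<^sub>0 e m\<close> with \<open>m \<noteq> l\<close>; primitivity of \<open>e l\<close> turns it into an isomorphism
  \<open>A e l \<cong> A e m\<close>, which basicness excludes.
\<close>

lemma e_notin_N:
  assumes l: "l \<in> \<Lambda>" shows "e l \<notin> N l"
proof
  assume "e l \<in> N l"
  obtain n and F :: "nat \<Rightarrow> 'a set" where F:
    "F 0 = {\<zero>\<^bsub>A\<^esub>}" "F n = N l" "\<And>i. i \<le> n \<Longrightarrow> lideal (F i)" "\<And>i. i \<le> n \<Longrightarrow> F i \<subseteq> N l"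
    "\<And>i. i < n \<Longrightarrow> F i \<subseteq> F (Suc i)"
    "\<And>i. i < n \<Longrightarrow> \<exists>k\<in>\<Lambda>. (l, k) \<in> r \<and> k \<noteq> l \<and> mod_iso A (quot_module (L (F (Suc i))) (F i)) (\<Delta> k)"
    by (rule filtration[OF l]) (rule that, assumption+)
  have "e l \<in> F n" "e l \<notin> F 0" using F(1,2) \<open>e l \<in> N l\<close> e_nonzero[OF l] by auto
  \<comment> \<open>At this step the left ideal F_(i+1) contains e_l and lies in A e_l, so it equals
    A e_l. The factor \<open>\<Delta> m\<close> is therefore generated by the image w of
    e_l.\<close>
  then have "\<exists>i<n. e l \<notin> F i \<and> e l \<in> F (Suc i)"
  proof (induct n)
    case (Suc n)
    then show ?case by (cases "e l \<in> F n") (auto intro: less_SucI)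
  qed simp
  then obtain i where i: "i < n" "e l \<notin> F i" "e l \<in> F (Suc i)" by blast
  obtain m where m: "m \<in> \<Lambda>" "m \<noteq> l" and iso: "mod_iso A (quot_module (L (F (Suc i))) (F i)) (\<Delta> m)"
    using F(6)[OF i(1)] by blast
  obtain f where f: "f \<in> mod_hom A (quot_module (L (F (Suc i))) (F i)) (\<Delta> m)"
    "bij_betw f (carrier (quot_module (L (F (Suc i))) (F i))) (carrier (\<Delta> m))"
    using iso unfolding mod_iso_def by blast
  have FS: "lideal (F (Suc i))" "lideal (F i)" "F i \<subseteq> F (Suc i)" using F(3,5) i(1) by auto
  note q = quot_iso[OF FS m(1) f]
  define w where "w = f (F i +>\<^bsub>A\<^esub> e l)"
  have w: "w \<in> carrier (\<Delta> m)" "w \<noteq> \<zero>\<^bsub>\<Delta> m\<^esub>" "e l \<odot>\<^bsub>\<Delta> m\<^esub> w = w"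
    using q(1,5)[of "e l"] q(3)[of "e l" "e l"] i l unfolding w_def by auto
  obtain z' where z': "z' \<in> \<A> 0" "z' \<otimes>\<^bsub>A\<^esub> e m = z'" "w = \<pi> m z'" by (rule \<Delta>_elt[OF m(1) w(1)])
  have z'A: "z' \<in> carrier A" "z' \<in> Ae m" using z' \<A>_carrier m by (auto simp: Ae_iff simp del: image_iff)
  define z where "z = e l \<otimes>\<^bsub>A\<^esub> z'"
  have z: "z \<in> \<A> 0" "z \<in> carrier A" "e l \<otimes>\<^bsub>A\<^esub> z = z" "z \<otimes>\<^bsub>A\<^esub> e m = z"
    using z' z'A \<A>_mult_0[OF e_degree[OF l] z'(1)] l m by (simp_all add: z_def A.m_assoc) (simp flip: A.m_assoc add: l)
  have zAe: "z \<in> Ae m" using z m by (simp add: Ae_iff del: image_iff)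
  have wz: "w = \<pi> m z" using w(3) z'(3) \<pi>_smult[OF m(1) e_closed[OF l] z'A(2)] by (simp add: z_def)
  \<comment> \<open>\<open>\<Delta> m\<close> contains the nonzero element w, which rules out the
    degenerate alternative for this m. Nonvanishing is thus available for m without knowing it for
    every index.\<close>
  have "e m \<notin> N m"
  proof
    assume "e m \<in> N m"
    then have "z \<otimes>\<^bsub>A\<^esub> e m \<in> N m" using lidealD(4)[OF lideal_N[OF m(1)]] z(2) by blast
    then have "w = \<zero>\<^bsub>\<Delta> m\<^esub>" using wz \<pi>_zero_iff[OF m(1) zAe] z(4) by simp
    then show False using w(2) by simp
  qed
  then have N0: "x = \<zero>\<^bsub>A\<^esub>" if "x \<in> N m" "x \<in> \<A> 0" for x using N_degree_0_or_total[OF m(1)] that by blast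
  have emAe: "e m \<in> Ae m" by (rule e_in_Ae[OF m(1)])
  have "\<pi> m (e m) \<in> carrier (\<Delta> m)" using emAe unfolding carrier_\<Delta> by (rule imageI)
  then obtain b where b: "b \<in> F (Suc i)" "f (F i +>\<^bsub>A\<^esub> b) = \<pi> m (e m)" using q(2) by blast
  have "b \<in> Ae l" using b(1) F(4)[of "Suc i"] N_subset[OF l] i(1) by auto
  then have bA: "b \<in> carrier A" "b \<otimes>\<^bsub>A\<^esub> e l = b" using Ae_iff[OF l] by blast+
  have "\<pi> m (e m) = b \<odot>\<^bsub>\<Delta> m\<^esub> w" using q(3)[OF bA(1) i(3)] b(2) bA(2) by (simp add: w_def)
  also have "\<dots> = \<pi> m (b \<otimes>\<^bsub>A\<^esub> z)" using \<pi>_smult[OF m(1) bA(1) zAe] wz by simp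
  finally have "e m \<ominus>\<^bsub>A\<^esub> b \<otimes>\<^bsub>A\<^esub> z \<in> N m"
    using \<pi>_eqD[OF m(1) emAe lidealD(4)[OF lideal_Ae[OF m(1)] bA(1) zAe]] by simp
  \<comment> \<open>Replacing b by its part of degree 0 changes b z by an element of J e_m, hence of
    \<open>N m\<close>. The difference e_m - a z then has degree 0 and lies in \<open>N m\<close>,
    so it vanishes.\<close>
  moreover define a where "a = hA 0 b"
  have a: "a \<in> \<A> 0" "a \<in> carrier A" using hA_degree bA by (simp_all add: a_def)
  have "(b \<ominus>\<^bsub>A\<^esub> a) \<otimes>\<^bsub>A\<^esub> z \<otimes>\<^bsub>A\<^esub> e m \<in> N m"
    using J_in_N[OF m(1) J_mult_r[OF minus_hA_0_in_J[OF bA(1)] z(2)]] by (simp add: a_def)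
  then have "(b \<ominus>\<^bsub>A\<^esub> a) \<otimes>\<^bsub>A\<^esub> z \<in> N m"
    using A.m_assoc[of "b \<ominus>\<^bsub>A\<^esub> a" z "e m"] a bA z m(1) by simp
  ultimately have "(e m \<ominus>\<^bsub>A\<^esub> b \<otimes>\<^bsub>A\<^esub> z) \<oplus>\<^bsub>A\<^esub> (b \<ominus>\<^bsub>A\<^esub> a) \<otimes>\<^bsub>A\<^esub> z \<in> N m"
    using lidealD(3)[OF lideal_N[OF m(1)]] by blast
  moreover have "(e m \<ominus>\<^bsub>A\<^esub> b \<otimes>\<^bsub>A\<^esub> z) \<oplus>\<^bsub>A\<^esub> (b \<ominus>\<^bsub>A\<^esub> a) \<otimes>\<^bsub>A\<^esub> z = e m \<ominus>\<^bsub>A\<^esub> a \<otimes>\<^bsub>A\<^esub> z"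
    using m(1) a bA z by (simp add: a_minus_def A.l_distr A.l_minus A.a_assoc) (simp flip: A.a_assoc add: A.l_neg)
  moreover have "e m \<ominus>\<^bsub>A\<^esub> a \<otimes>\<^bsub>A\<^esub> z \<in> \<A> 0"
    using \<A>_add[OF e_degree[OF m(1)] \<A>_minus[OF \<A>_mult_0[OF a(1) z(1)]]] by (simp add: a_minus_def)
  ultimately have "e m \<ominus>\<^bsub>A\<^esub> a \<otimes>\<^bsub>A\<^esub> z = \<zero>\<^bsub>A\<^esub>" using N0 by simp
  then have az: "e m = a \<otimes>\<^bsub>A\<^esub> z" using m(1) a z by simp
  \<comment> \<open>Trimmed on both sides, v satisfies v z = e_m. The reverse product z v is then an
    idempotent of e_l A e_l; primitivity leaves 0 or e_l, and 0 would force e_m = (v z)(v z) =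
    0.\<close>
  define v where "v = e m \<otimes>\<^bsub>A\<^esub> a \<otimes>\<^bsub>A\<^esub> e l"
  have v: "v \<in> carrier A" "e m \<otimes>\<^bsub>A\<^esub> v = v" "v \<otimes>\<^bsub>A\<^esub> e l = v"
    using m(1) l a by (simp_all add: v_def A.m_assoc) (simp flip: A.m_assoc add: m(1))
  have vz: "v \<otimes>\<^bsub>A\<^esub> z = e m"
    using m(1) l a z by (simp add: v_def A.m_assoc flip: az)
  have zv: "z \<otimes>\<^bsub>A\<^esub> v = \<zero>\<^bsub>A\<^esub> \<or> z \<otimes>\<^bsub>A\<^esub> v = e l"
  proof (rule e_primitive[OF l])
    have "z \<otimes>\<^bsub>A\<^esub> v \<otimes>\<^bsub>A\<^esub> (z \<otimes>\<^bsub>A\<^esub> v) = z \<otimes>\<^bsub>A\<^esub> ((v \<otimes>\<^bsub>A\<^esub> z) \<otimes>\<^bsub>A\<^esub> v)" using z v by (simp add: A.m_assoc)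
    then show "z \<otimes>\<^bsub>A\<^esub> v \<otimes>\<^bsub>A\<^esub> (z \<otimes>\<^bsub>A\<^esub> v) = z \<otimes>\<^bsub>A\<^esub> v" using vz v by simp
    show "e l \<otimes>\<^bsub>A\<^esub> (z \<otimes>\<^bsub>A\<^esub> v) = z \<otimes>\<^bsub>A\<^esub> v" using l z v by (simp flip: A.m_assoc)
  qed (use l z v in \<open>simp_all add: A.m_assoc\<close>)
  have "z \<otimes>\<^bsub>A\<^esub> v \<noteq> \<zero>\<^bsub>A\<^esub>"
  proof
    assume "z \<otimes>\<^bsub>A\<^esub> v = \<zero>\<^bsub>A\<^esub>"
    then have "v \<otimes>\<^bsub>A\<^esub> (z \<otimes>\<^bsub>A\<^esub> v) \<otimes>\<^bsub>A\<^esub> z = \<zero>\<^bsub>A\<^esub>" using z v by simp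
    moreover have "v \<otimes>\<^bsub>A\<^esub> (z \<otimes>\<^bsub>A\<^esub> v) \<otimes>\<^bsub>A\<^esub> z = (v \<otimes>\<^bsub>A\<^esub> z) \<otimes>\<^bsub>A\<^esub> (v \<otimes>\<^bsub>A\<^esub> z)" using z v by (simp add: A.m_assoc)
    ultimately show False using vz m(1) e_nonzero by simp
  qed
  with zv have "z \<otimes>\<^bsub>A\<^esub> v = e l" by simp
  from mod_iso_of_factorization[OF l m(1) z(2-4) v this vz]
  show False using basic[unfolded basic_algebra_def, rule_format, OF l m(1) m(2)[symmetric]] by contradiction
qed

lemma N_degree_0: "\<lbrakk>l \<in> \<Lambda>; n \<in> N l; n \<in> \<A> 0\<rbrakk> \<Longrightarrow> n = \<zero>\<^bsub>A\<^esub>"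
  using N_degree_0_or_total e_notin_N by blast

text \<open>The elements x and x - \<open>hA 0 x\<close> both lie in the kernel, the latter because
  it is in J e_l. Their difference is an element of the kernel of degree 0 and thus
  vanishes.\<close>

lemma N_iff:
  assumes l: "l \<in> \<Lambda>" shows "x \<in> N l \<longleftrightarrow> x \<in> J \<and> x \<otimes>\<^bsub>A\<^esub> e l = x"
proof
  assume "x \<in> J \<and> x \<otimes>\<^bsub>A\<^esub> e l = x"
  then show "x \<in> N l" using J_in_N[OF l, of x] by simp
next
  assume x: "x \<in> N l"
  then have "x \<in> Ae l" using N_subset[OF l] by blast
  then have xA: "x \<in> carrier A" "x \<otimes>\<^bsub>A\<^esub> e l = x" using Ae_iff[OF l] by blast+
  have h: "hA 0 x \<otimes>\<^bsub>A\<^esub> e l = hA 0 x"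
    using hA_0_mult[OF xA(1) e_closed[OF l]] xA(2) hA_0_homogeneous[OF e_degree[OF l]] by simp
  have "(x \<ominus>\<^bsub>A\<^esub> hA 0 x) \<otimes>\<^bsub>A\<^esub> e l = x \<ominus>\<^bsub>A\<^esub> hA 0 x"
    using xA h l by (simp add: a_minus_def A.l_distr A.l_minus)
  then have "x \<ominus>\<^bsub>A\<^esub> hA 0 x \<in> N l" using J_in_N[OF l minus_hA_0_in_J[OF xA(1)]] by simp
  then have "x \<oplus>\<^bsub>A\<^esub> \<ominus>\<^bsub>A\<^esub> (x \<ominus>\<^bsub>A\<^esub> hA 0 x) \<in> N l"
    using lidealD(3)[OF lideal_N[OF l] x lideal_minus[OF lideal_N[OF l]]] by blast
  moreover have "x \<oplus>\<^bsub>A\<^esub> \<ominus>\<^bsub>A\<^esub> (x \<ominus>\<^bsub>A\<^esub> hA 0 x) = hA 0 x"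
    using xA by (simp add: a_minus_def A.minus_add A.r_neg flip: A.a_assoc)
  ultimately have "hA 0 x = \<zero>\<^bsub>A\<^esub>" using N_degree_0[OF l] hA_degree[OF xA(1)] by simp
  then show "x \<in> J \<and> x \<otimes>\<^bsub>A\<^esub> e l = x" using xA by (simp add: J_iff)
qed

text \<open>The element lies in the trace part of the kernel and has degree 0. So e_m A_0 e_l can be
  nonzero only for m <= l, which is the directedness of A_0.\<close>

lemma e_mult_e_zero:
  assumes "l \<in> \<Lambda>" "m \<in> \<Lambda>" "(m, l) \<notin> r" "b \<in> \<A> 0"
  shows "e m \<otimes>\<^bsub>A\<^esub> b \<otimes>\<^bsub>A\<^esub> e l = \<zero>\<^bsub>A\<^esub>"
  using N_degree_0[OF assms(1) trace_in_N[OF assms(1-3) \<A>_carrier[OF assms(4)]]]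
    \<A>_mult_0[OF \<A>_mult_0[OF e_degree[OF assms(2)] assms(4)] e_degree[OF assms(1)]] by simp

lemma sum_mult_e:
  assumes "a \<in> carrier A" shows "finsum A (\<lambda>l. a \<otimes>\<^bsub>A\<^esub> e l) \<Lambda> = a"
  using A.finsum_rdistr[OF \<Lambda>_finite assms, of e] e_sum assms by simp

lemma \<pi>_hA_0:
  assumes "a \<in> carrier A" "l \<in> \<Lambda>" shows "\<pi> l (hA 0 a \<otimes>\<^bsub>A\<^esub> e l) = \<pi> l (a \<otimes>\<^bsub>A\<^esub> e l)"
proof -
  have "a \<otimes>\<^bsub>A\<^esub> e l = (a \<ominus>\<^bsub>A\<^esub> hA 0 a) \<otimes>\<^bsub>A\<^esub> e l \<oplus>\<^bsub>A\<^esub> hA 0 a \<otimes>\<^bsub>A\<^esub> e l"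
    using assms by (simp add: a_minus_def A.a_assoc A.l_neg flip: A.l_distr)
  then show ?thesis
    using \<pi>_eq_iff[OF assms(2) Ae_mult[OF assms(2,1)] Ae_mult[OF assms(2), of "hA 0 a"]] assms
      J_in_N[OF assms(2) minus_hA_0_in_J[OF assms(1)]] by auto
qed

lemma degree_zero_module_iso: "mod_iso A D0 (dsum_module \<Lambda> \<Delta>)"
proof -
  let ?S = "dsum_module \<Lambda> \<Delta>"
  have D: "left_module A D0" by (rule left_module_D0)
  \<comment> \<open>The map sends the class of a to the family of classes of a e_l. It is defined
    through the unique representative of degree 0; \<open>fq\<close> then shows that any
    representative gives the same value.\<close>
  define f where "f x = (\<lambda>l\<in>\<Lambda>. \<pi> l ((THE a. a \<in> \<A> 0 \<and> x = q a) \<otimes>\<^bsub>A\<^esub> e l))" for x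
  have carS: "x \<in> carrier ?S \<longleftrightarrow> x \<in> (\<Pi>\<^sub>E l\<in>\<Lambda>. carrier (\<Delta> l))" for x
    using \<Lambda>_finite by (simp add: dsum_module_def)
  have f0: "f (q a) = (\<lambda>l\<in>\<Lambda>. \<pi> l (a \<otimes>\<^bsub>A\<^esub> e l))" if a: "a \<in> \<A> 0" for a
  proof -
    have "(THE b. b \<in> \<A> 0 \<and> q a = q b) = a" using a q_inj by (intro the_equality) auto
    then show ?thesis by (simp add: f_def)
  qed
  have fq: "f (q a) = (\<lambda>l\<in>\<Lambda>. \<pi> l (a \<otimes>\<^bsub>A\<^esub> e l))" if a: "a \<in> carrier A" for a
    using f0[OF hA_degree[OF a]] q_hA_0[OF a] \<pi>_hA_0[OF a] by (simp add: restrict_def fun_eq_iff)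
  have hom: "restrict f (carrier D0) \<in> mod_hom A D0 ?S"
  proof (rule mod_hom_restrictI[OF D])
    fix x y assume "x \<in> carrier D0"
    then obtain a where a: "a \<in> carrier A" "x = q a" by (auto simp: carrier_D0)
    show "f x \<in> carrier ?S" using a by (simp add: carS fq carrier_\<Delta> del: image_iff)
    show "f (x \<oplus>\<^bsub>D0\<^esub> y) = f x \<oplus>\<^bsub>?S\<^esub> f y" if y: "y \<in> carrier D0"
    proof -
      obtain b where b: "b \<in> carrier A" "y = q b" using y by (auto simp: carrier_D0)
      show ?thesis using a b
        by (simp add: q_add fq dsum_module_def restrict_def fun_eq_iff \<pi>_add Ae_mult A.l_distr del: image_iff)
    qed
    show "f (c \<odot>\<^bsub>D0\<^esub> x) = c \<odot>\<^bsub>?S\<^esub> f x" if "c \<in> carrier A" for c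
      using a that by (simp add: q_smult fq dsum_module_def restrict_def fun_eq_iff \<pi>_smult Ae_mult A.m_assoc del: image_iff)
  qed
  have "inj_on f (carrier D0)"
  proof (rule inj_onI)
    fix x y assume "x \<in> carrier D0" "y \<in> carrier D0" and xy: "f x = f y"
    then obtain a b where a: "a \<in> \<A> 0" "x = q a" and b: "b \<in> \<A> 0" "y = q b" by (meson D0_elt)
    have "a \<otimes>\<^bsub>A\<^esub> e l = b \<otimes>\<^bsub>A\<^esub> e l" if l: "l \<in> \<Lambda>" for l
    proof -
      have ab: "a \<in> carrier A" "b \<in> carrier A" using a b \<A>_carrier by auto
      have "\<pi> l (a \<otimes>\<^bsub>A\<^esub> e l) = \<pi> l (b \<otimes>\<^bsub>A\<^esub> e l)"
      proof -
        have "f (q a) l = f (q b) l" using xy a(2) b(2) by simp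
        then show ?thesis unfolding f0[OF a(1)] f0[OF b(1)] using l by simp
      qed
      then have "a \<otimes>\<^bsub>A\<^esub> e l \<ominus>\<^bsub>A\<^esub> b \<otimes>\<^bsub>A\<^esub> e l \<in> N l" by (intro \<pi>_eqD Ae_mult l ab)
      moreover have "a \<otimes>\<^bsub>A\<^esub> e l \<ominus>\<^bsub>A\<^esub> b \<otimes>\<^bsub>A\<^esub> e l \<in> \<A> 0"
        using \<A>_add[OF \<A>_mult_0[OF a(1) e_degree[OF l]] \<A>_minus[OF \<A>_mult_0[OF b(1) e_degree[OF l]]]]
        by (simp add: a_minus_def)
      ultimately have "a \<otimes>\<^bsub>A\<^esub> e l \<ominus>\<^bsub>A\<^esub> b \<otimes>\<^bsub>A\<^esub> e l = \<zero>\<^bsub>A\<^esub>" by (rule N_degree_0[OF l])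
      then show ?thesis using ab l by simp
    qed
    then have "finsum A (\<lambda>l. a \<otimes>\<^bsub>A\<^esub> e l) \<Lambda> = finsum A (\<lambda>l. b \<otimes>\<^bsub>A\<^esub> e l) \<Lambda>"
      using b(1) \<A>_carrier by (intro A.finsum_cong') auto
    then show "x = y" using sum_mult_e a b \<A>_carrier by simp
  qed
  moreover have "f ` carrier D0 = carrier ?S"
  proof
    show "f ` carrier D0 \<subseteq> carrier ?S" using mod_homD(1)[OF hom] by auto
    show "carrier ?S \<subseteq> f ` carrier D0"
    proof
      fix x assume "x \<in> carrier ?S"
      then have x: "x \<in> (\<Pi>\<^sub>E l\<in>\<Lambda>. carrier (\<Delta> l))" by (simp add: carS)
      have "\<exists>a. a \<in> \<A> 0 \<and> a \<otimes>\<^bsub>A\<^esub> e l = a \<and> x l = \<pi> l a" if l: "l \<in> \<Lambda>" for l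
        by (rule \<Delta>_elt[OF l PiE_mem[OF x l]]) (intro exI conjI)
      then have "\<forall>l\<in>\<Lambda>. \<exists>a. a \<in> \<A> 0 \<and> a \<otimes>\<^bsub>A\<^esub> e l = a \<and> x l = \<pi> l a" by (rule ballI)
      from bchoice[OF this] obtain a where "\<forall>l\<in>\<Lambda>. a l \<in> \<A> 0 \<and> a l \<otimes>\<^bsub>A\<^esub> e l = a l \<and> x l = \<pi> l (a l)" ..
      then have a: "\<And>l. l \<in> \<Lambda> \<Longrightarrow> a l \<in> \<A> 0 \<and> a l \<otimes>\<^bsub>A\<^esub> e l = a l \<and> x l = \<pi> l (a l)" by (rule bspec)
      have aA: "a \<in> \<Lambda> \<rightarrow> carrier A" using a \<A>_carrier by blast
      let ?a = "finsum A a \<Lambda>"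
      \<comment> \<open>Each a_m equals a_m e_m, so orthogonality of the idempotents recovers the
        component a_l from the sum. This gives surjectivity.\<close>
      have "?a \<otimes>\<^bsub>A\<^esub> e l = a l" if l: "l \<in> \<Lambda>" for l
      proof -
        have "?a \<otimes>\<^bsub>A\<^esub> e l = finsum A (\<lambda>m. a m \<otimes>\<^bsub>A\<^esub> e l) \<Lambda>"
          using l aA by (intro A.finsum_ldistr[OF \<Lambda>_finite]) auto
        also have "\<dots> = finsum A (\<lambda>m. if l = m then a m else \<zero>\<^bsub>A\<^esub>) \<Lambda>"
        proof (rule A.finsum_cong'[OF refl])
          fix m assume m: "m \<in> \<Lambda>"
          have "a m \<in> carrier A" using aA m by blast
          then have "a m \<otimes>\<^bsub>A\<^esub> e l = a m \<otimes>\<^bsub>A\<^esub> (e m \<otimes>\<^bsub>A\<^esub> e l)" using a[OF m] m l by (simp flip: A.m_assoc)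
          then show "a m \<otimes>\<^bsub>A\<^esub> e l = (if l = m then a m else \<zero>\<^bsub>A\<^esub>)"
            using a[OF m] e_orth[OF m l] m \<open>a m \<in> carrier A\<close> by auto
        qed (use aA in auto)
        also have "\<dots> = a l" using aA by (intro A.add.finprod_singleton[OF l \<Lambda>_finite])
        finally show ?thesis .
      qed
      then have "\<pi> l (?a \<otimes>\<^bsub>A\<^esub> e l) = x l" if "l \<in> \<Lambda>" for l
        using a[OF that] that by (metis (no_types))
      then have "f (q ?a) = restrict x \<Lambda>"
        unfolding fq[OF A.finsum_closed[OF aA]] by (rule restrict_ext)
      then have "f (q ?a) = x" using PiE_restrict[OF x] by simp
      moreover have "q ?a \<in> carrier D0" using A.finsum_closed[OF aA] by simp
      ultimately show "x \<in> f ` carrier D0" by blast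
    qed
  qed
  ultimately have "bij_betw (restrict f (carrier D0)) (carrier D0) (carrier ?S)"
    by (simp only: bij_betw_restrict_eq) (simp only: bij_betw_def)
  then show ?thesis unfolding mod_iso_def by (rule bexI[OF _ hom])
qed

end

subsection \<open>Top weights of the linear resolutions\<close>

text \<open>Products of two elements of \<open>J\<close> start in degree 2. Hence the part of a in
  positive degrees contributes nothing to degree 1.\<close>

lemma (in graded_fd_algebra) hA_1_mult:
  assumes a: "a \<in> carrier A" and y: "y \<in> J"
  shows "hA 1 (a \<otimes>\<^bsub>A\<^esub> y) = hA 0 a \<otimes>\<^bsub>A\<^esub> hA 1 y"
proof -
  have yA: "y \<in> carrier A" by (rule J_carrier[OF y])
  have h: "hA 1 (hA 0 a \<otimes>\<^bsub>A\<^esub> y) = hA 0 a \<otimes>\<^bsub>A\<^esub> hA 1 y"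
    using hc_map(1)[OF GA.graded_group_axioms GA.graded_group_axioms yA, where T = "\<lambda>y. hA 0 a \<otimes>\<^bsub>A\<^esub> y" and \<sigma> = "\<lambda>i. i" and i = 1]
      a \<A>_mult[of "hA 0 a" 0] hA_degree[OF a] by (simp add: A.r_distr)
  define a' where "a' = a \<ominus>\<^bsub>A\<^esub> hA 0 a"
  have a': "a' \<in> carrier A" "hA 0 a' = \<zero>\<^bsub>A\<^esub>" using minus_hA_0_in_J[OF a] by (simp_all add: a'_def J_iff)
  have sub: "(\<Union>i\<in>{1..}. \<A> i) \<subseteq> carrier A" using \<A>_carrier by blast
  have "hA 1 (a' \<otimes>\<^bsub>A\<^esub> y) \<in> {\<zero>\<^bsub>A\<^esub>}"
  proof (rule add_span_image[OF A.abelian_group_axioms A.abelian_group_axioms sub y[unfolded positive_part_def]])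
    fix z assume "z \<in> (\<Union>i\<in>{1..}. \<A> i)"
    then obtain j where j: "1 \<le> j" "z \<in> \<A> j" by auto
    show "hA 1 (a' \<otimes>\<^bsub>A\<^esub> z) \<in> {\<zero>\<^bsub>A\<^esub>}"
    proof (cases "j = 1")
      case True
      then show ?thesis using hA_mult_r[OF a'(1) j(2), of 0] a'(2) \<A>_carrier[OF j(2)] by simp
    next
      case False
      have "hA 1 (a' \<otimes>\<^bsub>A\<^esub> z) = \<zero>\<^bsub>A\<^esub>"
        by (rule hc_map(2)[OF GA.graded_group_axioms GA.graded_group_axioms a'(1), where \<sigma> = "\<lambda>i. i + j"])
          (use j False in \<open>auto simp: A.l_distr \<A>_mult \<A>_carrier intro: injI\<close>)
      then show ?thesis by simp
    qed
  qed (use a' in \<open>auto simp: A.r_distr GA.hc_add intro!: A.additive_subgroupI'\<close>)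
  moreover have "a \<otimes>\<^bsub>A\<^esub> y = a' \<otimes>\<^bsub>A\<^esub> y \<oplus>\<^bsub>A\<^esub> hA 0 a \<otimes>\<^bsub>A\<^esub> y"
    using a yA by (simp add: a'_def a_minus_def A.a_assoc A.l_neg flip: A.l_distr)
  ultimately show ?thesis using h a' a yA by (simp add: GA.hc_add)
qed

context stratified_algebra
begin

abbreviation above :: "'l \<Rightarrow> 'l set" where "above l \<equiv> {k \<in> \<Lambda>. (l, k) \<in> r \<and> k \<noteq> l}"

text \<open>Each filtration factor \<open>\<Delta> k\<close> is generated by the class of e_k. If y
  represents the corresponding element of the factor, then e_k y lies in e_k N_l and generates it;
  induction along the filtration collects these generators.\<close>

lemma N_generated:
  assumes l: "l \<in> \<Lambda>" and x: "x \<in> N l"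
  shows "x \<in> add_span A {a \<otimes>\<^bsub>A\<^esub> (e k \<otimes>\<^bsub>A\<^esub> w) | a k w. a \<in> carrier A \<and> k \<in> above l \<and> w \<in> N l}" (is "x \<in> add_span A ?S")
proof -
  obtain n and F :: "nat \<Rightarrow> 'a set" where F:
    "F 0 = {\<zero>\<^bsub>A\<^esub>}" "F n = N l" "\<And>i. i \<le> n \<Longrightarrow> lideal (F i)" "\<And>i. i \<le> n \<Longrightarrow> F i \<subseteq> N l"
    "\<And>i. i < n \<Longrightarrow> F i \<subseteq> F (Suc i)"
    "\<And>i. i < n \<Longrightarrow> \<exists>k\<in>\<Lambda>. (l, k) \<in> r \<and> k \<noteq> l \<and> mod_iso A (quot_module (L (F (Suc i))) (F i)) (\<Delta> k)"
    by (rule filtration[OF l]) (rule that, assumption+)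
  have "F i \<subseteq> add_span A ?S" if "i \<le> n" for i
    using that
  proof (induct i)
    case 0
    then show ?case using F(1) add_span_zero[of A ?S] by simp
  next
    case (Suc i)
    obtain k where k: "k \<in> \<Lambda>" "(l, k) \<in> r" "k \<noteq> l" and iso: "mod_iso A (quot_module (L (F (Suc i))) (F i)) (\<Delta> k)"
      using F(6)[of i] Suc by auto
    obtain f where f: "f \<in> mod_hom A (quot_module (L (F (Suc i))) (F i)) (\<Delta> k)"
      "bij_betw f (carrier (quot_module (L (F (Suc i))) (F i))) (carrier (\<Delta> k))"
      using iso unfolding mod_iso_def by blast
    have FS: "lideal (F (Suc i))" "lideal (F i)" "F i \<subseteq> F (Suc i)" using F(3,5) Suc by auto
    note q = quot_iso[OF FS k(1) f]
    have "\<pi> k (e k) \<in> carrier (\<Delta> k)" using e_in_Ae[OF k(1)] unfolding carrier_\<Delta> by (rule imageI)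
    then obtain y where y: "y \<in> F (Suc i)" "f (F i +>\<^bsub>A\<^esub> y) = \<pi> k (e k)" using q(2) by blast
    have yA: "y \<in> carrier A" "y \<in> N l" using lidealD(1)[OF FS(1) y(1)] F(4)[of "Suc i"] y(1) Suc by auto
    show ?case
    proof
      fix x assume x: "x \<in> F (Suc i)"
      obtain b where b: "b \<in> \<A> 0" "b \<otimes>\<^bsub>A\<^esub> e k = b" "f (F i +>\<^bsub>A\<^esub> x) = \<pi> k b" by (rule \<Delta>_elt[OF k(1) q(1)[OF x]])
      have bA: "b \<in> carrier A" by (rule \<A>_carrier[OF b(1)])
      have "\<pi> k b = b \<odot>\<^bsub>\<Delta> k\<^esub> \<pi> k (e k)" using \<pi>_smult[OF k(1) bA e_in_Ae[OF k(1)]] b(2) by simp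
      also have "\<dots> = f (F i +>\<^bsub>A\<^esub> (b \<otimes>\<^bsub>A\<^esub> y))" using q(3)[OF bA y(1)] y(2) by simp
      finally obtain t where t: "t \<in> F i" "x = t \<oplus>\<^bsub>A\<^esub> b \<otimes>\<^bsub>A\<^esub> y"
        using q(4)[OF x lidealD(4)[OF FS(1) bA y(1)]] b(3) by auto
      have "b \<otimes>\<^bsub>A\<^esub> (e k \<otimes>\<^bsub>A\<^esub> y) \<in> ?S" using bA k yA(2) by (intro CollectI exI[of _ b] exI[of _ k] exI[of _ y]) simp
      moreover have "b \<otimes>\<^bsub>A\<^esub> (e k \<otimes>\<^bsub>A\<^esub> y) = b \<otimes>\<^bsub>A\<^esub> y" using bA k(1) yA b(2) by (simp flip: A.m_assoc)
      ultimately have "b \<otimes>\<^bsub>A\<^esub> y \<in> add_span A ?S" using add_span_incl[of "b \<otimes>\<^bsub>A\<^esub> (e k \<otimes>\<^bsub>A\<^esub> y)" ?S A] by simp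
      moreover have "t \<in> add_span A ?S" using Suc t(1) by auto
      ultimately show "x \<in> add_span A ?S" unfolding t(2) by (intro add_span_add)
    qed
  qed
  then show ?thesis using x F(2) by blast
qed

text \<open>The components of degree 1 in \<open>N_generated\<close>: since N_l lies in J, the left
  coefficients contribute only their parts of degree 0. Stratification thereby becomes a statement
  about the A_0-module A_1 e_l.\<close>

lemma \<A>_1_generated:
  assumes l: "l \<in> \<Lambda>" and x: "x \<in> \<A> 1" "x \<otimes>\<^bsub>A\<^esub> e l = x"
  shows "x \<in> add_span A {a \<otimes>\<^bsub>A\<^esub> (e k \<otimes>\<^bsub>A\<^esub> w) | a k w. a \<in> \<A> 0 \<and> k \<in> above l \<and> w \<in> \<A> 1}" (is "x \<in> add_span A ?T")
proof -
  let ?S = "{a \<otimes>\<^bsub>A\<^esub> (e k \<otimes>\<^bsub>A\<^esub> w) | a k w. a \<in> carrier A \<and> k \<in> above l \<and> w \<in> N l}"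
  have wA: "w \<in> J" "w \<in> carrier A" if "w \<in> N l" for w using that N_iff[OF l] J_carrier by auto
  have S: "?S \<subseteq> carrier A" using wA(2) by auto
  have T: "?T \<subseteq> carrier A" using \<A>_carrier by auto
  have "x \<in> J" using \<A>_subset_J[OF x(1)] by simp
  then have "x \<in> N l" using N_iff[OF l] x(2) by blast
  then have "x \<in> add_span A ?S" by (rule N_generated[OF l])
  then have "hA 1 x \<in> add_span A ?T"
  proof (rule add_span_image[OF A.abelian_group_axioms A.abelian_group_axioms S])
    show "additive_subgroup (add_span A ?T) A" by (rule A.additive_subgroup_add_span[OF T])
    fix y assume "y \<in> ?S"
    then obtain a k w where y: "y = a \<otimes>\<^bsub>A\<^esub> (e k \<otimes>\<^bsub>A\<^esub> w)" "a \<in> carrier A" "k \<in> above l" "w \<in> N l" by blast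
    have k: "k \<in> \<Lambda>" using y(3) by simp
    have "hA 1 y = hA 0 a \<otimes>\<^bsub>A\<^esub> (e k \<otimes>\<^bsub>A\<^esub> hA 1 w)"
      using hA_1_mult[OF y(2) J_mult_l[OF e_closed[OF k] wA(1)[OF y(4)]]] hA_1_mult[OF e_closed[OF k] wA(1)[OF y(4)]]
        hA_0_homogeneous[OF e_degree[OF k]] by (simp add: y(1))
    moreover have "hA 0 a \<in> \<A> 0" "hA 1 w \<in> \<A> 1" using hA_degree y(2) wA(2)[OF y(4)] by auto
    ultimately have "hA 1 y \<in> ?T" using y(3) by blast
    then show "hA 1 y \<in> add_span A ?T" by (rule add_span_incl)
  qed (simp_all add: GA.hc_add)
  then show ?thesis using x(1) by (simp add: GA.hc_homogeneous)
qed

text \<open>The ends of strictly increasing chains of i steps that start at l. These are the only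
  weights possible for generators of the i-th term of a linear resolution of
  \<open>\<Delta> l\<close>.\<close>

primrec up :: "'l \<Rightarrow> nat \<Rightarrow> 'l set" where
  "up l 0 = {l}"
| "up l (Suc i) = {k \<in> \<Lambda>. \<exists>m\<in>up l i. (m, k) \<in> r \<and> k \<noteq> m}"

lemma po_facts: "l \<in> \<Lambda> \<Longrightarrow> (l, l) \<in> r" "trans r" "antisym r"
  using po by (auto simp: partial_order_on_def preorder_on_def refl_on_def)

lemma up_\<Lambda>: "l \<in> \<Lambda> \<Longrightarrow> k \<in> up l i \<Longrightarrow> k \<in> \<Lambda>"
  by (cases i) auto

lemma up_above: "l \<in> \<Lambda> \<Longrightarrow> k \<in> up l i \<Longrightarrow> (l, k) \<in> r"
proof (induct i arbitrary: k)
  case 0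
  then show ?case using po_facts(1) by simp
next
  case (Suc i)
  then show ?case using po_facts(2) by (auto dest: transD)
qed

text \<open>A strict step enlarges the set of indices below its end point. Hence chains have fewer
  than \<open>card \<Lambda>\<close> steps, which is where this bound on the length of the
  resolutions comes from.\<close>

lemma up_card: "l \<in> \<Lambda> \<Longrightarrow> k \<in> up l i \<Longrightarrow> i < card {m \<in> \<Lambda>. (m, k) \<in> r}"
proof (induct i arbitrary: k)
  case 0
  then have "k \<in> {m \<in> \<Lambda>. (m, k) \<in> r}" using po_facts(1) by simp
  then show ?case using \<Lambda>_finite by (auto simp: card_gt_0_iff)
next
  case (Suc i)
  then obtain m where m: "m \<in> up l i" "(m, k) \<in> r" "k \<noteq> m" and k: "k \<in> \<Lambda>" by auto
  have "{n \<in> \<Lambda>. (n, m) \<in> r} \<subset> {n \<in> \<Lambda>. (n, k) \<in> r}"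
  proof (rule psubsetI)
    show "{n \<in> \<Lambda>. (n, m) \<in> r} \<subseteq> {n \<in> \<Lambda>. (n, k) \<in> r}" using m(2) po_facts(2) by (auto dest: transD)
    have "k \<notin> {n \<in> \<Lambda>. (n, m) \<in> r}" using m(2,3) po_facts(3) by (auto dest: antisymD)
    moreover have "k \<in> {n \<in> \<Lambda>. (n, k) \<in> r}" using k po_facts(1) by simp
    ultimately show "{n \<in> \<Lambda>. (n, m) \<in> r} \<noteq> {n \<in> \<Lambda>. (n, k) \<in> r}" by blast
  qed
  then have "card {n \<in> \<Lambda>. (n, m) \<in> r} < card {n \<in> \<Lambda>. (n, k) \<in> r}"
    by (rule psubset_card_mono[rotated]) (simp add: \<Lambda>_finite)
  then show ?case using Suc(1)[OF Suc(2) m(1)] by linarith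
qed

lemma up_empty:
  assumes "l \<in> \<Lambda>" "card \<Lambda> \<le> i" shows "up l i = {}"
proof -
  have "card {m \<in> \<Lambda>. (m, k) \<in> r} \<le> card \<Lambda>" for k by (rule card_mono[OF \<Lambda>_finite]) auto
  then show ?thesis using up_card[OF assms(1)] assms(2) by (meson equals0I leD le_trans)
qed

end

section \<open>Weights and finiteness of a linear resolution of a standard module\<close>

locale std_resolution = stratified_algebra K A \<A> \<Lambda> e r +
    LR: linear_resolution K A \<A> "std_module A \<Lambda> e r l" "std_grading A \<A> \<Lambda> e r l" R Q \<delta> \<eta>
  for K :: "('k, 'z) ring_scheme" and A :: "('k, 'a) module" and \<A> :: "nat \<Rightarrow> 'a set"
    and \<Lambda> :: "'l set" and e :: "'l \<Rightarrow> 'a" and r :: "'l rel" and l :: 'l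
    and R Q \<delta> \<eta> +
  assumes l: "l \<in> \<Lambda>"
begin

lemma ring_minus_one: "\<ominus>\<^bsub>A\<^esub> \<one>\<^bsub>A\<^esub> \<in> \<A> 0" by (rule \<A>_minus[OF one_degree])

lemma bottom_subset: "{b \<odot>\<^bsub>R i\<^esub> (e k \<odot>\<^bsub>R i\<^esub> z) | b k z. b \<in> \<A> 0 \<and> k \<in> up l j \<and> z \<in> Q i n} \<subseteq> carrier (R i)"
  using \<A>_carrier LR.R.GM.G_carrier up_\<Lambda>[OF l] by auto

text \<open>Induction on i. The differential embeds the generators of R_(i+1) into A_1 times those
  of R_i, where \<open>\<A>_1_generated\<close> raises the weights strictly; the A_0-linear
  retraction then carries this generating set back.\<close>

lemma top_weights:
  "x \<in> Q i (int i) \<Longrightarrow>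
   x \<in> add_span (R i) {b \<odot>\<^bsub>R i\<^esub> (e k \<odot>\<^bsub>R i\<^esub> z) | b k z. b \<in> \<A> 0 \<and> k \<in> up l i \<and> z \<in> Q i (int i)}"
proof (induct i arbitrary: x)
  case 0
  then have x: "x \<in> Q 0 0" by simp
  have xR: "x \<in> carrier (R 0)" by (rule LR.R.GM.G_carrier[OF x])
  have "\<eta> x \<in> std_grading A \<A> \<Lambda> e r l 0" using image_subset_iff[THEN iffD1, OF LR.\<eta>_degree[of 0]] x by blast
  then obtain a where a: "a \<in> \<A> 0" "\<eta> x = \<pi> l (a \<otimes>\<^bsub>A\<^esub> e l)" unfolding std_grading_0 by blast
  have aA: "a \<in> carrier A" by (rule \<A>_carrier[OF a(1)])
  have "\<pi> l (e l) \<in> std_grading A \<A> \<Lambda> e r l 0"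
    unfolding std_grading_0 using e_degree[OF l] e_idem[OF l] by (intro image_eqI[of _ _ "e l"]) simp_all
  then obtain y where y: "y \<in> Q 0 0" "\<eta> y = \<pi> l (e l)" using LR.\<eta>_surj by blast
  have yR: "y \<in> carrier (R 0)" by (rule LR.R.GM.G_carrier[OF y(1)])
  let ?y = "a \<odot>\<^bsub>R 0\<^esub> (e l \<odot>\<^bsub>R 0\<^esub> y)"
  have y': "?y \<in> Q 0 0" by (intro LR.R.G_smult_0 a e_degree l y)
  have "\<eta> ?y = \<eta> x"
    using aA yR l y(2) mod_homD(4)[OF LR.lr(5)] \<pi>_smult[OF l e_closed[OF l] e_in_Ae[OF l]] \<pi>_smult[OF l aA e_in_Ae[OF l]] a(2)
    by simp
  moreover have c: "?y \<in> carrier (R 0)" by (rule LR.R.GM.G_carrier[OF y'])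
  moreover have "x \<ominus>\<^bsub>R 0\<^esub> ?y \<in> Q 0 0" using x y' by (simp add: a_minus_def)
  ultimately have "x \<ominus>\<^bsub>R 0\<^esub> ?y = \<zero>\<^bsub>R 0\<^esub>"
    using xR mod_homD[OF LR.lr(5)] by (intro LR.\<eta>_inj) (simp_all add: a_minus_def mod_hom_minus[OF LR.lr(5,3,1)] LR.M.M.r_neg)
  then have "x = ?y"
    by (metis LR.R.M.M.add.inv_solve_right' LR.R.M.M.l_zero a_minus_def xR c LR.R.M.M.zero_closed)
  moreover have "?y \<in> {b \<odot>\<^bsub>R 0\<^esub> (e k \<odot>\<^bsub>R 0\<^esub> z) | b k z. b \<in> \<A> 0 \<and> k \<in> up l 0 \<and> z \<in> Q 0 (int 0)}"
    using a(1) y(1) by auto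
  ultimately show ?case using add_span_incl[of ?y _ "R 0"] by simp
next
  case (Suc i)
  let ?V = "Q i (int (Suc i))" and ?U = "Q (Suc i) (int (Suc i))"
  let ?T = "{b \<odot>\<^bsub>R i\<^esub> (e k \<odot>\<^bsub>R i\<^esub> z) | b k z. b \<in> \<A> 0 \<and> k \<in> up l (Suc i) \<and> z \<in> ?V}"
  let ?T' = "{b \<odot>\<^bsub>R (Suc i)\<^esub> (e k \<odot>\<^bsub>R (Suc i)\<^esub> z) | b k z. b \<in> \<A> 0 \<and> k \<in> up l (Suc i) \<and> z \<in> ?U}"
  have T: "additive_subgroup (add_span (R i) ?T) (R i)"
    by (rule LR.R.M.M.additive_subgroup_add_span[OF bottom_subset])
  have gen: "a \<odot>\<^bsub>R i\<^esub> y \<in> add_span (R i) ?T" if a: "a \<in> \<A> 1" and y: "y \<in> Q i (int i)" for a y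
  proof -
    have aA: "a \<in> carrier A" by (rule \<A>_carrier[OF a])
    show ?thesis
    proof (rule add_span_image[OF LR.R.M.M.abelian_group_axioms LR.R.M.M.abelian_group_axioms bottom_subset Suc(1)[OF y] _ _ _ T])
      fix y assume "y \<in> {b \<odot>\<^bsub>R i\<^esub> (e k \<odot>\<^bsub>R i\<^esub> z) | b k z. b \<in> \<A> 0 \<and> k \<in> up l i \<and> z \<in> Q i (int i)}"
      then obtain b k z where b: "b \<in> \<A> 0" "k \<in> up l i" "z \<in> Q i (int i)" "y = b \<odot>\<^bsub>R i\<^esub> (e k \<odot>\<^bsub>R i\<^esub> z)" by blast
      have k: "k \<in> \<Lambda>" by (rule up_\<Lambda>[OF l b(2)])
      have bA: "b \<in> carrier A" and zR: "z \<in> carrier (R i)" using b \<A>_carrier LR.R.GM.G_carrier by auto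
      \<comment> \<open>Absorbing b and e_k into the coefficient puts it into A_1 e_k, where
        \<open>\<A>_1_generated\<close> applies with k in place of l.\<close>
      let ?a = "a \<otimes>\<^bsub>A\<^esub> b \<otimes>\<^bsub>A\<^esub> e k"
      let ?S = "{a \<otimes>\<^bsub>A\<^esub> (e k' \<otimes>\<^bsub>A\<^esub> w) | a k' w. a \<in> \<A> 0 \<and> k' \<in> above k \<and> w \<in> \<A> 1}"
      have "?a \<in> \<A> 1" using \<A>_mult[OF \<A>_mult[OF a b(1)] e_degree[OF k]] by simp
      moreover have "?a \<otimes>\<^bsub>A\<^esub> e k = ?a" using aA bA k by (simp add: A.m_assoc)
      ultimately have s: "?a \<in> add_span A ?S" by (rule \<A>_1_generated[OF k])
      have S: "?S \<subseteq> carrier A" using \<A>_carrier by auto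
      have "?a \<odot>\<^bsub>R i\<^esub> z \<in> add_span (R i) ?T"
      proof (rule add_span_image[OF A.abelian_group_axioms LR.R.M.M.abelian_group_axioms S s _ _ _ T])
        fix c assume "c \<in> ?S"
        then obtain c' k' w where c: "c = c' \<otimes>\<^bsub>A\<^esub> (e k' \<otimes>\<^bsub>A\<^esub> w)" "c' \<in> \<A> 0" "k' \<in> above k" "w \<in> \<A> 1" by blast
        have "c \<odot>\<^bsub>R i\<^esub> z = c' \<odot>\<^bsub>R i\<^esub> (e k' \<odot>\<^bsub>R i\<^esub> (w \<odot>\<^bsub>R i\<^esub> z))"
          using c zR \<A>_carrier by (simp add: LR.R.M.smult_assoc1)
        moreover have "w \<odot>\<^bsub>R i\<^esub> z \<in> ?V" using LR.R.G_smult[OF c(4) b(3)] by simp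
        moreover have "k' \<in> up l (Suc i)" using c(3) b(2) by auto
        ultimately have "c \<odot>\<^bsub>R i\<^esub> z \<in> ?T" using c(2) by blast
        then show "c \<odot>\<^bsub>R i\<^esub> z \<in> add_span (R i) ?T" by (rule add_span_incl)
      qed (use zR in \<open>simp_all add: LR.R.M.smult_l_distr\<close>)
      moreover have "?a \<odot>\<^bsub>R i\<^esub> z = a \<odot>\<^bsub>R i\<^esub> y" using b(4) aA bA k zR by (simp add: LR.R.M.smult_assoc1)
      ultimately show "a \<odot>\<^bsub>R i\<^esub> y \<in> add_span (R i) ?T" by simp
    qed (use aA in \<open>simp_all add: LR.R.M.smult_r_distr\<close>)
  qed
  have "\<delta> i x \<in> ?V" using image_subset_iff[THEN iffD1, OF LR.\<delta>_degree] Suc(2) by blast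
  then have "\<delta> i x \<in> Q i (int 1 + int i)" by simp
  then have "\<delta> i x \<in> add_span (R i) {a \<odot>\<^bsub>R i\<^esub> y | a y. a \<in> \<A> 1 \<and> y \<in> Q i (int i)}"
    by (rule LR.R.generated_degree[OF LR.R_generated])
  moreover have "add_span (R i) {a \<odot>\<^bsub>R i\<^esub> y | a y. a \<in> \<A> 1 \<and> y \<in> Q i (int i)} \<subseteq> add_span (R i) ?T"
    by (rule LR.R.M.M.add_span_least[OF T]) (use gen in blast)
  ultimately have dx: "\<delta> i x \<in> add_span (R i) ?T" by blast
  \<comment> \<open>Since x = g(\<delta> x) and g commutes with A_0, in particular with the e_k, the
    description of \<delta> x by weights turns into one of x.\<close>
  obtain g where g: "g \<in> mod_hom A0 ((R i)\<lparr>carrier := ?V\<rparr>) ((R (Suc i))\<lparr>carrier := ?U\<rparr>)"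
    "\<And>x. x \<in> ?U \<Longrightarrow> g (\<delta> i x) = x"
    using LR.\<delta>_split[OF self, of i] by blast
  have gU: "g v \<in> ?U" if "v \<in> ?V" for v using mod_homD(1)[OF g(1)] that by simp
  have gadd: "g (v \<oplus>\<^bsub>R i\<^esub> w) = g v \<oplus>\<^bsub>R (Suc i)\<^esub> g w" if "v \<in> ?V" "w \<in> ?V" for v w
    using mod_homD(3)[OF g(1)] that by simp
  have gsm: "g (a \<odot>\<^bsub>R i\<^esub> v) = a \<odot>\<^bsub>R (Suc i)\<^esub> g v" if "a \<in> \<A> 0" "v \<in> ?V" for a v
    using mod_homD(4)[OF g(1), of a v] that by simp
  have smV: "a \<odot>\<^bsub>R i\<^esub> v \<in> ?V" if "a \<in> \<A> 0" "v \<in> ?V" for a v by (rule LR.R.G_smult_0[OF that])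
  \<comment> \<open>The map g is linear on \<open>?V\<close> only, not on all of R_i. The check on
    generators therefore goes through this subgroup instead of
    \<open>add_span_image\<close>.\<close>
  let ?H = "{v \<in> ?V. g v \<in> add_span (R (Suc i)) ?T'}"
  have "additive_subgroup ?H (R i)"
  proof (rule LR.R.M.M.additive_subgroupI')
    show "?H \<subseteq> carrier (R i)" using LR.R.GM.G_carrier by blast
    have z: "\<zero>\<^bsub>R i\<^esub> \<in> ?V" by (rule LR.R.GM.G.zero_closed)
    have "g (\<zero>\<^bsub>A\<^esub> \<odot>\<^bsub>R i\<^esub> \<zero>\<^bsub>R i\<^esub>) = \<zero>\<^bsub>A\<^esub> \<odot>\<^bsub>R (Suc i)\<^esub> g \<zero>\<^bsub>R i\<^esub>" by (rule gsm[OF \<A>_zero z])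
    then have "g \<zero>\<^bsub>R i\<^esub> = \<zero>\<^bsub>R (Suc i)\<^esub>" using LR.R.GM.G_carrier[OF gU[OF z]] by simp
    then show "\<zero>\<^bsub>R i\<^esub> \<in> ?H" using z add_span_zero[of "R (Suc i)"] by simp
    show "v \<oplus>\<^bsub>R i\<^esub> w \<in> ?H" if "v \<in> ?H" "w \<in> ?H" for v w
      using that gadd[of v w] add_span_add[of "g v" "R (Suc i)" ?T' "g w"] by simp
    show "\<ominus>\<^bsub>R i\<^esub> v \<in> ?H" if "v \<in> ?H" for v
    proof -
      have v: "v \<in> ?V" "g v \<in> add_span (R (Suc i)) ?T'" using that by auto
      have "\<ominus>\<^bsub>R i\<^esub> v = (\<ominus>\<^bsub>A\<^esub> \<one>\<^bsub>A\<^esub>) \<odot>\<^bsub>R i\<^esub> v"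
        using LR.R.M.smult_l_minus[OF A.one_closed LR.R.GM.G_carrier[OF v(1)]] LR.R.GM.G_carrier[OF v(1)] by simp
      moreover have "g ((\<ominus>\<^bsub>A\<^esub> \<one>\<^bsub>A\<^esub>) \<odot>\<^bsub>R i\<^esub> v) = \<ominus>\<^bsub>R (Suc i)\<^esub> g v"
        using gsm[OF ring_minus_one v(1)] LR.R.M.smult_l_minus[OF A.one_closed LR.R.GM.G_carrier[OF gU[OF v(1)]]]
          LR.R.GM.G_carrier[OF gU[OF v(1)]] by simp
      moreover have "\<ominus>\<^bsub>R (Suc i)\<^esub> g v \<in> add_span (R (Suc i)) ?T'"
        by (rule LR.R.M.M.add_span_minus[OF bottom_subset v(2)])
      ultimately show ?thesis using smV[OF ring_minus_one v(1)] by simp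
    qed
  qed
  moreover have "?T \<subseteq> ?H"
  proof
    fix t assume "t \<in> ?T"
    then obtain b k z where b: "b \<in> \<A> 0" "k \<in> up l (Suc i)" "z \<in> ?V" "t = b \<odot>\<^bsub>R i\<^esub> (e k \<odot>\<^bsub>R i\<^esub> z)" by blast
    have k: "e k \<in> \<A> 0" by (rule e_degree[OF up_\<Lambda>[OF l b(2)]])
    have "g t = b \<odot>\<^bsub>R (Suc i)\<^esub> (e k \<odot>\<^bsub>R (Suc i)\<^esub> g z)" unfolding b(4) gsm[OF b(1) smV[OF k b(3)]] gsm[OF k b(3)] ..
    then have "g t \<in> ?T'" using b(1,2) gU[OF b(3)] by blast
    then have "g t \<in> add_span (R (Suc i)) ?T'" by (rule add_span_incl)
    moreover have "t \<in> ?V" unfolding b(4) by (rule smV[OF b(1) smV[OF k b(3)]])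
    ultimately show "t \<in> ?H" by blast
  qed
  ultimately have "add_span (R i) ?T \<subseteq> ?H" by (rule LR.R.M.M.add_span_least)
  then show ?case using dx g(2)[OF Suc(2)] by auto
qed

lemma resolution_generated:
  assumes f: "f \<in> mod_hom A (R i) N'" and N': "left_module A N'"
    and 0: "\<And>y. y \<in> Q i (int i) \<Longrightarrow> f y = \<zero>\<^bsub>N'\<^esub>" and x: "x \<in> carrier (R i)"
  shows "f x = \<zero>\<^bsub>N'\<^esub>"
proof -
  interpret N': left_module A N' by fact
  let ?S = "{a \<odot>\<^bsub>R i\<^esub> x | a x. a \<in> carrier A \<and> x \<in> Q i (int i)}"
  have S: "?S \<subseteq> carrier (R i)" using LR.R.GM.G_carrier by auto
  have xs: "x \<in> add_span (R i) ?S" using LR.R_generated[of i] x by (simp add: generated_in_degree_def)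
  have "f x \<in> {\<zero>\<^bsub>N'\<^esub>}"
  proof (rule add_span_image[OF LR.R.M.M.abelian_group_axioms N'.M.abelian_group_axioms S xs])
    show "additive_subgroup {\<zero>\<^bsub>N'\<^esub>} N'" by (rule N'.M.additive_subgroupI') auto
    fix y assume "y \<in> ?S"
    then show "f y \<in> {\<zero>\<^bsub>N'\<^esub>}" using mod_homD(4)[OF f] LR.R.GM.G_carrier 0 by auto
  qed (simp_all add: mod_homD[OF f])
  then show ?thesis by simp
qed

text \<open>From \<open>card \<Lambda>\<close> steps on there are no weights left, so the generators
  of the term vanish, and with them the term.\<close>

lemma resolution_trivial:
  assumes "card \<Lambda> \<le> i" shows "carrier (R i) = {\<zero>\<^bsub>R i\<^esub>}"
proof -
  have "y = \<zero>\<^bsub>R i\<^esub>" if "y \<in> Q i (int i)" for y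
  proof -
    have "y \<in> add_span (R i) {}" using top_weights[OF that] up_empty[OF l assms] by simp
    then show ?thesis
      by (rule LR.R.M.M.add_span_induct[where P = "\<lambda>y. y = \<zero>\<^bsub>R i\<^esub>"]) auto
  qed
  then have "(\<lambda>x\<in>carrier (R i). x) y = \<zero>\<^bsub>R i\<^esub>" if "y \<in> Q i (int i)" for y
    using that LR.R.GM.G_carrier[OF that] by simp
  then have "(\<lambda>x\<in>carrier (R i). x) x = \<zero>\<^bsub>R i\<^esub>" if "x \<in> carrier (R i)" for x
    by (rule resolution_generated[OF mod_hom_id[OF LR.lr(3)] LR.lr(3) _ that])
  then have "carrier (R i) \<subseteq> {\<zero>\<^bsub>R i\<^esub>}" by auto
  then show ?thesis using LR.R.M.M.zero_closed[of i] by blast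
qed

text \<open>Generators of R_(i+1) have degree i + 1, so their images lie in A_1 times the generators
  of R_i. The ideal \<open>J\<close> acts as zero on \<open>D0\<close>, hence every homomorphism
  into \<open>D0\<close> is a cocycle.\<close>

lemma hom_D0_minimal:
  assumes f: "f \<in> mod_hom A (R i) D0" and x: "x \<in> carrier (R (Suc i))"
  shows "f (\<delta> i x) = \<zero>\<^bsub>D0\<^esub>"
proof -
  interpret D: left_module A D0 by (rule left_module_D0)
  let ?f = "compose (carrier (R (Suc i))) f (\<delta> i)"
  have "?f x = \<zero>\<^bsub>D0\<^esub>"
  proof (rule resolution_generated[OF mod_hom_compose[OF LR.lr(4) f LR.lr(3)] left_module_D0 _ x])
    fix y assume y: "y \<in> Q (Suc i) (int (Suc i))"
    let ?S = "{a \<odot>\<^bsub>R i\<^esub> y | a y. a \<in> \<A> 1 \<and> y \<in> Q i (int i)}"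
    have S: "?S \<subseteq> carrier (R i)" using LR.R.GM.G_carrier \<A>_carrier by auto
    have "\<delta> i y \<in> Q i (int 1 + int i)" using image_subset_iff[THEN iffD1, OF LR.\<delta>_degree] y by fastforce
    then have s: "\<delta> i y \<in> add_span (R i) ?S" by (rule LR.R.generated_degree[OF LR.R_generated])
    have "f (\<delta> i y) \<in> {\<zero>\<^bsub>D0\<^esub>}"
    proof (rule add_span_image[OF LR.R.M.M.abelian_group_axioms D.M.abelian_group_axioms S s])
      show "additive_subgroup {\<zero>\<^bsub>D0\<^esub>} D0" by (rule D.M.additive_subgroupI') auto
      fix z assume "z \<in> ?S"
      then obtain a w where "a \<in> \<A> 1" "w \<in> Q i (int i)" "z = a \<odot>\<^bsub>R i\<^esub> w" by blast
      moreover from this have "f z = a \<odot>\<^bsub>D0\<^esub> f w" "f w \<in> carrier D0"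
        using mod_homD(1,4)[OF f] LR.R.GM.G_carrier \<A>_carrier by auto
      ultimately show "f z \<in> {\<zero>\<^bsub>D0\<^esub>}" using J_smult_D0[OF \<A>_subset_J] by simp
    qed (simp_all add: mod_homD[OF f])
    then show "?f y = \<zero>\<^bsub>D0\<^esub>" using LR.R.GM.G_carrier[OF y] by (simp add: compose_def)
  qed
  then show ?thesis using x by (simp add: compose_def)
qed

text \<open>A generator e_k z is sent into the classes of e_k A_0 e_m. This space is zero unless k
  <= m, while all weights satisfy l <= k; so a nonzero map would force l <= m.\<close>

lemma hom_D0_weight:
  assumes f: "f \<in> mod_hom A (R i) D0" and m: "m \<in> \<Lambda>" "(l, m) \<notin> r"
    and f_weight: "\<And>x. x \<in> carrier (R i) \<Longrightarrow> \<exists>c\<in>\<A> 0. f x = q (c \<otimes>\<^bsub>A\<^esub> e m)" and x: "x \<in> carrier (R i)"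
  shows "f x = \<zero>\<^bsub>D0\<^esub>"
proof (rule resolution_generated[OF f left_module_D0 _ x])
  interpret D: left_module A D0 by (rule left_module_D0)
  let ?S = "{b \<odot>\<^bsub>R i\<^esub> (e k \<odot>\<^bsub>R i\<^esub> z) | b k z. b \<in> \<A> 0 \<and> k \<in> up l i \<and> z \<in> Q i (int i)}"
  fix y assume y: "y \<in> Q i (int i)"
  have "f y \<in> {\<zero>\<^bsub>D0\<^esub>}"
  proof (rule add_span_image[OF LR.R.M.M.abelian_group_axioms D.M.abelian_group_axioms bottom_subset top_weights[OF y]])
    show "additive_subgroup {\<zero>\<^bsub>D0\<^esub>} D0" by (rule D.M.additive_subgroupI') auto
    fix t assume "t \<in> ?S"
    then obtain b k z where b: "b \<in> \<A> 0" "k \<in> up l i" "z \<in> Q i (int i)" "t = b \<odot>\<^bsub>R i\<^esub> (e k \<odot>\<^bsub>R i\<^esub> z)" by blast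
    have k: "k \<in> \<Lambda>" by (rule up_\<Lambda>[OF l b(2)])
    have zR: "z \<in> carrier (R i)" by (rule LR.R.GM.G_carrier[OF b(3)])
    obtain c where c: "c \<in> \<A> 0" "f z = q (c \<otimes>\<^bsub>A\<^esub> e m)" using f_weight[OF zR] by blast
    have "(k, m) \<notin> r" using m(2) up_above[OF l b(2)] transD[OF po_facts(2)] by blast
    then have 0: "e k \<otimes>\<^bsub>A\<^esub> c \<otimes>\<^bsub>A\<^esub> e m = \<zero>\<^bsub>A\<^esub>" by (rule e_mult_e_zero[OF m(1) k _ c(1)])
    have "e k \<odot>\<^bsub>D0\<^esub> f z = q (e k \<otimes>\<^bsub>A\<^esub> c \<otimes>\<^bsub>A\<^esub> e m)"
      using c(2) q_smult[OF e_closed[OF k], of "c \<otimes>\<^bsub>A\<^esub> e m"] \<A>_carrier[OF c(1)] m(1) k by (simp add: A.m_assoc)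
    also have "\<dots> = \<zero>\<^bsub>D0\<^esub>" unfolding 0 by (simp add: q_zero_iff)
    finally have "e k \<odot>\<^bsub>D0\<^esub> f z = \<zero>\<^bsub>D0\<^esub>" .
    then have "f t = \<zero>\<^bsub>D0\<^esub>"
      using b(4) k zR \<A>_carrier[OF b(1)] by (simp add: mod_homD(4)[OF f])
    then show "f t \<in> {\<zero>\<^bsub>D0\<^esub>}" by simp
  qed (simp_all add: mod_homD[OF f])
  then show "f y = \<zero>\<^bsub>D0\<^esub>" by simp
qed

text \<open>Local finiteness makes the generating degree finite-dimensional, and a K-spanning set of
  it generates the term over A.\<close>

lemma resolution_fin_gen: "\<exists>S. finite S \<and> spans A (R i) S"
proof -
  let ?X = "(restrict_scalars A (R i))\<lparr>carrier := Q i (int i)\<rparr>"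
  have rs: "left_module K (restrict_scalars A (R i))" by (rule left_module_restrict_scalars[OF LR.lr(3)])
  interpret rs: left_module K "restrict_scalars A (R i)" by (rule rs)
  have "submodule (Q i (int i)) K (restrict_scalars A (R i))"
    by (rule rs.submoduleI)
      (use LR.R.GM.G_carrier LR.R.G_smult_0[OF sc_degree] in \<open>auto simp: restrict_scalars_def\<close>)
  then have X: "left_module K ?X" by (rule submodule_left_module[OF rs])
  have "fin_dim K ?X" using LR.R_graded[of i] unfolding graded_module_def by blast
  then obtain S where S: "finite S" "spans K ?X S" using fin_dim_iff[OF X] by blast
  interpret X: left_module K ?X by (rule X)
  have SQ: "S \<subseteq> Q i (int i)" using S(2) by (simp add: spans_def)
  have "carrier (R i) \<subseteq> W" if W: "submodule W A (R i)" "S \<subseteq> W" for W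
  proof
    note WD = LR.R.M.submoduleD[OF W(1)]
    have "submodule (W \<inter> Q i (int i)) K ?X"
      by (rule X.submoduleI)
        (use WD LR.R.G_smult_0[OF sc_degree] in \<open>auto simp: restrict_scalars_def\<close>)
    then have QW: "y \<in> W" if "y \<in> Q i (int i)" for y
      using spansD[OF S(2), of "W \<inter> Q i (int i)" y] SQ W(2) that by simp
    fix x assume "x \<in> carrier (R i)"
    then have "x \<in> add_span (R i) {a \<odot>\<^bsub>R i\<^esub> x | a x. a \<in> carrier A \<and> x \<in> Q i (int i)}"
      using LR.R_generated[of i] by (simp add: generated_in_degree_def)
    moreover have "add_span (R i) {a \<odot>\<^bsub>R i\<^esub> x | a x. a \<in> carrier A \<and> x \<in> Q i (int i)} \<subseteq> W"
      by (rule LR.R.M.M.add_span_least[OF LR.R.M.submodule_additive_subgroup[OF W(1)]]) (use WD(5) QW in blast)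
    ultimately show "x \<in> W" by blast
  qed
  then have "spans A (R i) S" using SQ LR.R.GM.G_carrier by (auto simp: spans_def)
  then show ?thesis using S(1) by blast
qed

end

subsection \<open>The Yoneda algebra of the degree-zero part\<close>

context stratified_algebra
begin

text \<open>Right multiplication on A_0 by an arbitrary element. The case c = e_l is the projection
  in \<open>degree_zero_proj\<close>; general c is needed to describe the whole degree-zero part of
  \<Gamma>.\<close>

definition rmult :: "'a \<Rightarrow> 'a set \<Rightarrow> 'a set" where
  "rmult c = (\<lambda>U\<in>carrier D0. \<Union>x\<in>U. J +>\<^bsub>A\<^esub> (x \<otimes>\<^bsub>A\<^esub> c))"

lemma degree_zero_proj_eq: "degree_zero_proj A \<A> e l = rmult (e l)"
  by (simp add: degree_zero_proj_def rmult_def)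

lemma rmult_q:
  assumes c: "c \<in> carrier A" and a: "a \<in> carrier A" shows "rmult c (q a) = q (a \<otimes>\<^bsub>A\<^esub> c)"
proof -
  have "q (x \<otimes>\<^bsub>A\<^esub> c) = q (a \<otimes>\<^bsub>A\<^esub> c)" if x: "x \<in> q a" for x
  proof -
    obtain j where j: "j \<in> J" "x = j \<oplus>\<^bsub>A\<^esub> a" using x by (auto simp: a_r_coset_def')
    have jA: "j \<in> carrier A" by (rule J_carrier[OF j(1)])
    have "x \<otimes>\<^bsub>A\<^esub> c \<ominus>\<^bsub>A\<^esub> a \<otimes>\<^bsub>A\<^esub> c = j \<otimes>\<^bsub>A\<^esub> c"
      using j jA a c by (simp add: A.l_distr a_minus_def A.a_assoc A.r_neg)
    then show ?thesis using J_mult_r[OF j(1) c] j jA a c by (subst q_eq_iff) auto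
  qed
  then have "(\<Union>x\<in>q a. q (x \<otimes>\<^bsub>A\<^esub> c)) = (\<Union>x\<in>q a. q (a \<otimes>\<^bsub>A\<^esub> c))" by (rule SUP_cong[OF refl])
  moreover have "a = \<zero>\<^bsub>A\<^esub> \<oplus>\<^bsub>A\<^esub> a" using a by simp
  then have "a \<in> q a" using J_zero by (force simp: a_r_coset_def')
  ultimately show ?thesis using a by (auto simp: rmult_def)
qed

lemma rmult_hom: assumes c: "c \<in> carrier A" shows "rmult c \<in> mod_hom A D0 D0"
proof (rule mod_homI)
  fix x assume "x \<in> carrier D0"
  then obtain a where a: "a \<in> \<A> 0" "x = q a" by (rule D0_elt)
  have aA: "a \<in> carrier A" by (rule \<A>_carrier[OF a(1)])
  show "rmult c x \<in> carrier D0" using aA c a by (simp add: rmult_q)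
  show "rmult c (x \<oplus>\<^bsub>D0\<^esub> y) = rmult c x \<oplus>\<^bsub>D0\<^esub> rmult c y" if y: "y \<in> carrier D0" for y
  proof -
    obtain b where b: "b \<in> \<A> 0" "y = q b" using y by (rule D0_elt)
    then show ?thesis using a aA \<A>_carrier[OF b(1)] c by (simp add: rmult_q q_add A.l_distr)
  qed
  show "rmult c (b \<odot>\<^bsub>D0\<^esub> x) = b \<odot>\<^bsub>D0\<^esub> rmult c x" if "b \<in> carrier A" for b
    using a aA c that by (simp add: rmult_q q_smult A.m_assoc)
qed (simp add: rmult_def)

text \<open>\<open>\<Delta> l\<close> is A_0 e_l, realised as a direct summand of A_0: u projects, v
  embeds, and v u is right multiplication by e_l. Both maps are defined through the unique
  representatives of degree 0.\<close>

lemma \<Delta>_summand: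
  assumes l: "l \<in> \<Lambda>"
  obtains u v where "u \<in> mod_hom A D0 (\<Delta> l)" "v \<in> mod_hom A (\<Delta> l) D0"
    "\<And>x. x \<in> carrier D0 \<Longrightarrow> v (u x) = rmult (e l) x"
proof -
  have emb: "a = b" if "a \<in> \<A> 0" "a \<otimes>\<^bsub>A\<^esub> e l = a" "b \<in> \<A> 0" "b \<otimes>\<^bsub>A\<^esub> e l = b" "\<pi> l a = \<pi> l b" for a b
  proof -
    have "a \<in> Ae l" "b \<in> Ae l" using that \<A>_carrier l Ae_iff by blast+
    then have "a \<ominus>\<^bsub>A\<^esub> b \<in> N l" using that(5) by (intro \<pi>_eqD[OF l])
    moreover have "a \<ominus>\<^bsub>A\<^esub> b \<in> \<A> 0" using \<A>_add[OF that(1) \<A>_minus[OF that(3)]] by (simp add: a_minus_def)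
    ultimately have "a \<ominus>\<^bsub>A\<^esub> b = \<zero>\<^bsub>A\<^esub>" by (rule N_degree_0[OF l])
    then show ?thesis using that(1,3) \<A>_carrier by simp
  qed
  define u where "u x = \<pi> l ((THE a. a \<in> \<A> 0 \<and> x = q a) \<otimes>\<^bsub>A\<^esub> e l)" for x
  define v where "v y = q (THE a. a \<in> \<A> 0 \<and> a \<otimes>\<^bsub>A\<^esub> e l = a \<and> y = \<pi> l a)" for y
  have u: "u (q a) = \<pi> l (a \<otimes>\<^bsub>A\<^esub> e l)" if a: "a \<in> \<A> 0" for a
  proof -
    have "(THE b. b \<in> \<A> 0 \<and> q a = q b) = a" using a q_inj by (intro the_equality) auto
    then show ?thesis by (simp add: u_def)
  qed
  have v: "v (\<pi> l a) = q a" if a: "a \<in> \<A> 0" "a \<otimes>\<^bsub>A\<^esub> e l = a" for a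
  proof -
    have "(THE b. b \<in> \<A> 0 \<and> b \<otimes>\<^bsub>A\<^esub> e l = b \<and> \<pi> l a = \<pi> l b) = a"
      using a emb by (intro the_equality) auto
    then show ?thesis by (simp add: v_def)
  qed
  have el: "e l \<in> \<A> 0" by (rule e_degree[OF l])
  have ae: "a \<otimes>\<^bsub>A\<^esub> e l \<in> \<A> 0" if "a \<in> \<A> 0" for a by (rule \<A>_mult_0[OF that el])
  have uA: "u (q a) = \<pi> l (a \<otimes>\<^bsub>A\<^esub> e l)" if a: "a \<in> carrier A" for a
    using u[OF hA_degree[OF a]] q_hA_0[OF a] \<pi>_hA_0[OF a l] by simp
  have qJ: "q (hA 0 a) = q a" if "a \<in> carrier A" for a by (rule q_hA_0[OF that])
  have vA: "v (\<pi> l (a \<otimes>\<^bsub>A\<^esub> e l)) = q (a \<otimes>\<^bsub>A\<^esub> e l)" if a: "a \<in> carrier A" for a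
  proof -
    have "hA 0 a \<otimes>\<^bsub>A\<^esub> e l = hA 0 (a \<otimes>\<^bsub>A\<^esub> e l)"
      using hA_0_mult[OF a e_closed[OF l]] hA_0_homogeneous[OF el] by simp
    then have "q (hA 0 a \<otimes>\<^bsub>A\<^esub> e l) = q (a \<otimes>\<^bsub>A\<^esub> e l)" using qJ a l by simp
    moreover have "hA 0 a \<otimes>\<^bsub>A\<^esub> e l \<otimes>\<^bsub>A\<^esub> e l = hA 0 a \<otimes>\<^bsub>A\<^esub> e l" using a l by (simp add: A.m_assoc)
    ultimately show ?thesis using v[OF ae[OF hA_degree[OF a]]] \<pi>_hA_0[OF a l] by simp
  qed
  have Ael: "a \<otimes>\<^bsub>A\<^esub> e l \<in> Ae l" if "a \<in> carrier A" for a by (rule Ae_mult[OF l that])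
  have uh: "restrict u (carrier D0) \<in> mod_hom A D0 (\<Delta> l)"
  proof (rule mod_hom_restrictI[OF left_module_D0])
    fix x assume "x \<in> carrier D0"
    then obtain a where a: "a \<in> carrier A" "x = q a" by (auto simp: carrier_D0)
    show "u x \<in> carrier (\<Delta> l)" unfolding a(2) uA[OF a(1)] carrier_\<Delta> using Ael[OF a(1)] by (rule imageI)
    show "u (x \<oplus>\<^bsub>D0\<^esub> y) = u x \<oplus>\<^bsub>\<Delta> l\<^esub> u y" if y: "y \<in> carrier D0" for y
    proof -
      obtain b where b: "b \<in> carrier A" "y = q b" using y by (auto simp: carrier_D0)
      show ?thesis using a b l \<pi>_add[OF l Ael[OF a(1)] Ael[OF b(1)]] by (simp add: q_add uA A.l_distr)
    qed
    show "u (c \<odot>\<^bsub>D0\<^esub> x) = c \<odot>\<^bsub>\<Delta> l\<^esub> u x" if "c \<in> carrier A" for c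
      using a that l \<pi>_smult[OF l that Ael[OF a(1)]] by (simp add: q_smult uA A.m_assoc)
  qed
  have vh: "restrict v (carrier (\<Delta> l)) \<in> mod_hom A (\<Delta> l) D0"
  proof (rule mod_hom_restrictI[OF left_module_\<Delta>[OF l]])
    fix x assume "x \<in> carrier (\<Delta> l)"
    then obtain a where a: "a \<in> carrier A" "x = \<pi> l (a \<otimes>\<^bsub>A\<^esub> e l)" unfolding carrier_\<Delta> by blast
    show "v x \<in> carrier D0" using a l by (simp add: vA)
    show "v (x \<oplus>\<^bsub>\<Delta> l\<^esub> y) = v x \<oplus>\<^bsub>D0\<^esub> v y" if y: "y \<in> carrier (\<Delta> l)" for y
    proof -
      obtain b where b: "b \<in> carrier A" "y = \<pi> l (b \<otimes>\<^bsub>A\<^esub> e l)" using y unfolding carrier_\<Delta> by blast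
      have "x \<oplus>\<^bsub>\<Delta> l\<^esub> y = \<pi> l ((a \<oplus>\<^bsub>A\<^esub> b) \<otimes>\<^bsub>A\<^esub> e l)"
        using \<pi>_add[OF l Ael[OF a(1)] Ael[OF b(1)]] a b l by (simp add: A.l_distr)
      then show ?thesis using a b l vA[of "a \<oplus>\<^bsub>A\<^esub> b"] by (simp add: vA q_add A.l_distr)
    qed
    show "v (c \<odot>\<^bsub>\<Delta> l\<^esub> x) = c \<odot>\<^bsub>D0\<^esub> v x" if c: "c \<in> carrier A" for c
    proof -
      have "c \<odot>\<^bsub>\<Delta> l\<^esub> x = \<pi> l ((c \<otimes>\<^bsub>A\<^esub> a) \<otimes>\<^bsub>A\<^esub> e l)"
        using \<pi>_smult[OF l c Ael[OF a(1)]] a c l by (simp add: A.m_assoc)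
      then show ?thesis using a c l vA[of "c \<otimes>\<^bsub>A\<^esub> a"] by (simp add: vA q_smult A.m_assoc)
    qed
  qed
  show thesis
  proof (rule that[OF uh vh])
    fix x assume x: "x \<in> carrier D0"
    then obtain a where a: "a \<in> carrier A" "x = q a" by (auto simp: carrier_D0)
    show "restrict v (carrier (\<Delta> l)) (restrict u (carrier D0) x) = rmult (e l) x"
      using x a l vA uA mod_homD(1)[OF uh x] by (simp add: rmult_q)
  qed
qed

end

section \<open>Comparison of an arbitrary resolution of A_0 with the linear resolutions of the
  standard modules\<close>

locale ext_comparison = stratified_algebra K A \<A> \<Lambda> e r + X: ext_setting K A "degree_zero_module A \<A>" P d \<epsilon>
  for K :: "('k, 'z) ring_scheme" and A :: "('k, 'a) module" and \<A> :: "nat \<Rightarrow> 'a set"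
    and \<Lambda> :: "'l set" and e :: "'l \<Rightarrow> 'a" and r :: "'l rel"
    and P :: "nat \<Rightarrow> ('a, 'p) module" and d \<epsilon>
begin

abbreviation w :: "'a \<Rightarrow> ('p \<Rightarrow> 'a set) set" where "w c \<equiv> X.cl 0 (X.cmp 0 (rmult c) \<epsilon>)"
abbreviation ym where "ym \<equiv> yoneda_product A P d \<epsilon> D0"
abbreviation \<Gamma> where "\<Gamma> \<equiv> X.GP.conv_algebra"

definition W :: "'a \<Rightarrow> nat \<Rightarrow> ('p \<Rightarrow> 'a set) set" where
  "W c = (\<lambda>i. if i = 0 then w c else \<zero>\<^bsub>X.E i\<^esub>)"

lemma ext_of_endo_W: "ext_of_endo A P d \<epsilon> D0 (degree_zero_proj A \<A> e l) = W (e l)"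
  by (simp add: X.ext_of_endo_eq degree_zero_proj_eq W_def)

lemma wZ: "c \<in> carrier A \<Longrightarrow> X.cmp 0 (rmult c) \<epsilon> \<in> X.Z 0"
  by (rule X.endo_Z[OF rmult_hom])

lemma w_closed [simp]: "c \<in> carrier A \<Longrightarrow> w c \<in> carrier (X.E 0)"
  by (rule X.cl_closed[OF wZ])

lemma \<epsilon>_closed: "x \<in> carrier (P 0) \<Longrightarrow> \<epsilon> x \<in> carrier D0"
  by (rule mod_homD(1)[OF X.r(5)])

lemma w_eq_iff:
  assumes c: "c \<in> \<A> 0" "c' \<in> \<A> 0" and eq: "w c = w c'" shows "c = c'"
proof -
  have cA: "c \<in> carrier A" "c' \<in> carrier A" using c \<A>_carrier by auto
  have "X.cmp 0 (rmult c) \<epsilon> \<in> X.cl 0 (X.cmp 0 (rmult c') \<epsilon>)"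
    using X.cl_self[OF wZ[OF cA(1)]] eq by simp
  then have "X.cmp 0 (rmult c) \<epsilon> = \<zero>\<^bsub>X.H 0\<^esub> \<oplus>\<^bsub>X.H 0\<^esub> X.cmp 0 (rmult c') \<epsilon>"
    using X.cl_memD(2)[OF wZ[OF cA(2)]] X.B_0 by auto
  also have "\<dots> = X.cmp 0 (rmult c') \<epsilon>"
    using wZ[OF cA(2)] by (intro X.H.M.l_zero) (simp add: X.Z_iff)
  finally have eq': "X.cmp 0 (rmult c) \<epsilon> = X.cmp 0 (rmult c') \<epsilon>" .
  have "q \<one>\<^bsub>A\<^esub> \<in> \<epsilon> ` carrier (P 0)" using X.r(6) by simp
  then obtain y where y: "y \<in> carrier (P 0)" "\<epsilon> y = q \<one>\<^bsub>A\<^esub>" by auto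
  have "rmult c (q \<one>\<^bsub>A\<^esub>) = rmult c' (q \<one>\<^bsub>A\<^esub>)" using fun_cong[OF eq', of y] y by (simp add: compose_def)
  then have "q c = q c'" using cA by (simp add: rmult_q)
  then show ?thesis by (rule q_inj[OF c])
qed

text \<open>By exactness at P_0 a cocycle of degree 0 factors through \<epsilon>. The factor is an
  endomorphism of A_0, which is cyclic, so it is right multiplication by a representative of the
  value at the class of 1.\<close>

lemma w_surj:
  assumes "x \<in> carrier (X.E 0)" shows "\<exists>c\<in>\<A> 0. x = w c"
proof -
  obtain f where f: "f \<in> X.Z 0" "x = X.cl 0 f" using assms by (auto simp: X.carrier_E)
  have fh: "f \<in> mod_hom A (P 0) D0" using f by (simp add: X.Z_iff)
  have f0: "f z = \<zero>\<^bsub>D0\<^esub>" if z: "z \<in> carrier (P 0)" "\<epsilon> z = \<zero>\<^bsub>D0\<^esub>" for z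
  proof -
    obtain y where "y \<in> carrier (P (Suc 0))" "z = d 0 y" using X.r(7)[of z] z by auto
    then show ?thesis using f(1) by (simp add: X.Z_iff)
  qed
  have fwd: "f y = f y'" if y: "y \<in> carrier (P 0)" "y' \<in> carrier (P 0)" "\<epsilon> y = \<epsilon> y'" for y y'
  proof -
    have "\<epsilon> (y \<oplus>\<^bsub>P 0\<^esub> \<ominus>\<^bsub>P 0\<^esub> y') = \<zero>\<^bsub>D0\<^esub>"
      using y \<epsilon>_closed by (simp add: mod_homD(3)[OF X.r(5)] mod_hom_minus[OF X.r(5) X.r(3) X.r(1)] X.M.M.r_neg)
    then have "f (y \<oplus>\<^bsub>P 0\<^esub> \<ominus>\<^bsub>P 0\<^esub> y') = \<zero>\<^bsub>D0\<^esub>" using y by (intro f0) auto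
    then have "f y \<oplus>\<^bsub>D0\<^esub> \<ominus>\<^bsub>D0\<^esub> f y' = \<zero>\<^bsub>D0\<^esub>"
      using y by (simp add: mod_homD(3)[OF fh] mod_hom_minus[OF fh X.r(3) X.r(1)])
    then show ?thesis
      using mod_homD(1)[OF fh] y by (metis X.M.M.add.inv_closed X.M.M.add.inv_solve_right' X.M.M.l_zero X.M.M.zero_closed)
  qed
  have "q \<one>\<^bsub>A\<^esub> \<in> \<epsilon> ` carrier (P 0)" using X.r(6) by simp
  then obtain y where y: "y \<in> carrier (P 0)" "\<epsilon> y = q \<one>\<^bsub>A\<^esub>" by auto
  obtain c where c: "c \<in> \<A> 0" "f y = q c" by (rule D0_elt[OF mod_homD(1)[OF fh y(1)]])
  have "f = X.cmp 0 (rmult c) \<epsilon>"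
  proof (rule mod_hom_ext[OF fh])
    show "X.cmp 0 (rmult c) \<epsilon> \<in> mod_hom A (P 0) D0" using wZ[OF \<A>_carrier[OF c(1)]] by (simp add: X.Z_iff)
    fix x assume x: "x \<in> carrier (P 0)"
    obtain a where a: "a \<in> \<A> 0" "\<epsilon> x = q a" by (rule D0_elt[OF \<epsilon>_closed[OF x]])
    have aA: "a \<in> carrier A" by (rule \<A>_carrier[OF a(1)])
    have "\<epsilon> (a \<odot>\<^bsub>P 0\<^esub> y) = \<epsilon> x" using a(2) y aA by (simp add: mod_homD(4)[OF X.r(5)] q_smult)
    then have "f x = f (a \<odot>\<^bsub>P 0\<^esub> y)" using x y aA by (intro fwd) auto
    also have "\<dots> = q (a \<otimes>\<^bsub>A\<^esub> c)" using y aA c \<A>_carrier[OF c(1)] by (simp add: mod_homD(4)[OF fh] q_smult)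
    also have "\<dots> = X.cmp 0 (rmult c) \<epsilon> x" using x a(2) aA \<A>_carrier[OF c(1)] by (simp add: compose_def rmult_q)
    finally show "f x = X.cmp 0 (rmult c) \<epsilon> x" .
  qed
  then show ?thesis using f(2) c(1) by blast
qed

lemma w_add:
  assumes "c \<in> carrier A" "c' \<in> carrier A" shows "w c \<oplus>\<^bsub>X.E 0\<^esub> w c' = w (c \<oplus>\<^bsub>A\<^esub> c')"
proof -
  have "rmult c x \<oplus>\<^bsub>D0\<^esub> rmult c' x = rmult (c \<oplus>\<^bsub>A\<^esub> c') x" if "x \<in> carrier D0" for x
    using that assms by (auto simp: carrier_D0 rmult_q q_add A.r_distr)
  then have "X.cmp 0 (rmult c) \<epsilon> \<oplus>\<^bsub>X.H 0\<^esub> X.cmp 0 (rmult c') \<epsilon> = X.cmp 0 (rmult (c \<oplus>\<^bsub>A\<^esub> c')) \<epsilon>"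
    using \<epsilon>_closed by (auto simp: X.add_H compose_def restrict_def fun_eq_iff)
  then show ?thesis using X.cl_add[OF wZ[OF assms(1)] wZ[OF assms(2)]] by simp
qed

text \<open>The order is reversed because right multiplications compose contravariantly: the
  degree-zero part of \<Gamma> is the opposite ring of A_0.\<close>

lemma w_mult:
  assumes "c \<in> carrier A" "c' \<in> carrier A" shows "ym 0 0 (w c) (w c') = w (c' \<otimes>\<^bsub>A\<^esub> c)"
proof -
  have "rmult c (rmult c' x) = rmult (c' \<otimes>\<^bsub>A\<^esub> c) x" if "x \<in> carrier D0" for x
    using that assms by (auto simp: carrier_D0 rmult_q A.m_assoc)
  then have "X.cmp 0 (rmult c) (X.cmp 0 (rmult c') \<epsilon>) = X.cmp 0 (rmult (c' \<otimes>\<^bsub>A\<^esub> c)) \<epsilon>"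
    using \<epsilon>_closed by (auto simp: compose_def restrict_def fun_eq_iff)
  then show ?thesis using X.yoneda_endo_l[OF rmult_hom[OF assms(1)] wZ[OF assms(2)]] by simp
qed

lemma w_one: "w \<one>\<^bsub>A\<^esub> = X.cl 0 (X.cmp 0 (\<lambda>x\<in>carrier D0. x) \<epsilon>)"
proof -
  have "rmult \<one>\<^bsub>A\<^esub> x = x" if "x \<in> carrier D0" for x
    using that by (auto simp: carrier_D0 rmult_q)
  then have "X.cmp 0 (rmult \<one>\<^bsub>A\<^esub>) \<epsilon> = X.cmp 0 (\<lambda>x\<in>carrier D0. x) \<epsilon>"
    using \<epsilon>_closed by (auto simp: compose_def restrict_def fun_eq_iff)
  then show ?thesis by simp
qed

lemma w_zero: "w \<zero>\<^bsub>A\<^esub> = \<zero>\<^bsub>X.E 0\<^esub>"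
  using w_add[OF A.zero_closed A.zero_closed] w_closed[OF A.zero_closed]
  by (metis A.l_zero A.zero_closed X.E.Q.M.add.r_cancel_one')

lemma w_sum:
  assumes "finite S" "f \<in> S \<rightarrow> carrier A" shows "finsum (X.E 0) (\<lambda>s. w (f s)) S = w (finsum A f S)"
  using assms by (induct S) (auto simp: w_zero w_add Pi_iff A.finsum_closed)

text \<open>Right Peirce decomposition. It reduces vanishing and finite dimension of Ext to the
  components x e_l, which factor through a linear resolution.\<close>

lemma component_sum:
  assumes "x \<in> carrier (X.E i)"
  shows "finsum (X.E i) (\<lambda>l. ym i 0 x (w (e l))) \<Lambda> = x"
proof -
  have "x = ym i 0 x (w (finsum A e \<Lambda>))" using X.GP.unit_r[OF assms] by (simp add: w_one e_sum)
  also have "\<dots> = ym i 0 x (finsum (X.E 0) (\<lambda>l. w (e l)) \<Lambda>)" using \<Lambda>_finite by (subst w_sum) auto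
  also have "\<dots> = finsum (X.E (i + 0)) (\<lambda>l. ym i 0 x (w (e l))) \<Lambda>"
    using assms \<Lambda>_finite by (intro X.GP.sum_r) auto
  finally show ?thesis by simp
qed

text \<open>Let \<alpha> : P -> R lift the projection A_0 -> \<open>\<Delta> l\<close> and \<beta> :
  R -> P the embedding back. Then \<beta> \<alpha> lifts right multiplication by e_l and may serve
  as the lift in the Yoneda product, so [f] times the idempotent is the class of f \<beta>
  \<alpha>.\<close>

lemma factorization:
  assumes l: "l \<in> \<Lambda>"
  obtains R Q \<delta> \<eta> \<alpha> \<beta> where "std_resolution K A \<A> \<Lambda> e r l R Q \<delta> \<eta>"
    "\<And>i. \<alpha> i \<in> mod_hom A (P i) (R i)" "\<And>i. \<beta> i \<in> mod_hom A (R i) (P i)"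
    "\<And>i x. x \<in> carrier (P (Suc i)) \<Longrightarrow> \<delta> i (\<alpha> (Suc i) x) = \<alpha> i (d i x)"
    "\<And>i f. f \<in> X.Z i \<Longrightarrow> ym i 0 (X.cl i f) (w (e l)) = X.cl i (X.cmp i (compose (carrier (R i)) f (\<beta> i)) (\<alpha> i))"
proof -
  obtain R Q \<delta> \<eta> where LR: "linear_resolution K A \<A> (\<Delta> l) (std_grading A \<A> \<Lambda> e r l) R Q \<delta> \<eta>"
    using linear_resolution_\<Delta>[OF l] by (elim exE)
  have SR: "std_resolution K A \<A> \<Lambda> e r l R Q \<delta> \<eta>"
    by (rule std_resolution.intro[OF stratified_algebra_axioms LR std_resolution_axioms.intro[OF l]])
  interpret SR: std_resolution K A \<A> \<Lambda> e r l R Q \<delta> \<eta> by (rule SR)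
  note lr = SR.LR.lr
  obtain u v where u: "u \<in> mod_hom A D0 (\<Delta> l)" and v: "v \<in> mod_hom A (\<Delta> l) D0"
    and vu: "\<And>x. x \<in> carrier D0 \<Longrightarrow> v (u x) = rmult (e l) x"
    by (rule \<Delta>_summand[OF l]) (rule that, assumption+)
  interpret C1: chain_map_setting A P d "\<Delta> l" R \<delta> \<eta>
    by (intro chain_map_setting.intro X.r(2) X.r(4) SR.LR.lres) (rule X.r(10))
  interpret C2: chain_map_setting A R \<delta> D0 P d \<epsilon>
    by (intro chain_map_setting.intro lr(2) lr(4) X.res) (rule lr(10))
  have u0: "u \<zero>\<^bsub>D0\<^esub> = \<zero>\<^bsub>\<Delta> l\<^esub>" by (rule mod_hom_zero[OF u X.r(1) lr(1)])
  have v0: "v \<zero>\<^bsub>\<Delta> l\<^esub> = \<zero>\<^bsub>D0\<^esub>" by (rule mod_hom_zero[OF v lr(1) X.r(1)])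
  have "\<exists>\<alpha>. (\<forall>m. \<alpha> m \<in> mod_hom A (P m) (R m)) \<and> (\<forall>x\<in>carrier (P 0). \<eta> (\<alpha> 0 x) = compose (carrier (P 0)) u \<epsilon> x) \<and>
      (\<forall>m. \<forall>x\<in>carrier (P (Suc m)). \<delta> m (\<alpha> (Suc m) x) = \<alpha> m (d m x))"
    by (rule C1.chain_map_exists[OF mod_hom_compose[OF X.r(5) u X.r(3)]]) (simp add: compose_def X.r(9) u0)
  then obtain \<alpha> where \<alpha>': "(\<forall>m. \<alpha> m \<in> mod_hom A (P m) (R m)) \<and> (\<forall>x\<in>carrier (P 0). \<eta> (\<alpha> 0 x) = compose (carrier (P 0)) u \<epsilon> x) \<and>
      (\<forall>m. \<forall>x\<in>carrier (P (Suc m)). \<delta> m (\<alpha> (Suc m) x) = \<alpha> m (d m x))" ..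
  have \<alpha>: "\<And>m. \<alpha> m \<in> mod_hom A (P m) (R m)"
    "\<And>x. x \<in> carrier (P 0) \<Longrightarrow> \<eta> (\<alpha> 0 x) = u (\<epsilon> x)"
    "\<And>m x. x \<in> carrier (P (Suc m)) \<Longrightarrow> \<delta> m (\<alpha> (Suc m) x) = \<alpha> m (d m x)"
    using \<alpha>' by (simp_all add: compose_def)
  have dc: "\<delta> 0 x \<in> carrier (R 0)" if "x \<in> carrier (R (Suc 0))" for x by (rule mod_homD(1)[OF lr(4) that])
  have "\<exists>\<beta>. (\<forall>m. \<beta> m \<in> mod_hom A (R m) (P m)) \<and> (\<forall>x\<in>carrier (R 0). \<epsilon> (\<beta> 0 x) = compose (carrier (R 0)) v \<eta> x) \<and>
      (\<forall>m. \<forall>x\<in>carrier (R (Suc m)). d m (\<beta> (Suc m) x) = \<beta> m (\<delta> m x))"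
    by (rule C2.chain_map_exists[OF mod_hom_compose[OF lr(5) v lr(3)]]) (simp add: compose_def lr(9) v0 dc)
  then obtain \<beta> where \<beta>': "(\<forall>m. \<beta> m \<in> mod_hom A (R m) (P m)) \<and> (\<forall>x\<in>carrier (R 0). \<epsilon> (\<beta> 0 x) = compose (carrier (R 0)) v \<eta> x) \<and>
      (\<forall>m. \<forall>x\<in>carrier (R (Suc m)). d m (\<beta> (Suc m) x) = \<beta> m (\<delta> m x))" ..
  have \<beta>: "\<And>m. \<beta> m \<in> mod_hom A (R m) (P m)"
    "\<And>x. x \<in> carrier (R 0) \<Longrightarrow> \<epsilon> (\<beta> 0 x) = v (\<eta> x)"
    "\<And>m x. x \<in> carrier (R (Suc m)) \<Longrightarrow> d m (\<beta> (Suc m) x) = \<beta> m (\<delta> m x)"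
    using \<beta>' by (simp_all add: compose_def)
  have \<alpha>c: "\<alpha> m x \<in> carrier (R m)" if "x \<in> carrier (P m)" for m x by (rule mod_homD(1)[OF \<alpha>(1) that])
  have lift: "chain_lift A P d \<epsilon> 0 (X.cmp 0 (rmult (e l)) \<epsilon>) (\<lambda>m. X.cmp m (\<beta> m) (\<alpha> m))"
    unfolding chain_lift_def
  proof (intro conjI allI ballI)
    show "X.cmp m (\<beta> m) (\<alpha> m) \<in> mod_hom A (P (0 + m)) (P m)" for m
      using mod_hom_compose[OF \<alpha>(1) \<beta>(1) X.r(3)] by simp
    show "\<epsilon> (X.cmp 0 (\<beta> 0) (\<alpha> 0) x) = X.cmp 0 (rmult (e l)) \<epsilon> x" if "x \<in> carrier (P 0)" for x
      using that \<alpha>(2)[OF that] \<beta>(2)[OF \<alpha>c[OF that]] vu[OF \<epsilon>_closed[OF that]] by (simp add: compose_def)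
    show "d m (X.cmp (Suc m) (\<beta> (Suc m)) (\<alpha> (Suc m)) x) = X.cmp m (\<beta> m) (\<alpha> m) (d (0 + m) x)"
      if "x \<in> carrier (P (Suc (0 + m)))" for m x
      using that \<alpha>(3)[of x m] \<beta>(3)[OF \<alpha>c, of x m] by (simp add: compose_def)
  qed
  show thesis
  proof (rule that[OF SR \<alpha>(1) \<beta>(1) \<alpha>(3)])
    fix i f assume f: "f \<in> X.Z i"
    have "X.cmp i f (X.cmp i (\<beta> i) (\<alpha> i)) = X.cmp i (compose (carrier (R i)) f (\<beta> i)) (\<alpha> i)"
      using \<alpha>c by (auto simp: compose_def restrict_def fun_eq_iff)
    then show "ym i 0 (X.cl i f) (w (e l)) = X.cl i (X.cmp i (compose (carrier (R i)) f (\<beta> i)) (\<alpha> i))"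
      using X.yoneda_product_cl[OF f wZ[OF e_closed[OF l]] lift] by simp
  qed
qed

text \<open>Minimality of R is used here: any homomorphism from R_i to A_0, whatever its origin,
  becomes a cocycle on P after composition with \<alpha>.\<close>

lemma cmp_\<alpha>_Z:
  assumes SR: "std_resolution K A \<A> \<Lambda> e r l R Q \<delta> \<eta>"
    and \<alpha>: "\<And>i. \<alpha> i \<in> mod_hom A (P i) (R i)" "\<And>i x. x \<in> carrier (P (Suc i)) \<Longrightarrow> \<delta> i (\<alpha> (Suc i) x) = \<alpha> i (d i x)"
    and g: "g \<in> mod_hom A (R i) D0"
  shows "X.cmp i g (\<alpha> i) \<in> X.Z i"
proof -
  interpret SR: std_resolution K A \<A> \<Lambda> e r l R Q \<delta> \<eta> by (rule SR)
  have "g (\<alpha> i (d i x)) = \<zero>\<^bsub>D0\<^esub>" if "x \<in> carrier (P (Suc i))" for x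
    using SR.hom_D0_minimal[OF g mod_homD(1)[OF \<alpha>(1) that]] \<alpha>(2)[OF that] by simp
  then show ?thesis using mod_hom_compose[OF \<alpha>(1) g X.r(3)] by (simp add: X.Z_iff compose_def)
qed

text \<open>The product is represented by the composite of \<alpha>, f \<beta> and right
  multiplication by e_m. The last two together map R_i into A_0 e_m, and by weights this map is
  zero.\<close>

lemma vanishing:
  assumes l: "l \<in> \<Lambda>" and m: "m \<in> \<Lambda>" "(l, m) \<notin> r" and x: "x \<in> carrier (X.E i)"
  shows "ym 0 i (w (e m)) (ym i 0 x (w (e l))) = \<zero>\<^bsub>X.E i\<^esub>"
proof -
  obtain R Q \<delta> \<eta> \<alpha> \<beta> where SR: "std_resolution K A \<A> \<Lambda> e r l R Q \<delta> \<eta>"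
    and \<alpha>: "\<And>i. \<alpha> i \<in> mod_hom A (P i) (R i)" and \<beta>: "\<And>i. \<beta> i \<in> mod_hom A (R i) (P i)"
    and \<alpha>d: "\<And>i x. x \<in> carrier (P (Suc i)) \<Longrightarrow> \<delta> i (\<alpha> (Suc i) x) = \<alpha> i (d i x)"
    and fac: "\<And>i f. f \<in> X.Z i \<Longrightarrow> ym i 0 (X.cl i f) (w (e l)) = X.cl i (X.cmp i (compose (carrier (R i)) f (\<beta> i)) (\<alpha> i))"
    by (rule factorization[OF l]) (rule that, assumption+)
  interpret SR: std_resolution K A \<A> \<Lambda> e r l R Q \<delta> \<eta> by (rule SR)
  obtain f where f: "f \<in> X.Z i" "x = X.cl i f" using x by (auto simp: X.carrier_E)
  have fh: "f \<in> mod_hom A (P i) D0" using f by (simp add: X.Z_iff)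
  let ?g = "compose (carrier (R i)) f (\<beta> i)"
  have g: "?g \<in> mod_hom A (R i) D0" by (rule mod_hom_compose[OF \<beta> fh SR.LR.lr(3)])
  let ?h = "compose (carrier (R i)) (rmult (e m)) ?g"
  have h: "?h \<in> mod_hom A (R i) D0" by (rule mod_hom_compose[OF g rmult_hom[OF e_closed[OF m(1)]] SR.LR.lr(3)])
  have "?h y = \<zero>\<^bsub>D0\<^esub>" if y: "y \<in> carrier (R i)" for y
  proof (rule SR.hom_D0_weight[OF h m _ y])
    fix y assume y: "y \<in> carrier (R i)"
    obtain c where c: "c \<in> \<A> 0" "?g y = q c" by (rule D0_elt[OF mod_homD(1)[OF g y]])
    then have "?h y = q (c \<otimes>\<^bsub>A\<^esub> e m)" using y m(1) \<A>_carrier[OF c(1)] by (simp add: compose_def rmult_q)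
    then show "\<exists>c\<in>\<A> 0. ?h y = q (c \<otimes>\<^bsub>A\<^esub> e m)" using c(1) by blast
  qed
  then have "rmult (e m) (X.cmp i ?g (\<alpha> i) y) = \<zero>\<^bsub>D0\<^esub>" if "y \<in> carrier (P i)" for y
    using mod_homD(1)[OF \<alpha> that] that by (simp add: compose_def)
  then have 0: "X.cmp i (rmult (e m)) (X.cmp i ?g (\<alpha> i)) = \<zero>\<^bsub>X.H i\<^esub>"
    by (auto simp: X.zero_H compose_def restrict_def fun_eq_iff)
  have "ym 0 i (w (e m)) (ym i 0 x (w (e l))) = X.cl i (X.cmp i (rmult (e m)) (X.cmp i ?g (\<alpha> i)))"
    unfolding f(2) fac[OF f(1)]
    by (rule X.yoneda_endo_l[OF rmult_hom[OF e_closed[OF m(1)]] cmp_\<alpha>_Z[OF SR \<alpha> \<alpha>d g]])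
  also have "\<dots> = \<zero>\<^bsub>X.E i\<^esub>"
    unfolding 0 using X.cl_zero_iff[OF X.H.submoduleD(2)[OF X.submodule_Z]] X.H.submoduleD(2)[OF X.submodule_B] by blast
  finally show ?thesis .
qed

lemma E_trivial:
  assumes i: "card \<Lambda> \<le> i" and x: "x \<in> carrier (X.E i)"
  shows "x = \<zero>\<^bsub>X.E i\<^esub>"
proof -
  have "ym i 0 x (w (e l)) = \<zero>\<^bsub>X.E i\<^esub>" if l: "l \<in> \<Lambda>" for l
  proof -
    obtain R Q \<delta> \<eta> \<alpha> \<beta> where SR: "std_resolution K A \<A> \<Lambda> e r l R Q \<delta> \<eta>"
      and \<alpha>: "\<And>i. \<alpha> i \<in> mod_hom A (P i) (R i)" and \<beta>: "\<And>i. \<beta> i \<in> mod_hom A (R i) (P i)"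
      and \<alpha>d: "\<And>i x. x \<in> carrier (P (Suc i)) \<Longrightarrow> \<delta> i (\<alpha> (Suc i) x) = \<alpha> i (d i x)"
      and fac: "\<And>i f. f \<in> X.Z i \<Longrightarrow> ym i 0 (X.cl i f) (w (e l)) = X.cl i (X.cmp i (compose (carrier (R i)) f (\<beta> i)) (\<alpha> i))"
      by (rule factorization[OF l]) (rule that, assumption+)
    interpret SR: std_resolution K A \<A> \<Lambda> e r l R Q \<delta> \<eta> by (rule SR)
    obtain f where f: "f \<in> X.Z i" "x = X.cl i f" using x by (auto simp: X.carrier_E)
    have fh: "f \<in> mod_hom A (P i) D0" using f by (simp add: X.Z_iff)
    let ?g = "compose (carrier (R i)) f (\<beta> i)"
    have g: "?g \<in> mod_hom A (R i) D0" by (rule mod_hom_compose[OF \<beta> fh SR.LR.lr(3)])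
    have "?g (\<alpha> i y) = \<zero>\<^bsub>D0\<^esub>" if "y \<in> carrier (P i)" for y
      using mod_homD(1)[OF \<alpha> that] SR.resolution_trivial[OF i] mod_hom_zero[OF g SR.LR.lr(3) X.r(1)] by auto
    then have 0: "X.cmp i ?g (\<alpha> i) = \<zero>\<^bsub>X.H i\<^esub>"
      by (auto simp: X.zero_H compose_def restrict_def fun_eq_iff)
    show ?thesis unfolding f(2) fac[OF f(1)] 0
      using X.cl_zero_iff[OF X.H.submoduleD(2)[OF X.submodule_Z]] X.H.submoduleD(2)[OF X.submodule_B] by blast
  qed
  then have "finsum (X.E i) (\<lambda>l. ym i 0 x (w (e l))) \<Lambda> = \<zero>\<^bsub>X.E i\<^esub>"
    by (rule X.E.Q.M.add.finprod_one_eqI)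
  then show ?thesis using component_sum[OF x] by simp
qed

end

lemma left_module_proj_mod:
  fixes B :: "('k, 'b) module"
  assumes "ring B" "e l \<in> carrier B"
  shows "left_module B (proj_mod B e l)"
proof -
  interpret B: ring B by fact
  interpret reg: left_module B "regular_module B" by (rule left_module_regular_module[OF assms(1)])
  have "submodule ((\<lambda>b. b \<otimes>\<^bsub>B\<^esub> e l) ` carrier B) B (regular_module B)"
  proof (rule reg.submoduleI)
    show "\<zero>\<^bsub>regular_module B\<^esub> \<in> (\<lambda>b. b \<otimes>\<^bsub>B\<^esub> e l) ` carrier B"
      using assms by (auto simp: regular_module_def intro!: image_eqI[of _ _ "\<zero>\<^bsub>B\<^esub>"])
    show "a \<oplus>\<^bsub>regular_module B\<^esub> b \<in> (\<lambda>b. b \<otimes>\<^bsub>B\<^esub> e l) ` carrier B"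
      if "a \<in> (\<lambda>b. b \<otimes>\<^bsub>B\<^esub> e l) ` carrier B" "b \<in> (\<lambda>b. b \<otimes>\<^bsub>B\<^esub> e l) ` carrier B" for a b
      using that assms by (auto simp: regular_module_def simp flip: B.l_distr)
    show "a \<odot>\<^bsub>regular_module B\<^esub> x \<in> (\<lambda>b. b \<otimes>\<^bsub>B\<^esub> e l) ` carrier B"
      if "a \<in> carrier B" "x \<in> (\<lambda>b. b \<otimes>\<^bsub>B\<^esub> e l) ` carrier B" for a x
      using that assms by (auto simp: regular_module_def simp flip: B.m_assoc)
  qed (use assms in \<open>auto simp: regular_module_def\<close>)
  then show ?thesis unfolding proj_mod_def by (rule submodule_left_module[OF left_module_regular_module[OF assms(1)]])
qed

lemma (in left_module) add_span_subset_zero: "S \<subseteq> {\<zero>\<^bsub>M\<^esub>} \<Longrightarrow> add_span M S = {\<zero>\<^bsub>M\<^esub>}"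
  using M.add_span_least[OF M.additive_subgroupI'[of "{\<zero>\<^bsub>M\<^esub>}"], of S] add_span_zero[of M S]
  by fastforce

text \<open>
  If \<open>e m B e l = 0\<close> unless \<open>l \<le> m\<close>, then the indecomposable projective modules are the standard
  modules for the opposite order, so that the required filtrations are trivial.
\<close>

lemma directed_standardly_stratified:
  fixes B :: "('k, 'b) module"
  assumes B: "fd_algebra K B" and cpi: "complete_primitive_idempotents B \<Lambda> e" and po: "partial_order_on \<Lambda> r"
    and directed: "\<And>l m x. \<lbrakk>l \<in> \<Lambda>; m \<in> \<Lambda>; (l, m) \<notin> r; x \<in> carrier B\<rbrakk> \<Longrightarrow> e m \<otimes>\<^bsub>B\<^esub> (x \<otimes>\<^bsub>B\<^esub> e l) = \<zero>\<^bsub>B\<^esub>"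
  shows "standardly_stratified K B \<Lambda> e (r\<inverse>)"
proof -
  interpret B: ring B using B by (simp add: fd_algebra_def)
  have e: "e l \<in> carrier B" "e l \<otimes>\<^bsub>B\<^esub> e l = e l" "e l \<noteq> \<zero>\<^bsub>B\<^esub>" if "l \<in> \<Lambda>" for l
    using cpi that by (auto simp: complete_primitive_idempotents_def primitive_idempotent_def idempotent_elt_def)
  have car: "x \<in> carrier (proj_mod B e l) \<longleftrightarrow> (\<exists>b\<in>carrier B. x = b \<otimes>\<^bsub>B\<^esub> e l)" for x l
    by (auto simp: proj_mod_def)
  have sm: "a \<odot>\<^bsub>proj_mod B e l\<^esub> x = a \<otimes>\<^bsub>B\<^esub> x" for a x l by (simp add: proj_mod_def regular_module_def)
  have zero: "\<zero>\<^bsub>proj_mod B e l\<^esub> = \<zero>\<^bsub>B\<^esub>" for l by (simp add: proj_mod_def regular_module_def)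
  have el: "e l \<in> carrier (proj_mod B e l)" if "l \<in> \<Lambda>" for l using e[OF that] car by metis
  have mod: "left_module B (proj_mod B e l)" if "l \<in> \<Lambda>" for l
    by (rule left_module_proj_mod[of B e l, OF B.ring_axioms e(1)[OF that]])
  \<comment> \<open>Since x = x e_l, a homomorphism out of B e_l is right multiplication by its
    value at e_l.\<close>
  have hom: "f x = x \<otimes>\<^bsub>B\<^esub> f (e l)" if f: "f \<in> mod_hom B (proj_mod B e l) (proj_mod B e m)"
    and x: "x \<in> carrier (proj_mod B e l)" and l: "l \<in> \<Lambda>" for f x l m
  proof -
    obtain b where b: "b \<in> carrier B" "x = b \<otimes>\<^bsub>B\<^esub> e l" using x car by blast
    have "x \<odot>\<^bsub>proj_mod B e l\<^esub> e l = x" using b e[OF l] by (simp add: sm B.m_assoc)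
    moreover have "x \<in> carrier B" using b e[OF l] by simp
    ultimately show ?thesis using mod_homD(4)[OF f _ el[OF l], of x] by (simp add: sm)
  qed
  have hom0: "f x = \<zero>\<^bsub>B\<^esub>" if f: "f \<in> mod_hom B (proj_mod B e l) (proj_mod B e m)"
    and x: "x \<in> carrier (proj_mod B e l)" and lm: "l \<in> \<Lambda>" "m \<in> \<Lambda>" "(m, l) \<notin> r" for f x l m
  proof -
    obtain y where y: "y \<in> carrier B" "f (e l) = y \<otimes>\<^bsub>B\<^esub> e m" using mod_homD(1)[OF f el[OF lm(1)]] car by blast
    have "f (e l) = e l \<otimes>\<^bsub>B\<^esub> f (e l)" by (rule hom[OF f el[OF lm(1)] lm(1)])
    also have "\<dots> = \<zero>\<^bsub>B\<^esub>" unfolding y(2) by (rule directed[OF lm(2,1,3) y(1)])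
    finally have "f (e l) = \<zero>\<^bsub>B\<^esub>" .
    moreover have "x \<in> carrier B" using x car e[OF lm(1)] by auto
    ultimately show ?thesis using hom[OF f x lm(1)] by simp
  qed
  \<comment> \<open>An isomorphism B e_l -> B e_m is nonzero, which gives m <= l. A preimage z of
    e_m lies in B e_l, and e_m = e_m z f(e_l) is nonzero, which gives l <= m; antisymmetry excludes
    l different from m.\<close>
  have basic: "basic_algebra B \<Lambda> e"
    unfolding basic_algebra_def
  proof (intro ballI impI notI)
    fix l m assume lm: "l \<in> \<Lambda>" "m \<in> \<Lambda>" "l \<noteq> m" and "mod_iso B (proj_mod B e l) (proj_mod B e m)"
    then obtain f where f: "f \<in> mod_hom B (proj_mod B e l) (proj_mod B e m)"
      "bij_betw f (carrier (proj_mod B e l)) (carrier (proj_mod B e m))" unfolding mod_iso_def by blast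
    have inj: "inj_on f (carrier (proj_mod B e l))" and surj: "f ` carrier (proj_mod B e l) = carrier (proj_mod B e m)"
      using f(2) by (auto simp: bij_betw_def)
    obtain z where z: "z \<in> carrier (proj_mod B e l)" "f z = e m" using el[OF lm(2)] surj by (metis imageE)
    have "(m, l) \<in> r"
      using hom0[OF f(1) z(1) lm(1,2)] z(2) e(3)[OF lm(2)] by auto
    moreover have "(l, m) \<in> r"
    proof (rule ccontr)
      assume n: "(l, m) \<notin> r"
      obtain y where y: "y \<in> carrier B" "z = y \<otimes>\<^bsub>B\<^esub> e l" using z(1) car by blast
      have fl: "f (e l) \<in> carrier B" using mod_homD(1)[OF f(1) el[OF lm(1)]] car e(1)[OF lm(2)] by auto
      have zB: "z \<in> carrier B" using y e(1)[OF lm(1)] by simp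
      have "e m = e m \<otimes>\<^bsub>B\<^esub> (z \<otimes>\<^bsub>B\<^esub> f (e l))" using hom[OF f(1) z(1) lm(1)] z(2) e(2)[OF lm(2)] by simp
      also have "\<dots> = e m \<otimes>\<^bsub>B\<^esub> z \<otimes>\<^bsub>B\<^esub> f (e l)" using e(1)[OF lm(2)] zB fl by (simp add: B.m_assoc)
      also have "\<dots> = \<zero>\<^bsub>B\<^esub>" unfolding y(2) directed[OF lm(1,2) n y(1)] using fl by simp
      finally show False using e(3)[OF lm(2)] by simp
    qed
    ultimately show False using po lm(3) by (auto simp: partial_order_on_def dest: antisymD)
  qed
  \<comment> \<open>For the opposite order the traces come from those m for which l <= m fails, and
    for these \<open>hom0\<close> leaves only the zero homomorphism B e_m -> B e_l.\<close>
  have ker: "std_kernel B \<Lambda> e (r\<inverse>) l = {\<zero>\<^bsub>B\<^esub>}" if l: "l \<in> \<Lambda>" for l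
  proof -
    interpret Pl: left_module B "proj_mod B e l" by (rule mod[OF l])
    have "trace_module B (proj_mod B e m) (proj_mod B e l) = {\<zero>\<^bsub>proj_mod B e l\<^esub>}" if "m \<in> \<Lambda>" "(m, l) \<notin> r\<inverse>" for m
      unfolding trace_module_def
      by (rule Pl.add_span_subset_zero) (use hom0[OF _ _ that(1) l] that(2) in \<open>auto simp: zero\<close>)
    then show ?thesis
      unfolding std_kernel_def using Pl.add_span_subset_zero by (subst Pl.add_span_subset_zero) (auto simp: zero)
  qed
  have "has_filtration B ((proj_mod B e l)\<lparr>carrier := std_kernel B \<Lambda> e (r\<inverse>) l\<rparr>)
      (std_module B \<Lambda> e (r\<inverse>)) {m \<in> \<Lambda>. (l, m) \<in> r\<inverse> \<and> m \<noteq> l}" if l: "l \<in> \<Lambda>" for l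
  proof -
    interpret Pl: left_module B "proj_mod B e l" by (rule mod[OF l])
    have "submodule {\<zero>\<^bsub>B\<^esub>} B (proj_mod B e l)" by (rule Pl.submoduleI) (auto simp flip: zero[of l])
    then have "left_module B ((proj_mod B e l)\<lparr>carrier := {\<zero>\<^bsub>B\<^esub>}\<rparr>)" by (rule submodule_left_module[OF mod[OF l]])
    then interpret Z: left_module B "(proj_mod B e l)\<lparr>carrier := {\<zero>\<^bsub>B\<^esub>}\<rparr>" .
    have "submodule {\<zero>\<^bsub>B\<^esub>} B ((proj_mod B e l)\<lparr>carrier := {\<zero>\<^bsub>B\<^esub>}\<rparr>)"
      by (rule Z.submoduleI) (use Z.M.a_closed Z.smult_closed in \<open>auto simp: zero\<close>)
    then show ?thesis
      unfolding has_filtration_def ker[OF l]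
      by (intro exI[of _ "0::nat"] exI[of _ "\<lambda>_. {\<zero>\<^bsub>B\<^esub>}"]) (simp add: zero)
  qed
  moreover have "partial_order_on \<Lambda> (r\<inverse>)" using po by simp
  ultimately show ?thesis using B cpi basic by (simp add: standardly_stratified_def)
qed

section \<open>Finite dimension and idempotents of convolution algebras\<close>

context graded_product
begin

lemma finsum_conv_algebra:
  assumes "finite S" "f \<in> S \<rightarrow> carrier conv_algebra"
  shows "finsum conv_algebra f S n = finsum (E n) (\<lambda>s. f s n) S"
proof -
  interpret L: left_module K conv_algebra by (rule left_module_conv_algebra)
  show ?thesis
    using assms by (induct S) (auto simp: Pi_iff carrier_conv_algebra simp del: conv_algebra_simps(4))
qed

definition single :: "nat \<Rightarrow> 'v \<Rightarrow> nat \<Rightarrow> 'v" where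
  "single i x = (\<lambda>j. if j = i then x else \<zero>\<^bsub>E j\<^esub>)"

lemma single_closed: "x \<in> carrier (E i) \<Longrightarrow> single i x \<in> carrier conv_algebra"
  by (auto simp: carrier_conv_algebra single_def intro: finite_subset[of _ "{i}"])

text \<open>Finite spanning sets of the finitely many nonzero degrees are placed in their degrees;
  an element is then assembled one degree at a time up to the bound n.\<close>

lemma fin_dim_conv_algebra:
  assumes fd: "\<And>i. \<exists>T. finite T \<and> spans K (E i) T" and trivial: "\<And>i x. n \<le> i \<Longrightarrow> x \<in> carrier (E i) \<Longrightarrow> x = \<zero>\<^bsub>E i\<^esub>"
  shows "fin_dim K conv_algebra"
proof -
  interpret L: left_module K conv_algebra by (rule left_module_conv_algebra)
  from choice[OF allI[OF fd]] obtain T where "\<forall>i. finite (T i) \<and> spans K (E i) (T i)" ..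
  then have T: "\<And>i. finite (T i)" "\<And>i. spans K (E i) (T i)" by simp_all
  let ?T = "\<Union>i\<in>{..<n}. single i ` T i"
  have TE: "T i \<subseteq> carrier (E i)" for i using T(2) by (simp add: spans_def)
  have "x \<in> W" if W: "submodule W K conv_algebra" "?T \<subseteq> W" and x: "x \<in> carrier conv_algebra" for x W
  proof -
    note WD = L.submoduleD[OF W(1)]
    have single: "single i y \<in> W" if i: "i < n" and y: "y \<in> carrier (E i)" for i y
    proof -
      have "submodule {y \<in> carrier (E i). single i y \<in> W} K (E i)"
      proof (rule E.submoduleI)
        have "single i \<zero>\<^bsub>E i\<^esub> = \<zero>\<^bsub>conv_algebra\<^esub>" by (auto simp: single_def)
        then show "\<zero>\<^bsub>E i\<^esub> \<in> {y \<in> carrier (E i). single i y \<in> W}" using WD(2) by simp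
        show "a \<oplus>\<^bsub>E i\<^esub> b \<in> {y \<in> carrier (E i). single i y \<in> W}"
          if "a \<in> {y \<in> carrier (E i). single i y \<in> W}" "b \<in> {y \<in> carrier (E i). single i y \<in> W}" for a b
        proof -
          have "single i (a \<oplus>\<^bsub>E i\<^esub> b) = single i a \<oplus>\<^bsub>conv_algebra\<^esub> single i b" by (auto simp: single_def)
          then show ?thesis using that WD(3)[of "single i a" "single i b"] by simp
        qed
        show "c \<odot>\<^bsub>E i\<^esub> a \<in> {y \<in> carrier (E i). single i y \<in> W}"
          if "c \<in> carrier K" "a \<in> {y \<in> carrier (E i). single i y \<in> W}" for c a
        proof -
          have "single i (c \<odot>\<^bsub>E i\<^esub> a) = c \<odot>\<^bsub>conv_algebra\<^esub> single i a" using that(1) by (auto simp: single_def)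
          then show ?thesis using that WD(5)[of c "single i a"] by simp
        qed
      qed auto
      moreover have "single i ` T i \<subseteq> ?T" using i by (intro UN_upper) simp
      then have "T i \<subseteq> {y \<in> carrier (E i). single i y \<in> W}" using TE[of i] W(2) by blast
      ultimately show ?thesis using spansD[OF T(2) _ _ y] by blast
    qed
    have xE: "x i \<in> carrier (E i)" for i using x by (simp add: carrier_conv_algebra)
    have "(\<lambda>j. if j < k then x j else \<zero>\<^bsub>E j\<^esub>) \<in> W" if "k \<le> n" for k
      using that
    proof (induct k)
      case 0
      then show ?case using WD(2) by simp
    next
      case (Suc k)
      have "(\<lambda>j. if j < Suc k then x j else \<zero>\<^bsub>E j\<^esub>) = (\<lambda>j. if j < k then x j else \<zero>\<^bsub>E j\<^esub>) \<oplus>\<^bsub>conv_algebra\<^esub> single k (x k)"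
        using xE by (auto simp: single_def fun_eq_iff less_Suc_eq)
      then show ?case using WD(3)[OF Suc(1) single[of k "x k"]] Suc(2) xE by simp
    qed
    moreover have "(\<lambda>j. if j < n then x j else \<zero>\<^bsub>E j\<^esub>) = x" using trivial[OF _ xE] by (auto simp: fun_eq_iff)
    ultimately show "x \<in> W" by (metis order_refl)
  qed
  moreover have "?T \<subseteq> carrier conv_algebra" using single_closed TE by blast
  ultimately have "spans K conv_algebra ?T" unfolding spans_def by blast
  moreover have "finite ?T" using T(1) by simp
  ultimately show ?thesis using fin_dim_iff[OF left_module_conv_algebra] by blast
qed

text \<open>By induction on the degree: in degree n of x x every term has either a left factor of
  smaller degree or the right factor x_0, and both vanish.\<close>

lemma conv_idempotent_zero:
  assumes x: "x \<in> carrier conv_algebra" "conv x x = x" and 0: "x 0 = \<zero>\<^bsub>E 0\<^esub>"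
  shows "x = \<zero>\<^bsub>conv_algebra\<^esub>"
proof -
  have xE: "x i \<in> carrier (E i)" for i using x by (simp add: carrier_conv_algebra)
  have "x n = \<zero>\<^bsub>E n\<^esub>" for n
  proof (induct n rule: less_induct)
    case (less n)
    have "conv x x n = \<zero>\<^bsub>E n\<^esub>"
      unfolding conv_def
    proof (rule E.M.add.finprod_one_eqI)
      fix i assume i: "i \<in> {..n}"
      show "m i (n - i) (x i) (x (n - i)) = \<zero>\<^bsub>E n\<^esub>"
      proof (cases "i = n")
        case True
        then show ?thesis using zero_r[OF xE, of n 0] 0 by simp
      next
        case False
        then show ?thesis using i less[of i] zero_l[OF xE, of i "n - i"] by simp
      qed
    qed
    then show ?case using x(2) by simp
  qed
  then show ?thesis by auto
qed

end

section \<open>Idempotents, directedness and finite dimension of the Yoneda algebra\<close>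

context ext_comparison
begin

lemma W_closed: "c \<in> carrier A \<Longrightarrow> W c \<in> carrier \<Gamma>"
  unfolding W_def by (rule X.GP.homogeneous_closed[OF w_closed])

lemma W_0: "W c 0 = w c" by (simp add: W_def)

lemma conv_0: "\<lbrakk>x \<in> carrier \<Gamma>; y \<in> carrier \<Gamma>\<rbrakk> \<Longrightarrow> (x \<otimes>\<^bsub>\<Gamma>\<^esub> y) 0 = ym 0 0 (x 0) (y 0)"
  using X.GP.closed[of "x 0" 0 "y 0" 0] by (simp add: X.GP.conv_def X.GP.carrier_conv_algebra)

lemma W_mult: "\<lbrakk>c \<in> carrier A; c' \<in> carrier A\<rbrakk> \<Longrightarrow> W c \<otimes>\<^bsub>\<Gamma>\<^esub> W c' = W (c' \<otimes>\<^bsub>A\<^esub> c)"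
proof
  fix n assume c: "c \<in> carrier A" "c' \<in> carrier A"
  have "W c' i \<in> carrier (X.E i)" for i using W_closed[OF c(2)] by (simp add: X.GP.carrier_conv_algebra)
  then have "(W c \<otimes>\<^bsub>\<Gamma>\<^esub> W c') n = ym 0 n (w c) (W c' n)"
    unfolding X.GP.conv_algebra_simps W_def[of c] by (rule X.GP.conv_homogeneous_l[OF w_closed[OF c(1)]])
  then show "(W c \<otimes>\<^bsub>\<Gamma>\<^esub> W c') n = W (c' \<otimes>\<^bsub>A\<^esub> c) n"
    using w_mult[OF c] X.GP.zero_r[OF w_closed[OF c(1)], of n] by (simp add: W_def)
qed

text \<open>Primitivity is inherited from A: the degree-zero parts of a decomposition of the
  idempotent of l are represented by a decomposition of e_l, so one of them vanishes, and an
  idempotent without part of degree 0 is zero.\<close>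

lemma complete_primitive_idempotents_\<Gamma>:
  "complete_primitive_idempotents \<Gamma> \<Lambda> (\<lambda>l. W (e l))"
  unfolding complete_primitive_idempotents_def
proof (intro conjI ballI impI)
  show "finite \<Lambda>" by (rule \<Lambda>_finite)
  show "W (e l) \<otimes>\<^bsub>\<Gamma>\<^esub> W (e m) = \<zero>\<^bsub>\<Gamma>\<^esub>" if "l \<in> \<Lambda>" "m \<in> \<Lambda>" "l \<noteq> m" for l m
    using that W_mult[of "e l" "e m"] e_orth[of m l] w_zero by (auto simp: W_def fun_eq_iff simp del: X.GP.conv_algebra_simps(4))
  have "finsum \<Gamma> (\<lambda>l. W (e l)) \<Lambda> n = \<one>\<^bsub>\<Gamma>\<^esub> n" for n
  proof (cases "n = 0")
    case True
    have "finsum (X.E 0) (\<lambda>l. W (e l) 0) \<Lambda> = w \<one>\<^bsub>A\<^esub>"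
      unfolding W_0 using w_sum[OF \<Lambda>_finite, of e] e_sum by simp
    then show ?thesis using X.GP.finsum_conv_algebra[OF \<Lambda>_finite, of "\<lambda>l. W (e l)" n] W_closed True by (simp add: w_one)
  next
    case False
    have "finsum (X.E n) (\<lambda>l. W (e l) n) \<Lambda> = \<zero>\<^bsub>X.E n\<^esub>"
      using False by (intro X.E.Q.M.add.finprod_one_eqI) (simp add: W_def)
    then show ?thesis using X.GP.finsum_conv_algebra[OF \<Lambda>_finite, of "\<lambda>l. W (e l)" n] W_closed False by simp
  qed
  then show "finsum \<Gamma> (\<lambda>l. W (e l)) \<Lambda> = \<one>\<^bsub>\<Gamma>\<^esub>" by (rule ext)
  fix l assume l: "l \<in> \<Lambda>"
  have prim: "primitive_idempotent A (e l)" using cpi l by (simp add: complete_primitive_idempotents_def)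
  show "primitive_idempotent \<Gamma> (W (e l))"
    unfolding primitive_idempotent_def
  proof (intro conjI allI impI)
    show "idempotent_elt \<Gamma> (W (e l))"
      using W_closed[OF e_closed[OF l]] W_mult[OF e_closed[OF l] e_closed[OF l]] l by (simp add: idempotent_elt_def del: X.GP.conv_algebra_simps)
    show "W (e l) \<noteq> \<zero>\<^bsub>\<Gamma>\<^esub>"
    proof
      assume "W (e l) = \<zero>\<^bsub>\<Gamma>\<^esub>"
      then have "W (e l) 0 = \<zero>\<^bsub>X.E 0\<^esub>" by simp
      then have "w (e l) = w \<zero>\<^bsub>A\<^esub>" by (simp add: W_0 w_zero)
      then show False using w_eq_iff[OF e_degree[OF l] \<A>_zero] e_nonzero[OF l] by simp
    qed
    fix f g
    assume f: "idempotent_elt \<Gamma> f" and g: "idempotent_elt \<Gamma> g"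
      and fg: "f \<otimes>\<^bsub>\<Gamma>\<^esub> g = \<zero>\<^bsub>\<Gamma>\<^esub>" and gf: "g \<otimes>\<^bsub>\<Gamma>\<^esub> f = \<zero>\<^bsub>\<Gamma>\<^esub>" and sum: "W (e l) = f \<oplus>\<^bsub>\<Gamma>\<^esub> g"
    have f': "f \<in> carrier \<Gamma>" "f \<otimes>\<^bsub>\<Gamma>\<^esub> f = f" and g': "g \<in> carrier \<Gamma>" "g \<otimes>\<^bsub>\<Gamma>\<^esub> g = g"
      using f g by (simp_all add: idempotent_elt_def)
    have f0: "f 0 \<in> carrier (X.E 0)" and g0: "g 0 \<in> carrier (X.E 0)"
      using f'(1) g'(1) by (simp_all add: X.GP.carrier_conv_algebra)
    obtain a where a: "a \<in> \<A> 0" "f 0 = w a" using w_surj[OF f0] by blast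
    obtain b where b: "b \<in> \<A> 0" "g 0 = w b" using w_surj[OF g0] by blast
    have aA: "a \<in> carrier A" "b \<in> carrier A" using a b \<A>_carrier by auto
    have "w (a \<otimes>\<^bsub>A\<^esub> a) = w a" using conv_0[OF f'(1) f'(1)] f'(2) a(2) w_mult[OF aA(1) aA(1)] by simp
    then have aa: "a \<otimes>\<^bsub>A\<^esub> a = a" by (rule w_eq_iff[OF \<A>_mult_0[OF a(1) a(1)] a(1)])
    have "w (b \<otimes>\<^bsub>A\<^esub> b) = w b" using conv_0[OF g'(1) g'(1)] g'(2) b(2) w_mult[OF aA(2) aA(2)] by simp
    then have bb: "b \<otimes>\<^bsub>A\<^esub> b = b" by (rule w_eq_iff[OF \<A>_mult_0[OF b(1) b(1)] b(1)])
    \<comment> \<open>The order of the factors is exchanged by \<open>w_mult\<close>: f g = 0 yields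
      b a = 0.\<close>
    have "w (b \<otimes>\<^bsub>A\<^esub> a) = w \<zero>\<^bsub>A\<^esub>" using conv_0[OF f'(1) g'(1)] fg a(2) b(2) w_mult[OF aA(1) aA(2)] by (simp add: w_zero)
    then have ba: "b \<otimes>\<^bsub>A\<^esub> a = \<zero>\<^bsub>A\<^esub>" by (rule w_eq_iff[OF \<A>_mult_0[OF b(1) a(1)] \<A>_zero])
    have "w (a \<otimes>\<^bsub>A\<^esub> b) = w \<zero>\<^bsub>A\<^esub>" using conv_0[OF g'(1) f'(1)] gf a(2) b(2) w_mult[OF aA(2) aA(1)] by (simp add: w_zero)
    then have ab: "a \<otimes>\<^bsub>A\<^esub> b = \<zero>\<^bsub>A\<^esub>" by (rule w_eq_iff[OF \<A>_mult_0[OF a(1) b(1)] \<A>_zero])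
    have "w (e l) = w (a \<oplus>\<^bsub>A\<^esub> b)" using fun_cong[OF sum, of 0] a(2) b(2) w_add[OF aA] by (simp add: W_0)
    then have eab: "e l = a \<oplus>\<^bsub>A\<^esub> b" by (rule w_eq_iff[OF e_degree[OF l] \<A>_add[OF a(1) b(1)]])
    have "a = \<zero>\<^bsub>A\<^esub> \<or> b = \<zero>\<^bsub>A\<^esub>"
      using prim aa bb ab ba eab aA unfolding primitive_idempotent_def idempotent_elt_def by blast
    then show "f = \<zero>\<^bsub>\<Gamma>\<^esub> \<or> g = \<zero>\<^bsub>\<Gamma>\<^esub>"
    proof
      assume "a = \<zero>\<^bsub>A\<^esub>"
      then have "f 0 = \<zero>\<^bsub>X.E 0\<^esub>" using a(2) w_zero by simp
      then show ?thesis using X.GP.conv_idempotent_zero[OF f'(1)] f'(2) by simp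
    next
      assume "b = \<zero>\<^bsub>A\<^esub>"
      then have "g 0 = \<zero>\<^bsub>X.E 0\<^esub>" using b(2) w_zero by simp
      then show ?thesis using X.GP.conv_idempotent_zero[OF g'(1)] g'(2) by simp
    qed
  qed
qed

lemma directed_\<Gamma>:
  assumes "l \<in> \<Lambda>" "m \<in> \<Lambda>" "(l, m) \<notin> r" "x \<in> carrier \<Gamma>"
  shows "W (e m) \<otimes>\<^bsub>\<Gamma>\<^esub> (x \<otimes>\<^bsub>\<Gamma>\<^esub> W (e l)) = \<zero>\<^bsub>\<Gamma>\<^esub>"
proof
  fix n
  have xE: "x i \<in> carrier (X.E i)" for i using assms(4) by (simp add: X.GP.carrier_conv_algebra)
  have 1: "(x \<otimes>\<^bsub>\<Gamma>\<^esub> W (e l)) i = ym i 0 (x i) (w (e l))" for i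
    unfolding X.GP.conv_algebra_simps W_def using assms(1) by (intro X.GP.conv_homogeneous_r[OF _ xE]) simp
  have 2: "(x \<otimes>\<^bsub>\<Gamma>\<^esub> W (e l)) i \<in> carrier (X.E i)" for i
    unfolding 1 using X.GP.closed[OF xE w_closed[OF e_closed[OF assms(1)]], of i] by simp
  have "(W (e m) \<otimes>\<^bsub>\<Gamma>\<^esub> (x \<otimes>\<^bsub>\<Gamma>\<^esub> W (e l))) n = ym 0 n (w (e m)) ((x \<otimes>\<^bsub>\<Gamma>\<^esub> W (e l)) n)"
    using 2 assms(2) unfolding X.GP.conv_algebra_simps W_def[of "e m"] by (intro X.GP.conv_homogeneous_l) simp_all
  also have "\<dots> = \<zero>\<^bsub>X.E n\<^esub>" unfolding 1 by (rule vanishing[OF assms(1-3) xE])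
  finally show "(W (e m) \<otimes>\<^bsub>\<Gamma>\<^esub> (x \<otimes>\<^bsub>\<Gamma>\<^esub> W (e l))) n = \<zero>\<^bsub>\<Gamma>\<^esub> n" by simp
qed

text \<open>By \<open>factorization\<close> the component is a linear image of Hom(R_i, A_0), and
  this space is finite-dimensional because R_i has a finite dual basis and A a finite basis.
  Quantifying over \<open>W\<close> expresses that \<open>T\<close> spans the component without
  forming the component as a module.\<close>

lemma component_fin_dim:
  assumes l: "l \<in> \<Lambda>"
  shows "\<exists>T. finite T \<and> T \<subseteq> carrier (X.E i) \<and>
    (\<forall>W. submodule W K (X.E i) \<longrightarrow> T \<subseteq> W \<longrightarrow> (\<forall>x\<in>carrier (X.E i). ym i 0 x (w (e l)) \<in> W))"
proof -
  obtain R Q \<delta> \<eta> \<alpha> \<beta> where SR: "std_resolution K A \<A> \<Lambda> e r l R Q \<delta> \<eta>"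
    and \<alpha>: "\<And>i. \<alpha> i \<in> mod_hom A (P i) (R i)" and \<beta>: "\<And>i. \<beta> i \<in> mod_hom A (R i) (P i)"
    and \<alpha>d: "\<And>i x. x \<in> carrier (P (Suc i)) \<Longrightarrow> \<delta> i (\<alpha> (Suc i) x) = \<alpha> i (d i x)"
    and fac: "\<And>i f. f \<in> X.Z i \<Longrightarrow> ym i 0 (X.cl i f) (w (e l)) = X.cl i (X.cmp i (compose (carrier (R i)) f (\<beta> i)) (\<alpha> i))"
    by (rule factorization[OF l]) (rule that, assumption+)
  interpret SR: std_resolution K A \<A> \<Lambda> e r l R Q \<delta> \<eta> by (rule SR)
  have Ri: "left_module A (R i)" by (rule SR.LR.lr(3))
  obtain S where S: "finite S" "spans A (R i) S" using SR.resolution_fin_gen by blast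
  obtain \<phi> where \<phi>: "dual_basis A (R i) S (\<lambda>x. x) \<phi>"
    using projective_module_dual_basis_spans[OF SR.LR.lr(2) S(2)] by blast
  note \<phi>D = \<phi>[unfolded dual_basis_def]
  have \<phi>c: "\<phi> s x \<in> carrier A" if "s \<in> S" "x \<in> carrier (R i)" for s x using \<phi>D that by blast
  have KA: "left_module K A"
    by (rule left_moduleI[OF K.ring_axioms])
      (auto simp: A.a_assoc KA.smult_l_distr KA.smult_r_distr KA.smult_assoc1 intro: A.a_comm)
  interpret KAm: left_module K A by (rule KA)
  have "fin_dim K A" using alg by (simp add: fd_algebra_def)
  then obtain TA where TA: "finite TA" "spans K A TA" using fin_dim_iff[OF KA] by blast
  have TAc: "TA \<subseteq> carrier A" using TA(2) by (simp add: spans_def)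
  \<comment> \<open>The coordinate \<phi>_s followed by x |-> x a into A_0. Every homomorphism g is
    the sum of the \<open>G s (a s)\<close>, where \<open>a s\<close> represents g(s).\<close>
  define G where "G s a = (\<lambda>x\<in>carrier (R i). q (\<phi> s x \<otimes>\<^bsub>A\<^esub> a))" for s a
  have G: "G s a \<in> mod_hom A (R i) D0" if s: "s \<in> S" and a: "a \<in> carrier A" for s a
    unfolding G_def
  proof (rule mod_hom_restrictI[OF Ri])
    have \<phi>add: "\<phi> s (x \<oplus>\<^bsub>R i\<^esub> y) = \<phi> s x \<oplus>\<^bsub>A\<^esub> \<phi> s y" if "x \<in> carrier (R i)" "y \<in> carrier (R i)" for x y
      using \<phi>D s that by blast
    have \<phi>sm: "\<phi> s (b \<odot>\<^bsub>R i\<^esub> x) = b \<otimes>\<^bsub>A\<^esub> \<phi> s x" if "x \<in> carrier (R i)" "b \<in> carrier A" for x b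
      using \<phi>D s that by blast
    show "q (\<phi> s x \<otimes>\<^bsub>A\<^esub> a) \<in> carrier D0" if "x \<in> carrier (R i)" for x using \<phi>c[OF s that] a by simp
    show "q (\<phi> s (x \<oplus>\<^bsub>R i\<^esub> y) \<otimes>\<^bsub>A\<^esub> a) = q (\<phi> s x \<otimes>\<^bsub>A\<^esub> a) \<oplus>\<^bsub>D0\<^esub> q (\<phi> s y \<otimes>\<^bsub>A\<^esub> a)"
      if "x \<in> carrier (R i)" "y \<in> carrier (R i)" for x y
      using \<phi>c[OF s that(1)] \<phi>c[OF s that(2)] a by (simp add: \<phi>add[OF that] q_add A.l_distr)
    show "q (\<phi> s (b \<odot>\<^bsub>R i\<^esub> x) \<otimes>\<^bsub>A\<^esub> a) = b \<odot>\<^bsub>D0\<^esub> q (\<phi> s x \<otimes>\<^bsub>A\<^esub> a)"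
      if "b \<in> carrier A" "x \<in> carrier (R i)" for b x
      using \<phi>c[OF s that(2)] a that by (simp add: \<phi>sm q_smult A.m_assoc)
  qed
  \<comment> \<open>Pulls homomorphisms on R_i back along \<alpha> to classes in Ext. The values are
    classes of cocycles by minimality, and \<open>Cadd\<close>, \<open>Csm\<close> and
    \<open>C0\<close> express K-linearity.\<close>
  define C where "C g = X.cl i (X.cmp i g (\<alpha> i))" for g
  have CZ: "X.cmp i g (\<alpha> i) \<in> X.Z i" if "g \<in> mod_hom A (R i) D0" for g
    by (rule cmp_\<alpha>_Z[OF SR \<alpha> \<alpha>d that])
  have \<alpha>c: "\<alpha> i x \<in> carrier (R i)" if "x \<in> carrier (P i)" for x by (rule mod_homD(1)[OF \<alpha> that])
  have Cadd: "C g'' = C g \<oplus>\<^bsub>X.E i\<^esub> C g'"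
    if g: "g \<in> mod_hom A (R i) D0" "g' \<in> mod_hom A (R i) D0"
      and eq: "\<And>x. x \<in> carrier (R i) \<Longrightarrow> g'' x = g x \<oplus>\<^bsub>D0\<^esub> g' x" for g g' g''
  proof -
    have "X.cmp i g'' (\<alpha> i) = X.cmp i g (\<alpha> i) \<oplus>\<^bsub>X.H i\<^esub> X.cmp i g' (\<alpha> i)"
      using \<alpha>c eq by (auto simp: X.add_H compose_def restrict_def fun_eq_iff)
    then show ?thesis unfolding C_def using X.cl_add[OF CZ[OF g(1)] CZ[OF g(2)]] by simp
  qed
  have Csm: "C g' = c \<odot>\<^bsub>X.E i\<^esub> C g"
    if c: "c \<in> carrier K" and g: "g \<in> mod_hom A (R i) D0"
      and eq: "\<And>x. x \<in> carrier (R i) \<Longrightarrow> g' x = sc c \<odot>\<^bsub>D0\<^esub> g x" for c g g'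
  proof -
    have "X.cmp i g' (\<alpha> i) = c \<odot>\<^bsub>X.H i\<^esub> X.cmp i g (\<alpha> i)"
      using \<alpha>c eq by (auto simp: X.smult_H compose_def restrict_def fun_eq_iff)
    then show ?thesis unfolding C_def using X.cl_smult[OF c CZ[OF g]] by simp
  qed
  have C0: "C g = \<zero>\<^bsub>X.E i\<^esub>" if "\<And>x. x \<in> carrier (R i) \<Longrightarrow> g x = \<zero>\<^bsub>D0\<^esub>" for g
  proof -
    have "X.cmp i g (\<alpha> i) = \<zero>\<^bsub>X.H i\<^esub>" using that \<alpha>c by (auto simp: X.zero_H compose_def restrict_def fun_eq_iff)
    then show ?thesis unfolding C_def
      using X.cl_zero_iff[OF X.H.submoduleD(2)[OF X.submodule_Z]] X.H.submoduleD(2)[OF X.submodule_B] by simp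
  qed
  let ?T = "(\<lambda>(s, t). C (G s t)) ` (S \<times> TA)"
  have CW: "C g \<in> W" if W: "submodule W K (X.E i)" "?T \<subseteq> W" and g: "g \<in> mod_hom A (R i) D0" for W g
  proof -
    note WD = X.E.Q.submoduleD[OF W(1)]
    have CG: "C (G s a) \<in> W" if s: "s \<in> S" and a: "a \<in> carrier A" for s a
    proof -
      \<comment> \<open>For fixed s the class depends K-linearly on a, so membership in W needs to
        be checked only on the spanning set \<open>TA\<close> of A.\<close>
      have "submodule {a \<in> carrier A. C (G s a) \<in> W} K A"
      proof (rule KAm.submoduleI)
        show "\<zero>\<^bsub>A\<^esub> \<in> {a \<in> carrier A. C (G s a) \<in> W}"
          using C0[of "G s \<zero>\<^bsub>A\<^esub>"] \<phi>c[OF s] WD(2) by (simp add: G_def q_zero_iff)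
        show "a \<oplus>\<^bsub>A\<^esub> b \<in> {a \<in> carrier A. C (G s a) \<in> W}"
          if "a \<in> {a \<in> carrier A. C (G s a) \<in> W}" "b \<in> {a \<in> carrier A. C (G s a) \<in> W}" for a b
        proof -
          have ab: "a \<in> carrier A" "b \<in> carrier A" "C (G s a) \<in> W" "C (G s b) \<in> W" using that by auto
          have "C (G s (a \<oplus>\<^bsub>A\<^esub> b)) = C (G s a) \<oplus>\<^bsub>X.E i\<^esub> C (G s b)"
            by (rule Cadd[OF G[OF s ab(1)] G[OF s ab(2)]]) (use \<phi>c[OF s] ab in \<open>simp add: G_def q_add A.r_distr\<close>)
          then show ?thesis using ab WD(3)[OF ab(3,4)] by simp
        qed
        show "c \<odot>\<^bsub>A\<^esub> a \<in> {a \<in> carrier A. C (G s a) \<in> W}"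
          if c: "c \<in> carrier K" and "a \<in> {a \<in> carrier A. C (G s a) \<in> W}" for c a
        proof -
          have a: "a \<in> carrier A" "C (G s a) \<in> W" using that by auto
          have "\<phi> s x \<otimes>\<^bsub>A\<^esub> (c \<odot>\<^bsub>A\<^esub> a) = sc c \<otimes>\<^bsub>A\<^esub> (\<phi> s x \<otimes>\<^bsub>A\<^esub> a)" if x: "x \<in> carrier (R i)" for x
          proof -
            have "\<phi> s x \<otimes>\<^bsub>A\<^esub> (c \<odot>\<^bsub>A\<^esub> a) = \<phi> s x \<otimes>\<^bsub>A\<^esub> sc c \<otimes>\<^bsub>A\<^esub> a"
              using sc_mult[OF c a(1)] \<phi>c[OF s x] a(1) c by (simp add: A.m_assoc)
            then show ?thesis using sc_central[OF c \<phi>c[OF s x]] \<phi>c[OF s x] a(1) c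
              by (metis A.m_assoc sc_closed)
          qed
          then have "C (G s (c \<odot>\<^bsub>A\<^esub> a)) = c \<odot>\<^bsub>X.E i\<^esub> C (G s a)"
            by (intro Csm[OF c G[OF s a(1)]]) (use \<phi>c[OF s] a c in \<open>simp add: G_def q_smult\<close>)
          then show ?thesis using a c WD(5)[OF c a(2)] by simp
        qed
      qed auto
      moreover have "TA \<subseteq> {a \<in> carrier A. C (G s a) \<in> W}" using TAc W(2) s by auto
      ultimately show ?thesis using spansD[OF TA(2) _ _ a] by blast
    qed
    have Sc: "S \<subseteq> carrier (R i)" using S(2) by (simp add: spans_def)
    have "\<exists>a. a \<in> \<A> 0 \<and> g s = q a" if s: "s \<in> S" for s
      by (rule D0_elt[OF mod_homD(1)[OF g, of s]]) (use Sc s in auto)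
    then have "\<forall>s\<in>S. \<exists>a. a \<in> \<A> 0 \<and> g s = q a" by blast
    from bchoice[OF this] obtain a where "\<forall>s\<in>S. a s \<in> \<A> 0 \<and> g s = q (a s)" ..
    then have a: "\<And>s. s \<in> S \<Longrightarrow> a s \<in> carrier A" "\<And>s. s \<in> S \<Longrightarrow> g s = q (a s)" using \<A>_carrier by auto
    have Gx: "G s (a s) x = \<phi> s x \<odot>\<^bsub>D0\<^esub> g s" if "s \<in> S" "x \<in> carrier (R i)" for s x
      using that \<phi>c[OF that] a[OF that(1)] by (simp add: G_def q_smult)
    \<comment> \<open>The partial sums have to be carried along as homomorphisms too, because
      additivity of \<open>C\<close> is known only for homomorphisms.\<close>
    have "C (\<lambda>x\<in>carrier (R i). finsum D0 (\<lambda>s. G s (a s) x) F) \<in> W \<and>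
        (\<lambda>x\<in>carrier (R i). finsum D0 (\<lambda>s. G s (a s) x) F) \<in> mod_hom A (R i) D0" if "F \<subseteq> S" for F
      using finite_subset[OF that S(1)] that
    proof (induct F)
      case empty
      have "C (\<lambda>x\<in>carrier (R i). \<zero>\<^bsub>D0\<^esub>) \<in> W"
        using C0[of "\<lambda>x\<in>carrier (R i). \<zero>\<^bsub>D0\<^esub>"] WD(2) by simp
      then show ?case unfolding X.M.M.finsum_empty using mod_hom_zero_map[OF Ri left_module_D0] by (rule conjI)
    next
      case (insert s F)
      let ?f = "\<lambda>x\<in>carrier (R i). finsum D0 (\<lambda>s. G s (a s) x) F"
      have s: "s \<in> S" using insert by simp
      have "F \<subseteq> S" using insert(4) by simp
      note IH = insert(3)[OF this, THEN conjunct1] insert(3)[OF this, THEN conjunct2]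
      have Gs: "G s (a s) \<in> mod_hom A (R i) D0" by (rule G[OF s a(1)[OF s]])
      have Gc: "G t (a t) x \<in> carrier D0" if "t \<in> S" "x \<in> carrier (R i)" for t x
        by (rule mod_homD(1)[OF G[OF that(1) a(1)[OF that(1)]] that(2)])
      have eq: "finsum D0 (\<lambda>s. G s (a s) x) (insert s F) = G s (a s) x \<oplus>\<^bsub>D0\<^esub> ?f x" if x: "x \<in> carrier (R i)" for x
        using insert x Gc by (simp add: Pi_iff subset_iff)
      have "C (\<lambda>x\<in>carrier (R i). finsum D0 (\<lambda>s. G s (a s) x) (insert s F)) = C (G s (a s)) \<oplus>\<^bsub>X.E i\<^esub> C ?f"
        by (rule Cadd[OF Gs IH(2)]) (use eq in simp)
      moreover have "(\<lambda>x\<in>carrier (R i). finsum D0 (\<lambda>s. G s (a s) x) (insert s F)) \<in> mod_hom A (R i) D0"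
      proof -
        have "(\<lambda>x\<in>carrier (R i). finsum D0 (\<lambda>s. G s (a s) x) (insert s F)) = (\<lambda>x\<in>carrier (R i). G s (a s) x \<oplus>\<^bsub>D0\<^esub> ?f x)"
          by (rule restrict_ext) (rule eq)
        then show ?thesis using mod_hom_add[OF Ri left_module_D0 Gs IH(2)] by (simp only:)
      qed
      ultimately show ?case using WD(3)[OF CG[OF s a(1)[OF s]] IH(1)] by (simp only:)
    qed
    then have CS: "C (\<lambda>x\<in>carrier (R i). finsum D0 (\<lambda>s. G s (a s) x) S) \<in> W" by blast
    \<comment> \<open>Applying g to the dual basis identity x = sum of \<phi>_s(x) s recovers g from
      its values on \<open>S\<close>.\<close>
    have "finsum D0 (\<lambda>s. G s (a s) x) S = g x" if x: "x \<in> carrier (R i)" for x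
    proof -
      have lc: "lin_comb A (R i) S (\<lambda>x. x) (\<lambda>s. \<phi> s x) = finsum (R i) (\<lambda>s. \<phi> s x \<odot>\<^bsub>R i\<^esub> s) S"
        using Sc \<phi>c[OF _ x] by (intro SR.LR.R.M.lin_comb_superset[OF S(1)]) auto
      have "g x = g (finsum (R i) (\<lambda>s. \<phi> s x \<odot>\<^bsub>R i\<^esub> s) S)" using \<phi>D x lc by simp
      also have "\<dots> = finsum D0 (\<lambda>s. g (\<phi> s x \<odot>\<^bsub>R i\<^esub> s)) S"
        using Sc \<phi>c[OF _ x] by (intro mod_hom_finsum[OF g Ri left_module_D0 S(1)]) auto
      also have "\<dots> = finsum D0 (\<lambda>s. G s (a s) x) S"
        using Sc \<phi>c[OF _ x] Gx[OF _ x] mod_homD(1)[OF g] by (intro X.M.M.finsum_cong') (auto simp: mod_homD(4)[OF g])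
      finally show ?thesis by simp
    qed
    then have "X.cmp i (\<lambda>x\<in>carrier (R i). finsum D0 (\<lambda>s. G s (a s) x) S) (\<alpha> i) = X.cmp i g (\<alpha> i)"
      using \<alpha>c by (auto simp: compose_def restrict_def fun_eq_iff)
    then show ?thesis using CS by (simp add: C_def)
  qed
  show ?thesis
  proof (intro exI[of _ ?T] conjI allI impI ballI)
    show "?T \<subseteq> carrier (X.E i)" using G TAc X.cl_closed[OF CZ] by (auto simp: C_def)
    show "finite ?T" using S(1) TA(1) by simp
    fix W x assume W: "submodule W K (X.E i)" "?T \<subseteq> W" and x: "x \<in> carrier (X.E i)"
    obtain f where f: "f \<in> X.Z i" "x = X.cl i f" using x by (auto simp: X.carrier_E)
    have fh: "f \<in> mod_hom A (P i) D0" using f by (simp add: X.Z_iff)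
    have "compose (carrier (R i)) f (\<beta> i) \<in> mod_hom A (R i) D0" by (rule mod_hom_compose[OF \<beta> fh Ri])
    then show "ym i 0 x (w (e l)) \<in> W" unfolding f(2) fac[OF f(1)] using CW[OF W] by (simp only: C_def)
  qed
qed

lemma E_fin_dim: "\<exists>T. finite T \<and> spans K (X.E i) T"
proof -
  have "\<forall>l\<in>\<Lambda>. \<exists>T. finite T \<and> T \<subseteq> carrier (X.E i) \<and>
    (\<forall>W. submodule W K (X.E i) \<longrightarrow> T \<subseteq> W \<longrightarrow> (\<forall>x\<in>carrier (X.E i). ym i 0 x (w (e l)) \<in> W))"
    using component_fin_dim by (rule ballI)
  from bchoice[OF this] obtain T where T: "\<forall>l\<in>\<Lambda>. finite (T l) \<and> T l \<subseteq> carrier (X.E i) \<and>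
    (\<forall>W. submodule W K (X.E i) \<longrightarrow> T l \<subseteq> W \<longrightarrow> (\<forall>x\<in>carrier (X.E i). ym i 0 x (w (e l)) \<in> W))" ..
  have "carrier (X.E i) \<subseteq> W" if W: "submodule W K (X.E i)" "(\<Union>l\<in>\<Lambda>. T l) \<subseteq> W" for W
  proof
    fix x assume x: "x \<in> carrier (X.E i)"
    have "ym i 0 x (w (e l)) \<in> W" if l: "l \<in> \<Lambda>" for l
    proof -
      have "T l \<subseteq> W" using W(2) l by blast
      then show ?thesis using bspec[OF T l] W(1) x by simp
    qed
    then have "finsum (X.E i) (\<lambda>l. ym i 0 x (w (e l))) \<Lambda> \<in> W"
      by (rule X.E.Q.M.finsum_in_additive_subgroup[OF X.E.Q.submodule_additive_subgroup[OF W(1)]])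
    then show "x \<in> W" using component_sum[OF x] by simp
  qed
  moreover have "(\<Union>l\<in>\<Lambda>. T l) \<subseteq> carrier (X.E i)" using T by (intro UN_least) simp
  ultimately have "spans K (X.E i) (\<Union>l\<in>\<Lambda>. T l)" by (simp add: spans_def)
  moreover have "finite (\<Union>l\<in>\<Lambda>. T l)" using T \<Lambda>_finite by simp
  ultimately show ?thesis by blast
qed

lemma fd_algebra_\<Gamma>: "fd_algebra K \<Gamma>"
  unfolding fd_algebra_def
proof (intro conjI ballI)
  show "field K" by (rule K.field_axioms)
  show "ring \<Gamma>" by (rule X.GP.ring_conv_algebra)
  show "module K \<Gamma>" by (rule X.GP.module_conv_algebra)
  show "fin_dim K \<Gamma>" by (rule X.GP.fin_dim_conv_algebra[OF E_fin_dim E_trivial])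
  fix c x y assume "c \<in> carrier K" "x \<in> carrier \<Gamma>" "y \<in> carrier \<Gamma>"
  then show "(c \<odot>\<^bsub>\<Gamma>\<^esub> x) \<otimes>\<^bsub>\<Gamma>\<^esub> y = c \<odot>\<^bsub>\<Gamma>\<^esub> (x \<otimes>\<^bsub>\<Gamma>\<^esub> y)" "x \<otimes>\<^bsub>\<Gamma>\<^esub> (c \<odot>\<^bsub>\<Gamma>\<^esub> y) = c \<odot>\<^bsub>\<Gamma>\<^esub> (x \<otimes>\<^bsub>\<Gamma>\<^esub> y)"
    unfolding X.GP.conv_algebra_simps(4) by (rule X.GP.conv_smult)+
qed

lemma ext_algebra_standardly_stratified:
  "standardly_stratified K (ext_algebra A P d \<epsilon> D0) \<Lambda>
     (\<lambda>l. ext_of_endo A P d \<epsilon> D0 (degree_zero_proj A \<A> e l)) (r\<inverse>)"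
  unfolding X.ext_algebra_eq ext_of_endo_W
  by (rule directed_standardly_stratified[OF fd_algebra_\<Gamma> complete_primitive_idempotents_\<Gamma> po directed_\<Gamma>])

end

theorem theorem7p1:
  fixes K :: "('k, 'z) ring_scheme"
    and A :: "('k, 'a) module"
    and \<A> :: "nat \<Rightarrow> 'a set"
    and \<Lambda> :: "'l set"
    and e :: "'l \<Rightarrow> 'a"
    and r :: "'l rel"
  assumes "algebraically_closed K"
    and "fd_algebra K A"
    and "graded_algebra K A \<A>"
    and "\<And>i j. add_span A {x \<otimes>\<^bsub>A\<^esub> y | x y. x \<in> \<A> i \<and> y \<in> \<A> j} = \<A> (i + j)"
    and "self_injective (degree_zero_ring A \<A>)"
    and "complete_primitive_idempotents A \<Lambda> e"
    and "\<And>l. l \<in> \<Lambda> \<Longrightarrow> e l \<in> \<A> 0"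
    and "basic_algebra A \<Lambda> e"
    and "partial_order_on \<Lambda> r"
    and "standardly_stratified K A \<Lambda> e r"
    and "\<And>l. l \<in> \<Lambda> \<Longrightarrow>
           concentrated_in_degree_zero (std_module A \<Lambda> e r l) (std_grading A \<A> \<Lambda> e r l)"
    and "\<And>l. l \<in> \<Lambda> \<Longrightarrow>
           koszul_module K A \<A> (std_module A \<Lambda> e r l) (std_grading A \<A> \<Lambda> e r l)"
  shows "mod_iso A (degree_zero_module A \<A>) (dsum_module \<Lambda> (std_module A \<Lambda> e r)) \<and>
    (\<forall>(P :: nat \<Rightarrow> ('a, 'p) module) d \<epsilon>.
       projective_resolution A (degree_zero_module A \<A>) P d \<epsilon> \<longrightarrow>
       standardly_stratified K
         (ext_algebra A P d \<epsilon> (degree_zero_module A \<A>))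
         \<Lambda>
         (\<lambda>l. ext_of_endo A P d \<epsilon> (degree_zero_module A \<A>) (degree_zero_proj A \<A> e l))
         (r\<inverse>))"
proof -
  have fa: "fin_dim_algebra K A" using assms(2) by (rule fin_dim_algebra.intro)
  interpret fin_dim_algebra K A by (rule fa)
  have "\<A> 0 \<subseteq> carrier A" "additive_subgroup (\<A> 0) A"
    using assms(3) by (auto simp: graded_algebra_def internal_dsum_def dest: additive_subgroup.a_subset)
  \<comment> \<open>The unit is the sum of the idempotents, which all have degree 0; this supplies
    \<open>one_degree\<close>.\<close>
  then have "finsum A e \<Lambda> \<in> \<A> 0" using A.finsum_in_additive_subgroup assms(7) by blast
  then have one: "\<one>\<^bsub>A\<^esub> \<in> \<A> 0" using assms(6) by (simp add: complete_primitive_idempotents_def)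
  interpret stratified_algebra K A \<A> \<Lambda> e r
    by (intro stratified_algebra.intro graded_fd_algebra.intro fa graded_fd_algebra_axioms.intro
        stratified_algebra_axioms.intro assms one)
  show ?thesis
  proof (intro conjI allI impI)
    show "mod_iso A (degree_zero_module A \<A>) (dsum_module \<Lambda> (std_module A \<Lambda> e r))"
      by (rule degree_zero_module_iso)
    fix P :: "nat \<Rightarrow> ('a, 'p) module" and d \<epsilon>
    assume res: "projective_resolution A (degree_zero_module A \<A>) P d \<epsilon>"
    interpret ext_comparison K A \<A> \<Lambda> e r P d \<epsilon>
      by (intro ext_comparison.intro stratified_algebra_axioms ext_setting.intro fa ext_setting_axioms.intro res)
    show "standardly_stratified K (ext_algebra A P d \<epsilon> (degree_zero_module A \<A>)) \<Lambda>
        (\<lambda>l. ext_of_endo A P d \<epsilon> (degree_zero_module A \<A>) (degree_zero_proj A \<A> e l)) (r\<inverse>)"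
      by (rule ext_algebra_standardly_stratified)
  qed
qed

end
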